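(* Let $M$ be a left $\mathbf{F}$-module and let $\Sigma$ and $\Omega$ be two great filtrations on $M$. Then $\delta_1(\mathrm{HS}_{(M,\Omega)})=\delta_1(\mathrm{HS}_{(M,\Sigma)})$. Moreover, letting $$a_\Omega(t)=(1-t)^{\delta_1(\mathrm{HS}_{(M,\Omega)})}\,g_{p,n}(t)\,\mathrm{HS}_{(M,\Omega)}(t)$$ and defining $a_\Sigma(t)$ analogously, with $\Sigma$ in place of $\Omega$, we have $a_\Omega(1)=a_\Sigma(1)$.
   Context: Fix a prime $p$ and an integer $n\ge1$. Let $R=\mathbb{F}_p[x_1,\ldots,x_n]$ and let $\mathbf{F}=R\{F\}/(Fr-r^pF\mid r\in R)$ be the ring of Frobenius operators, i.e. the free noncommutative $\mathbb{F}_p$-algebra on $x_1,\ldots,x_n,F$ modulo the two-sided ideal generated by $x_ix_j-x_jx_i$ and $x_i^pF-Fx_i$. A word is a finite string in the symbols $x_1,\ldots,x_n,F$; the complexity of a monomial of $\mathbf{F}$ is the length of the shortest word representing it. The Bernstein filtration $\mathcal{B}$ is given by $\mathcal{B}_i$ = the $\mathbb{F}_p$-span of all monomials of complexity at most $i$ ($\mathcal{B}_i=0$ for $i<0$). Let $\mathbf{A}=\mathrm{gr}_{\mathcal{B}}(\mathbf{F})=\bigoplus_i\mathcal{B}_i/\mathcal{B}_{i-1}$. A $\mathcal{B}$-compatible filtration on a left $\mathbf{F}$-module $M$ is a chain $\Omega_0\subseteq\Omega_1\subseteq\cdots$ of finite-dimensional $\mathbb{F}_p$-subspaces of $M$ with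 $\bigcup_i\Omega_i=M$ and $\mathcal{B}_i\Omega_j\subseteq\Omega_{i+j}$ for all $i,j$ (with $\Omega_i=0$ for $i<0$). Its associated graded $\mathbf{A}$-module is $\mathrm{gr}_\Omega(M)=\bigoplus_i\Omega_i/\Omega_{i-1}$, and $\mathrm{HS}_{(M,\Omega)}(t)=\sum_{i\ge0}\dim_{\mathbb{F}_p}(\Omega_i/\Omega_{i-1})t^i$. The filtration $\Omega$ is great if it is $\mathcal{B}$-compatible and $\mathrm{gr}_\Omega(M)$ is a finitely presented left $\mathbf{A}$-module; in that case $\mathrm{HS}_{(M,\Omega)}(t)$ is a rational function. For a rational function $h(t)$, $\delta_1(h)$ is the least nonnegative integer $d$ such that $(1-t)^dh(t)$ has no pole at $t=1$. Also $g_{p,n}(t)=1-t(1+t+\cdots+t^{p-1})^n$. *)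

theory Defs
  imports
    "HOL-Algebra.QuotRing"
    "HOL-Algebra.Module"
    "HOL-Number_Theory.Residues"
    "HOL-Computational_Algebra.Computational_Algebra"
begin

section \<open>Left modules over a possibly noncommutative ring\<close>

text \<open>The library locale \<^locale>\<open>module\<close> requires a commutative ring of scalars; otherwise
  the axioms are the same.\<close>

locale left_module = R?: ring R + M?: abelian_group M
  for R :: "('a, 'c) ring_scheme" (structure) and M :: "('a, 'b, 'd) module_scheme" (structure) +
  assumes smult_closed:
      "\<lbrakk>a \<in> carrier R; x \<in> carrier M\<rbrakk> \<Longrightarrow> a \<odot>\<^bsub>M\<^esub> x \<in> carrier M"
    and smult_l_distr:
      "\<lbrakk>a \<in> carrier R; b \<in> carrier R; x \<in> carrier M\<rbrakk> \<Longrightarrow>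
        (a \<oplus> b) \<odot>\<^bsub>M\<^esub> x = a \<odot>\<^bsub>M\<^esub> x \<oplus>\<^bsub>M\<^esub> b \<odot>\<^bsub>M\<^esub> x"
    and smult_r_distr:
      "\<lbrakk>a \<in> carrier R; x \<in> carrier M; y \<in> carrier M\<rbrakk> \<Longrightarrow>
        a \<odot>\<^bsub>M\<^esub> (x \<oplus>\<^bsub>M\<^esub> y) = a \<odot>\<^bsub>M\<^esub> x \<oplus>\<^bsub>M\<^esub> a \<odot>\<^bsub>M\<^esub> y"
    and smult_assoc1:
      "\<lbrakk>a \<in> carrier R; b \<in> carrier R; x \<in> carrier M\<rbrakk> \<Longrightarrow>
        (a \<otimes> b) \<odot>\<^bsub>M\<^esub> x = a \<odot>\<^bsub>M\<^esub> (b \<odot>\<^bsub>M\<^esub> x)"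
    and smult_one:
      "x \<in> carrier M \<Longrightarrow> \<one> \<odot>\<^bsub>M\<^esub> x = x"

text \<open>The record type \<^type>\<open>module_ext\<close> extends that of rings, so a module carries fields
  \<^const>\<open>monoid.mult\<close> and \<^const>\<open>monoid.one\<close> that have no meaning for it. They are filled with
  \<^const>\<open>undefined\<close> below and never used.\<close>

definition regular_module :: "('a, 'c) ring_scheme \<Rightarrow> ('a, 'a) module" where
  "regular_module R =
     \<lparr>carrier = carrier R, monoid.mult = undefined, one = undefined, zero = \<zero>\<^bsub>R\<^esub>, add = add R,
      module.smult = monoid.mult R\<rparr>"

definition free_module :: "('a, 'c) ring_scheme \<Rightarrow> nat \<Rightarrow> ('a, nat \<Rightarrow> 'a) module" where
  "free_module R m =
     \<lparr>carrier = {..<m} \<rightarrow>\<^sub>E carrier R, monoid.mult = undefined, one = undefined,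
      zero = (\<lambda>i\<in>{..<m}. \<zero>\<^bsub>R\<^esub>),
      add = (\<lambda>u v. \<lambda>i\<in>{..<m}. u i \<oplus>\<^bsub>R\<^esub> v i),
      module.smult = (\<lambda>a u. \<lambda>i\<in>{..<m}. a \<otimes>\<^bsub>R\<^esub> u i)\<rparr>"

definition linear_span ::
  "('a, 'c) ring_scheme \<Rightarrow> ('a, 'b, 'd) module_scheme \<Rightarrow> 'b set \<Rightarrow> 'b set" where
  "linear_span R M S =
     {\<Oplus>\<^bsub>M\<^esub>v\<in>T. c v \<odot>\<^bsub>M\<^esub> v | T c. finite T \<and> T \<subseteq> S \<and> c \<in> T \<rightarrow> carrier R}"

definition finitely_generated ::
  "('a, 'c) ring_scheme \<Rightarrow> ('a, 'b, 'd) module_scheme \<Rightarrow> bool" where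
  "finitely_generated R M \<longleftrightarrow>
     (\<exists>S. finite S \<and> S \<subseteq> carrier M \<and> linear_span R M S = carrier M)"

definition left_module_hom ::
  "('a, 'c) ring_scheme \<Rightarrow> ('a, 'b, 'd) module_scheme \<Rightarrow> ('a, 'e, 'f) module_scheme \<Rightarrow>
   ('b \<Rightarrow> 'e) set" where
  "left_module_hom R M N =
     {\<phi> \<in> carrier M \<rightarrow> carrier N.
        (\<forall>x\<in>carrier M. \<forall>y\<in>carrier M. \<phi> (x \<oplus>\<^bsub>M\<^esub> y) = \<phi> x \<oplus>\<^bsub>N\<^esub> \<phi> y) \<and>
        (\<forall>a\<in>carrier R. \<forall>x\<in>carrier M. \<phi> (a \<odot>\<^bsub>M\<^esub> x) = a \<odot>\<^bsub>N\<^esub> \<phi> x)}"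

definition finitely_presented ::
  "('a, 'c) ring_scheme \<Rightarrow> ('a, 'b, 'd) module_scheme \<Rightarrow> bool" where
  "finitely_presented R N \<longleftrightarrow>
     (\<exists>m. \<exists>\<phi>\<in>left_module_hom R (free_module R m) N.
        \<phi> ` carrier (free_module R m) = carrier N \<and>
        finitely_generated R
          ((free_module R m)\<lparr>carrier := a_kernel (free_module R m) N \<phi>\<rparr>))"


section \<open>Dimension of a vector space\<close>

definition linearly_independent ::
  "('a, 'c) ring_scheme \<Rightarrow> ('a, 'b, 'd) module_scheme \<Rightarrow> 'b set \<Rightarrow> bool" where
  "linearly_independent K V S \<longleftrightarrow>
     (\<forall>T c. finite T \<and> T \<subseteq> S \<and> c \<in> T \<rightarrow> carrier K \<and> (\<Oplus>\<^bsub>V\<^esub>v\<in>T. c v \<odot>\<^bsub>V\<^esub> v) = \<zero>\<^bsub>V\<^esub>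
        \<longrightarrow> (\<forall>v\<in>T. c v = \<zero>\<^bsub>K\<^esub>))"

definition vs_basis ::
  "('a, 'c) ring_scheme \<Rightarrow> ('a, 'b, 'd) module_scheme \<Rightarrow> 'b set \<Rightarrow> bool" where
  "vs_basis K V S \<longleftrightarrow>
     S \<subseteq> carrier V \<and> linearly_independent K V S \<and> linear_span K V S = carrier V"

definition vs_dim :: "('a, 'c) ring_scheme \<Rightarrow> ('a, 'b, 'd) module_scheme \<Rightarrow> nat" where
  "vs_dim K V = card (SOME S. vs_basis K V S)"


section \<open>The ring of Frobenius operators\<close>

datatype letter = X nat | Frob

definition letters :: "nat \<Rightarrow> letter set" where
  "letters n = X ` {..<n} \<union> {Frob}"

text \<open>The free associative unital algebra on \<open>S\<close>: finitely supported \<open>K\<close>-valued functions on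
  the words over \<open>S\<close>, multiplied by convolution along concatenation.\<close>

definition free_algebra :: "('k, 'c) ring_scheme \<Rightarrow> 's set \<Rightarrow> ('s list \<Rightarrow> 'k) ring" where
  "free_algebra K S =
     \<lparr>carrier = {f. (\<forall>w. f w \<in> carrier K) \<and> finite {w. f w \<noteq> \<zero>\<^bsub>K\<^esub>} \<and>
                    {w. f w \<noteq> \<zero>\<^bsub>K\<^esub>} \<subseteq> lists S},
      monoid.mult = (\<lambda>f g w. \<Oplus>\<^bsub>K\<^esub>i\<in>{..length w}. f (take i w) \<otimes>\<^bsub>K\<^esub> g (drop i w)),
      one = (\<lambda>w. if w = [] then \<one>\<^bsub>K\<^esub> else \<zero>\<^bsub>K\<^esub>),
      zero = (\<lambda>w. \<zero>\<^bsub>K\<^esub>),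
      add = (\<lambda>f g w. f w \<oplus>\<^bsub>K\<^esub> g w)\<rparr>"

definition word_elt :: "('k, 'c) ring_scheme \<Rightarrow> 's list \<Rightarrow> 's list \<Rightarrow> 'k" where
  "word_elt K w = (\<lambda>v. if v = w then \<one>\<^bsub>K\<^esub> else \<zero>\<^bsub>K\<^esub>)"

abbreviation GFp :: "nat \<Rightarrow> int ring" where
  "GFp p \<equiv> residue_ring (int p)"

abbreviation frob_free :: "nat \<Rightarrow> nat \<Rightarrow> (letter list \<Rightarrow> int) ring" where
  "frob_free p n \<equiv> free_algebra (GFp p) (letters n)"

definition frob_relations :: "nat \<Rightarrow> nat \<Rightarrow> (letter list \<Rightarrow> int) set" where
  "frob_relations p n =
     {word_elt (GFp p) [X i, X j] \<ominus>\<^bsub>frob_free p n\<^esub> word_elt (GFp p) [X j, X i] | i j. i < n \<and> j < n}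
     \<union> {word_elt (GFp p) (replicate p (X i) @ [Frob]) \<ominus>\<^bsub>frob_free p n\<^esub> word_elt (GFp p) [Frob, X i]
         | i. i < n}"

definition frob_ideal :: "nat \<Rightarrow> nat \<Rightarrow> (letter list \<Rightarrow> int) set" where
  "frob_ideal p n = genideal (frob_free p n) (frob_relations p n)"

type_synonym frob = "(letter list \<Rightarrow> int) set"

definition frob_ring :: "nat \<Rightarrow> nat \<Rightarrow> frob ring" where
  "frob_ring p n = frob_free p n Quot frob_ideal p n"

definition frob_word :: "nat \<Rightarrow> nat \<Rightarrow> letter list \<Rightarrow> frob" where
  "frob_word p n w = frob_ideal p n +>\<^bsub>frob_free p n\<^esub> word_elt (GFp p) w"

definition frob_scalar :: "nat \<Rightarrow> nat \<Rightarrow> int \<Rightarrow> frob" where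
  "frob_scalar p n c = frob_ideal p n +>\<^bsub>frob_free p n\<^esub> (\<lambda>w. if w = [] then c else \<zero>\<^bsub>GFp p\<^esub>)"

definition frob_monomials :: "nat \<Rightarrow> nat \<Rightarrow> frob set" where
  "frob_monomials p n = frob_word p n ` lists (letters n)"

definition complexity :: "nat \<Rightarrow> nat \<Rightarrow> frob \<Rightarrow> nat" where
  "complexity p n m = (LEAST l. \<exists>w\<in>lists (letters n). frob_word p n w = m \<and> length w = l)"

text \<open>The \<open>\<F>\<^sub>p\<close>-vector space underlying a left module over the ring of Frobenius operators.\<close>

definition underlying_vs ::
  "nat \<Rightarrow> nat \<Rightarrow> (frob, 'm, 'd) module_scheme \<Rightarrow> (int, 'm) module" where
  "underlying_vs p n M =
     \<lparr>carrier = carrier M, monoid.mult = undefined, one = undefined, zero = \<zero>\<^bsub>M\<^esub>, add = add M,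
      module.smult = (\<lambda>c x. frob_scalar p n c \<odot>\<^bsub>M\<^esub> x)\<rparr>"

definition bernstein :: "nat \<Rightarrow> nat \<Rightarrow> nat \<Rightarrow> frob set" where
  "bernstein p n i =
     linear_span (GFp p) (underlying_vs p n (regular_module (frob_ring p n)))
       {m \<in> frob_monomials p n. complexity p n m \<le> i}"


section \<open>Associated graded rings and modules\<close>

text \<open>Filtrations are indexed by \<^typ>\<open>nat\<close>; \<open>below M \<Omega> i\<close> is \<open>\<Omega>\<^sub>i\<^sub>-\<^sub>1\<close>, with \<open>\<Omega>\<^sub>-\<^sub>1 = 0\<close>.\<close>

definition below :: "('b, 'd) ring_scheme \<Rightarrow> (nat \<Rightarrow> 'b set) \<Rightarrow> nat \<Rightarrow> 'b set" where
  "below M \<Omega> i = (case i of 0 \<Rightarrow> {\<zero>\<^bsub>M\<^esub>} | Suc j \<Rightarrow> \<Omega> j)"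

text \<open>The quotient \<open>\<Omega>\<^sub>i/\<Omega>\<^sub>i\<^sub>-\<^sub>1\<close>. Its scalar multiplication is meaningful for those scalars that
  preserve \<open>\<Omega>\<^sub>i\<close> and \<open>\<Omega>\<^sub>i\<^sub>-\<^sub>1\<close>; it is used for \<open>\<F>\<^sub>p\<close>-vector spaces only.\<close>

definition gr_piece ::
  "('a, 'b, 'd) module_scheme \<Rightarrow> (nat \<Rightarrow> 'b set) \<Rightarrow> nat \<Rightarrow> ('a, 'b set) module" where
  "gr_piece M \<Omega> i =
     \<lparr>carrier = a_rcosets\<^bsub>M\<lparr>carrier := \<Omega> i\<rparr>\<^esub> (below M \<Omega> i), monoid.mult = undefined, one = undefined,
      zero = below M \<Omega> i,
      add = (\<lambda>x y. x <+>\<^bsub>M\<^esub> y),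
      module.smult = (\<lambda>c x. \<Union>u\<in>x. below M \<Omega> i +>\<^bsub>M\<^esub> (c \<odot>\<^bsub>M\<^esub> u))\<rparr>"

text \<open>The product \<open>B\<^sub>i/B\<^sub>i\<^sub>-\<^sub>1 \<times> \<Omega>\<^sub>j/\<Omega>\<^sub>j\<^sub>-\<^sub>1 \<rightarrow> \<Omega>\<^sub>k/\<Omega>\<^sub>k\<^sub>-\<^sub>1\<close> induced by the module action, where
  \<open>k = i + j\<close>; the union is over equal cosets.\<close>

definition gr_coset_smult ::
  "('a, 'b, 'd) module_scheme \<Rightarrow> (nat \<Rightarrow> 'b set) \<Rightarrow> nat \<Rightarrow> 'a set \<Rightarrow> 'b set \<Rightarrow> 'b set" where
  "gr_coset_smult M \<Omega> k a x = (\<Union>r\<in>a. \<Union>u\<in>x. below M \<Omega> k +>\<^bsub>M\<^esub> (r \<odot>\<^bsub>M\<^esub> u))"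

text \<open>The direct sum of the \<open>\<Omega>\<^sub>i/\<Omega>\<^sub>i\<^sub>-\<^sub>1\<close>, as a module over the associated graded ring of \<open>R\<close>.
  An element is the family of its homogeneous components.\<close>

definition gr_module ::
  "('a, 'b, 'd) module_scheme \<Rightarrow> (nat \<Rightarrow> 'b set) \<Rightarrow> (nat \<Rightarrow> 'a set, nat \<Rightarrow> 'b set) module" where
  "gr_module M \<Omega> =
     \<lparr>carrier = {\<xi>. (\<forall>i. \<xi> i \<in> carrier (gr_piece M \<Omega> i)) \<and>
                    finite {i. \<xi> i \<noteq> \<zero>\<^bsub>gr_piece M \<Omega> i\<^esub>}},
      monoid.mult = undefined, one = undefined,
      zero = (\<lambda>i. \<zero>\<^bsub>gr_piece M \<Omega> i\<^esub>),
      add = (\<lambda>\<xi> \<eta> i. \<xi> i \<oplus>\<^bsub>gr_piece M \<Omega> i\<^esub> \<eta> i),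
      module.smult = (\<lambda>\<alpha> \<xi> k. \<Oplus>\<^bsub>gr_piece M \<Omega> k\<^esub>i\<in>{..k}. gr_coset_smult M \<Omega> k (\<alpha> i) (\<xi> (k - i)))\<rparr>"

definition gr_ring ::
  "('a, 'c) ring_scheme \<Rightarrow> (nat \<Rightarrow> 'a set) \<Rightarrow> (nat \<Rightarrow> 'a set) ring" where
  "gr_ring R B = (let G = gr_module (regular_module R) B in
     \<lparr>carrier = carrier G,
      monoid.mult = module.smult G,
      one = (\<lambda>i. if i = 0 then below R B 0 +>\<^bsub>R\<^esub> \<one>\<^bsub>R\<^esub> else below R B i),
      zero = zero G,
      add = add G\<rparr>)"

definition gr_frob :: "nat \<Rightarrow> nat \<Rightarrow> (nat \<Rightarrow> frob set) ring" where
  "gr_frob p n = gr_ring (frob_ring p n) (bernstein p n)"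


section \<open>Great filtrations and their Hilbert series\<close>

definition compatible_filtration ::
  "nat \<Rightarrow> nat \<Rightarrow> (frob, 'm, 'd) module_scheme \<Rightarrow> (nat \<Rightarrow> 'm set) \<Rightarrow> bool" where
  "compatible_filtration p n M \<Omega> \<longleftrightarrow>
     (\<forall>i. submodule (\<Omega> i) (GFp p) (underlying_vs p n M)) \<and>
     (\<forall>i. finitely_generated (GFp p) ((underlying_vs p n M)\<lparr>carrier := \<Omega> i\<rparr>)) \<and>
     (\<forall>i. \<Omega> i \<subseteq> \<Omega> (Suc i)) \<and>
     (\<Union>i. \<Omega> i) = carrier M \<and>
     (\<forall>i j. \<forall>b\<in>bernstein p n i. \<forall>x\<in>\<Omega> j. b \<odot>\<^bsub>M\<^esub> x \<in> \<Omega> (i + j))"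

definition great_filtration ::
  "nat \<Rightarrow> nat \<Rightarrow> (frob, 'm, 'd) module_scheme \<Rightarrow> (nat \<Rightarrow> 'm set) \<Rightarrow> bool" where
  "great_filtration p n M \<Omega> \<longleftrightarrow>
     compatible_filtration p n M \<Omega> \<and> finitely_presented (gr_frob p n) (gr_module M \<Omega>)"

definition hilbert_fps ::
  "nat \<Rightarrow> nat \<Rightarrow> (frob, 'm, 'd) module_scheme \<Rightarrow> (nat \<Rightarrow> 'm set) \<Rightarrow> rat fps" where
  "hilbert_fps p n M \<Omega> =
     Abs_fps (\<lambda>i. of_nat (vs_dim (GFp p) (gr_piece (underlying_vs p n M) \<Omega> i)))"

text \<open>\<open>h\<close> is a rational function whose power series expansion at \<open>0\<close> is \<open>f\<close>.\<close>

definition expands_to :: "rat poly fract \<Rightarrow> rat fps \<Rightarrow> bool" where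
  "expands_to h f \<longleftrightarrow>
     (\<exists>P Q. Q \<noteq> 0 \<and> h = Fraction_Field.Fract P Q \<and> fps_of_poly Q * f = fps_of_poly P)"

text \<open>There is at most one such \<open>h\<close>, and for great filtrations there is one.\<close>

definition HS ::
  "nat \<Rightarrow> nat \<Rightarrow> (frob, 'm, 'd) module_scheme \<Rightarrow> (nat \<Rightarrow> 'm set) \<Rightarrow> rat poly fract" where
  "HS p n M \<Omega> = (THE h. expands_to h (hilbert_fps p n M \<Omega>))"

definition no_pole_at :: "rat \<Rightarrow> rat poly fract \<Rightarrow> bool" where
  "no_pole_at a h \<longleftrightarrow> (\<exists>P Q. poly Q a \<noteq> 0 \<and> h = Fraction_Field.Fract P Q)"

definition eval_at :: "rat \<Rightarrow> rat poly fract \<Rightarrow> rat" where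
  "eval_at a h =
     (THE v. \<exists>P Q. poly Q a \<noteq> 0 \<and> h = Fraction_Field.Fract P Q \<and> v = poly P a / poly Q a)"

definition one_minus_t :: "rat poly fract" where
  "one_minus_t = Fraction_Field.Fract [:1, -1:] 1"

definition delta1 :: "rat poly fract \<Rightarrow> nat" where
  "delta1 h = (LEAST d. no_pole_at 1 (one_minus_t ^ d * h))"

definition g_poly :: "nat \<Rightarrow> nat \<Rightarrow> rat poly" where
  "g_poly p n = 1 - [:0, 1:] * (\<Sum>i<p. [:0, 1:] ^ i) ^ n"

definition leading_fun ::
  "nat \<Rightarrow> nat \<Rightarrow> (frob, 'm, 'd) module_scheme \<Rightarrow> (nat \<Rightarrow> 'm set) \<Rightarrow> rat poly fract" where
  "leading_fun p n M \<Omega> =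
     one_minus_t ^ delta1 (HS p n M \<Omega>) * Fraction_Field.Fract (g_poly p n) 1 * HS p n M \<Omega>"

end

theory Submission
  imports Defs "HOL-Library.Function_Algebras"
begin

text \<open>Write \<open>R\<close> for the polynomial ring, \<open>D\<close> for the ring of Frobenius operators and \<open>A\<close> for its
  associated graded ring. As a right module over itself, \<open>D\<close> contains the free submodule with basis
  \<open>x\<^sup>b F\<close>, where \<open>b\<close> runs over the exponent vectors with entries less than \<open>p\<close>, and the quotient is
  \<open>R\<close>. The same holds for \<open>A\<close> (\<open>xF_independent\<close>, \<open>regular_Psi_inj\<close>). Hence for a left
  module \<open>N\<close> the groups \<open>Tor\<^sub>0\<close> and \<open>Tor\<^sub>1\<close> of \<open>R\<close> and \<open>N\<close> are the cokernel and the kernel of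
  \<open>\<Psi> : (u\<^sub>b)\<^sub>b \<mapsto> \<Sum> x\<^sup>b F u\<^sub>b\<close>. The generating function of the degrees of the \<open>x\<^sup>b F\<close> is
  \<open>t (1 + \<dots> + t\<^sup>p\<^sup>-\<^sup>1)\<^sup>n\<close>, so counting dimensions gives \<open>g HS = HS(Tor\<^sub>0) - HS(Tor\<^sub>1)\<close>.

  The point is that \<open>Tor\<^sub>1\<close> is finite for a finitely presented graded module (\<open>finite_Psi_kernel\<close>).
  If the module is \<open>G / K\<close> with \<open>G\<close> free, its \<open>Tor\<^sub>1\<close> embeds into \<open>K / F K\<close>, where \<open>F K\<close> is the
  submodule generated by the image of \<open>K\<close>. That quotient is a finitely generated \<open>R\<close>-module because
  \<open>K\<close> is finitely generated, and the image of \<open>Tor\<^sub>1\<close> in it is killed by every \<open>x\<^sub>j\<^sup>p\<close>, since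
  \<open>x\<^sub>j\<^sup>p F = F x\<^sub>j\<close> has smaller degree than expected and so \<open>x\<^sub>j\<^sup>p F = 0\<close> in \<open>A\<close>.

  For a great filtration \<open>\<Omega>\<close> of \<open>M\<close> it follows that, in large degrees, \<open>\<Psi>\<close> is strict for the filtrations
  (\<open>strictness\<close>). Thus the kernel of \<open>\<Psi>\<close> on \<open>M\<close> itself is finite, of some dimension \<open>c\<close>, and
  \<open>dim \<Omega>\<^sub>i + c = h\<^sub>i + \<Sum> dim \<Omega>\<^sub>i\<^sub>-\<^sub>1\<^sub>-\<^sub>|\<^sub>b\<^sub>|\<close> for large \<open>i\<close>, where \<open>h\<^sub>i\<close> is the dimension of the image
  of \<open>\<Omega>\<^sub>i\<close> in \<open>M / R F M\<close> (\<open>dimension_count\<close>). So the pole at \<open>1\<close> of \<open>g HS\<close>, and with it both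
  invariants, is determined by the growth of \<open>h\<^sub>i - c\<close> (\<open>hilbert_series_growth\<close>). Here \<open>c\<close> and
  \<open>M / R F M\<close> depend on \<open>M\<close> only, and \<open>h\<close> is up to a shift the Hilbert function of a good filtration
  of a finitely generated \<open>R\<close>-module. Two great filtrations are comparable up to a shift of the index
  (\<open>great_filtrations_comparable\<close>), so their functions \<open>h\<close> bound each other up to a shift and
  have the same leading term (\<open>same_growth\<close>).

  Since the base field is finite, dimensions are compared through cardinalities of finite
  sets throughout.\<close>

section \<open>Additive spans in abelian groups of prime exponent\<close>

text \<open>The additive submonoid generated by \<open>S\<close>. In a group of finite exponent it is the subgroup
  generated by \<open>S\<close>.\<close>

inductive_set add_span :: "('a, 'b) ring_scheme \<Rightarrow> 'a set \<Rightarrow> 'a set"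
  for G :: "('a, 'b) ring_scheme" and S :: "'a set" where
  zero: "\<zero>\<^bsub>G\<^esub> \<in> add_span G S"
| add: "x \<in> add_span G S \<Longrightarrow> s \<in> S \<Longrightarrow> x \<oplus>\<^bsub>G\<^esub> s \<in> add_span G S"

lemma add_span_mono: "x \<in> add_span G S \<Longrightarrow> S \<subseteq> T \<Longrightarrow> x \<in> add_span G T"
  by (induction rule: add_span.induct) (auto intro: add_span.intros)

context abelian_group
begin

lemma add_span_closed: "x \<in> add_span G S \<Longrightarrow> S \<subseteq> carrier G \<Longrightarrow> x \<in> carrier G"
  by (induction rule: add_span.induct) auto

lemma add_span_base: "s \<in> S \<Longrightarrow> S \<subseteq> carrier G \<Longrightarrow> s \<in> add_span G S"
  using add_span.add[OF add_span.zero, of s S G] by auto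

lemma add_span_plus:
  assumes "y \<in> add_span G S" "x \<in> add_span G S" "S \<subseteq> carrier G"
  shows "x \<oplus> y \<in> add_span G S"
  using assms(1)
proof induction
  case zero
  then show ?case using assms add_span_closed by auto
next
  case (add y s)
  have "x \<oplus> (y \<oplus> s) = (x \<oplus> y) \<oplus> s"
    using add assms add_span_closed by (auto simp: a_assoc subset_eq)
  then show ?case using add by (metis add_span.add)
qed

lemma add_span_subset:
  assumes "x \<in> add_span G S" "S \<subseteq> add_span G T" "T \<subseteq> carrier G"
  shows "x \<in> add_span G T"
  using assms by induction (auto intro: add_span.zero add_span_plus)

lemma add_span_image:
  assumes "x \<in> add_span G S" "S \<subseteq> carrier G" "T \<subseteq> carrier H" "abelian_group H"
    and "f \<zero> = \<zero>\<^bsub>H\<^esub>"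
    and "\<And>x y. x \<in> carrier G \<Longrightarrow> y \<in> carrier G \<Longrightarrow> f (x \<oplus> y) = f x \<oplus>\<^bsub>H\<^esub> f y"
    and "\<And>s. s \<in> S \<Longrightarrow> f s \<in> add_span H T"
  shows "f x \<in> add_span H T"
  using assms(1)
proof induction
  case zero then show ?case using assms by (simp add: add_span.zero)
next
  case (add x s)
  then have "f (x \<oplus> s) = f x \<oplus>\<^bsub>H\<^esub> f s"
    using assms add_span_closed by (auto simp: subset_eq)
  then show ?case using add assms abelian_group.add_span_plus by metis
qed

lemma add_span_multiple:
  "x \<in> add_span G S \<Longrightarrow> S \<subseteq> carrier G \<Longrightarrow> [(k::nat)] \<cdot> x \<in> add_span G S"
  by (induction k) (auto simp: add_span_plus add_span.zero)

end

text \<open>A vector space over the prime field, given by its additive group only.\<close>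

locale exponent_p_group = abelian_group G for G (structure) +
  fixes p :: nat
  assumes prime_p: "prime p"
    and exponent: "x \<in> carrier G \<Longrightarrow> [p] \<cdot> x = \<zero>"
begin

lemma p_pos: "p > 0" using prime_p prime_gt_0_nat by blast

lemma a_inv_multiple:
  assumes "x \<in> carrier G" shows "\<ominus> x = [(p - 1)] \<cdot> x"
proof -
  have "[(p - 1)] \<cdot> x \<oplus> x = [p] \<cdot> x"
    using p_pos assms by (metis Suc_pred' add.nat_pow_Suc)
  then show ?thesis using exponent assms by (simp add: minus_equality)
qed

lemma add_span_neg: "x \<in> add_span G S \<Longrightarrow> S \<subseteq> carrier G \<Longrightarrow> \<ominus> x \<in> add_span G S"
  using a_inv_multiple add_span_multiple add_span_closed by metis

lemma add_span_minus:
  "x \<in> add_span G S \<Longrightarrow> y \<in> add_span G S \<Longrightarrow> S \<subseteq> carrier G \<Longrightarrow> x \<ominus> y \<in> add_span G S"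
  by (simp add: a_minus_def add_span_neg add_span_plus)

lemma multiple_mod:
  assumes "x \<in> carrier G" shows "[(k mod p)] \<cdot> x = [k] \<cdot> x"
proof -
  have "[k] \<cdot> x = [(p * (k div p))] \<cdot> x \<oplus> [(k mod p)] \<cdot> x"
    using assms by (simp add: add.nat_pow_mult)
  also have "[(p * (k div p))] \<cdot> x = [(k div p)] \<cdot> ([p] \<cdot> x)"
    using assms by (metis add.nat_pow_pow)
  finally show ?thesis using assms exponent by simp
qed

lemma add_span_insertE:
  assumes "x \<in> add_span G (insert v S)" "S \<subseteq> carrier G" "v \<in> carrier G"
  shows "\<exists>c<p. \<exists>y\<in>add_span G S. x = y \<oplus> [c] \<cdot> v"
proof -
  have "\<exists>c. \<exists>y\<in>add_span G S. x = y \<oplus> [(c::nat)] \<cdot> v"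
    using assms(1)
  proof induction
    case zero
    show ?case by (rule exI[of _ 0], rule bexI[of _ \<zero>]) (auto intro: add_span.zero)
  next
    case (add x s)
    then obtain c y where cy: "y \<in> add_span G S" "x = y \<oplus> [(c::nat)] \<cdot> v" by auto
    have yc: "y \<in> carrier G" using cy assms add_span_closed by auto
    show ?case
    proof (cases "s = v")
      case True
      then have "x \<oplus> s = y \<oplus> [Suc c] \<cdot> v" using cy yc assms by (simp add: a_assoc)
      then show ?thesis using cy by blast
    next
      case False
      then have s: "s \<in> S" using add by auto
      then have "x \<oplus> s = (y \<oplus> s) \<oplus> [c] \<cdot> v"
        using cy yc assms by (simp add: a_ac subset_eq)
      then show ?thesis using cy add_span.add[OF cy(1) s] by blast
    qed
  qed
  then obtain c y where "y\<in>add_span G S" "x = y \<oplus> [(c::nat)] \<cdot> v" by blast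
  then show ?thesis using multiple_mod assms(3) p_pos
    by (metis mod_less_divisor)
qed

lemma add_span_insertI:
  assumes "y \<in> add_span G S" "S \<subseteq> carrier G" "v \<in> carrier G"
  shows "y \<oplus> [(c::nat)] \<cdot> v \<in> add_span G (insert v S)"
  using assms by (intro add_span_plus add_span_multiple)
    (auto intro: add_span_mono[of y G S] add_span_base)

lemma add_span_redundant:
  assumes "v \<in> add_span G S" "S \<subseteq> carrier G"
  shows "add_span G (insert v S) = add_span G S"
  using assms add_span_subset[of _ "insert v S" S] add_span_base
    add_span_mono[OF _ subset_insertI, of _ G S v] by blast

lemma multiple_in_span_imp:
  assumes "[c] \<cdot> v \<in> add_span G S" "0 < c" "c < p" "S \<subseteq> carrier G" "v \<in> carrier G"
  shows "v \<in> add_span G S"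
proof -
  have "coprime c p"
    using assms prime_p by (metis coprime_commute nat_dvd_not_less prime_imp_coprime_nat)
  then obtain k where k: "[c * k = 1] (mod p)"
    using cong_solve_coprime_nat by auto
  have "[k] \<cdot> ([c] \<cdot> v) = [(c * k)] \<cdot> v" using assms add.nat_pow_pow by blast
  also have "\<dots> = [(1::nat)] \<cdot> v" using k multiple_mod assms(5) unfolding cong_def by metis
  also have "\<dots> = v" using assms by simp
  finally show ?thesis using add_span_multiple assms by metis
qed

lemma finite_add_span:
  assumes "finite S" "S \<subseteq> carrier G"
  shows "finite (add_span G S)"
  using assms
proof (induction S)
  case empty
  have "add_span G {} \<subseteq> {\<zero>}"
    by (auto elim: add_span.cases)
  then show ?case by (simp add: finite_subset)
next
  case (insert v S)
  have "add_span G (insert v S) \<subseteq> (\<lambda>(c,y). y \<oplus> [c] \<cdot> v) ` ({..<p} \<times> add_span G S)"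
    using add_span_insertE[of _ v S] insert.prems by (fastforce simp: image_iff)
  then show ?case using insert by (meson finite_SigmaI finite_imageI finite_lessThan
        finite_subset insert_subset)
qed

text \<open>The counting form of exchange: a vector outside the span multiplies the cardinality of the
  span by \<open>p\<close>.\<close>

lemma card_add_span_insert:
  assumes "finite (add_span G S)" "S \<subseteq> carrier G" "v \<in> carrier G" "v \<notin> add_span G S"
  shows "card (add_span G (insert v S)) = p * card (add_span G S)"
proof -
  let ?f = "\<lambda>(c::nat,y). y \<oplus> [c] \<cdot> v"
  have eq: "add_span G (insert v S) = ?f ` ({..<p} \<times> add_span G S)"
    using add_span_insertE[of _ v S] add_span_insertI[of _ S v] assms by (fastforce simp: image_iff)
  have key: "c = d" if "y \<oplus> [c] \<cdot> v = z \<oplus> [d] \<cdot> v" "y \<in> add_span G S" "z \<in> add_span G S" "c < p" "d \<le> c"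
    for c d :: nat and y z
  proof (rule ccontr)
    assume "c \<noteq> d"
    then have lt: "0 < c - d" "c - d < p" using that by auto
    have yz: "y \<in> carrier G" "z \<in> carrier G" using that assms add_span_closed by auto
    have "[c] \<cdot> v = [(c - d)] \<cdot> v \<oplus> [d] \<cdot> v"
      using that assms by (simp add: add.nat_pow_mult)
    then have "(y \<oplus> [(c - d)] \<cdot> v) \<oplus> [d] \<cdot> v = z \<oplus> [d] \<cdot> v"
      using that yz assms by (simp add: a_assoc)
    then have "y \<oplus> [(c - d)] \<cdot> v = z" using yz assms by simp
    then have "[(c - d)] \<cdot> v = z \<ominus> y"
      using yz assms by (metis a_comm a_inv_closed a_minus_def add.inv_solve_left add.nat_pow_closed)
    then have "[(c - d)] \<cdot> v \<in> add_span G S" using that assms add_span_minus by metis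
    then show False using multiple_in_span_imp lt assms by blast
  qed
  have "inj_on ?f ({..<p} \<times> add_span G S)"
  proof (rule inj_onI, clarsimp)
    fix c d :: nat and y z
    assume a: "c < p" "d < p" "y \<in> add_span G S" "z \<in> add_span G S" "y \<oplus> [c] \<cdot> v = z \<oplus> [d] \<cdot> v"
    have "c = d"
      using key[of y c z d] key[of z d y c] a by (cases "d \<le> c") auto
    then show "c = d \<and> y = z"
      using a assms add_span_closed by (metis add.nat_pow_closed add.right_cancel)
  qed
  then show ?thesis unfolding eq by (simp add: card_image card_cartesian_product)
qed

lemma add_span_Un_subgroup:
  assumes "x \<in> add_span G (J \<union> Y)" "J \<subseteq> carrier G" "Y \<subseteq> carrier G" "add_span G J \<subseteq> J"
  shows "\<exists>j\<in>J. \<exists>y\<in>add_span G Y. x = j \<oplus> y"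
  using assms(1)
proof induction
  case zero
  show ?case using assms(4) add_span.zero by (intro bexI[of _ \<zero>]) auto
next
  case (add x s)
  then obtain j y where jy: "j \<in> J" "y \<in> add_span G Y" "x = j \<oplus> y" by auto
  have c: "j \<in> carrier G" "y \<in> carrier G" "s \<in> carrier G"
    using jy add assms add_span_closed by auto
  show ?case
  proof (cases "s \<in> J")
    case True
    then have "j \<oplus> s \<in> J" using jy assms
      by (meson add_span_base add_span_plus subsetD)
    moreover have "x \<oplus> s = (j \<oplus> s) \<oplus> y" using jy c by (simp add: a_ac)
    ultimately show ?thesis using jy by blast
  next
    case False
    then have "y \<oplus> s \<in> add_span G Y" using add jy by (auto intro: add_span.add)
    moreover have "x \<oplus> s = j \<oplus> (y \<oplus> s)" using jy c by (simp add: a_ac)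
    ultimately show ?thesis using jy by blast
  qed
qed

end

section \<open>Monomials in commuting variables\<close>

text \<open>Exponent vectors of monomials in \<open>n\<close> variables, extended by zero.\<close>

definition exponents :: "nat \<Rightarrow> (nat \<Rightarrow> nat) set" where
  "exponents n = {a. \<forall>i\<ge>n. a i = 0}"

definition total_degree :: "nat \<Rightarrow> (nat \<Rightarrow> nat) \<Rightarrow> nat" where
  "total_degree n a = (\<Sum>i<n. a i)"

text \<open>The exponent vector of \<open>x\<^sub>j\<^sup>k\<close>.\<close>

definition var_power :: "nat \<Rightarrow> nat \<Rightarrow> nat \<Rightarrow> nat" where
  "var_power j k = (\<lambda>i. if i = j then k else 0)"

lemma exponents_plus: "a \<in> exponents n \<Longrightarrow> b \<in> exponents n \<Longrightarrow> a + b \<in> exponents n"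
  by (auto simp: exponents_def)

lemma exponents_minus: "a \<in> exponents n \<Longrightarrow> a - b \<in> exponents n"
  by (auto simp: exponents_def)

lemma exponents_zero: "0 \<in> exponents n"
  by (auto simp: exponents_def)

lemma exponents_var_power: "j < n \<Longrightarrow> var_power j k \<in> exponents n"
  by (auto simp: exponents_def var_power_def)

lemma total_degree_plus: "total_degree n (a + b) = total_degree n a + total_degree n b"
  by (simp add: total_degree_def sum.distrib)

lemma total_degree_zero [simp]: "total_degree n 0 = 0"
  by (simp add: total_degree_def)

lemma total_degree_var_power: "j < n \<Longrightarrow> total_degree n (var_power j k) = k"
  by (simp add: total_degree_def var_power_def)

lemma exponents_split:
  fixes a b :: "nat \<Rightarrow> nat"
  assumes "b \<le> a" shows "a = b + (a - b)"
  using assms by (auto simp: fun_eq_iff le_fun_def)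

lemma exponent_le_total_degree: "i < n \<Longrightarrow> a i \<le> total_degree n a"
  unfolding total_degree_def by (rule member_le_sum) auto

lemma finite_exponents_bounded: "finite {a \<in> exponents n. \<forall>i<n. a i \<le> d}"
proof (rule finite_subset)
  let ?f = "\<lambda>g i. if i < n then g i else (0::nat)"
  show "{a \<in> exponents n. \<forall>i<n. a i \<le> d} \<subseteq> ?f ` ({..<n} \<rightarrow>\<^sub>E {..d})"
  proof
    fix a assume a: "a \<in> {a \<in> exponents n. \<forall>i<n. a i \<le> d}"
    then have "a = ?f (restrict a {..<n})" by (auto simp: exponents_def fun_eq_iff)
    moreover have "restrict a {..<n} \<in> {..<n} \<rightarrow>\<^sub>E {..d}" using a by auto
    ultimately show "a \<in> ?f ` ({..<n} \<rightarrow>\<^sub>E {..d})" by (rule image_eqI)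
  qed
qed (auto intro!: finite_PiE)

lemma finite_exponents_degree_le: "finite {a \<in> exponents n. total_degree n a \<le> d}"
  by (rule finite_subset[OF _ finite_exponents_bounded[of n d]])
    (auto dest: exponent_le_total_degree intro: order_trans)

lemma finite_exponents_degree: "finite {a \<in> exponents n. P a \<and> total_degree n a = d}"
  by (rule finite_subset[OF _ finite_exponents_degree_le[of n d]]) auto

lemma dickson:
  assumes "U \<subseteq> exponents n"
  shows "\<exists>B. finite B \<and> B \<subseteq> U \<and> (\<forall>u\<in>U. \<exists>b\<in>B. b \<le> u)"
  using assms
proof (induction n arbitrary: U)
  case 0
  then have "U \<subseteq> {0}" by (auto simp: exponents_def fun_eq_iff)
  then show ?case by (intro exI[of _ U]) (auto intro: finite_subset)
next
  case (Suc n)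
  define pr where "pr = (\<lambda>a::nat\<Rightarrow>nat. a(n := 0))"
  have pr: "pr a \<in> exponents n" if "a \<in> exponents (Suc n)" for a
    using that by (auto simp: exponents_def pr_def)
  have proj: "\<exists>B. finite B \<and> B \<subseteq> V \<and> (\<forall>u\<in>V. \<exists>b\<in>B. \<forall>i. i \<noteq> n \<longrightarrow> b i \<le> u i)"
    if V: "V \<subseteq> U" for V
  proof -
    have "pr ` V \<subseteq> exponents n" using V Suc.prems pr by auto
    then obtain C where C: "finite C" "C \<subseteq> pr ` V" "\<forall>u\<in>pr ` V. \<exists>b\<in>C. b \<le> u"
      using Suc.IH by meson
    have "\<exists>B\<subseteq>V. finite B \<and> C = pr ` B" by (rule finite_subset_image[OF C(1,2)])
    then obtain B where B: "finite B" "B \<subseteq> V" "C = pr ` B" by (elim exE conjE) simp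
    have "\<exists>b\<in>B. \<forall>i. i \<noteq> n \<longrightarrow> b i \<le> u i" if "u \<in> V" for u
    proof -
      have "\<exists>c\<in>pr ` B. c \<le> pr u" by (rule bspec[OF C(3)[unfolded B(3)] imageI[OF that]])
      then obtain b where b: "b \<in> B" "pr b \<le> pr u" by (elim bexE imageE) simp
      have "b i \<le> u i" if "i \<noteq> n" for i
        using le_funD[OF b(2), of i] that by (simp add: pr_def)
      then show ?thesis using b(1) by (intro bexI[of _ b]) simp
    qed
    then show ?thesis using B by blast
  qed
  obtain B0 where B0: "finite B0" "B0 \<subseteq> U" "\<forall>u\<in>U. \<exists>b\<in>B0. \<forall>i. i \<noteq> n \<longrightarrow> b i \<le> u i"
    using proj[of U] by blast
  define N where "N = Max (insert 0 ((\<lambda>b. b n) ` B0))"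
  \<comment> \<open>A finite basis for each of the finitely many slices \<open>u n = k\<close> below the height of \<open>B0\<close>.\<close>
  have "\<forall>k. \<exists>B. finite B \<and> B \<subseteq> {u\<in>U. u n = k} \<and>
      (\<forall>u\<in>{u\<in>U. u n = k}. \<exists>b\<in>B. \<forall>i. i \<noteq> n \<longrightarrow> b i \<le> u i)"
    by (intro allI proj) blast
  from choice[OF this] obtain S where S': "\<forall>k. finite (S k) \<and> S k \<subseteq> {u\<in>U. u n = k} \<and>
      (\<forall>u\<in>{u\<in>U. u n = k}. \<exists>b\<in>S k. \<forall>i. i \<noteq> n \<longrightarrow> b i \<le> u i)" ..
  note S = S'[rule_format, THEN conjunct1] S'[rule_format, THEN conjunct2, THEN conjunct1]
    spec[OF S', THEN conjunct2, THEN conjunct2]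
  show ?case
  proof (intro exI conjI ballI)
    show "finite (B0 \<union> (\<Union>k<N. S k))" using B0 S by auto
    show "B0 \<union> (\<Union>k<N. S k) \<subseteq> U" using B0 S(2) by blast
    fix u assume u: "u \<in> U"
    show "\<exists>b\<in>B0 \<union> (\<Union>k<N. S k). b \<le> u"
    proof (cases "u n < N")
      case True
      then obtain b where "b \<in> S (u n)" "\<forall>i. i \<noteq> n \<longrightarrow> b i \<le> u i"
        using bspec[OF S(3)[of "u n"], of u] u by auto
      moreover then have "b n = u n" using S(2) by blast
      ultimately have "b \<le> u" by (metis le_funI order_refl)
      then show ?thesis using True \<open>b \<in> S (u n)\<close> by blast
    next
      case False
      obtain b where b: "b \<in> B0" "\<forall>i. i \<noteq> n \<longrightarrow> b i \<le> u i" using B0 u by blast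
      then have "b n \<le> N" unfolding N_def using B0(1) by (intro Max_ge) auto
      then have "b \<le> u" using b False by (metis le_funI le_trans linorder_not_less)
      then show ?thesis using b by blast
    qed
  qed
qed

text \<open>The exponent vectors of the monomials in a monomial ideal of the polynomial ring.\<close>

definition monomial_ideal :: "nat \<Rightarrow> (nat \<Rightarrow> nat) set \<Rightarrow> bool" where
  "monomial_ideal n U \<longleftrightarrow> U \<subseteq> exponents n \<and> (\<forall>a\<in>U. \<forall>c\<in>exponents n. a + c \<in> U)"

lemma monomial_ideal_ge:
  assumes "monomial_ideal n U" "b \<in> U" "a \<in> exponents n" "b \<le> a"
  shows "a \<in> U"
proof -
  have "b + (a - b) \<in> U" using assms exponents_minus by (auto simp: monomial_ideal_def)
  then show ?thesis using exponents_split[OF assms(4)] by metis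
qed

lemma monomial_ideal_chain:
  assumes "\<And>k. monomial_ideal n (U k)" "\<And>k. U k \<subseteq> U (Suc k)"
  shows "\<exists>k. \<forall>j\<ge>k. U j = U k"
proof -
  have mono: "U k \<subseteq> U j" if "k \<le> j" for k j
    using lift_Suc_mono_le[of U, OF assms(2) that] .
  obtain B where B: "finite B" "B \<subseteq> (\<Union>k. U k)" "\<forall>u\<in>(\<Union>k. U k). \<exists>b\<in>B. b \<le> u"
    using dickson[of "\<Union>k. U k" n] assms(1) by (auto simp: monomial_ideal_def)
  have "\<exists>k. B \<subseteq> U k" using B(1,2)
  proof (induction B)
    case (insert b B)
    then obtain k j where "B \<subseteq> U k" "b \<in> U j" by auto
    then have "insert b B \<subseteq> U (max k j)" using mono[of k "max k j"] mono[of j "max k j"] by auto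
    then show ?case by blast
  qed auto
  then obtain k where k: "B \<subseteq> U k" by blast
  have "U j \<subseteq> U k" for j
  proof
    fix u assume u: "u \<in> U j"
    then obtain b where b: "b \<in> B" "b \<le> u" using B(3) by blast
    have "u \<in> exponents n" using assms(1)[of j] u by (auto simp: monomial_ideal_def)
    then show "u \<in> U k"
      using monomial_ideal_ge[OF assms(1) subsetD[OF k b(1)] _ b(2)] by blast
  qed
  then show ?thesis using mono by blast
qed


section \<open>Hilbert series of monomial ideals\<close>

text \<open>\<open>f\<close> is the expansion of a polynomial divided by \<open>(1 - t)\<^sup>k\<close>.\<close>

definition pole_order_le :: "nat \<Rightarrow> rat fps \<Rightarrow> bool" where
  "pole_order_le k f \<longleftrightarrow> (\<exists>P. (1 - fps_X) ^ k * f = fps_of_poly P)"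

lemma pole_order_le_add:
  "pole_order_le k f \<Longrightarrow> pole_order_le k g \<Longrightarrow> pole_order_le k (f + g)"
  unfolding pole_order_le_def by (metis distrib_left fps_of_poly_add)

lemma pole_order_le_mult_poly:
  "pole_order_le k f \<Longrightarrow> pole_order_le k (fps_of_poly Q * f)"
  unfolding pole_order_le_def by (metis fps_of_poly_mult mult.left_commute)

lemma fps_one_minus_X_poly: "fps_of_poly [:1, - 1:] = (1 - fps_X :: rat fps)"
  by (simp add: fps_of_poly_pCons)

lemma pole_order_le_poly: "pole_order_le k (fps_of_poly Q)"
  unfolding pole_order_le_def
proof
  show "(1 - fps_X) ^ k * fps_of_poly Q = fps_of_poly ([:1, - 1:] ^ k * Q)"
    by (simp add: fps_of_poly_mult fps_of_poly_power fps_one_minus_X_poly)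
qed

lemma pole_order_le_sum:
  "(\<And>x. x \<in> A \<Longrightarrow> pole_order_le k (f x)) \<Longrightarrow> pole_order_le k (\<Sum>x\<in>A. f x)"
  by (induction A rule: infinite_finite_induct)
    (auto intro: pole_order_le_add pole_order_le_poly[of k 0, simplified])

lemma pole_order_le_mono:
  assumes "pole_order_le k f" "k \<le> l" shows "pole_order_le l f"
proof -
  obtain P where P: "(1 - fps_X) ^ k * f = fps_of_poly P"
    using assms by (auto simp: pole_order_le_def)
  obtain m where m: "l = m + k" using assms(2) by (metis le_iff_add add.commute)
  have "pole_order_le 0 ((1 - fps_X) ^ m * fps_of_poly P)"
    using pole_order_le_poly[of 0 "[:1, - 1:] ^ m * P"]
    by (simp add: fps_of_poly_mult fps_of_poly_power fps_one_minus_X_poly)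
  then show ?thesis unfolding pole_order_le_def m power_add
    using P by (simp add: mult.assoc)
qed

lemma pole_order_le_Suc:
  assumes "pole_order_le k ((1 - fps_X) * f)" shows "pole_order_le (Suc k) f"
  using assms unfolding pole_order_le_def by (metis (no_types) mult.assoc power_Suc2)

text \<open>The generating function, by degree, of the monomials outside \<open>U\<close>.\<close>

definition standard_series :: "nat \<Rightarrow> (nat \<Rightarrow> nat) set \<Rightarrow> rat fps" where
  "standard_series n U = Abs_fps (\<lambda>d. of_nat (card {a \<in> exponents n. a \<notin> U \<and> total_degree n a = d}))"

text \<open>Split the monomials outside \<open>U\<close> in \<open>n + 1\<close> variables into those without the last variable and
  the multiples of it.\<close>

lemma standard_series_step:
  fixes n :: nat and U :: "(nat \<Rightarrow> nat) set"
  defines "e \<equiv> var_power n 1"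
  shows "standard_series (Suc n) U = standard_series n (U \<inter> exponents n)
    + fps_X * standard_series (Suc n) {a \<in> exponents (Suc n). a + e \<in> U}"
proof (rule fps_ext)
  fix d
  let ?A = "\<lambda>d. {a \<in> exponents (Suc n). a \<notin> U \<and> total_degree (Suc n) a = d}"
  let ?B = "{a \<in> exponents n. a \<notin> U \<inter> exponents n \<and> total_degree n a = d}"
  let ?U = "{a \<in> exponents (Suc n). a + e \<in> U}"
  let ?C = "\<lambda>d. {a \<in> exponents (Suc n). a \<notin> ?U \<and> total_degree (Suc n) a = d}"
  have sub: "exponents n \<subseteq> exponents (Suc n)" by (auto simp: exponents_def)
  have e: "e \<in> exponents (Suc n)" "total_degree (Suc n) e = 1" "e n = 1"
    by (simp_all add: e_def exponents_var_power total_degree_var_power) (simp add: var_power_def)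
  have dg: "total_degree (Suc n) a = total_degree n a + a n" for a by (simp add: total_degree_def)
  have low: "a \<in> exponents n \<longleftrightarrow> a \<in> exponents (Suc n) \<and> a n = 0" for a
    unfolding exponents_def by (auto simp: not_less_eq_eq) (metis le_antisym not_less_eq_eq)
  have B: "?B = {a \<in> ?A d. a n = 0}"
    by (auto simp: dg low)
  have C: "(\<lambda>a. a + e) ` ?C k = {a \<in> ?A (Suc k). a n \<noteq> 0}" for k
  proof (intro equalityI subsetI)
    fix b assume "b \<in> {a \<in> ?A (Suc k). a n \<noteq> 0}"
    then have b: "b \<in> ?A (Suc k)" "b n \<noteq> 0" by auto
    then have "e \<le> b" by (auto simp: e_def var_power_def le_fun_def)
    then have eq: "(b - e) + e = b" using exponents_split by (metis add.commute)
    have ex: "b - e \<in> exponents (Suc n)" using b exponents_minus by auto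
    have "total_degree (Suc n) b = total_degree (Suc n) (b - e) + 1"
      using total_degree_plus[of "Suc n" "b - e" e] eq e by simp
    then have "b - e \<in> ?C k" using b eq ex by auto
    then show "b \<in> (\<lambda>a. a + e) ` ?C k" by (intro image_eqI[where x = "b - e"]) (simp add: eq)
  next
    fix b assume "b \<in> (\<lambda>a. a + e) ` ?C k"
    then obtain a where "b = a + e" "a \<in> ?C k" by blast
    then show "b \<in> {a \<in> ?A (Suc k). a n \<noteq> 0}"
      using e by (auto simp: exponents_plus total_degree_plus)
  qed
  have inj: "inj_on (\<lambda>a. a + e) S" for S by (auto simp: inj_on_def)
  have fin: "finite (?A d)" for d by (rule finite_exponents_degree)
  have split: "card (?A d) = card ?B + card {a \<in> ?A d. a n \<noteq> 0}"
  proof -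
    have "?A d = {a \<in> ?A d. a n = 0} \<union> {a \<in> ?A d. a n \<noteq> 0}" by auto
    moreover have "card ({a \<in> ?A d. a n = 0} \<union> {a \<in> ?A d. a n \<noteq> 0})
        = card {a \<in> ?A d. a n = 0} + card {a \<in> ?A d. a n \<noteq> 0}"
      by (intro card_Un_disjoint finite_subset[OF _ fin[of d]]) auto
    ultimately show ?thesis unfolding B by argo
  qed
  show "standard_series (Suc n) U $ d = (standard_series n (U \<inter> exponents n)
    + fps_X * standard_series (Suc n) ?U) $ d"
  proof (cases d)
    case 0
    have ne: "{a \<in> ?A d. a n \<noteq> 0} = {}" using 0 by (auto simp: dg)
    have "card (?A d) = card ?B" using split unfolding ne by simp
    then show ?thesis using 0 by (simp add: standard_series_def)
  next
    case (Suc k)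
    have eq: "card {a \<in> ?A d. a n \<noteq> 0} = card (?C k)"
      unfolding Suc C[symmetric] by (rule card_image[OF inj])
    have "card (?A d) = card ?B + card (?C k)" using split unfolding eq .
    then show ?thesis using Suc by (simp add: standard_series_def)
  qed
qed

text \<open>The ideals \<open>U : x\<^sub>n\<^sup>k\<close> form an ascending chain, which stabilises; at the stable ideal the series
  is determined by one with fewer variables, and the earlier ideals are reached by descent on \<open>k\<close>.\<close>

lemma pole_order_standard_series:
  assumes "monomial_ideal n U"
  shows "pole_order_le n (standard_series n U)"
  using assms
proof (induction n arbitrary: U)
  case 0
  have "standard_series 0 U = fps_of_poly [:of_nat (card {a \<in> exponents 0. a \<notin> U}):]"
    by (rule fps_ext)
      (auto simp: standard_series_def total_degree_def fps_of_poly_const split: if_splits)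
  then show ?case by (metis pole_order_le_poly)
next
  case (Suc n)
  define e where "e = var_power n"
  have e: "e k \<in> exponents (Suc n)" "e (Suc k) = e 1 + e k" for k
    unfolding e_def by (simp add: exponents_var_power) (auto simp: var_power_def)
  define V where "V = (\<lambda>k. {a \<in> exponents (Suc n). a + e k \<in> U})"
  have V: "monomial_ideal (Suc n) (V k)" for k
    unfolding monomial_ideal_def
  proof (intro conjI ballI)
    fix a c assume a: "a \<in> V k" and c: "c \<in> exponents (Suc n)"
    then have "(a + e k) + c \<in> U" using Suc.prems by (auto simp: V_def monomial_ideal_def)
    then have "(a + c) + e k \<in> U" by (simp add: ac_simps)
    then show "a + c \<in> V k" using a c by (auto simp: V_def exponents_plus)
  qed (auto simp: V_def)
  have "e 0 = 0" by (auto simp: e_def var_power_def)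
  then have V0: "V 0 = U" using Suc.prems by (auto simp: V_def monomial_ideal_def)
  have V_Suc: "V (Suc k) = {a \<in> exponents (Suc n). a + e 1 \<in> V k}" for k
    using e(1)[of 1] exponents_plus unfolding V_def e(2) by (auto simp: add.assoc)
  have "V k \<subseteq> V (Suc k)" for k
    using V[of k] e(1)[of 1] unfolding V_Suc monomial_ideal_def by blast
  then obtain k0 where k0: "\<forall>j\<ge>k0. V j = V k0" using monomial_ideal_chain V by metis
  have recur: "standard_series (Suc n) (V k) = standard_series n (V k \<inter> exponents n)
      + fps_X * standard_series (Suc n) (V (Suc k))" for k
    using standard_series_step[of n "V k"] unfolding V_Suc e_def .
  have slice: "pole_order_le n (standard_series n (V k \<inter> exponents n))" for k
  proof (rule Suc.IH)
    have "exponents n \<subseteq> exponents (Suc n)" by (auto simp: exponents_def)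
    then show "monomial_ideal n (V k \<inter> exponents n)"
      using V[of k] exponents_plus unfolding monomial_ideal_def by blast
  qed
  have "(1 - fps_X) * standard_series (Suc n) (V k0) = standard_series n (V k0 \<inter> exponents n)"
  proof -
    have "V (Suc k0) = V k0" using k0[rule_format, of "Suc k0"] by (meson le_SucI order_refl)
    then show ?thesis using recur[of k0] by (simp add: algebra_simps)
  qed
  then have top: "pole_order_le (Suc n) (standard_series (Suc n) (V k0))"
    using slice pole_order_le_Suc by metis
  have weaken: "pole_order_le (Suc n) f" if "pole_order_le n f" for f
    using pole_order_le_mono[OF that, of "Suc n"] by simp
  have "pole_order_le (Suc n) (standard_series (Suc n) (V k))" if "k \<le> k0" for k
    using that
  proof (induction k rule: inc_induct)
    case base then show ?case by (rule top)
  next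
    case (step k)
    have "pole_order_le (Suc n) (fps_of_poly [:0, 1:] * standard_series (Suc n) (V (Suc k)))"
      by (rule pole_order_le_mult_poly) (rule step)
    then have "pole_order_le (Suc n) (fps_X * standard_series (Suc n) (V (Suc k)))"
      by (simp add: fps_of_poly_pCons fps_of_poly_0)
    then show ?case
      by (subst recur) (rule pole_order_le_add[OF weaken[OF slice]])
  qed
  then have "pole_order_le (Suc n) (standard_series (Suc n) (V 0))" by blast
  then show ?case unfolding V0 .
qed

section \<open>Standard monomials of a finitely generated module\<close>

text \<open>A graded lexicographic order on the pairs \<open>(a, s)\<close>, which stand for the monomial \<open>x\<^sup>a\<close> times
  the \<open>s\<close>-th generator: compare total degrees, then exponent vectors lexicographically, then
  generators. All three comparisons are one lexicographic comparison of \<open>monomial_key\<close>.\<close>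

definition lex_less :: "(nat \<Rightarrow> nat) \<Rightarrow> (nat \<Rightarrow> nat) \<Rightarrow> bool" where
  "lex_less f g \<longleftrightarrow> (\<exists>i. f i < g i \<and> (\<forall>j<i. f j = g j))"

definition monomial_key :: "nat \<Rightarrow> (nat \<Rightarrow> nat) \<times> nat \<Rightarrow> nat \<Rightarrow> nat" where
  "monomial_key n m i = (if i = 0 then total_degree n (fst m)
     else if i \<le> n then fst m (i - 1) else if i = Suc n then snd m else 0)"

definition monomial_less :: "nat \<Rightarrow> (nat \<Rightarrow> nat) \<times> nat \<Rightarrow> (nat \<Rightarrow> nat) \<times> nat \<Rightarrow> bool" where
  "monomial_less n l m \<longleftrightarrow> lex_less (monomial_key n l) (monomial_key n m)"

lemma lex_less_irrefl: "\<not> lex_less f f"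
  by (auto simp: lex_less_def)

lemma lex_less_trans: "lex_less f g \<Longrightarrow> lex_less g h \<Longrightarrow> lex_less f h"
  unfolding lex_less_def by (metis nat_neq_iff order.strict_trans)

lemma lex_less_total: "f \<noteq> g \<Longrightarrow> lex_less f g \<or> lex_less g f"
proof -
  assume "f \<noteq> g"
  then have ex: "\<exists>i. f i \<noteq> g i" by auto
  define i where "i = (LEAST i. f i \<noteq> g i)"
  have "f i \<noteq> g i" "\<forall>j<i. f j = g j"
    using LeastI_ex[OF ex] not_less_Least unfolding i_def by blast+
  then show ?thesis unfolding lex_less_def by (metis nat_neq_iff)
qed

lemma monomial_key_inj:
  assumes "fst l \<in> exponents n" "fst m \<in> exponents n" "monomial_key n l = monomial_key n m"
  shows "l = m"
proof (rule prod_eqI)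
  show "fst l = fst m"
  proof
    fix i
    have "monomial_key n l (Suc i) = monomial_key n m (Suc i)" using assms(3) by simp
    then show "fst l i = fst m i"
      using assms(1,2) by (cases "i < n") (auto simp: monomial_key_def exponents_def)
  qed
  have "monomial_key n l (Suc n) = monomial_key n m (Suc n)" using assms(3) by simp
  then show "snd l = snd m" by (simp add: monomial_key_def)
qed

lemma monomial_less_irrefl: "\<not> monomial_less n m m"
  by (simp add: monomial_less_def lex_less_irrefl)

lemma monomial_less_trans: "monomial_less n l m \<Longrightarrow> monomial_less n m k \<Longrightarrow> monomial_less n l k"
  unfolding monomial_less_def by (rule lex_less_trans)

lemma monomial_less_total:
  "fst l \<in> exponents n \<Longrightarrow> fst m \<in> exponents n \<Longrightarrow> l \<noteq> m \<Longrightarrow>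
    monomial_less n l m \<or> monomial_less n m l"
  unfolding monomial_less_def using lex_less_total monomial_key_inj by blast

lemma monomial_less_degree: "monomial_less n l m \<Longrightarrow> total_degree n (fst l) \<le> total_degree n (fst m)"
proof -
  assume "monomial_less n l m"
  then obtain i where "monomial_key n l i < monomial_key n m i" "\<forall>j<i. monomial_key n l j = monomial_key n m j"
    by (auto simp: monomial_less_def lex_less_def)
  then have "monomial_key n l 0 \<le> monomial_key n m 0" by (cases "i = 0") auto
  then show ?thesis by (simp add: monomial_key_def)
qed

lemma monomial_less_degreeI:
  "total_degree n (fst l) < total_degree n (fst m) \<Longrightarrow> monomial_less n l m"
  unfolding monomial_less_def lex_less_def by (rule exI[of _ 0]) (simp add: monomial_key_def)

lemma monomial_less_plus:
  assumes "monomial_less n l m"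
  shows "monomial_less n (fst l + c, snd l) (fst m + c, snd m)"
proof -
  have eq: "monomial_key n (fst m + c, snd m) i = monomial_key n m i + monomial_key n (c, 0) i" for m i
    by (auto simp: monomial_key_def total_degree_plus)
  show ?thesis using assms unfolding monomial_less_def lex_less_def eq by auto
qed

text \<open>An \<open>\<F>\<^sub>p\<close>-vector space \<open>G\<close> on which the monoid of monomials in \<open>n\<close> variables acts, a stable
  subspace \<open>J\<close> and finitely many elements \<open>gen s\<close>. The object of study is the submodule of \<open>G/J\<close>
  generated by the \<open>gen s\<close>. No quotient is formed: all statements are about sums with \<open>J\<close>.\<close>

locale monomial_action = exponent_p_group G p for G (structure) and p :: nat +
  fixes n :: nat and act :: "(nat \<Rightarrow> nat) \<Rightarrow> 'a \<Rightarrow> 'a" and J :: "'a set"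
    and gen :: "nat \<Rightarrow> 'a" and r :: nat
  assumes act_closed: "a \<in> exponents n \<Longrightarrow> x \<in> carrier G \<Longrightarrow> act a x \<in> carrier G"
    and act_add: "a \<in> exponents n \<Longrightarrow> x \<in> carrier G \<Longrightarrow> y \<in> carrier G \<Longrightarrow>
      act a (x \<oplus> y) = act a x \<oplus> act a y"
    and act_comp: "a \<in> exponents n \<Longrightarrow> b \<in> exponents n \<Longrightarrow> x \<in> carrier G \<Longrightarrow>
      act (a + b) x = act a (act b x)"
    and J_carrier: "J \<subseteq> carrier G"
    and J_span: "add_span G J \<subseteq> J"
    and J_act: "a \<in> exponents n \<Longrightarrow> x \<in> J \<Longrightarrow> act a x \<in> J"
    and gen_closed: "s < r \<Longrightarrow> gen s \<in> carrier G"
begin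

text \<open>The monomials times generators, and the elements of \<open>G\<close> they stand for.\<close>

definition indices :: "((nat \<Rightarrow> nat) \<times> nat) set" where
  "indices = exponents n \<times> {..<r}"

definition vec :: "(nat \<Rightarrow> nat) \<times> nat \<Rightarrow> 'a" where
  "vec m = act (fst m) (gen (snd m))"

text \<open>\<open>J\<close> and the monomials below \<open>m\<close>; \<open>m\<close> is standard if its vector is not in the span of these.\<close>

definition lower :: "(nat \<Rightarrow> nat) \<times> nat \<Rightarrow> 'a set" where
  "lower m = J \<union> vec ` {l \<in> indices. monomial_less n l m}"

definition standard :: "((nat \<Rightarrow> nat) \<times> nat) set" where
  "standard = {m \<in> indices. vec m \<notin> add_span G (lower m)}"

lemma vec_closed: "m \<in> indices \<Longrightarrow> vec m \<in> carrier G"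
  by (auto simp: indices_def vec_def act_closed gen_closed)

lemma lower_closed: "lower m \<subseteq> carrier G"
  using J_carrier vec_closed by (auto simp: lower_def)

lemma J_zero: "\<zero> \<in> J" using J_span add_span.zero by blast

lemma act_zero: "a \<in> exponents n \<Longrightarrow> act a \<zero> = \<zero>"
  using act_add[of a \<zero> \<zero>] act_closed[of a \<zero>] by (metis add.r_cancel_one l_zero zero_closed)

lemma vec_plus:
  assumes "m \<in> indices" "c \<in> exponents n"
  shows "(fst m + c, snd m) \<in> indices" "vec (fst m + c, snd m) = act c (vec m)"
  using assms act_comp[of c "fst m" "gen (snd m)"]
  by (auto simp: indices_def vec_def exponents_plus gen_closed add.commute)

lemma act_lower:
  assumes "c \<in> exponents n" "x \<in> add_span G (lower m)"
  shows "act c x \<in> add_span G (lower (fst m + c, snd m))"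
proof (rule add_span_image[OF assms(2) lower_closed lower_closed])
  fix v assume "v \<in> lower m"
  then consider "v \<in> J" | l where "l \<in> indices" "monomial_less n l m" "v = vec l"
    by (auto simp: lower_def)
  then have "act c v \<in> lower (fst m + c, snd m)"
  proof cases
    case 1 then show ?thesis using J_act assms by (auto simp: lower_def)
  next
    case 2
    then have "vec (fst l + c, snd l) \<in> lower (fst m + c, snd m)"
      using vec_plus(1)[of l c] monomial_less_plus[of n l m c] assms(1)
      unfolding lower_def by blast
    then show ?thesis using vec_plus(2)[of l c] 2 assms(1) by simp
  qed
  then show "act c v \<in> add_span G (lower (fst m + c, snd m))" by (rule add_span_base[OF _ lower_closed])
qed (use assms act_add act_zero in \<open>auto intro: abelian_group_axioms\<close>)

lemma finite_degree_le: "finite {m \<in> indices. total_degree n (fst m) \<le> d}"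
proof (rule finite_subset)
  show "{m \<in> indices. total_degree n (fst m) \<le> d}
    \<subseteq> {a \<in> exponents n. total_degree n a \<le> d} \<times> {..<r}" by (auto simp: indices_def)
qed (simp add: finite_exponents_degree_le)

lemma finite_less: "finite {l \<in> indices. monomial_less n l m}"
  by (rule finite_subset[OF _ finite_degree_le[of "total_degree n (fst m)"]])
    (auto dest: monomial_less_degree)

lemma max_index:
  assumes "finite E" "E \<noteq> {}" "E \<subseteq> indices"
  shows "\<exists>m\<in>E. \<forall>l\<in>E. l \<noteq> m \<longrightarrow> monomial_less n l m"
  using assms
proof (induction E rule: finite_ne_induct)
  case (insert x F)
  then obtain m where m: "m \<in> F" "\<forall>l\<in>F. l \<noteq> m \<longrightarrow> monomial_less n l m" by auto
  have "x \<noteq> m" using insert m by auto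
  then have "monomial_less n x m \<or> monomial_less n m x"
    using insert.prems m by (intro monomial_less_total) (auto simp: indices_def)
  then show ?case
  proof
    assume "monomial_less n x m"
    then show ?thesis using m by auto
  next
    assume "monomial_less n m x"
    then have "monomial_less n l x" if "l \<in> F" for l
      using m that monomial_less_trans[of n l m x] by (cases "l = m") auto
    then show ?thesis by blast
  qed
qed auto

text \<open>A modular law: an element of \<open>W\<close> needs only the part of \<open>J\<close> in \<open>W\<close>.\<close>

lemma vec_span_modular:
  assumes W: "W \<subseteq> carrier G" "add_span G W \<subseteq> W" and E: "E \<subseteq> indices" "vec ` E \<subseteq> W"
    and x: "x \<in> W" "x \<in> add_span G (J \<union> vec ` E)"
  shows "x \<in> add_span G (W \<inter> J \<union> vec ` E)"
proof -
  have vE: "vec ` E \<subseteq> carrier G" using E vec_closed by auto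
  obtain j y where jy: "j \<in> J" "y \<in> add_span G (vec ` E)" "x = j \<oplus> y"
    using add_span_Un_subgroup[OF x(2) J_carrier vE J_span] by blast
  have y: "y \<in> add_span G W" using add_span_mono jy E by metis
  have c: "j \<in> carrier G" "y \<in> carrier G" using jy J_carrier W y add_span_closed by auto
  have "x \<ominus> y \<in> add_span G W" using y x W add_span_base add_span_minus by metis
  moreover have "x \<ominus> y = j" using jy c by (simp add: a_minus_def a_assoc r_neg)
  ultimately have "j \<in> W \<inter> J" using W jy by auto
  then show ?thesis unfolding jy
    using vE W J_carrier jy(2) by (intro add_span_plus) (auto intro: add_span_base add_span_mono)
qed

text \<open>The standard monomials are a basis modulo \<open>J\<close>; as the field is finite, dimensions are
  counted by cardinalities.\<close>

lemma card_span_standard: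
  assumes W: "finite W" "W \<subseteq> carrier G" "add_span G W \<subseteq> W"
    and E: "finite E" "E \<subseteq> indices" "vec ` E \<subseteq> W"
    and down: "\<And>l m. m \<in> E \<Longrightarrow> l \<in> indices \<Longrightarrow> monomial_less n l m \<Longrightarrow> l \<in> E"
  shows "card (add_span G (W \<inter> J \<union> vec ` E)) = p ^ card (E \<inter> standard) * card (W \<inter> J)"
  using E down
proof (induction "card E" arbitrary: E)
  case 0
  then have "E = {}" by simp
  moreover have "add_span G (W \<inter> J) = W \<inter> J"
    using W J_carrier J_span add_span_base[of _ "W \<inter> J"]
      add_span_mono[of _ G "W \<inter> J" W] add_span_mono[of _ G "W \<inter> J" J] by blast
  ultimately show ?case by simp
next
  case (Suc k)
  then obtain m where m: "m \<in> E" "\<forall>l\<in>E. l \<noteq> m \<longrightarrow> monomial_less n l m"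
    using max_index[of E] by (metis card.empty nat.distinct(1))
  define F where "F = {l \<in> indices. monomial_less n l m}"
  have EF: "E = insert m F" "m \<notin> F"
  proof (intro equalityI subsetI)
    fix l assume "l \<in> insert m F"
    then show "l \<in> E" using m(1) Suc.prems(4)[OF m(1), of l] by (auto simp: F_def)
  next
    fix l assume "l \<in> E"
    then show "l \<in> insert m F" using m(2) Suc.prems(2) by (auto simp: F_def)
  qed (simp add: F_def monomial_less_irrefl)
  have F: "finite F" "F \<subseteq> indices" "vec ` F \<subseteq> W" "vec m \<in> W" "m \<in> indices"
    using Suc.prems EF by auto
  have downF: "l' \<in> F" if "l \<in> F" "l' \<in> indices" "monomial_less n l' l" for l l'
    using that monomial_less_trans by (auto simp: F_def)
  have "k = card F" using EF F Suc.hyps(2) by simp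
  note IH = Suc.hyps(1)[OF this F(1-3) downF]
  have low: "lower m = J \<union> vec ` F" by (auto simp: lower_def F_def)
  have sub: "W \<inter> J \<union> vec ` F \<subseteq> carrier G" using W F by auto
  have iff: "vec m \<in> add_span G (W \<inter> J \<union> vec ` F) \<longleftrightarrow> vec m \<in> add_span G (lower m)"
    using vec_span_modular[of W F "vec m"] W F add_span_mono[of "vec m" G "W \<inter> J \<union> vec ` F" "lower m"]
    unfolding low by blast
  have ins: "W \<inter> J \<union> vec ` E = insert (vec m) (W \<inter> J \<union> vec ` F)" unfolding EF by auto
  show ?case
  proof (cases "m \<in> standard")
    case True
    then have "vec m \<notin> add_span G (W \<inter> J \<union> vec ` F)" unfolding iff by (simp add: standard_def)
    then have "card (add_span G (W \<inter> J \<union> vec ` E)) = p * card (add_span G (W \<inter> J \<union> vec ` F))"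
      unfolding ins using W F sub vec_closed by (intro card_add_span_insert finite_add_span) auto
    moreover have "E \<inter> standard = insert m (F \<inter> standard)" using EF True by auto
    then have "card (E \<inter> standard) = Suc (card (F \<inter> standard))" using EF F by simp
    ultimately show ?thesis using IH by simp
  next
    case False
    then have "vec m \<in> add_span G (W \<inter> J \<union> vec ` F)" unfolding iff using F by (simp add: standard_def)
    then have "add_span G (W \<inter> J \<union> vec ` E) = add_span G (W \<inter> J \<union> vec ` F)"
      unfolding ins using sub by (rule add_span_redundant)
    moreover have "E \<inter> standard = F \<inter> standard" using EF False by auto
    ultimately show ?thesis using IH by simp
  qed
qed

lemma card_filtered_piece:
  assumes W: "finite W" "W \<subseteq> carrier G" "add_span G W \<subseteq> W"
    and span: "W \<subseteq> add_span G (J \<union> vec ` {m \<in> indices. total_degree n (fst m) \<le> d})"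
    and vecs: "vec ` {m \<in> indices. total_degree n (fst m) \<le> d} \<subseteq> W"
  shows "card W = p ^ card {m \<in> standard. total_degree n (fst m) \<le> d} * card (W \<inter> J)"
proof -
  let ?E = "{m \<in> indices. total_degree n (fst m) \<le> d}"
  have "add_span G (W \<inter> J \<union> vec ` ?E) = W"
  proof
    show "add_span G (W \<inter> J \<union> vec ` ?E) \<subseteq> W"
      using W vecs add_span_mono[of _ G "W \<inter> J \<union> vec ` ?E" W] by blast
    show "W \<subseteq> add_span G (W \<inter> J \<union> vec ` ?E)"
      using vec_span_modular[OF W(2,3) _ vecs] span by blast
  qed
  moreover have "card (add_span G (W \<inter> J \<union> vec ` ?E)) = p ^ card (?E \<inter> standard) * card (W \<inter> J)"
    using finite_degree_le vecs
    by (intro card_span_standard W) (auto dest: monomial_less_degree)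
  moreover have "?E \<inter> standard = {m \<in> standard. total_degree n (fst m) \<le> d}"
    by (auto simp: standard_def)
  ultimately show ?thesis by simp
qed

text \<open>For a fixed generator the nonstandard monomials form a monomial ideal, because the order is
  compatible with multiplication. Hence the count of standard monomials has a rational generating
  function.\<close>

lemma standard_complement_ideal:
  assumes "s < r" shows "monomial_ideal n {a \<in> exponents n. (a, s) \<notin> standard}"
  unfolding monomial_ideal_def
proof (intro conjI ballI)
  fix a c assume a: "a \<in> {a \<in> exponents n. (a, s) \<notin> standard}" and c: "c \<in> exponents n"
  then have "vec (a, s) \<in> add_span G (lower (a, s))" using assms by (auto simp: standard_def indices_def)
  then have "act c (vec (a, s)) \<in> add_span G (lower (a + c, s))" using act_lower[OF c] by force
  then show "a + c \<in> {a \<in> exponents n. (a, s) \<notin> standard}"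
    using vec_plus[of "(a, s)" c] a c assms by (auto simp: standard_def indices_def exponents_plus)
qed auto

lemma pole_order_standard_count:
  "pole_order_le (Suc n)
    (Abs_fps (\<lambda>d. of_nat (card {m \<in> standard. total_degree n (fst m) \<le> d})))"
proof (rule pole_order_le_Suc)
  let ?U = "\<lambda>s. {a \<in> exponents n. (a, s) \<notin> standard}"
  let ?S = "\<lambda>d. {m \<in> standard. total_degree n (fst m) = d}"
  let ?T = "\<lambda>d. {m \<in> standard. total_degree n (fst m) \<le> d}"
  have fin: "finite (?T d)" for d
    by (rule finite_subset[OF _ finite_degree_le[of d]]) (auto simp: standard_def)
  have "(1 - fps_X) * Abs_fps (\<lambda>d. of_nat (card (?T d))) = Abs_fps (\<lambda>d. of_nat (card (?S d)) :: rat)"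
  proof (rule fps_ext)
    fix d
    show "((1 - fps_X) * Abs_fps (\<lambda>d. of_nat (card (?T d)))) $ d
      = Abs_fps (\<lambda>d. of_nat (card (?S d)) :: rat) $ d"
    proof (cases d)
      case 0 then show ?thesis by (simp add: algebra_simps)
    next
      case (Suc k)
      have "?T (Suc k) = ?T k \<union> ?S (Suc k)" by auto
      moreover have "card (?T k \<union> ?S (Suc k)) = card (?T k) + card (?S (Suc k))"
        using fin[of "Suc k"] by (intro card_Un_disjoint finite_subset[OF _ fin[of "Suc k"]]) auto
      ultimately have "card (?T (Suc k)) = card (?T k) + card (?S (Suc k))" by argo
      then show ?thesis using Suc by (simp add: left_diff_distrib)
    qed
  qed
  also have "\<dots> = (\<Sum>s<r. standard_series n (?U s))"
  proof (rule fps_ext)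
    fix d
    let ?A = "\<lambda>s. {a \<in> exponents n. a \<notin> ?U s \<and> total_degree n a = d}"
    have "?S d = (\<Union>s\<in>{..<r}. (\<lambda>a. (a, s)) ` ?A s)" by (auto simp: standard_def indices_def)
    then have "card (?S d) = card (\<Union>s\<in>{..<r}. (\<lambda>a. (a, s)) ` ?A s)" by argo
    also have "\<dots> = (\<Sum>s<r. card ((\<lambda>a. (a, s)) ` ?A s))"
      by (rule card_UN_disjoint) (use finite_exponents_degree in auto)
    also have "\<dots> = (\<Sum>s<r. card (?A s))"
      by (intro sum.cong refl card_image) (auto simp: inj_on_def)
    finally show "Abs_fps (\<lambda>d. of_nat (card (?S d)) :: rat) $ d = (\<Sum>s<r. standard_series n (?U s)) $ d"
      by (simp add: fps_sum_nth standard_series_def)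
  qed
  finally show "pole_order_le n ((1 - fps_X) * Abs_fps (\<lambda>d. of_nat (card (?T d))))"
    using pole_order_standard_series[OF standard_complement_ideal] by (auto intro: pole_order_le_sum)
qed

text \<open>Elements killed modulo \<open>J\<close> by a power of every variable span a finite subspace of \<open>G/J\<close>.
  A monomial \<open>m\<close> of large degree that is a leading monomial of such elements is
  \<open>x\<^sub>j\<^sup>q m'\<close> for another leading monomial \<open>m'\<close>, by Dickson's lemma; then
  \<open>m\<close> lies in the span of smaller monomials, as \<open>x\<^sub>j\<^sup>q\<close> kills the element with leading monomial \<open>m'\<close>.\<close>

lemma finite_torsion:
  assumes K: "K \<subseteq> add_span G (J \<union> vec ` indices)" "add_span G K \<subseteq> K"
    and K_act: "\<And>a x. a \<in> exponents n \<Longrightarrow> x \<in> K \<Longrightarrow> act a x \<in> K"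
    and torsion: "\<And>j x. j < n \<Longrightarrow> x \<in> K \<Longrightarrow> act (var_power j q) x \<in> J"
  shows "\<exists>D. K \<subseteq> add_span G (J \<union> vec ` {m \<in> indices. total_degree n (fst m) \<le> D})"
proof -
  have vI: "J \<union> vec ` indices \<subseteq> carrier G" using J_carrier vec_closed by auto
  have Kc: "K \<subseteq> carrier G" using K vI add_span_closed by blast
  define L where "L = {m \<in> indices. \<exists>z\<in>K. \<exists>y\<in>add_span G (lower m). vec m = z \<oplus> y}"
  have L_up: "(fst m + c, snd m) \<in> L" if m: "m \<in> L" and c: "c \<in> exponents n" for m c
  proof -
    obtain z y where zy: "z \<in> K" "y \<in> add_span G (lower m)" "vec m = z \<oplus> y" "m \<in> indices"
      using m by (auto simp: L_def)
    have yc: "y \<in> carrier G" using zy lower_closed add_span_closed by blast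
    have "vec (fst m + c, snd m) = act c z \<oplus> act c y"
      using vec_plus[OF zy(4) c] act_add[OF c] zy Kc yc by auto
    then show ?thesis using vec_plus[OF zy(4) c] K_act[OF c zy(1)] act_lower[OF c zy(2)]
      unfolding L_def by blast
  qed
  have "\<forall>s. \<exists>B. finite B \<and> B \<subseteq> {a \<in> exponents n. (a, s) \<in> L} \<and>
      (\<forall>a\<in>{a \<in> exponents n. (a, s) \<in> L}. \<exists>b\<in>B. b \<le> a)"
    by (intro allI dickson) auto
  from choice[OF this] obtain B where B': "\<forall>s. finite (B s) \<and> B s \<subseteq> {a \<in> exponents n. (a, s) \<in> L} \<and>
      (\<forall>a\<in>{a \<in> exponents n. (a, s) \<in> L}. \<exists>b\<in>B s. b \<le> a)" ..
  note B = B'[rule_format, THEN conjunct1] B'[rule_format, THEN conjunct2, THEN conjunct1]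
  have B3: "\<exists>b\<in>B s. b \<le> a" if "a \<in> exponents n" "(a, s) \<in> L" for a s
    using spec[OF B', of s, THEN conjunct2, THEN conjunct2] that by blast
  define D where "D = Max (insert 0 (total_degree n ` (\<Union>s<r. B s))) + n * q"
  have reducible: "vec m \<in> add_span G (lower m)" if m: "m \<in> L" and D: "total_degree n (fst m) > D" for m
  proof -
    obtain a s where as: "m = (a, s)" by force
    have a: "a \<in> exponents n" "s < r" using m by (auto simp: as L_def indices_def)
    obtain b where b: "b \<in> B s" "b \<le> a" using B3 a m as by blast
    have "total_degree n b \<le> Max (insert 0 (total_degree n ` (\<Union>s<r. B s)))"
      using B(1) b a by (intro Max_ge) auto
    then have lt: "total_degree n b + n * q < total_degree n a" using D unfolding D_def as by simp
    have "\<exists>j<n. b j + q \<le> a j"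
    proof (rule ccontr)
      assume "\<not> (\<exists>j<n. b j + q \<le> a j)"
      then have "total_degree n a \<le> (\<Sum>j<n. b j + q)"
        unfolding total_degree_def by (intro sum_mono) (auto simp: not_le less_imp_le)
      then show False using lt by (simp add: total_degree_def sum.distrib)
    qed
    then obtain j where j: "j < n" "b j + q \<le> a j" by blast
    define a' where "a' = a - var_power j q"
    have le: "var_power j q \<le> a" "b \<le> a'"
      using j b by (auto simp: le_fun_def var_power_def a'_def)
    have eq: "a = a' + var_power j q"
      using exponents_split[OF le(1)] by (simp add: a'_def add.commute)
    have a'e: "a' \<in> exponents n" using a exponents_minus by (auto simp: a'_def)
    have "(b + (a' - b), s) \<in> L"
      using L_up[of "(b, s)" "a' - b"] B(2) b a'e exponents_minus by auto
    then have "(a', s) \<in> L" using exponents_split[OF le(2)] by simp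
    then obtain z y where zy: "z \<in> K" "y \<in> add_span G (lower (a', s))" "vec (a', s) = z \<oplus> y"
      "(a', s) \<in> indices"
      by (auto simp: L_def)
    have yc: "y \<in> carrier G" using zy lower_closed add_span_closed by blast
    note vp = exponents_var_power[OF j(1), of q]
    have "vec m = act (var_power j q) z \<oplus> act (var_power j q) y"
      using vec_plus[OF zy(4) vp] act_add[OF vp] zy Kc yc by (auto simp: as eq)
    moreover have "act (var_power j q) z \<in> add_span G (lower m)"
      using torsion[OF j(1) zy(1)] lower_closed by (intro add_span_base) (auto simp: lower_def)
    moreover have "act (var_power j q) y \<in> add_span G (lower m)"
      using act_lower[OF vp zy(2)] by (simp add: as eq)
    ultimately show ?thesis using add_span_plus lower_closed by metis
  qed
  define E where "E = {m \<in> indices. total_degree n (fst m) \<le> D}"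
  have JE: "J \<union> vec ` E \<subseteq> carrier G" using vI by (auto simp: E_def)
  \<comment> \<open>Descend from the leading monomial until the degree is at most \<open>D\<close>.\<close>
  have desc: "x \<in> add_span G (J \<union> vec ` E)" if "x \<in> K" "x \<in> add_span G (lower m)" for x m
    using that(2)
  proof (induction "card {l \<in> indices. monomial_less n l m}" arbitrary: m rule: less_induct)
    case less
    let ?F = "{l \<in> indices. monomial_less n l m}"
    show ?case
    proof (cases "?F \<subseteq> E")
      case True
      then have "lower m \<subseteq> J \<union> vec ` E" by (auto simp: lower_def)
      then show ?thesis using less.prems add_span_mono by metis
    next
      case False
      then have ne: "?F \<noteq> {}" by auto
      obtain l where l: "l \<in> ?F" "\<forall>k\<in>?F. k \<noteq> l \<longrightarrow> monomial_less n k l"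
        using max_index[OF finite_less ne] by blast
      have F: "?F = insert l {k \<in> indices. monomial_less n k l}"
      proof (intro equalityI subsetI)
        fix k assume "k \<in> ?F"
        then show "k \<in> insert l {k \<in> indices. monomial_less n k l}" using bspec[OF l(2), of k] by auto
      next
        fix k assume "k \<in> insert l {k \<in> indices. monomial_less n k l}"
        then show "k \<in> ?F" using l(1) monomial_less_trans[of n k l m] by auto
      qed
      have low: "lower m = insert (vec l) (lower l)"
        unfolding lower_def by (subst F) (simp only: image_insert Un_insert_right)
      have lD: "total_degree n (fst l) > D"
      proof (rule ccontr)
        assume "\<not> ?thesis"
        then have "k \<in> E" if "k \<in> ?F" for k
          using that bspec[OF l(2) that] l(1) monomial_less_degree[of n k l]
          by (cases "k = l") (auto simp: E_def)
        then show False using False by blast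
      qed
      have vl: "vec l \<in> carrier G" using l vec_closed by auto
      obtain c y where cy: "c < p" "y \<in> add_span G (lower l)" "x = y \<oplus> [c] \<cdot> vec l"
        using add_span_insertE[OF less.prems[unfolded low] lower_closed vl] by blast
      have yc: "y \<in> carrier G" "x \<in> carrier G" using cy lower_closed add_span_closed that Kc by auto
      have "vec l \<in> add_span G (lower l)" if c: "c \<noteq> 0"
      proof -
        have "coprime c p"
          using c cy(1) prime_p by (metis coprime_commute nat_dvd_not_less neq0_conv prime_imp_coprime_nat)
        then obtain k where k: "[c * k = 1] (mod p)" using cong_solve_coprime_nat by auto
        have "vec l = [(c * k)] \<cdot> vec l"
          using k multiple_mod[OF vl] unfolding cong_def by (metis add.nat_pow_eone vl)
        also have "\<dots> = [k] \<cdot> ([c] \<cdot> vec l)" using add.nat_pow_pow[OF vl, of k c] by (simp add: mult.commute)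
        also have "[c] \<cdot> vec l = x \<oplus> \<ominus> y"
          unfolding cy(3) using yc vl by (simp add: a_comm[of y] a_assoc r_neg)
        also have "[k] \<cdot> (x \<oplus> \<ominus> y) = [k] \<cdot> x \<oplus> [k] \<cdot> (\<ominus> y)"
          using yc by (intro add.nat_pow_distrib) auto
        finally have eq: "vec l = [k] \<cdot> x \<oplus> [k] \<cdot> (\<ominus> y)" .
        have "[k] \<cdot> x \<in> K" using add_span_multiple add_span_base K(2) Kc \<open>x \<in> K\<close> by blast
        moreover have "[k] \<cdot> (\<ominus> y) \<in> add_span G (lower l)"
          using add_span_multiple add_span_neg cy lower_closed by blast
        ultimately have "l \<in> L" using l eq unfolding L_def by blast
        then show ?thesis using reducible lD by blast
      qed
      then have "[c] \<cdot> vec l \<in> add_span G (lower l)"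
        using add_span_multiple[OF _ lower_closed] by (cases "c = 0") (auto simp: add_span.zero)
      then have xl: "x \<in> add_span G (lower l)"
        using cy add_span_plus lower_closed by metis
      have "l \<notin> {k \<in> indices. monomial_less n k l}" using monomial_less_irrefl by auto
      then have "card {k \<in> indices. monomial_less n k l} < card ?F"
        unfolding F using finite_less by simp
      then show ?thesis using less.hyps xl by blast
    qed
  qed
  have "x \<in> add_span G (J \<union> vec ` E)" if x: "x \<in> K" for x
  proof -
    have "\<exists>m. y \<in> add_span G (lower m)" if "y \<in> add_span G (J \<union> vec ` indices)" for y
      using that
    proof induction
      case zero then show ?case by (auto intro: add_span.zero)
    next
      case (add y v)
      then obtain m where m: "y \<in> add_span G (lower m)" by blast
      have "\<exists>m'. lower m \<subseteq> lower m' \<and> v \<in> lower m'"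
      proof (cases "v \<in> J")
        case True then show ?thesis by (intro exI[of _ m]) (simp add: lower_def)
      next
        case False
        then obtain l where l: "l \<in> indices" "v = vec l" using add by auto
        show ?thesis
        proof (cases "n = 0")
          case True
          \<comment> \<open>Without variables the degree cannot be raised; the generator index is.\<close>
          have "monomial_less n k (0, Suc (max (snd m) (snd l)))"
            if "k = l \<or> monomial_less n k m" "k \<in> indices" for k
          proof -
            have z: "monomial_key n k i = (if i = 1 then snd k else 0)" for k i
              using True by (auto simp: monomial_key_def total_degree_def)
            have "snd k \<le> max (snd m) (snd l)"
              using that unfolding monomial_less_def lex_less_def z by (auto split: if_splits)
            then show ?thesis unfolding monomial_less_def lex_less_def z
              by (intro exI[of _ 1]) auto
          qed
          then show ?thesis using l
            by (intro exI[of _ "(0, Suc (max (snd m) (snd l)))"]) (auto simp: lower_def)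
        next
          case False
          define e where "e = var_power 0 (Suc (total_degree n (fst m) + total_degree n (fst l)))"
          have "total_degree n e = Suc (total_degree n (fst m) + total_degree n (fst l))"
            using False by (simp add: e_def total_degree_var_power)
          then have "monomial_less n k (e, 0)" if "k = l \<or> monomial_less n k m" for k
            using that monomial_less_degree[of n k m] by (intro monomial_less_degreeI) auto
          then show ?thesis using l by (intro exI[of _ "(e, 0)"]) (auto simp: lower_def)
        qed
      qed
      then show ?case using m add_span_mono add_span.add by metis
    qed
    then show ?thesis using desc x K by blast
  qed
  then show ?thesis unfolding E_def by blast
qed

end

section \<open>The free algebra over a prime field\<close>

lemma sum_mod_cong:
  "(\<And>x. x \<in> A \<Longrightarrow> f x mod m = g x mod m) \<Longrightarrow> (\<Sum>x\<in>A. f x) mod m = (\<Sum>x\<in>A. g x :: int) mod m"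
  by (metis (mono_tags, lifting) mod_sum_eq sum.cong)

lemma sum_mod_mult: "(\<Sum>x\<in>A. (f x mod m) * g x) mod m = (\<Sum>x\<in>A. f x * g x :: int) mod m"
  by (rule sum_mod_cong) (simp add: mod_mult_left_eq)

text \<open>The linear extension of \<open>\<phi>\<close> from words to the free algebra, as an integer. Multiplication is
  determined by these functionals modulo \<open>p\<close>, which avoids sums over splittings of words.\<close>

definition word_pairing :: "('s list \<Rightarrow> int) \<Rightarrow> ('s list \<Rightarrow> int) \<Rightarrow> int" where
  "word_pairing f \<phi> = (\<Sum>w | f w \<noteq> 0. f w * \<phi> w)"

lemma word_pairing_superset:
  "finite W \<Longrightarrow> {w. f w \<noteq> 0} \<subseteq> W \<Longrightarrow> word_pairing f \<phi> = (\<Sum>w\<in>W. f w * \<phi> w)"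
  unfolding word_pairing_def by (rule sum.mono_neutral_left) auto

text \<open>A sum over the splittings of a word, rewritten as a sum over the two supports.\<close>

lemma sum_splittings:
  assumes "finite {u. f u \<noteq> (0::int)}" "finite {u. g u \<noteq> (0::int)}"
  shows "(\<Sum>i\<le>length w. f (take i w) * g (drop i w))
    = (\<Sum>u | f u \<noteq> 0. \<Sum>v | g v \<noteq> 0. if u @ v = w then f u * g v else 0)"
proof -
  let ?P = "{u. f u \<noteq> 0} \<times> {v. g v \<noteq> 0}"
  have "(\<Sum>u | f u \<noteq> 0. \<Sum>v | g v \<noteq> 0. if u @ v = w then f u * g v else 0)
    = (\<Sum>uv\<in>?P. if fst uv @ snd uv = w then f (fst uv) * g (snd uv) else 0)"
    by (simp add: sum.cartesian_product split_def)
  also have "\<dots> = (\<Sum>uv\<in>{uv \<in> ?P. fst uv @ snd uv = w}. f (fst uv) * g (snd uv))"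
    using assms by (intro sum.inter_filter[symmetric]) auto
  also have "\<dots> = (\<Sum>i\<in>{i \<in> {..length w}. f (take i w) \<noteq> 0 \<and> g (drop i w) \<noteq> 0}.
      f (take i w) * g (drop i w))"
    by (rule sum.reindex_bij_witness[of _ "\<lambda>i. (take i w, drop i w)" "\<lambda>uv. length (fst uv)"]) auto
  also have "\<dots> = (\<Sum>i\<le>length w. f (take i w) * g (drop i w))"
    by (rule sum.mono_neutral_left) auto
  finally show ?thesis by simp
qed

text \<open>The free algebra over \<open>\<F>\<^sub>p\<close> on the letters \<open>S\<close>, with coefficients represented in
  \<open>{0..<p}\<close>.\<close>

locale prime_free_algebra =
  fixes p :: nat and S :: "'s set"
  assumes prime_p: "prime p"
begin

abbreviation A :: "('s list \<Rightarrow> int) ring" where "A \<equiv> free_algebra (GFp p) S"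

sublocale gf: residues_prime p "GFp p"
  by unfold_locales (rule prime_p)

lemma p_gt_1: "int p > 1" using prime_p prime_gt_1_nat by auto

lemmas A_defs = free_algebra_def gf.res_carrier_eq gf.res_zero_eq gf.res_one_eq gf.res_add_eq

lemma A_carrier: "f \<in> carrier A \<longleftrightarrow>
    (\<forall>w. 0 \<le> f w \<and> f w < int p) \<and> finite {w. f w \<noteq> 0} \<and> {w. f w \<noteq> 0} \<subseteq> lists S"
  by (auto simp: A_defs)

lemma A_add: "f \<oplus>\<^bsub>A\<^esub> g = (\<lambda>w. (f w + g w) mod int p)"
  by (simp add: A_defs)

lemma A_zero: "\<zero>\<^bsub>A\<^esub> = (\<lambda>w. 0)"
  by (simp add: A_defs)

lemma A_one: "\<one>\<^bsub>A\<^esub> = word_elt (GFp p) []"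
  by (simp only: A_defs word_elt_def monoid.simps ring.simps)

lemma word_elt_eq: "word_elt (GFp p) w = (\<lambda>v. if v = w then 1 else 0)"
  by (simp only: word_elt_def gf.res_zero_eq gf.res_one_eq)

lemma word_elt_carrier: "w \<in> lists S \<Longrightarrow> word_elt (GFp p) w \<in> carrier A"
  using p_gt_1 by (auto simp: A_carrier word_elt_eq)

lemma A_finite: "f \<in> carrier A \<Longrightarrow> finite {w. f w \<noteq> 0}"
  by (simp add: A_carrier)

lemma A_mod: "f \<in> carrier A \<Longrightarrow> f w mod int p = f w"
  by (simp add: A_carrier)

lemma A_mult:
  assumes "f \<in> carrier A" "g \<in> carrier A"
  shows "(f \<otimes>\<^bsub>A\<^esub> g) w = (\<Sum>i\<le>length w. f (take i w) * g (drop i w)) mod int p"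
  using gf.sum_cong[of "{..length w}" "\<lambda>i. f (take i w) * g (drop i w)"]
  by (simp add: free_algebra_def gf.res_mult_eq)

lemma A_mult_support:
  assumes "f \<in> carrier A" "g \<in> carrier A"
  shows "{w. (f \<otimes>\<^bsub>A\<^esub> g) w \<noteq> 0} \<subseteq> (\<lambda>(u, v). u @ v) ` ({u. f u \<noteq> 0} \<times> {v. g v \<noteq> 0})"
proof
  fix w assume "w \<in> {w. (f \<otimes>\<^bsub>A\<^esub> g) w \<noteq> 0}"
  then have "(\<Sum>i\<le>length w. f (take i w) * g (drop i w)) \<noteq> 0" using A_mult[OF assms] by auto
  then obtain i where "f (take i w) * g (drop i w) \<noteq> 0" by (meson sum.neutral)
  then show "w \<in> (\<lambda>(u, v). u @ v) ` ({u. f u \<noteq> 0} \<times> {v. g v \<noteq> 0})"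
    by (intro image_eqI[of _ _ "(take i w, drop i w)"]) auto
qed

lemma A_mult_closed:
  assumes "f \<in> carrier A" "g \<in> carrier A" shows "f \<otimes>\<^bsub>A\<^esub> g \<in> carrier A"
  unfolding A_carrier
proof (intro conjI allI)
  fix w show "0 \<le> (f \<otimes>\<^bsub>A\<^esub> g) w" "(f \<otimes>\<^bsub>A\<^esub> g) w < int p"
    using p_gt_1 by (auto simp: A_mult[OF assms])
next
  show "finite {w. (f \<otimes>\<^bsub>A\<^esub> g) w \<noteq> 0}"
    by (rule finite_subset[OF A_mult_support[OF assms]]) (use assms A_finite in auto)
  show "{w. (f \<otimes>\<^bsub>A\<^esub> g) w \<noteq> 0} \<subseteq> lists S"
    by (rule order_trans[OF A_mult_support[OF assms]]) (use assms in \<open>fastforce simp: A_carrier\<close>)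
qed

lemma word_pairing_mult:
  assumes "f \<in> carrier A" "g \<in> carrier A"
  shows "word_pairing (f \<otimes>\<^bsub>A\<^esub> g) \<phi> mod int p
    = word_pairing f (\<lambda>u. word_pairing g (\<lambda>v. \<phi> (u @ v))) mod int p"
proof -
  let ?U = "{u. f u \<noteq> 0}" and ?V = "{v. g v \<noteq> 0}"
  let ?W = "(\<lambda>(u, v). u @ v) ` (?U \<times> ?V)"
  have fin: "finite ?U" "finite ?V" using assms A_finite by auto
  have W: "finite ?W" using fin by auto
  define c where "c = (\<lambda>w. \<Sum>u\<in>?U. \<Sum>v\<in>?V. if u @ v = w then f u * g v else 0)"
  have c: "(f \<otimes>\<^bsub>A\<^esub> g) w = c w mod int p" for w
    unfolding c_def A_mult[OF assms] sum_splittings[OF fin] ..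
  have "word_pairing (f \<otimes>\<^bsub>A\<^esub> g) \<phi> = (\<Sum>w\<in>?W. (f \<otimes>\<^bsub>A\<^esub> g) w * \<phi> w)"
    by (rule word_pairing_superset[OF W A_mult_support[OF assms]])
  also have "\<dots> mod int p = (\<Sum>w\<in>?W. c w * \<phi> w) mod int p"
    unfolding c by (rule sum_mod_mult)
  also have "(\<Sum>w\<in>?W. c w * \<phi> w)
      = (\<Sum>w\<in>?W. \<Sum>u\<in>?U. \<Sum>v\<in>?V. if u @ v = w then f u * g v * \<phi> w else 0)"
    unfolding c_def sum_distrib_right by (intro sum.cong refl) simp
  also have "\<dots> = (\<Sum>u\<in>?U. \<Sum>v\<in>?V. \<Sum>w\<in>?W. if u @ v = w then f u * g v * \<phi> w else 0)"
    by (subst sum.swap, rule sum.cong[OF refl], rule sum.swap)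
  also have "\<dots> = (\<Sum>u\<in>?U. \<Sum>v\<in>?V. f u * g v * \<phi> (u @ v))"
    using W by (intro sum.cong refl) (auto simp: sum.delta')
  also have "\<dots> = word_pairing f (\<lambda>u. word_pairing g (\<lambda>v. \<phi> (u @ v)))"
    by (auto simp: word_pairing_def sum_distrib_left mult.assoc)
  finally show ?thesis .
qed

lemma word_pairing_add:
  assumes "f \<in> carrier A" "g \<in> carrier A"
  shows "word_pairing (f \<oplus>\<^bsub>A\<^esub> g) \<phi> mod int p = (word_pairing f \<phi> + word_pairing g \<phi>) mod int p"
proof -
  let ?W = "{u. f u \<noteq> 0} \<union> {v. g v \<noteq> 0}"
  have W: "finite ?W" using assms A_finite by auto
  have "word_pairing (f \<oplus>\<^bsub>A\<^esub> g) \<phi> = (\<Sum>w\<in>?W. ((f w + g w) mod int p) * \<phi> w)"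
    unfolding A_add using W by (intro word_pairing_superset) auto
  also have "\<dots> mod int p = (\<Sum>w\<in>?W. (f w + g w) * \<phi> w) mod int p"
    by (rule sum_mod_mult)
  also have "(\<Sum>w\<in>?W. (f w + g w) * \<phi> w) = word_pairing f \<phi> + word_pairing g \<phi>"
    using word_pairing_superset[OF W, of f] word_pairing_superset[OF W, of g]
    by (simp add: distrib_right sum.distrib)
  finally show ?thesis .
qed

lemma word_pairing_cong_mod:
  "(\<And>w. \<phi> w mod m = \<psi> w mod m) \<Longrightarrow> word_pairing f \<phi> mod m = word_pairing f \<psi> mod m"
  unfolding word_pairing_def by (rule sum_mod_cong) (metis mod_mult_right_eq)

lemma word_pairing_sum: "word_pairing f (\<lambda>w. \<phi> w + \<psi> w) = word_pairing f \<phi> + word_pairing f \<psi>"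
  by (simp add: word_pairing_def distrib_left sum.distrib)

lemma word_pairing_word: "word_pairing (word_elt (GFp p) w) \<phi> = \<phi> w"
  using word_pairing_superset[of "{w}" "word_elt (GFp p) w" \<phi>] by (simp add: word_elt_eq)

lemma word_pairing_delta:
  assumes "f \<in> carrier A"
  shows "word_pairing f (\<lambda>v. if v = w then 1 else 0) = f w"
  using assms A_finite[OF assms] by (auto simp: word_pairing_def sum.delta if_distrib cong: if_cong)

text \<open>An element is determined by its pairings; the ring axioms follow by comparing pairings.\<close>

lemma A_eqI:
  assumes "f \<in> carrier A" "g \<in> carrier A"
    and "\<And>\<phi>. word_pairing f \<phi> mod int p = word_pairing g \<phi> mod int p"
  shows "f = g"
proof
  fix w
  show "f w = g w"
    using assms(3)[of "\<lambda>v. if v = w then 1 else 0"] assms(1,2)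
    by (simp only: word_pairing_delta A_mod)
qed

lemma A_add_closed: "f \<in> carrier A \<Longrightarrow> g \<in> carrier A \<Longrightarrow> f \<oplus>\<^bsub>A\<^esub> g \<in> carrier A"
proof -
  assume fg: "f \<in> carrier A" "g \<in> carrier A"
  have sub: "{w. (f w + g w) mod int p \<noteq> 0} \<subseteq> {w. f w \<noteq> 0} \<union> {w. g w \<noteq> 0}" by auto
  have "finite {w. (f w + g w) mod int p \<noteq> 0}"
    by (rule finite_subset[OF sub]) (use fg A_finite in auto)
  moreover have "{w. (f w + g w) mod int p \<noteq> 0} \<subseteq> lists S"
    by (rule order_trans[OF sub]) (use fg in \<open>simp add: A_carrier\<close>)
  ultimately show ?thesis using p_gt_1 unfolding A_add by (simp add: A_carrier)
qed

lemma A_ring: "ring A"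
proof (rule ringI)
  show "abelian_group A"
  proof (rule abelian_groupI)
    show "\<zero>\<^bsub>A\<^esub> \<in> carrier A" using p_gt_1 by (auto simp: A_zero A_carrier)
    fix f assume f: "f \<in> carrier A"
    show "\<zero>\<^bsub>A\<^esub> \<oplus>\<^bsub>A\<^esub> f = f" using f by (simp add: A_add A_zero A_mod)
    let ?g = "\<lambda>w. (- f w) mod int p"
    have "{w. ?g w \<noteq> 0} \<subseteq> {w. f w \<noteq> 0}" by auto
    then have "?g \<in> carrier A" using f p_gt_1 by (auto simp: A_carrier intro: finite_subset)
    moreover have "?g \<oplus>\<^bsub>A\<^esub> f = \<zero>\<^bsub>A\<^esub>" by (simp add: A_add A_zero mod_add_left_eq)
    ultimately show "\<exists>g\<in>carrier A. g \<oplus>\<^bsub>A\<^esub> f = \<zero>\<^bsub>A\<^esub>" by blast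
  next
    fix f g h assume "f \<in> carrier A" "g \<in> carrier A" "h \<in> carrier A"
    show "f \<oplus>\<^bsub>A\<^esub> g \<oplus>\<^bsub>A\<^esub> h = f \<oplus>\<^bsub>A\<^esub> (g \<oplus>\<^bsub>A\<^esub> h)"
      by (simp add: A_add mod_add_left_eq mod_add_right_eq add.assoc)
  qed (simp_all add: A_add_closed, simp add: A_add add.commute)
  show "Group.monoid A"
  proof (rule monoidI)
    show "\<one>\<^bsub>A\<^esub> \<in> carrier A" by (simp add: A_one word_elt_carrier)
    fix f assume f: "f \<in> carrier A"
    show "\<one>\<^bsub>A\<^esub> \<otimes>\<^bsub>A\<^esub> f = f"
      using f by (intro A_eqI) (auto simp: A_one A_mult_closed word_elt_carrier word_pairing_mult word_pairing_word)
    show "f \<otimes>\<^bsub>A\<^esub> \<one>\<^bsub>A\<^esub> = f"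
      using f by (intro A_eqI) (auto simp: A_one A_mult_closed word_elt_carrier word_pairing_mult word_pairing_word)
  next
    fix f g h assume c: "f \<in> carrier A" "g \<in> carrier A" "h \<in> carrier A"
    show "f \<otimes>\<^bsub>A\<^esub> g \<otimes>\<^bsub>A\<^esub> h = f \<otimes>\<^bsub>A\<^esub> (g \<otimes>\<^bsub>A\<^esub> h)"
    proof (rule A_eqI)
      fix \<phi>
      have "word_pairing (f \<otimes>\<^bsub>A\<^esub> g \<otimes>\<^bsub>A\<^esub> h) \<phi> mod int p
        = word_pairing f (\<lambda>u. word_pairing g (\<lambda>v. word_pairing h (\<lambda>w. \<phi> (u @ v @ w)))) mod int p"
        using c by (simp add: A_mult_closed word_pairing_mult)
      also have "\<dots> = word_pairing (f \<otimes>\<^bsub>A\<^esub> (g \<otimes>\<^bsub>A\<^esub> h)) \<phi> mod int p"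
        unfolding word_pairing_mult[OF c(1) A_mult_closed[OF c(2,3)]]
        by (rule word_pairing_cong_mod) (simp add: word_pairing_mult[OF c(2,3)])
      finally show "word_pairing (f \<otimes>\<^bsub>A\<^esub> g \<otimes>\<^bsub>A\<^esub> h) \<phi> mod int p
        = word_pairing (f \<otimes>\<^bsub>A\<^esub> (g \<otimes>\<^bsub>A\<^esub> h)) \<phi> mod int p" .
    qed (use c A_mult_closed in auto)
  qed (rule A_mult_closed)
next
  fix f g h assume c: "f \<in> carrier A" "g \<in> carrier A" "h \<in> carrier A"
  show "(f \<oplus>\<^bsub>A\<^esub> g) \<otimes>\<^bsub>A\<^esub> h = f \<otimes>\<^bsub>A\<^esub> h \<oplus>\<^bsub>A\<^esub> g \<otimes>\<^bsub>A\<^esub> h"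
  proof (rule A_eqI)
    fix \<phi>
    show "word_pairing ((f \<oplus>\<^bsub>A\<^esub> g) \<otimes>\<^bsub>A\<^esub> h) \<phi> mod int p
      = word_pairing (f \<otimes>\<^bsub>A\<^esub> h \<oplus>\<^bsub>A\<^esub> g \<otimes>\<^bsub>A\<^esub> h) \<phi> mod int p"
      unfolding word_pairing_mult[OF A_add_closed[OF c(1,2)] c(3)] word_pairing_add[OF c(1,2)]
        word_pairing_add[OF A_mult_closed[OF c(1,3)] A_mult_closed[OF c(2,3)]]
      by (intro mod_add_cong word_pairing_mult[symmetric] c)
  qed (use c A_mult_closed A_add_closed in auto)
  show "h \<otimes>\<^bsub>A\<^esub> (f \<oplus>\<^bsub>A\<^esub> g) = h \<otimes>\<^bsub>A\<^esub> f \<oplus>\<^bsub>A\<^esub> h \<otimes>\<^bsub>A\<^esub> g"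
  proof (rule A_eqI)
    fix \<phi>
    have "word_pairing (h \<otimes>\<^bsub>A\<^esub> (f \<oplus>\<^bsub>A\<^esub> g)) \<phi> mod int p
      = word_pairing h (\<lambda>u. word_pairing f (\<lambda>v. \<phi> (u @ v)) + word_pairing g (\<lambda>v. \<phi> (u @ v))) mod int p"
      unfolding word_pairing_mult[OF c(3) A_add_closed[OF c(1,2)]]
      by (rule word_pairing_cong_mod) (rule word_pairing_add[OF c(1,2)])
    then show "word_pairing (h \<otimes>\<^bsub>A\<^esub> (f \<oplus>\<^bsub>A\<^esub> g)) \<phi> mod int p
      = word_pairing (h \<otimes>\<^bsub>A\<^esub> f \<oplus>\<^bsub>A\<^esub> h \<otimes>\<^bsub>A\<^esub> g) \<phi> mod int p"
      unfolding word_pairing_sum word_pairing_add[OF A_mult_closed[OF c(3,1)] A_mult_closed[OF c(3,2)]]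
      by (elim trans) (intro mod_add_cong word_pairing_mult[symmetric] c)
  qed (use c A_mult_closed A_add_closed in auto)
qed

lemma word_elt_mult:
  assumes "u \<in> lists S" "v \<in> lists S"
  shows "word_elt (GFp p) u \<otimes>\<^bsub>A\<^esub> word_elt (GFp p) v = word_elt (GFp p) (u @ v)"
  using assms by (intro A_eqI) (auto simp: A_mult_closed word_elt_carrier word_pairing_mult word_pairing_word)

lemma add_span_words: "f \<in> carrier A \<Longrightarrow> f \<in> add_span A (word_elt (GFp p) ` lists S)"
proof -
  assume f: "f \<in> carrier A"
  interpret A: ring A by (rule A_ring)
  have sub: "word_elt (GFp p) ` lists S \<subseteq> carrier A" using word_elt_carrier by blast
  have "f \<in> add_span A (word_elt (GFp p) ` lists S)"
    if "finite W" "{w. f w \<noteq> 0} = W" "f \<in> carrier A" for W f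
    using that
  proof (induction W arbitrary: f rule: finite_induct)
    case empty
    then have "f = \<zero>\<^bsub>A\<^esub>" by (auto simp: A_zero)
    then show ?case by (simp add: add_span.zero)
  next
    case (insert w W)
    define g where "g = f(w := 0)"
    have g: "{v. g v \<noteq> 0} = W" using insert by (auto simp: g_def)
    have gc: "g \<in> carrier A" using insert.prems g insert.hyps p_gt_1
      by (auto simp: A_carrier g_def)
    have w: "w \<in> lists S" using insert.prems by (auto simp: A_carrier)
    have "(\<lambda>v. if v = w then int k mod int p else 0) \<in> add_span A (word_elt (GFp p) ` lists S)" for k
    proof (induction k)
      case 0
      have "(\<lambda>v. if v = w then int 0 mod int p else 0) = \<zero>\<^bsub>A\<^esub>" by (auto simp: A_zero)
      then show ?case by (simp only: add_span.zero)
    next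
      case (Suc k)
      have "(\<lambda>v. if v = w then int (Suc k) mod int p else 0)
        = (\<lambda>v. if v = w then int k mod int p else 0) \<oplus>\<^bsub>A\<^esub> word_elt (GFp p) w"
        by (auto simp: A_add word_elt_eq mod_add_right_eq add.commute fun_eq_iff)
      then show ?case using add_span.add[OF Suc imageI[OF w]] by (simp only:)
    qed
    moreover have "int (nat (f w)) mod int p = f w" using insert.prems by (simp add: A_carrier)
    ultimately have "(\<lambda>v. if v = w then f w else 0) \<in> add_span A (word_elt (GFp p) ` lists S)"
      by metis
    moreover have "f = g \<oplus>\<^bsub>A\<^esub> (\<lambda>v. if v = w then f w else 0)"
      using A_mod[OF insert.prems(2)] by (auto simp: A_add g_def fun_eq_iff)
    ultimately show ?case using insert.IH[OF g gc] A.add_span_plus sub by metis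
  qed
  then show ?thesis using f A_finite by blast
qed

lemma A_multiple: "f \<in> carrier A \<Longrightarrow> [(k::nat)] \<cdot>\<^bsub>A\<^esub> f = (\<lambda>w. (int k * f w) mod int p)"
proof -
  assume f: "f \<in> carrier A"
  interpret A: ring A by (rule A_ring)
  show ?thesis
  proof (induction k)
    case 0 then show ?case by (simp add: A_zero)
  next
    case (Suc k)
    then show ?case by (simp add: A_add mod_add_right_eq algebra_simps)
  qed
qed

end

section \<open>Words and monomials of the ring of Frobenius operators\<close>

text \<open>The monomial \<open>x\<^sup>a F\<^sup>k\<close> represented by a word, as the pair \<open>(a, k)\<close>: moving all \<open>F\<close> to the
  right turns \<open>F x\<^sup>a\<close> into \<open>x\<^sup>p\<^sup>a F\<close>.\<close>

fun word_value :: "nat \<Rightarrow> letter list \<Rightarrow> (nat \<Rightarrow> nat) \<times> nat" where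
  "word_value p [] = (0, 0)"
| "word_value p (X i # w) = (var_power i 1 + fst (word_value p w), snd (word_value p w))"
| "word_value p (Frob # w) = ((\<lambda>i. p * fst (word_value p w) i), Suc (snd (word_value p w)))"

lemma word_value_append:
  "word_value p (u @ v) = (fst (word_value p u) + (\<lambda>i. p ^ snd (word_value p u) * fst (word_value p v) i),
     snd (word_value p u) + snd (word_value p v))"
  by (induction p u rule: word_value.induct) (auto simp: fun_eq_iff algebra_simps)

text \<open>The word \<open>x\<^sub>0\<^sup>a\<^sup>0 \<dots> x\<^sub>n\<^sub>-\<^sub>1\<^sup>a\<^sup>(\<^sup>n\<^sup>-\<^sup>1\<^sup>)\<close>.\<close>

primrec monomial_word :: "nat \<Rightarrow> (nat \<Rightarrow> nat) \<Rightarrow> letter list" where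
  "monomial_word 0 a = []"
| "monomial_word (Suc m) a = monomial_word m a @ replicate (a m) (X m)"

lemma set_monomial_word: "set (monomial_word m a) \<subseteq> X ` {..<m}"
  by (induction m) (auto split: if_splits)

lemma length_monomial_word: "length (monomial_word m a) = total_degree m a"
  by (induction m) (auto simp: total_degree_def)

lemma word_value_replicate_X: "word_value p (replicate k (X i)) = (var_power i k, 0)"
  by (induction k) (auto simp: var_power_def fun_eq_iff)

lemma word_value_monomial_word:
  "word_value p (monomial_word m a) = ((\<lambda>i. if i < m then a i else 0), 0)"
  by (induction m) (auto simp: word_value_append word_value_replicate_X var_power_def fun_eq_iff)

lemma word_value_exponents:
  "a \<in> exponents n \<Longrightarrow> word_value p (monomial_word n a) = (a, 0)"
  by (auto simp: word_value_monomial_word exponents_def fun_eq_iff)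

lemma fst_word_value: "w \<in> lists (letters n) \<Longrightarrow> fst (word_value p w) \<in> exponents n"
  by (induction p w rule: word_value.induct)
    (auto simp: letters_def exponents_def var_power_def)

lemma mset_monomial_word_plus:
  "mset (monomial_word m (a + b)) = mset (monomial_word m a) + mset (monomial_word m b)"
  by (induction m) (auto simp: replicate_add)

lemma mset_monomial_word_var: "i < m \<Longrightarrow> mset (monomial_word m (var_power i 1)) = {#X i#}"
proof (induction m)
  case (Suc m)
  have z: "monomial_word k (var_power i 1) = []" if "k \<le> i" for k
    using that by (induction k) (auto simp: var_power_def)
  show ?case
    using Suc z[of m] by (cases "i = m") (auto simp: var_power_def)
qed auto

lemma mset_monomial_word_times:
  "mset (concat (map (replicate p) (monomial_word m a))) = mset (monomial_word m (\<lambda>i. p * a i))"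
proof (induction m)
  case (Suc m)
  have "concat (map (replicate p) (replicate k (X m))) = replicate (p * k) (X m)" for k
    by (induction k) (auto simp: replicate_add)
  then show ?case using Suc by auto
qed auto

text \<open>The setting of the ring of Frobenius operators over \<open>\<F>\<^sub>p[x\<^sub>0, \<dots>, x\<^sub>n\<^sub>-\<^sub>1]\<close>, as the quotient of the
  free algebra \<open>A\<close>; \<open>cls\<close> is the quotient map.\<close>

locale frobenius = prime_free_algebra p "letters n" for p n :: nat
begin

lemma frob_relations_carrier: "frob_relations p n \<subseteq> carrier A"
proof -
  interpret A: ring A by (rule A_ring)
  have "X i \<in> letters n" if "i < n" for i using that by (simp add: letters_def)
  moreover have "Frob \<in> letters n" by (simp add: letters_def)
  ultimately show ?thesis
    unfolding frob_relations_def by (auto intro!: A.minus_closed word_elt_carrier)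
qed

sublocale quot: ideal "frob_ideal p n" A
  unfolding frob_ideal_def by (rule ring.genideal_ideal[OF A_ring frob_relations_carrier])

abbreviation F where "F \<equiv> frob_ring p n"

sublocale F: ring F
  unfolding frob_ring_def by (rule quot.quotient_is_ring)

abbreviation cls where "cls f \<equiv> frob_ideal p n +>\<^bsub>A\<^esub> f"

lemma F_carrier: "carrier F = cls ` carrier A"
  by (auto simp: frob_ring_def FactRing_def A_RCOSETS_def')

lemma cls_closed: "f \<in> carrier A \<Longrightarrow> cls f \<in> carrier F"
  by (auto simp: F_carrier)

lemma cls_add: "f \<in> carrier A \<Longrightarrow> g \<in> carrier A \<Longrightarrow> cls (f \<oplus>\<^bsub>A\<^esub> g) = cls f \<oplus>\<^bsub>F\<^esub> cls g"
  by (simp add: frob_ring_def FactRing_def quot.a_rcos_sum)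

lemma cls_mult: "f \<in> carrier A \<Longrightarrow> g \<in> carrier A \<Longrightarrow> cls (f \<otimes>\<^bsub>A\<^esub> g) = cls f \<otimes>\<^bsub>F\<^esub> cls g"
  by (simp add: frob_ring_def FactRing_def quot.rcoset_mult_add)

lemma cls_one: "cls \<one>\<^bsub>A\<^esub> = \<one>\<^bsub>F\<^esub>"
  by (simp add: frob_ring_def FactRing_def)

lemma cls_ideal: "f \<in> frob_ideal p n \<Longrightarrow> cls f = \<zero>\<^bsub>F\<^esub>"
  by (simp add: frob_ring_def FactRing_def quot.a_rcos_const)

lemma cls_zero: "cls \<zero>\<^bsub>A\<^esub> = \<zero>\<^bsub>F\<^esub>"
  by (rule cls_ideal) simp

lemma cls_multiple: "f \<in> carrier A \<Longrightarrow> cls ([(k::nat)] \<cdot>\<^bsub>A\<^esub> f) = [k] \<cdot>\<^bsub>F\<^esub> cls f"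
  by (induction k) (auto simp: cls_zero cls_add)

lemma frob_word_cls: "frob_word p n w = cls (word_elt (GFp p) w)"
  by (simp add: frob_word_def)

lemma frob_word_closed: "w \<in> lists (letters n) \<Longrightarrow> frob_word p n w \<in> carrier F"
  by (simp add: frob_word_cls cls_closed word_elt_carrier)

lemma frob_word_append:
  "u \<in> lists (letters n) \<Longrightarrow> v \<in> lists (letters n) \<Longrightarrow>
    frob_word p n (u @ v) = frob_word p n u \<otimes>\<^bsub>F\<^esub> frob_word p n v"
  by (simp add: frob_word_cls cls_mult[symmetric] word_elt_carrier word_elt_mult)

lemma frob_word_Nil: "frob_word p n [] = \<one>\<^bsub>F\<^esub>"
  by (simp add: frob_word_cls A_one[symmetric] cls_one)

sublocale Fp: exponent_p_group F p
proof
  fix r assume "r \<in> carrier F"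
  then obtain f where f: "f \<in> carrier A" "r = cls f" by (auto simp: F_carrier)
  have "[p] \<cdot>\<^bsub>A\<^esub> f = \<zero>\<^bsub>A\<^esub>" by (simp add: A_multiple f A_zero)
  then show "[p] \<cdot>\<^bsub>F\<^esub> r = \<zero>\<^bsub>F\<^esub>" using f cls_multiple[of f p] cls_zero by simp
qed (rule prime_p)

lemma frob_words_carrier: "frob_word p n ` lists (letters n) \<subseteq> carrier F"
  using frob_word_closed by blast

lemma F_words:
  assumes "r \<in> carrier F" shows "r \<in> add_span F (frob_word p n ` lists (letters n))"
proof -
  obtain f where f: "f \<in> carrier A" "r = cls f" using assms by (auto simp: F_carrier)
  show ?thesis unfolding f(2)
  proof (rule quot.add_span_image[OF add_span_words[OF f(1)]])
    show "word_elt (GFp p) ` lists (letters n) \<subseteq> carrier A" using word_elt_carrier by blast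
    fix s assume "s \<in> word_elt (GFp p) ` lists (letters n)"
    then show "cls s \<in> add_span F (frob_word p n ` lists (letters n))"
      using frob_words_carrier by (intro F.add_span_base) (auto simp: frob_word_cls)
  qed (use frob_words_carrier in \<open>auto simp: cls_zero cls_add F.abelian_group_axioms\<close>)
qed

lemma frob_scalar_multiple:
  assumes "c \<in> carrier (GFp p)" shows "frob_scalar p n c = [nat c] \<cdot>\<^bsub>F\<^esub> \<one>\<^bsub>F\<^esub>"
proof -
  have one: "\<one>\<^bsub>A\<^esub> \<in> carrier A" by simp
  have "[nat c] \<cdot>\<^bsub>A\<^esub> \<one>\<^bsub>A\<^esub> = (\<lambda>w. if w = [] then c else \<zero>\<^bsub>GFp p\<^esub>)"
    using assms unfolding A_multiple[OF one]
    by (auto simp: A_one word_elt_eq gf.res_zero_eq gf.res_carrier_eq fun_eq_iff)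
  then show ?thesis
    unfolding frob_scalar_def cls_one[symmetric] cls_multiple[OF one, symmetric] by simp
qed

lemma word_pairing_minus:
  assumes "f \<in> carrier A" "g \<in> carrier A"
  shows "word_pairing (f \<ominus>\<^bsub>A\<^esub> g) \<phi> mod int p = (word_pairing f \<phi> - word_pairing g \<phi>) mod int p"
proof -
  have "(f \<ominus>\<^bsub>A\<^esub> g) \<oplus>\<^bsub>A\<^esub> g = f" using assms by (simp add: a_minus_def quot.a_assoc quot.l_neg)
  then have "word_pairing f \<phi> mod int p = (word_pairing (f \<ominus>\<^bsub>A\<^esub> g) \<phi> + word_pairing g \<phi>) mod int p"
    using word_pairing_add[OF quot.minus_closed[OF assms] assms(2), of \<phi>] by simp
  then show ?thesis by (metis add_diff_cancel_right' mod_diff_left_eq)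
qed

text \<open>The elements of the free algebra on which every functional of the value of words vanishes
  modulo \<open>p\<close>. It is an ideal, as the value is multiplicative.\<close>

definition value_null :: "(letter list \<Rightarrow> int) set" where
  "value_null = {f \<in> carrier A. \<forall>h. word_pairing f (\<lambda>w. h (word_value p w)) mod int p = 0}"

lemma value_null_ideal: "ideal value_null A"
proof (rule idealI[OF A_ring])
  show "subgroup value_null (add_monoid A)"
  proof (rule quot.add.subgroupI)
    show "value_null \<subseteq> carrier A" by (auto simp: value_null_def)
    have "\<zero>\<^bsub>A\<^esub> \<in> carrier A" by simp
    moreover have "word_pairing \<zero>\<^bsub>A\<^esub> \<phi> = 0" for \<phi> by (simp add: word_pairing_def A_zero)
    ultimately have z: "\<zero>\<^bsub>A\<^esub> \<in> value_null" unfolding value_null_def by simp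
    then show "value_null \<noteq> {}" by auto
    fix f g assume fg: "f \<in> value_null" "g \<in> value_null"
    have sum0: "(a + b) mod int p = 0" "(a - b) mod int p = 0" if "a mod int p = 0" "b mod int p = 0" for a b
      using that by (simp_all add: mod_eq_0_iff_dvd)
    show "f \<oplus>\<^bsub>A\<^esub> g \<in> value_null"
      using fg by (simp add: value_null_def word_pairing_add A_add_closed sum0)
    have "\<zero>\<^bsub>A\<^esub> \<ominus>\<^bsub>A\<^esub> f \<in> value_null"
      using fg z by (simp add: value_null_def word_pairing_minus sum0)
    then show "\<ominus>\<^bsub>A\<^esub> f \<in> value_null"
      using fg by (simp add: a_minus_def value_null_def)
  qed
  fix f x assume f: "f \<in> value_null" and x: "x \<in> carrier A"
  have fc: "f \<in> carrier A" and f0: "\<And>h. word_pairing f (\<lambda>w. h (word_value p w)) mod int p = 0"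
    using f by (auto simp: value_null_def)
  have "word_pairing (x \<otimes>\<^bsub>A\<^esub> f) (\<lambda>w. h (word_value p w)) mod int p = 0" for h
  proof -
    have "word_pairing (x \<otimes>\<^bsub>A\<^esub> f) (\<lambda>w. h (word_value p w)) mod int p
        = word_pairing x (\<lambda>u. word_pairing f (\<lambda>v. h (word_value p (u @ v)))) mod int p"
      by (rule word_pairing_mult[OF x fc])
    also have "\<dots> = word_pairing x (\<lambda>u. 0) mod int p"
    proof (rule word_pairing_cong_mod)
      fix u
      show "word_pairing f (\<lambda>v. h (word_value p (u @ v))) mod int p = 0 mod int p"
        using f0[of "\<lambda>m. h (fst (word_value p u) + (\<lambda>i. p ^ snd (word_value p u) * fst m i),
          snd (word_value p u) + snd m)"]
        by (simp add: word_value_append)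
    qed
    finally show ?thesis by (simp add: word_pairing_def)
  qed
  then show "x \<otimes>\<^bsub>A\<^esub> f \<in> value_null" using x fc A_mult_closed by (simp add: value_null_def)
  have "word_pairing (f \<otimes>\<^bsub>A\<^esub> x) (\<lambda>w. h (word_value p w)) mod int p = 0" for h
    using f0[of "\<lambda>m. word_pairing x (\<lambda>v. h (fst m + (\<lambda>i. p ^ snd m * fst (word_value p v) i),
          snd m + snd (word_value p v)))"]
    unfolding word_pairing_mult[OF fc x] by (simp add: word_value_append)
  then show "f \<otimes>\<^bsub>A\<^esub> x \<in> value_null" using x fc A_mult_closed by (simp add: value_null_def)
qed

lemma value_nullI:
  assumes "u \<in> lists (letters n)" "v \<in> lists (letters n)" "word_value p u = word_value p v"
  shows "word_elt (GFp p) u \<ominus>\<^bsub>A\<^esub> word_elt (GFp p) v \<in> value_null"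
  using assms
  by (auto simp: value_null_def word_elt_carrier word_pairing_minus word_pairing_word)

text \<open>Functionals that depend on the value of a word only annihilate the defining ideal, so they
  descend to the ring of Frobenius operators.\<close>

lemma frob_ideal_null: "frob_ideal p n \<subseteq> value_null"
  unfolding frob_ideal_def
proof (rule quot.genideal_minimal[OF value_null_ideal])
  have l: "X i \<in> letters n" if "i < n" for i using that by (simp add: letters_def)
  have Fl: "Frob \<in> letters n" by (simp add: letters_def)
  have "word_value p (replicate p (X i) @ [Frob]) = word_value p [Frob, X i]" for i
    by (auto simp: word_value_append word_value_replicate_X var_power_def fun_eq_iff)
  then show "frob_relations p n \<subseteq> value_null"
    unfolding frob_relations_def using l Fl
    by (auto intro!: value_nullI simp: add.commute add.left_commute)
qed

text \<open>The coefficient of a monomial in an element of the ring of Frobenius operators, read off from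
  any representative.\<close>

definition coefficient :: "frob \<Rightarrow> (nat \<Rightarrow> nat) \<times> nat \<Rightarrow> int" where
  "coefficient r \<mu> = word_pairing (SOME f. f \<in> r) (\<lambda>w. if word_value p w = \<mu> then 1 else 0) mod int p"

lemma coefficient_cls:
  assumes f: "f \<in> carrier A"
  shows "coefficient (cls f) \<mu> = word_pairing f (\<lambda>w. if word_value p w = \<mu> then 1 else 0) mod int p"
proof -
  have "(SOME g. g \<in> cls f) \<in> cls f" using quot.a_rcos_self[OF f] by (metis someI)
  then obtain i where i: "i \<in> frob_ideal p n" "(SOME g. g \<in> cls f) = i \<oplus>\<^bsub>A\<^esub> f"
    by (auto simp: a_r_coset_def')
  have "i \<in> value_null" using i frob_ideal_null by auto
  then have ic: "i \<in> carrier A"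
    and h: "\<forall>h. word_pairing i (\<lambda>w. h (word_value p w)) mod int p = 0"
    by (simp_all add: value_null_def)
  have i0: "word_pairing i (\<lambda>w. if word_value p w = \<mu> then 1 else 0) mod int p = 0"
    by (rule spec[OF h, of "\<lambda>m. if m = \<mu> then 1 else 0"])
  have "(a + b) mod int p = b mod int p" if "a mod int p = 0" for a b
    using that mod_add_left_eq[of a "int p" b] by simp
  from this[OF i0] show ?thesis
    unfolding coefficient_def i(2) word_pairing_add[OF ic f] .
qed

lemma coefficient_add:
  assumes "r \<in> carrier F" "s \<in> carrier F"
  shows "coefficient (r \<oplus>\<^bsub>F\<^esub> s) \<mu> = (coefficient r \<mu> + coefficient s \<mu>) mod int p"
proof -
  obtain f where f: "f \<in> carrier A" "r = cls f" using assms(1) by (auto simp: F_carrier)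
  obtain g where g: "g \<in> carrier A" "s = cls g" using assms(2) by (auto simp: F_carrier)
  show ?thesis
    unfolding f(2) g(2) cls_add[OF f(1) g(1), symmetric] coefficient_cls[OF f(1)]
      coefficient_cls[OF g(1)] coefficient_cls[OF A_add_closed[OF f(1) g(1)]]
    by (simp add: word_pairing_add[OF f(1) g(1)] mod_add_eq)
qed

lemma coefficient_word:
  "w \<in> lists (letters n) \<Longrightarrow> coefficient (frob_word p n w) \<mu> = (if word_value p w = \<mu> then 1 else 0)"
  using p_gt_1 by (simp add: frob_word_cls coefficient_cls word_elt_carrier word_pairing_word)

lemma coefficient_zero: "coefficient \<zero>\<^bsub>F\<^esub> \<mu> = 0"
proof -
  have z: "\<zero>\<^bsub>A\<^esub> \<in> carrier A" by simp
  show ?thesis unfolding cls_zero[symmetric] coefficient_cls[OF z] by (simp add: word_pairing_def A_zero)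
qed

text \<open>Conversely, a word is determined in the ring of Frobenius operators by its value.\<close>

lemma frob_word_relation:
  assumes "word_elt (GFp p) u \<ominus>\<^bsub>A\<^esub> word_elt (GFp p) v \<in> frob_relations p n"
    "u \<in> lists (letters n)" "v \<in> lists (letters n)"
  shows "frob_word p n u = frob_word p n v"
proof -
  let ?u = "word_elt (GFp p) u" and ?v = "word_elt (GFp p) v"
  have c: "?u \<in> carrier A" "?v \<in> carrier A" using assms word_elt_carrier by auto
  have "?u \<ominus>\<^bsub>A\<^esub> ?v \<in> frob_ideal p n"
    unfolding frob_ideal_def using quot.genideal_self[OF frob_relations_carrier] assms(1) by blast
  then have "cls (?u \<ominus>\<^bsub>A\<^esub> ?v) = \<zero>\<^bsub>F\<^esub>" by (rule cls_ideal)
  moreover have "(?u \<ominus>\<^bsub>A\<^esub> ?v) \<oplus>\<^bsub>A\<^esub> ?v = ?u" using c by (simp add: a_minus_def quot.a_assoc quot.l_neg)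
  ultimately have "cls ?u = \<zero>\<^bsub>F\<^esub> \<oplus>\<^bsub>F\<^esub> cls ?v" using c cls_add[of "?u \<ominus>\<^bsub>A\<^esub> ?v" ?v] by simp
  then show ?thesis using c cls_closed by (simp add: frob_word_cls)
qed

lemma letter_X: "i < n \<Longrightarrow> X i \<in> letters n" by (simp add: letters_def)
lemma letter_Frob: "Frob \<in> letters n" by (simp add: letters_def)
lemma X_letters: "u \<in> lists (X ` {..<n}) \<Longrightarrow> u \<in> lists (letters n)" by (auto simp: letters_def)

lemma frob_word_context:
  assumes "frob_word p n u = frob_word p n v"
    "u \<in> lists (letters n)" "v \<in> lists (letters n)" "s \<in> lists (letters n)" "t \<in> lists (letters n)"
  shows "frob_word p n (s @ u @ t) = frob_word p n (s @ v @ t)"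
  using assms by (simp add: frob_word_append)

lemma frob_word_commute: "i < n \<Longrightarrow> j < n \<Longrightarrow> frob_word p n [X i, X j] = frob_word p n [X j, X i]"
  by (rule frob_word_relation) (auto simp: frob_relations_def letter_X)

lemma frob_word_rotate:
  assumes "u \<in> lists (X ` {..<n})" "i < n"
  shows "frob_word p n (X i # u) = frob_word p n (u @ [X i])"
  using assms(1)
proof (induction u)
  case (Cons x u)
  then obtain j where j: "x = X j" "j < n" by auto
  have u: "u \<in> lists (letters n)" using Cons X_letters by auto
  have "frob_word p n (X i # x # u) = frob_word p n (x # X i # u)"
    using frob_word_context[OF frob_word_commute[OF assms(2) j(2)], of "[]" u] u j assms(2)
    by (simp add: letter_X)
  also have "\<dots> = frob_word p n (x # u @ [X i])"
    using frob_word_context[of "X i # u" "u @ [X i]" "[x]" "[]"] Cons u j assms(2)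
    by (simp add: letter_X)
  finally show ?case by simp
qed simp

lemma frob_word_mset:
  assumes "mset u = mset v" "u \<in> lists (X ` {..<n})"
  shows "frob_word p n u = frob_word p n v"
  using assms
proof (induction u arbitrary: v)
  case (Cons x u)
  have "x \<in> set v" using Cons.prems by (metis list.set_intros(1) set_mset_mset)
  then obtain v1 v2 where v: "v = v1 @ x # v2" by (meson split_list)
  obtain i where i: "x = X i" "i < n" using Cons.prems by auto
  have "set v = set (x # u)" using Cons.prems by (metis set_mset_mset)
  then have vs: "v1 \<in> lists (X ` {..<n})" "v2 \<in> lists (X ` {..<n})" "u \<in> lists (X ` {..<n})"
    using Cons.prems(2) v by auto
  note l = vs[THEN X_letters]
  have "frob_word p n (x # u) = frob_word p n (x # v1 @ v2)"
  proof -
    have "mset u = mset (v1 @ v2)" using Cons.prems(1) unfolding v by simp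
    then have eq: "frob_word p n u = frob_word p n (v1 @ v2)" using Cons.IH vs(3) by blast
    show ?thesis using frob_word_context[OF eq, of "[x]" "[]"] l i(2) by (simp add: i(1) letter_X)
  qed
  also have "\<dots> = frob_word p n (v1 @ x # v2)"
    using frob_word_context[OF frob_word_rotate[OF vs(1) i(2)], of "[]" v2] l i(2) by (simp add: i(1) letter_X)
  finally show ?case unfolding v .
qed simp

lemma frob_word_Frob_X: "i < n \<Longrightarrow> frob_word p n [Frob, X i] = frob_word p n (replicate p (X i) @ [Frob])"
  by (rule frob_word_relation[symmetric])
    (auto simp: frob_relations_def letter_X letter_Frob)

lemma frob_word_Frob_move:
  assumes "u \<in> lists (X ` {..<n})"
  shows "frob_word p n (Frob # u) = frob_word p n (concat (map (replicate p) u) @ [Frob])"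
  using assms
proof (induction u)
  case (Cons x u)
  then obtain i where i: "x = X i" "i < n" by auto
  have u: "u \<in> lists (letters n)" using Cons X_letters by auto
  then have cu: "concat (map (replicate p) u) \<in> lists (letters n)" by (auto split: if_splits)
  have r: "replicate p (X i) \<in> lists (letters n)" using i letter_X by auto
  have "frob_word p n (Frob # x # u) = frob_word p n (replicate p (X i) @ Frob # u)"
    using frob_word_context[OF frob_word_Frob_X[OF i(2)], of "[]" u] u i r
    by (simp add: letter_X letter_Frob)
  also have "\<dots> = frob_word p n (replicate p (X i) @ concat (map (replicate p) u) @ [Frob])"
    using frob_word_context[of "Frob # u" "concat (map (replicate p) u) @ [Frob]" "replicate p (X i)" "[]"]
      Cons u cu r by (simp add: letter_Frob)
  finally show ?case using i by simp
qed simp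

text \<open>The word \<open>x\<^sup>a F\<^sup>k\<close> of value \<open>\<mu> = (a, k)\<close>.\<close>

definition normal_word :: "(nat \<Rightarrow> nat) \<times> nat \<Rightarrow> letter list" where
  "normal_word \<mu> = monomial_word n (fst \<mu>) @ replicate (snd \<mu>) Frob"

lemma monomial_word_X: "monomial_word n a \<in> lists (X ` {..<n})"
  using set_monomial_word[of n a] by auto

lemma monomial_word_letters: "monomial_word n a \<in> lists (letters n)"
  using X_letters monomial_word_X by blast

lemma frob_word_normal:
  "w \<in> lists (letters n) \<Longrightarrow> frob_word p n w = frob_word p n (normal_word (word_value p w))"
proof (induction w)
  case Nil
  have "monomial_word m 0 = []" for m by (induction m) auto
  then show ?case by (simp add: normal_word_def)
next
  case (Cons x w)
  obtain a k where ak: "word_value p w = (a, k)" by force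
  have Fk: "replicate k Frob \<in> lists (letters n)" "replicate (Suc k) Frob \<in> lists (letters n)"
    using letter_Frob by auto
  have nw: "normal_word (a, k) \<in> lists (letters n)"
    using monomial_word_letters Fk by (simp add: normal_word_def)
  have "frob_word p n (x # w) = frob_word p n (x # normal_word (a, k))"
    using frob_word_context[of w "normal_word (a, k)" "[x]" "[]"] Cons nw ak by simp
  also have "\<dots> = frob_word p n (normal_word (word_value p (x # w)))"
  proof (cases x)
    case (X i)
    then have i: "i < n" using Cons by (auto simp: letters_def)
    have "frob_word p n (X i # monomial_word n a) = frob_word p n (monomial_word n (var_power i 1 + a))"
    proof (rule frob_word_mset)
      show "mset (X i # monomial_word n a) = mset (monomial_word n (var_power i 1 + a))"
        unfolding mset_monomial_word_plus mset_monomial_word_var[OF i] by simp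
    qed (use i monomial_word_X in simp)
    from frob_word_context[OF this, of "[]" "replicate k Frob"]
    show ?thesis using X i Fk monomial_word_letters ak by (simp add: normal_word_def letter_X)
  next
    case Frob
    have c: "concat (map (replicate p) (monomial_word n a)) \<in> lists (X ` {..<n})"
      using monomial_word_X[of a] by (auto split: if_splits)
    have "frob_word p n (Frob # monomial_word n a)
        = frob_word p n (concat (map (replicate p) (monomial_word n a)) @ [Frob])"
      by (rule frob_word_Frob_move[OF monomial_word_X])
    also have "\<dots> = frob_word p n (monomial_word n (\<lambda>i. p * a i) @ [Frob])"
      using frob_word_context[OF frob_word_mset[OF mset_monomial_word_times c], of "[]" "[Frob]"]
        X_letters[OF c] monomial_word_letters letter_Frob by simp
    finally have "frob_word p n (Frob # monomial_word n a)
        = frob_word p n (monomial_word n (\<lambda>i. p * a i) @ [Frob])" .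
    from frob_word_context[OF this, of "[]" "replicate k Frob"]
    show ?thesis using Frob Fk monomial_word_letters ak by (simp add: normal_word_def letter_Frob)
  qed
  finally show ?case .
qed

lemma frob_word_eqI:
  "u \<in> lists (letters n) \<Longrightarrow> v \<in> lists (letters n) \<Longrightarrow> word_value p u = word_value p v \<Longrightarrow>
    frob_word p n u = frob_word p n v"
  using frob_word_normal[of u] frob_word_normal[of v] by simp

end

section \<open>The Bernstein filtration\<close>

lemma add_span_cong:
  assumes "\<zero>\<^bsub>G\<^esub> = \<zero>\<^bsub>H\<^esub>" "\<And>x y. x \<oplus>\<^bsub>G\<^esub> y = x \<oplus>\<^bsub>H\<^esub> y"
  shows "add_span G S = add_span H S"
proof -
  have "add_span G S \<subseteq> add_span H S" if "\<zero>\<^bsub>G\<^esub> = \<zero>\<^bsub>H\<^esub>" "\<And>x y. x \<oplus>\<^bsub>G\<^esub> y = x \<oplus>\<^bsub>H\<^esub> y"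
    for G :: "('a, 'b) ring_scheme" and H :: "('a, 'c) ring_scheme"
  proof
    fix x assume "x \<in> add_span G S"
    then show "x \<in> add_span H S"
      by induction (simp_all add: that add_span.intros)
  qed
  moreover have "add_span H S \<subseteq> add_span G S"
  proof
    fix x assume "x \<in> add_span H S"
    then show "x \<in> add_span G S"
      by induction (simp_all add: assms[symmetric] add_span.intros)
  qed
  ultimately show ?thesis using assms by blast
qed

lemma add_span_empty: "add_span G {} = {\<zero>\<^bsub>G\<^esub>}"
proof -
  have "x = \<zero>\<^bsub>G\<^esub>" if "x \<in> add_span G {}" for x
    using that by (rule add_span.cases) auto
  then show ?thesis using add_span.zero[of G "{}"] by blast
qed

lemma add_pow_cong:
  assumes "\<zero>\<^bsub>G\<^esub> = \<zero>\<^bsub>H\<^esub>" "\<And>x y. x \<oplus>\<^bsub>G\<^esub> y = x \<oplus>\<^bsub>H\<^esub> y"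
  shows "[(k::nat)] \<cdot>\<^bsub>G\<^esub> x = [k] \<cdot>\<^bsub>H\<^esub> x"
  by (induction k) (simp_all add: add_pow_def assms)

lemma finsum_cong_structure:
  assumes "carrier G = carrier H" "\<zero>\<^bsub>G\<^esub> = \<zero>\<^bsub>H\<^esub>" "add G = add H"
  shows "finsum G f T = finsum H f T"
  by (simp add: finsum_def finprod_def assms)

lemma abelian_group_cong:
  assumes "abelian_group G" "carrier G = carrier H" "\<zero>\<^bsub>G\<^esub> = \<zero>\<^bsub>H\<^esub>" "add G = add H"
  shows "abelian_group H"
proof (rule abelian_groupI)
  note E = abelian_groupE[OF assms(1), unfolded assms(2-4)]
  show "\<zero>\<^bsub>H\<^esub> \<in> carrier H" by (rule E)
  fix x y assume "x \<in> carrier H" "y \<in> carrier H"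
  then show "x \<oplus>\<^bsub>H\<^esub> y \<in> carrier H" by (rule E)
next
  note E = abelian_groupE[OF assms(1), unfolded assms(2-4)]
  fix x y z assume "x \<in> carrier H" "y \<in> carrier H" "z \<in> carrier H"
  then show "x \<oplus>\<^bsub>H\<^esub> y \<oplus>\<^bsub>H\<^esub> z = x \<oplus>\<^bsub>H\<^esub> (y \<oplus>\<^bsub>H\<^esub> z)" by (rule E)
next
  note E = abelian_groupE[OF assms(1), unfolded assms(2-4)]
  fix x y assume "x \<in> carrier H" "y \<in> carrier H"
  then show "x \<oplus>\<^bsub>H\<^esub> y = y \<oplus>\<^bsub>H\<^esub> x" by (rule E)
next
  note E = abelian_groupE[OF assms(1), unfolded assms(2-4)]
  fix x assume "x \<in> carrier H"
  then show "\<zero>\<^bsub>H\<^esub> \<oplus>\<^bsub>H\<^esub> x = x" "\<exists>y\<in>carrier H. y \<oplus>\<^bsub>H\<^esub> x = \<zero>\<^bsub>H\<^esub>" by (rule E)+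
qed

lemma exponent_p_group_cong:
  assumes "exponent_p_group G p" "carrier G = carrier H" "\<zero>\<^bsub>G\<^esub> = \<zero>\<^bsub>H\<^esub>" "add G = add H"
  shows "exponent_p_group H p"
proof -
  interpret exponent_p_group G p by fact
  show ?thesis
  proof (intro exponent_p_group.intro exponent_p_group_axioms.intro prime_p)
    show "abelian_group H" by (rule abelian_group_cong[OF abelian_group_axioms assms(2-4)])
    fix x assume "x \<in> carrier H"
    then show "[p] \<cdot>\<^bsub>H\<^esub> x = \<zero>\<^bsub>H\<^esub>"
      using exponent[of x] add_pow_cong[of G H p x] assms(2-4) by simp
  qed
qed

lemma add_span_finsum:
  assumes "abelian_group G" "S \<subseteq> carrier G" "finite T" "\<And>v. v \<in> T \<Longrightarrow> f v \<in> add_span G S"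
  shows "(\<Oplus>\<^bsub>G\<^esub>v\<in>T. f v) \<in> add_span G S"
proof -
  interpret abelian_group G by fact
  show ?thesis using assms(3,4)
  proof (induction T)
    case empty then show ?case by (simp add: add_span.zero)
  next
    case (insert v T)
    then have "f \<in> T \<rightarrow> carrier G" "f v \<in> carrier G" using add_span_closed assms(2) by auto
    then have "(\<Oplus>\<^bsub>G\<^esub>v\<in>insert v T. f v) = f v \<oplus>\<^bsub>G\<^esub> (\<Oplus>\<^bsub>G\<^esub>v\<in>T. f v)" using insert by simp
    then show ?case using insert add_span_plus assms(2) by simp
  qed
qed

text \<open>Over the prime field, linear spans are additive spans.\<close>

lemma linear_span_prime_field:
  fixes V :: "(int, 'b, 'd) module_scheme"
  assumes V: "exponent_p_group V p"
    and smult: "\<And>c v. c \<in> carrier (GFp p) \<Longrightarrow> v \<in> carrier V \<Longrightarrow> c \<odot>\<^bsub>V\<^esub> v = [nat c] \<cdot>\<^bsub>V\<^esub> v"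
    and S: "S \<subseteq> carrier V"
  shows "linear_span (GFp p) V S = add_span V S"
proof -
  interpret exponent_p_group V p by fact
  have carr: "carrier (GFp p) = {0..int p - 1}" by (simp add: residue_ring_def)
  have p1: "p > 1" using prime_p prime_gt_1_nat by auto
  show ?thesis
  proof (intro equalityI subsetI)
    fix x assume "x \<in> linear_span (GFp p) V S"
    then obtain T c where T: "finite T" "T \<subseteq> S" "c \<in> T \<rightarrow> carrier (GFp p)" "x = (\<Oplus>\<^bsub>V\<^esub>v\<in>T. c v \<odot>\<^bsub>V\<^esub> v)"
      by (auto simp: linear_span_def)
    have "c v \<odot>\<^bsub>V\<^esub> v \<in> add_span V S" if "v \<in> T" for v
    proof -
      have v: "v \<in> S" "c v \<in> carrier (GFp p)" using T(2,3) that by (auto dest: funcset_mem)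
      have "c v \<odot>\<^bsub>V\<^esub> v = [nat (c v)] \<cdot>\<^bsub>V\<^esub> v" using v S by (intro smult) auto
      then show ?thesis using add_span_multiple[OF add_span_base[OF v(1) S] S] by simp
    qed
    then show "x \<in> add_span V S" unfolding T(4) by (intro add_span_finsum abelian_group_axioms S T)
  next
    fix x assume "x \<in> add_span V S"
    then have "\<exists>T k. finite T \<and> T \<subseteq> S \<and> x = (\<Oplus>\<^bsub>V\<^esub>v\<in>T. [(k v::nat)] \<cdot>\<^bsub>V\<^esub> v)"
    proof induction
      case zero
      show ?case by (intro exI[of _ "{}"]) auto
    next
      case (add x s)
      then obtain T k where T: "finite T" "T \<subseteq> S" "x = (\<Oplus>\<^bsub>V\<^esub>v\<in>T. [(k v::nat)] \<cdot>\<^bsub>V\<^esub> v)" by blast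
      have Tc: "T - {s} \<subseteq> carrier V" "s \<in> carrier V" using T S add by auto
      define k' where "k' = (\<lambda>v. if v = s then (if s \<in> T then Suc (k s) else 1) else k v)"
      have fin: "finite (T - {s})" using T by simp
      let ?r = "\<Oplus>\<^bsub>V\<^esub>v\<in>T - {s}. [(k v)] \<cdot>\<^bsub>V\<^esub> v"
      have r: "?r \<in> carrier V" using Tc by (intro finsum_closed) auto
      have "(\<Oplus>\<^bsub>V\<^esub>v\<in>insert s (T - {s}). [(k' v)] \<cdot>\<^bsub>V\<^esub> v)
          = [(k' s)] \<cdot>\<^bsub>V\<^esub> s \<oplus>\<^bsub>V\<^esub> (\<Oplus>\<^bsub>V\<^esub>v\<in>T - {s}. [(k' v)] \<cdot>\<^bsub>V\<^esub> v)"
        using Tc fin by (intro finsum_insert) auto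
      also have "(\<Oplus>\<^bsub>V\<^esub>v\<in>T - {s}. [(k' v)] \<cdot>\<^bsub>V\<^esub> v) = ?r"
        using Tc by (intro finsum_cong') (auto simp: k'_def)
      also have "[(k' s)] \<cdot>\<^bsub>V\<^esub> s \<oplus>\<^bsub>V\<^esub> ?r = x \<oplus>\<^bsub>V\<^esub> s"
      proof (cases "s \<in> T")
        case True
        then have "T = insert s (T - {s})" by auto
        then have "x = (\<Oplus>\<^bsub>V\<^esub>v\<in>insert s (T - {s}). [(k v)] \<cdot>\<^bsub>V\<^esub> v)" using T(3) by simp
        also have "\<dots> = [(k s)] \<cdot>\<^bsub>V\<^esub> s \<oplus>\<^bsub>V\<^esub> ?r" using Tc fin by (intro finsum_insert) auto
        finally have "x = [(k s)] \<cdot>\<^bsub>V\<^esub> s \<oplus>\<^bsub>V\<^esub> ?r" .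
        then show ?thesis using True Tc r by (simp add: k'_def a_ac)
      next
        case False
        then have "T - {s} = T" by auto
        then show ?thesis using False Tc r T(3) by (simp add: k'_def a_comm)
      qed
      finally have "(\<Oplus>\<^bsub>V\<^esub>v\<in>insert s (T - {s}). [(k' v)] \<cdot>\<^bsub>V\<^esub> v) = x \<oplus>\<^bsub>V\<^esub> s" .
      then show ?case using T add fin by (intro exI[of _ "insert s (T - {s})"] exI[of _ k']) auto
    qed
    then obtain T k where T: "finite T" "T \<subseteq> S" "x = (\<Oplus>\<^bsub>V\<^esub>v\<in>T. [(k v::nat)] \<cdot>\<^bsub>V\<^esub> v)" by blast
    define c where "c = (\<lambda>v. int (k v mod p))"
    have c: "c v \<in> carrier (GFp p)" for v
      using p1 by (simp add: carr c_def)
    have "c v \<odot>\<^bsub>V\<^esub> v = [(k v)] \<cdot>\<^bsub>V\<^esub> v" if "v \<in> T" for v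
      using T S that c smult[of "c v" v] multiple_mod[of v "k v"] by (auto simp: c_def)
    then have "x = (\<Oplus>\<^bsub>V\<^esub>v\<in>T. c v \<odot>\<^bsub>V\<^esub> v)"
      unfolding T(3) using T S by (intro finsum_cong') auto
    moreover have "c \<in> T \<rightarrow> carrier (GFp p)" using c by simp
    ultimately show "x \<in> linear_span (GFp p) V S"
      using T(1,2) unfolding linear_span_def by (intro CollectI exI[of _ T] exI[of _ c]) simp
  qed
qed

context frobenius
begin

text \<open>The span of the words of length less than \<open>k\<close>. The index is shifted by one against the
  Bernstein filtration so that \<open>\<B>\<^sub>-\<^sub>1 = 0\<close> is included.\<close>

definition word_span :: "nat \<Rightarrow> frob set" where
  "word_span k = add_span F (frob_word p n ` {w \<in> lists (letters n). length w < k})"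

lemma word_span_gen: "frob_word p n ` {w \<in> lists (letters n). length w < k} \<subseteq> carrier F"
  using frob_word_closed by blast

lemma word_span_closed: "r \<in> word_span k \<Longrightarrow> r \<in> carrier F"
  unfolding word_span_def using F.add_span_closed word_span_gen by blast

lemma word_span_word: "w \<in> lists (letters n) \<Longrightarrow> length w < k \<Longrightarrow> frob_word p n w \<in> word_span k"
  unfolding word_span_def by (rule F.add_span_base[OF _ word_span_gen]) blast

lemma word_span_0: "word_span 0 = {\<zero>\<^bsub>F\<^esub>}"
  by (simp add: word_span_def add_span_empty)

lemma word_span_mono: "k \<le> l \<Longrightarrow> word_span k \<subseteq> word_span l"
  unfolding word_span_def by (rule subsetI, erule add_span_mono) (rule image_mono, auto)

text \<open>The index of the first factor is \<open>Suc i\<close> because of the shift: its words have length at most \<open>i\<close>.\<close>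

lemma word_span_mult:
  assumes "r \<in> word_span (Suc i)" "s \<in> word_span k"
  shows "r \<otimes>\<^bsub>F\<^esub> s \<in> word_span (i + k)"
proof -
  have w: "frob_word p n u \<otimes>\<^bsub>F\<^esub> s \<in> word_span (i + k)"
    if u: "u \<in> lists (letters n)" "length u \<le> i" for u
    using assms(2) unfolding word_span_def
  proof (rule F.add_span_image)
    fix t assume "t \<in> frob_word p n ` {w \<in> lists (letters n). length w < k}"
    then obtain w where w: "w \<in> lists (letters n)" "length w < k" "t = frob_word p n w" by auto
    then have "frob_word p n u \<otimes>\<^bsub>F\<^esub> t = frob_word p n (u @ w)" using u by (simp add: frob_word_append)
    then show "frob_word p n u \<otimes>\<^bsub>F\<^esub> t \<in> add_span F (frob_word p n ` {w \<in> lists (letters n). length w < i + k})"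
      using word_span_word[of "u @ w" "i + k"] u w by (simp add: word_span_def)
  qed (use word_span_gen frob_word_closed[OF u(1)] in \<open>auto simp: F.abelian_group_axioms F.r_distr\<close>)
  have s: "s \<in> carrier F" using assms(2) word_span_closed by auto
  show ?thesis
    using assms(1) unfolding word_span_def
  proof (rule F.add_span_image)
    fix t assume "t \<in> frob_word p n ` {w \<in> lists (letters n). length w < Suc i}"
    then obtain u where u: "u \<in> lists (letters n)" "length u \<le> i" "t = frob_word p n u"
      using less_Suc_eq_le by blast
    show "t \<otimes>\<^bsub>F\<^esub> s \<in> add_span F (frob_word p n ` {w \<in> lists (letters n). length w < i + k})"
      using w[OF u(1,2)] unfolding u(3) word_span_def .
  qed (use word_span_gen s in \<open>auto simp: F.abelian_group_axioms F.l_distr\<close>)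
qed

lemma complexity_le_iff:
  "{m \<in> frob_monomials p n. complexity p n m \<le> i} = frob_word p n ` {w \<in> lists (letters n). length w < Suc i}"
proof (intro equalityI subsetI)
  fix m assume "m \<in> {m \<in> frob_monomials p n. complexity p n m \<le> i}"
  then have ex: "\<exists>l. \<exists>w\<in>lists (letters n). frob_word p n w = m \<and> length w = l" and le: "complexity p n m \<le> i"
    by (auto simp: frob_monomials_def)
  from LeastI_ex[OF ex] obtain w where "w \<in> lists (letters n)" "frob_word p n w = m" "length w = complexity p n m"
    unfolding complexity_def by blast
  then show "m \<in> frob_word p n ` {w \<in> lists (letters n). length w < Suc i}" using le by auto
next
  fix m assume "m \<in> frob_word p n ` {w \<in> lists (letters n). length w < Suc i}"
  then obtain w where w: "w \<in> lists (letters n)" "length w < Suc i" "m = frob_word p n w" by auto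
  then have "complexity p n m \<le> length w"
    unfolding complexity_def by (intro Least_le) blast
  then show "m \<in> {m \<in> frob_monomials p n. complexity p n m \<le> i}" using w by (auto simp: frob_monomials_def)
qed

lemma frob_scalar_mult:
  assumes "c \<in> carrier (GFp p)" "r \<in> carrier F"
  shows "frob_scalar p n c \<otimes>\<^bsub>F\<^esub> r = [nat c] \<cdot>\<^bsub>F\<^esub> r"
  using assms by (simp add: frob_scalar_multiple F.add_pow_ldistr)

lemma bernstein_eq_word_span: "bernstein p n i = word_span (Suc i)"
proof -
  let ?V = "underlying_vs p n (regular_module F)"
  have eq: "carrier ?V = carrier F" "\<zero>\<^bsub>?V\<^esub> = \<zero>\<^bsub>F\<^esub>" "add ?V = add F"
    by (simp_all add: underlying_vs_def regular_module_def)
  have pw: "[k] \<cdot>\<^bsub>?V\<^esub> x = [k] \<cdot>\<^bsub>F\<^esub> x" for k :: nat and x by (rule add_pow_cong) (simp_all add: eq)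
  have "exponent_p_group ?V p"
    by (rule exponent_p_group_cong[OF Fp.exponent_p_group_axioms]) (simp_all add: eq)
  then have "bernstein p n i = add_span ?V {m \<in> frob_monomials p n. complexity p n m \<le> i}"
    unfolding bernstein_def
  proof (rule linear_span_prime_field)
    fix c v assume "c \<in> carrier (GFp p)" "v \<in> carrier ?V"
    then show "c \<odot>\<^bsub>?V\<^esub> v = [nat c] \<cdot>\<^bsub>?V\<^esub> v"
      unfolding pw by (simp add: underlying_vs_def regular_module_def frob_scalar_mult)
  next
    show "{m \<in> frob_monomials p n. complexity p n m \<le> i} \<subseteq> carrier ?V"
      unfolding complexity_le_iff eq by (rule word_span_gen)
  qed
  also have "\<dots> = word_span (Suc i)"
    unfolding complexity_le_iff word_span_def by (rule add_span_cong) (simp_all add: eq)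
  finally show ?thesis .
qed

subsection \<open>Lengths of monomials\<close>

text \<open>The complexity of the monomial of value \<open>\<mu>\<close>.\<close>

definition monomial_length :: "(nat \<Rightarrow> nat) \<times> nat \<Rightarrow> nat" where
  "monomial_length \<mu> = (LEAST l. \<exists>w\<in>lists (letters n). word_value p w = \<mu> \<and> length w = l)"

lemma monomial_length_le: "w \<in> lists (letters n) \<Longrightarrow> monomial_length (word_value p w) \<le> length w"
  unfolding monomial_length_def by (rule Least_le) blast

lemma monomial_length_witness:
  assumes "w \<in> lists (letters n)"
  obtains u where "u \<in> lists (letters n)" "word_value p u = word_value p w"
    "length u = monomial_length (word_value p w)"
proof -
  have ex: "\<exists>l. \<exists>u\<in>lists (letters n). word_value p u = word_value p w \<and> length u = l" using assms by blast
  from LeastI_ex[OF ex] show thesis using that unfolding monomial_length_def by blast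
qed

lemma word_value_X_word:
  "u \<in> lists (X ` {..<n}) \<Longrightarrow> snd (word_value p u) = 0 \<and> total_degree n (fst (word_value p u)) = length u"
  by (induction u) (auto simp: total_degree_plus total_degree_var_power)

text \<open>Exponent vectors with all entries less than \<open>p\<close>. The ring of Frobenius operators is the direct
  sum of the polynomials and of the \<open>x\<^sup>b F\<close>-multiples over these \<open>b\<close>.\<close>

definition digits :: "(nat \<Rightarrow> nat) set" where
  "digits = {b \<in> exponents n. \<forall>i. b i < p}"

lemma finite_digits: "finite digits"
  by (rule finite_subset[OF _ finite_exponents_bounded[of n p]]) (auto simp: digits_def less_imp_le)

text \<open>The value of \<open>x\<^sup>b F w\<close> for a word \<open>w\<close> of value \<open>\<mu>\<close>. For digit vectors \<open>b\<close> this is injective in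
  \<open>(b, \<mu>)\<close> by division with remainder.\<close>

definition shift :: "(nat \<Rightarrow> nat) \<Rightarrow> (nat \<Rightarrow> nat) \<times> nat \<Rightarrow> (nat \<Rightarrow> nat) \<times> nat" where
  "shift b \<mu> = (b + (\<lambda>i. p * fst \<mu> i), Suc (snd \<mu>))"

lemma word_value_shift:
  "b \<in> exponents n \<Longrightarrow> word_value p (monomial_word n b @ Frob # w) = shift b (word_value p w)"
  by (simp add: word_value_append word_value_exponents shift_def)

lemma shift_inj:
  assumes "b \<in> digits" "b' \<in> digits" "shift b \<mu> = shift b' \<nu>"
  shows "b = b'" "\<mu> = \<nu>"
proof -
  have eq: "b i + p * fst \<mu> i = b' i + p * fst \<nu> i" for i
    using assms(3) by (auto simp: shift_def fun_eq_iff)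
  have lt: "b i < p" "b' i < p" for i using assms(1,2) by (auto simp: digits_def)
  show "b = b'"
  proof
    fix i show "b i = b' i" using arg_cong[OF eq[of i], of "\<lambda>x. x mod p"] lt[of i] by simp
  qed
  moreover have "fst \<mu> i = fst \<nu> i" for i
    using eq[of i] lt[of i] \<open>b = b'\<close> by simp
  ultimately show "\<mu> = \<nu>" using assms(3) by (auto simp: shift_def prod_eq_iff fun_eq_iff)
qed

text \<open>Multiplication by \<open>x\<^sup>b F\<close> raises the complexity by its full length. In a shortest word
  for the product, the variables before the first \<open>F\<close> have exponents \<open>b + p c\<close>; moving \<open>x\<^sup>p\<^sup>c\<close> to the
  other side of that \<open>F\<close> as \<open>x\<^sup>c\<close> leaves a word for the other factor.\<close>

lemma monomial_length_shift:
  assumes b: "b \<in> digits" and w: "w \<in> lists (letters n)"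
  shows "Suc (total_degree n b + monomial_length (word_value p w)) \<le> monomial_length (shift b (word_value p w))"
proof -
  have be: "b \<in> exponents n" using b by (simp add: digits_def)
  let ?v = "monomial_word n b @ Frob # w"
  have "?v \<in> lists (letters n)" using w monomial_word_letters letter_Frob by auto
  then obtain u where u: "u \<in> lists (letters n)" "word_value p u = shift b (word_value p w)"
    "length u = monomial_length (shift b (word_value p w))"
    using monomial_length_witness[of ?v] word_value_shift[OF be] by metis
  have "Frob \<in> set u"
  proof (rule ccontr)
    assume "Frob \<notin> set u"
    then have "u \<in> lists (X ` {..<n})" using u(1) by (fastforce simp: letters_def)
    from word_value_X_word[OF this] have "snd (word_value p u) = 0" ..
    then show False using u(2) by (simp add: shift_def)
  qed
  then obtain u1 u2 where u12: "u = u1 @ Frob # u2" "Frob \<notin> set u1" by (meson split_list_first)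
  have u1: "u1 \<in> lists (X ` {..<n})" and u2: "u2 \<in> lists (letters n)"
  proof -
    have "x \<in> X ` {..<n}" if "x \<in> set u1" for x
    proof -
      have "x \<in> letters n" "x \<noteq> Frob" using that u(1) u12 by auto
      then show ?thesis by (simp add: letters_def)
    qed
    then show "u1 \<in> lists (X ` {..<n})" by auto
    show "u2 \<in> lists (letters n)" using u(1) u12(1) by simp
  qed
  define c where "c = fst (word_value p u1)"
  define c' where "c' = (\<lambda>i. c i div p)"
  have c: "snd (word_value p u1) = 0" "total_degree n c = length u1" "c \<in> exponents n"
    using word_value_X_word[OF u1] fst_word_value[OF X_letters[OF u1]] by (auto simp: c_def)
  have eq: "c i + p * fst (word_value p u2) i = b i + p * fst (word_value p w) i"
    and sn: "snd (word_value p u2) = snd (word_value p w)" for i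
    using u(2) by (auto simp: u12 word_value_append c c_def[symmetric] shift_def fun_eq_iff)
  have "c i mod p = b i" for i
    using arg_cong[OF eq[of i], of "\<lambda>x. x mod p"] b by (simp add: digits_def)
  then have ci: "c i = b i + p * c' i" for i by (metis c'_def mod_mult_div_eq)
  then have a: "c' i + fst (word_value p u2) i = fst (word_value p w) i" for i
    using eq[of i] p_gt_1 by (simp add: distrib_left[symmetric])
  have c'e: "c' \<in> exponents n" using c by (auto simp: exponents_def c'_def)
  have "word_value p (monomial_word n c' @ u2) = word_value p w"
    using a sn by (auto simp: word_value_append word_value_exponents[OF c'e] prod_eq_iff fun_eq_iff)
  then have "monomial_length (word_value p w) \<le> total_degree n c' + length u2"
    using monomial_length_le[of "monomial_word n c' @ u2"] u2 monomial_word_letters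
    by (simp add: length_monomial_word)
  moreover have "total_degree n b + total_degree n c' \<le> total_degree n c"
    unfolding total_degree_def sum.distrib[symmetric] using p_gt_1
    by (intro sum_mono) (simp add: ci)
  ultimately show ?thesis using u(3) c(2) by (simp add: u12)
qed

lemma coefficient_word_span:
  assumes "r \<in> word_span k" "k \<le> monomial_length \<mu>"
  shows "coefficient r \<mu> = 0"
  using assms(1) unfolding word_span_def
proof induction
  case zero then show ?case by (rule coefficient_zero)
next
  case (add r s)
  then obtain w where w: "w \<in> lists (letters n)" "length w < k" "s = frob_word p n w" by auto
  then have "word_value p w \<noteq> \<mu>" using monomial_length_le[OF w(1)] assms(2) by auto
  moreover have "r \<in> carrier F" "s \<in> carrier F"
    using add w word_span_closed frob_word_closed by (auto simp: word_span_def)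
  ultimately show ?case using w add.IH by (simp add: coefficient_add coefficient_word)
qed

text \<open>The sum of a list of words; the list allows multiplicities to be counted.\<close>

primrec word_sum :: "letter list list \<Rightarrow> frob" where
  "word_sum [] = \<zero>\<^bsub>F\<^esub>"
| "word_sum (w # ws) = frob_word p n w \<oplus>\<^bsub>F\<^esub> word_sum ws"

lemma word_sum_closed: "set ws \<subseteq> lists (letters n) \<Longrightarrow> word_sum ws \<in> carrier F"
  by (induction ws) (auto simp: frob_word_closed)

lemma word_sum_exists:
  assumes "r \<in> carrier F" shows "\<exists>ws. set ws \<subseteq> lists (letters n) \<and> r = word_sum ws"
  using F_words[OF assms]
proof induction
  case zero show ?case by (rule exI[of _ "[]"]) simp
next
  case (add r s)
  then obtain ws w where "set ws \<subseteq> lists (letters n)" "r = word_sum ws" "w \<in> lists (letters n)" "s = frob_word p n w"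
    by blast
  then show ?case
    by (intro exI[of _ "w # ws"]) (simp add: F.a_comm word_sum_closed frob_word_closed)
qed

lemma coefficient_word_sum:
  "set ws \<subseteq> lists (letters n) \<Longrightarrow>
    coefficient (word_sum ws) \<mu> = int (length (filter (\<lambda>w. word_value p w = \<mu>) ws)) mod int p"
  by (induction ws)
    (auto simp: coefficient_zero coefficient_add coefficient_word frob_word_closed word_sum_closed
      mod_add_right_eq add.commute)

lemma word_sum_split:
  assumes "w \<in> lists (letters n)" "set ws \<subseteq> lists (letters n)"
  shows "word_sum ws = [(length (filter (\<lambda>v. word_value p v = word_value p w) ws))] \<cdot>\<^bsub>F\<^esub> frob_word p n w
    \<oplus>\<^bsub>F\<^esub> word_sum (filter (\<lambda>v. word_value p v \<noteq> word_value p w) ws)"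
  using assms(2)
proof (induction ws)
  case (Cons v ws)
  have c: "frob_word p n w \<in> carrier F" "frob_word p n v \<in> carrier F"
    "word_sum (filter (\<lambda>v. word_value p v \<noteq> word_value p w) ws) \<in> carrier F"
    using Cons.prems assms(1) frob_word_closed by (auto intro!: word_sum_closed)
  show ?case
  proof (cases "word_value p v = word_value p w")
    case True
    then have "frob_word p n v = frob_word p n w" using Cons.prems assms(1) by (intro frob_word_eqI) auto
    then show ?thesis using True Cons c by (simp add: F.a_ac)
  next
    case False
    then show ?thesis using Cons c by (simp add: F.a_ac)
  qed
qed (use frob_word_closed[OF assms(1)] in simp)

text \<open>Membership in the Bernstein filtration is detected by coefficients: a monomial that occurs in
  a sum of words with multiplicity divisible by \<open>p\<close> can be dropped.\<close>

lemma word_spanI: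
  assumes "r \<in> carrier F"
    and "\<And>w. w \<in> lists (letters n) \<Longrightarrow> k \<le> monomial_length (word_value p w) \<Longrightarrow> coefficient r (word_value p w) = 0"
  shows "r \<in> word_span k"
proof -
  obtain ws where ws: "set ws \<subseteq> lists (letters n)" "r = word_sum ws" using word_sum_exists[OF assms(1)] by blast
  have "word_sum ws \<in> word_span k"
    if "set ws \<subseteq> lists (letters n)"
      "\<And>w. w \<in> lists (letters n) \<Longrightarrow> k \<le> monomial_length (word_value p w) \<Longrightarrow> coefficient (word_sum ws) (word_value p w) = 0"
    for ws
    using that
  proof (induction "length ws" arbitrary: ws rule: less_induct)
    case less
    show ?case
    proof (cases "\<exists>w\<in>set ws. k \<le> monomial_length (word_value p w)")
      case True
      then obtain w where w: "w \<in> set ws" "k \<le> monomial_length (word_value p w)" by blast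
      then have wl: "w \<in> lists (letters n)" using less.prems by auto
      let ?c = "length (filter (\<lambda>v. word_value p v = word_value p w) ws)"
      let ?ws = "filter (\<lambda>v. word_value p v \<noteq> word_value p w) ws"
      have sub: "set ?ws \<subseteq> lists (letters n)" using less.prems by auto
      have "int ?c mod int p = 0"
        using less.prems(2)[OF wl w(2)] coefficient_word_sum[OF less.prems(1)] by simp
      then have "?c mod p = 0" by (metis of_nat_eq_0_iff of_nat_mod)
      then have "[?c] \<cdot>\<^bsub>F\<^esub> frob_word p n w = \<zero>\<^bsub>F\<^esub>"
        using Fp.multiple_mod[OF frob_word_closed[OF wl], of ?c] by simp
      then have eq: "word_sum ws = word_sum ?ws"
        using word_sum_split[OF wl less.prems(1)] word_sum_closed[OF sub] by simp
      have "length ?ws < length ws" using w(1) by (intro length_filter_less) auto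
      then show ?thesis unfolding eq
        by (rule less.hyps) (use sub less.prems(2) eq in auto)
    next
      case False
      have "frob_word p n w \<in> word_span k" if "w \<in> set ws" for w
      proof -
        have wl: "w \<in> lists (letters n)" using that less.prems by auto
        then obtain u where "u \<in> lists (letters n)" "word_value p u = word_value p w"
          "length u = monomial_length (word_value p w)" by (rule monomial_length_witness)
        then show ?thesis
          using frob_word_eqI[of u w] wl False that word_span_word[of u k] by auto
      qed
      then show ?thesis
      proof (induction ws)
        case Nil then show ?case by (simp add: word_span_def add_span.zero)
      next
        case (Cons w ws)
        then show ?case using F.add_span_plus[OF _ _ word_span_gen] by (simp add: word_span_def)
      qed
    qed
  qed
  then show ?thesis using ws assms by blast
qed

abbreviation xF where "xF b \<equiv> frob_word p n (monomial_word n b @ [Frob])"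

lemma xF_letters: "monomial_word n b @ [Frob] \<in> lists (letters n)"
  using monomial_word_letters letter_Frob by auto

lemma xF_closed: "xF b \<in> carrier F"
  by (rule frob_word_closed[OF xF_letters])

lemma coefficient_xF_mult:
  assumes "b \<in> digits" "b' \<in> digits" "r \<in> carrier F"
  shows "coefficient (xF b \<otimes>\<^bsub>F\<^esub> r) (shift b' \<mu>) = (if b = b' then coefficient r \<mu> else 0)"
  using F_words[OF assms(3)]
proof induction
  case zero then show ?case using xF_closed by (simp add: coefficient_zero)
next
  case (add r s)
  then obtain w where w: "w \<in> lists (letters n)" "s = frob_word p n w" by blast
  have c: "r \<in> carrier F" "s \<in> carrier F"
    using add F.add_span_closed frob_words_carrier frob_word_closed w by blast+
  have "xF b \<otimes>\<^bsub>F\<^esub> s = frob_word p n ((monomial_word n b @ [Frob]) @ w)"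
    unfolding w(2) using frob_word_append[OF xF_letters w(1)] by simp
  moreover have "(monomial_word n b @ [Frob]) @ w \<in> lists (letters n)" using xF_letters w by auto
  ultimately have "coefficient (xF b \<otimes>\<^bsub>F\<^esub> s) (shift b' \<mu>)
      = (if shift b (word_value p w) = shift b' \<mu> then 1 else 0)"
    using word_value_shift[of b w] assms(1) by (simp add: coefficient_word digits_def)
  also have "\<dots> = (if b = b' then coefficient s \<mu> else 0)"
    using shift_inj[OF assms(1,2), of "word_value p w" \<mu>] w by (auto simp: coefficient_word)
  finally show ?case
    using add.IH c xF_closed by (simp add: F.r_distr coefficient_add)
qed

lemma coefficient_finsum:
  assumes "finite B" "\<And>b. b \<in> B \<Longrightarrow> f b \<in> carrier F"
  shows "coefficient (\<Oplus>\<^bsub>F\<^esub>b\<in>B. f b) \<mu> = (\<Sum>b\<in>B. coefficient (f b) \<mu>) mod int p"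
  using assms
proof (induction B)
  case (insert b B)
  then have "(\<Oplus>\<^bsub>F\<^esub>b\<in>insert b B. f b) = f b \<oplus>\<^bsub>F\<^esub> (\<Oplus>\<^bsub>F\<^esub>b\<in>B. f b)" "(\<Oplus>\<^bsub>F\<^esub>b\<in>B. f b) \<in> carrier F"
    by (auto intro!: F.finsum_closed)
  then show ?case using insert by (simp add: coefficient_add mod_add_right_eq)
qed (simp add: coefficient_zero)

lemma coefficient_mod: "coefficient r \<mu> mod int p = coefficient r \<mu>"
  by (simp add: coefficient_def)

text \<open>The elements \<open>x\<^sup>b F\<close> are a basis of a free right submodule, and the filtration of a sum controls
  the filtration of its coefficients; so the independence persists in the associated graded ring.\<close>

lemma xF_independent:
  assumes a: "\<And>b. b \<in> digits \<Longrightarrow> a b \<in> carrier F"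
    and sum: "(\<Oplus>\<^bsub>F\<^esub>b\<in>digits. xF b \<otimes>\<^bsub>F\<^esub> a b) \<in> word_span k" and b: "b \<in> digits"
  shows "a b \<in> word_span (k - Suc (total_degree n b))"
proof (rule word_spanI[OF a[OF b]])
  fix w assume w: "w \<in> lists (letters n)" and len: "k - Suc (total_degree n b) \<le> monomial_length (word_value p w)"
  have c: "xF d \<otimes>\<^bsub>F\<^esub> a d \<in> carrier F" if "d \<in> digits" for d using xF_closed a that by simp
  let ?\<mu> = "shift b (word_value p w)"
  have "k \<le> monomial_length ?\<mu>" using monomial_length_shift[OF b w] len by simp
  then have "0 = coefficient (\<Oplus>\<^bsub>F\<^esub>b\<in>digits. xF b \<otimes>\<^bsub>F\<^esub> a b) ?\<mu>"
    using coefficient_word_span[OF sum] by simp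
  also have "\<dots> = (\<Sum>d\<in>digits. coefficient (xF d \<otimes>\<^bsub>F\<^esub> a d) ?\<mu>) mod int p"
    by (rule coefficient_finsum[OF finite_digits c])
  also have "(\<Sum>d\<in>digits. coefficient (xF d \<otimes>\<^bsub>F\<^esub> a d) ?\<mu>)
      = (\<Sum>d\<in>digits. if d = b then coefficient (a b) (word_value p w) else 0)"
    using coefficient_xF_mult[OF _ b a] by (intro sum.cong) auto
  also have "\<dots> = coefficient (a b) (word_value p w)" using b finite_digits by (simp add: sum.delta)
  finally show "coefficient (a b) (word_value p w) = 0" by (simp add: coefficient_mod)
qed

end

section \<open>Associated graded modules\<close>

lemma below_regular [simp]: "below (regular_module R) B = below R B"
  by (rule ext) (simp add: below_def regular_module_def split: nat.split)

lemma coset_regular [simp]: "H +>\<^bsub>regular_module R\<^esub> r = H +>\<^bsub>R\<^esub> r"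
  by (simp add: a_r_coset_def' regular_module_def)

lemma regular_module_simps [simp]:
  "carrier (regular_module R) = carrier R" "\<zero>\<^bsub>regular_module R\<^esub> = \<zero>\<^bsub>R\<^esub>"
  "add (regular_module R) = add R" "module.smult (regular_module R) = monoid.mult R"
  by (simp_all add: regular_module_def)

lemma gr_ring_simps:
  "carrier (gr_ring R B) = carrier (gr_module (regular_module R) B)"
  "\<zero>\<^bsub>gr_ring R B\<^esub> = \<zero>\<^bsub>gr_module (regular_module R) B\<^esub>"
  "add (gr_ring R B) = add (gr_module (regular_module R) B)"
  "monoid.mult (gr_ring R B) = module.smult (gr_module (regular_module R) B)"
  by (simp_all add: gr_ring_def Let_def)

text \<open>The class of \<open>r \<in> B\<^sub>d\<close> in degree \<open>d\<close> of the associated graded ring.\<close>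

definition symbol :: "('a, 'c) ring_scheme \<Rightarrow> (nat \<Rightarrow> 'a set) \<Rightarrow> nat \<Rightarrow> 'a \<Rightarrow> nat \<Rightarrow> 'a set" where
  "symbol R B d r = (\<lambda>i. if i = d then below R B d +>\<^bsub>R\<^esub> r else below R B i)"

text \<open>A filtered module over a filtered ring. Classes in the degree \<open>i\<close> piece are written \<open>coset i x\<close>
  and \<open>coset_R i r\<close>.\<close>

locale filtered_module = left_module R M
  for R :: "('a, 'c) ring_scheme" (structure) and M :: "('a, 'b, 'd) module_scheme" (structure) +
  fixes B :: "nat \<Rightarrow> 'a set" and \<Omega> :: "nat \<Rightarrow> 'b set"
  assumes B_subgroup: "additive_subgroup (B i) R"
    and B_Suc: "B i \<subseteq> B (Suc i)"
    and B_one: "\<one>\<^bsub>R\<^esub> \<in> B 0"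
    and B_mult: "r \<in> B i \<Longrightarrow> s \<in> B j \<Longrightarrow> r \<otimes>\<^bsub>R\<^esub> s \<in> B (i + j)"
    and Omega_subgroup: "additive_subgroup (\<Omega> i) M"
    and Omega_Suc: "\<Omega> i \<subseteq> \<Omega> (Suc i)"
    and B_smult: "r \<in> B i \<Longrightarrow> x \<in> \<Omega> j \<Longrightarrow> r \<odot>\<^bsub>M\<^esub> x \<in> \<Omega> (i + j)"
begin

lemma B_closed: "r \<in> B i \<Longrightarrow> r \<in> carrier R"
  using additive_subgroup.a_subset[OF B_subgroup] by blast

lemma Omega_closed: "x \<in> \<Omega> i \<Longrightarrow> x \<in> carrier M"
  using additive_subgroup.a_subset[OF Omega_subgroup] by blast

lemma below_B_subgroup: "abelian_subgroup (below R B i) R"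
proof -
  have "additive_subgroup (below R B i) R"
  proof (cases i)
    case 0
    then show ?thesis
      using R.add.triv_subgroup by (simp add: below_def additive_subgroup_def)
  qed (simp add: below_def B_subgroup)
  then show ?thesis using R.abelian_group_axioms by (rule abelian_subgroupI3)
qed

lemma below_subgroup: "abelian_subgroup (below M \<Omega> i) M"
proof -
  have "additive_subgroup (below M \<Omega> i) M"
  proof (cases i)
    case 0
    then show ?thesis
      using M.add.triv_subgroup by (simp add: below_def additive_subgroup_def)
  qed (simp add: below_def Omega_subgroup)
  then show ?thesis using M.abelian_group_axioms by (rule abelian_subgroupI3)
qed

lemma below_subset: "below M \<Omega> i \<subseteq> \<Omega> i" "below R B i \<subseteq> B i"
  using Omega_Suc B_Suc additive_subgroup.zero_closed[OF Omega_subgroup]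
    additive_subgroup.zero_closed[OF B_subgroup]
  by (auto simp: below_def split: nat.splits)

lemma smult_zero_right: "r \<in> carrier R \<Longrightarrow> r \<odot>\<^bsub>M\<^esub> \<zero>\<^bsub>M\<^esub> = \<zero>\<^bsub>M\<^esub>"
  using smult_r_distr[of r "\<zero>\<^bsub>M\<^esub>" "\<zero>\<^bsub>M\<^esub>"] smult_closed[of r "\<zero>\<^bsub>M\<^esub>"]
  by (metis M.add.r_cancel_one M.l_zero M.zero_closed)

lemma smult_zero_left: "x \<in> carrier M \<Longrightarrow> \<zero>\<^bsub>R\<^esub> \<odot>\<^bsub>M\<^esub> x = \<zero>\<^bsub>M\<^esub>"
  using smult_l_distr[of "\<zero>\<^bsub>R\<^esub>" "\<zero>\<^bsub>R\<^esub>" x] smult_closed[of "\<zero>\<^bsub>R\<^esub>" x]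
  by (metis M.add.r_cancel_one R.l_zero R.zero_closed)

lemma below_smult_left:
  assumes "r \<in> below R B i" "x \<in> \<Omega> j" shows "r \<odot>\<^bsub>M\<^esub> x \<in> below M \<Omega> (i + j)"
proof (cases i)
  case 0
  then have "r \<odot>\<^bsub>M\<^esub> x = \<zero>\<^bsub>M\<^esub>" using assms smult_zero_left Omega_closed by (simp add: below_def)
  then show ?thesis
    using additive_subgroup.zero_closed[OF abelian_subgroup.axioms(1)[OF below_subgroup]] by simp
next
  case (Suc k)
  then show ?thesis using assms B_smult by (simp add: below_def)
qed

lemma below_smult_right:
  assumes "r \<in> B i" "x \<in> below M \<Omega> j" shows "r \<odot>\<^bsub>M\<^esub> x \<in> below M \<Omega> (i + j)"
proof (cases j)
  case 0
  then have "r \<odot>\<^bsub>M\<^esub> x = \<zero>\<^bsub>M\<^esub>" using assms smult_zero_right B_closed by (simp add: below_def)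
  then show ?thesis
    using additive_subgroup.zero_closed[OF abelian_subgroup.axioms(1)[OF below_subgroup]] by simp
next
  case (Suc k)
  then show ?thesis using assms B_smult by (simp add: below_def)
qed

abbreviation coset where "coset i x \<equiv> below M \<Omega> i +>\<^bsub>M\<^esub> x"
abbreviation coset_R where "coset_R i r \<equiv> below R B i +>\<^bsub>R\<^esub> r"

lemma coset_eq_iff:
  assumes "x \<in> carrier M" "y \<in> carrier M"
  shows "coset i x = coset i y \<longleftrightarrow> x \<ominus>\<^bsub>M\<^esub> y \<in> below M \<Omega> i"
proof -
  interpret H: abelian_subgroup "below M \<Omega> i" M by (rule below_subgroup)
  show ?thesis
  proof
    assume "coset i x = coset i y"
    then have "x \<in> coset i y" using H.a_rcos_self[OF assms(1)] by simp
    then show "x \<ominus>\<^bsub>M\<^esub> y \<in> below M \<Omega> i" using assms by (simp add: H.a_rcos_module a_minus_def)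
  next
    assume "x \<ominus>\<^bsub>M\<^esub> y \<in> below M \<Omega> i"
    then have "x \<in> coset i y" using assms by (simp add: H.a_rcos_module a_minus_def)
    then show "coset i x = coset i y" using H.a_repr_independence' assms by simp
  qed
qed

lemma coset_add:
  "x \<in> carrier M \<Longrightarrow> y \<in> carrier M \<Longrightarrow> coset i x \<oplus>\<^bsub>gr_piece M \<Omega> i\<^esub> coset i y = coset i (x \<oplus>\<^bsub>M\<^esub> y)"
  by (simp add: gr_piece_def abelian_subgroup.a_rcos_sum[OF below_subgroup])

lemma coset_zero_iff: "x \<in> carrier M \<Longrightarrow> coset i x = \<zero>\<^bsub>gr_piece M \<Omega> i\<^esub> \<longleftrightarrow> x \<in> below M \<Omega> i"
proof -
  interpret H: abelian_subgroup "below M \<Omega> i" M by (rule below_subgroup)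
  assume "x \<in> carrier M"
  then show ?thesis
    using H.a_rcos_const H.a_rcos_self[of x] by (auto simp: gr_piece_def)
qed

lemma piece_carrier: "carrier (gr_piece M \<Omega> i) = coset i ` \<Omega> i"
  by (auto simp: gr_piece_def A_RCOSETS_def' a_r_coset_def')

lemma piece_zero: "\<zero>\<^bsub>gr_piece M \<Omega> i\<^esub> = coset i \<zero>\<^bsub>M\<^esub>"
  using coset_zero_iff[of "\<zero>\<^bsub>M\<^esub>" i]
    additive_subgroup.zero_closed[OF abelian_subgroup.axioms(1)[OF below_subgroup]] by simp

lemma piece_abelian_group: "abelian_group (gr_piece M \<Omega> i)"
proof (rule abelian_groupI)
  note sub = additive_subgroup.a_closed[OF Omega_subgroup] additive_subgroup.zero_closed[OF Omega_subgroup]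
    additive_subgroup.a_inv_closed[OF Omega_subgroup]
  show "\<zero>\<^bsub>gr_piece M \<Omega> i\<^esub> \<in> carrier (gr_piece M \<Omega> i)"
    using sub by (auto simp: piece_zero piece_carrier)
  fix X assume "X \<in> carrier (gr_piece M \<Omega> i)"
  then obtain x where x: "x \<in> \<Omega> i" "X = coset i x" by (auto simp: piece_carrier)
  show "\<zero>\<^bsub>gr_piece M \<Omega> i\<^esub> \<oplus>\<^bsub>gr_piece M \<Omega> i\<^esub> X = X"
    using x Omega_closed by (simp add: piece_zero coset_add)
  show "\<exists>Y\<in>carrier (gr_piece M \<Omega> i). Y \<oplus>\<^bsub>gr_piece M \<Omega> i\<^esub> X = \<zero>\<^bsub>gr_piece M \<Omega> i\<^esub>"
    using x Omega_closed sub
    by (intro bexI[of _ "coset i (\<ominus>\<^bsub>M\<^esub> x)"]) (auto simp: piece_zero coset_add piece_carrier M.l_neg)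
  fix Y assume "Y \<in> carrier (gr_piece M \<Omega> i)"
  then obtain y where y: "y \<in> \<Omega> i" "Y = coset i y" by (auto simp: piece_carrier)
  show "X \<oplus>\<^bsub>gr_piece M \<Omega> i\<^esub> Y \<in> carrier (gr_piece M \<Omega> i)"
    using x y Omega_closed sub by (auto simp: coset_add piece_carrier)
  show "X \<oplus>\<^bsub>gr_piece M \<Omega> i\<^esub> Y = Y \<oplus>\<^bsub>gr_piece M \<Omega> i\<^esub> X"
    using x y Omega_closed by (simp add: coset_add M.a_comm)
  fix Z assume "Z \<in> carrier (gr_piece M \<Omega> i)"
  then obtain z where z: "z \<in> \<Omega> i" "Z = coset i z" by (auto simp: piece_carrier)
  show "X \<oplus>\<^bsub>gr_piece M \<Omega> i\<^esub> Y \<oplus>\<^bsub>gr_piece M \<Omega> i\<^esub> Z = X \<oplus>\<^bsub>gr_piece M \<Omega> i\<^esub> (Y \<oplus>\<^bsub>gr_piece M \<Omega> i\<^esub> Z)"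
    using x y z Omega_closed by (simp add: coset_add M.a_assoc)
qed

lemma gr_coset_smult_coset:
  assumes r: "r \<in> B i" and x: "x \<in> \<Omega> j"
  shows "gr_coset_smult M \<Omega> (i + j) (coset_R i r) (coset j x) = coset (i + j) (r \<odot>\<^bsub>M\<^esub> x)"
proof -
  interpret H: abelian_subgroup "below M \<Omega> j" M by (rule below_subgroup)
  interpret HR: abelian_subgroup "below R B i" R by (rule below_B_subgroup)
  have c: "r \<in> carrier R" "x \<in> carrier M" using r x B_closed Omega_closed by auto
  have eq: "coset (i + j) (s \<odot>\<^bsub>M\<^esub> y) = coset (i + j) (r \<odot>\<^bsub>M\<^esub> x)"
    if s: "s \<in> coset_R i r" and y: "y \<in> coset j x" for s y
  proof -
    obtain h where h: "h \<in> below R B i" "s = h \<oplus>\<^bsub>R\<^esub> r" 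
      using s unfolding a_r_coset_def' by blast
    obtain g where g: "g \<in> below M \<Omega> j" "y = g \<oplus>\<^bsub>M\<^esub> x" 
      using y unfolding a_r_coset_def' by blast
    have hB: "h \<in> B i" "h \<in> carrier R" using h below_subset B_closed by auto
    have gO: "g \<in> \<Omega> j" "g \<in> carrier M" using g below_subset Omega_closed by auto
    have yO: "y \<in> \<Omega> j" "y \<in> carrier M"
      using g gO x Omega_closed additive_subgroup.a_closed[OF Omega_subgroup] by auto
    have "s \<odot>\<^bsub>M\<^esub> y = h \<odot>\<^bsub>M\<^esub> y \<oplus>\<^bsub>M\<^esub> r \<odot>\<^bsub>M\<^esub> y" unfolding h(2) using hB c yO by (intro smult_l_distr)
    also have "r \<odot>\<^bsub>M\<^esub> y = r \<odot>\<^bsub>M\<^esub> g \<oplus>\<^bsub>M\<^esub> r \<odot>\<^bsub>M\<^esub> x" unfolding g(2) using gO c by (intro smult_r_distr)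
    finally have "s \<odot>\<^bsub>M\<^esub> y = (h \<odot>\<^bsub>M\<^esub> y \<oplus>\<^bsub>M\<^esub> r \<odot>\<^bsub>M\<^esub> g) \<oplus>\<^bsub>M\<^esub> r \<odot>\<^bsub>M\<^esub> x"
      using hB c yO gO smult_closed by (simp add: M.a_assoc)
    moreover have "h \<odot>\<^bsub>M\<^esub> y \<oplus>\<^bsub>M\<^esub> r \<odot>\<^bsub>M\<^esub> g \<in> below M \<Omega> (i + j)"
      using below_smult_left[OF h(1) yO(1)] below_smult_right[OF r g(1)]
      by (rule additive_subgroup.a_closed[OF abelian_subgroup.axioms(1)[OF below_subgroup]])
    moreover have cc: "h \<odot>\<^bsub>M\<^esub> y \<oplus>\<^bsub>M\<^esub> r \<odot>\<^bsub>M\<^esub> g \<in> carrier M" "r \<odot>\<^bsub>M\<^esub> x \<in> carrier M"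
      using hB c yO gO smult_closed by auto
    ultimately show ?thesis
      by (subst coset_eq_iff) (simp_all add: a_minus_def M.a_assoc M.r_neg)
  qed
  have "coset_R i r \<noteq> {}" "coset j x \<noteq> {}" using HR.a_rcos_self H.a_rcos_self c by blast+
  moreover have "(\<Union>s\<in>coset_R i r. \<Union>y\<in>coset j x. coset (i + j) (s \<odot>\<^bsub>M\<^esub> y))
      = (\<Union>s\<in>coset_R i r. \<Union>y\<in>coset j x. coset (i + j) (r \<odot>\<^bsub>M\<^esub> x))"
    by (intro SUP_cong refl eq)
  ultimately show ?thesis unfolding gr_coset_smult_def by simp
qed

text \<open>The ring as a filtered module over itself.\<close>

lemma B_regular: "filtered_module R (regular_module R) B B"
proof (intro filtered_module.intro filtered_module_axioms.intro)
  show "left_module R (regular_module R)"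
  proof (intro left_module.intro left_module_axioms.intro R.ring_axioms)
    show "abelian_group (regular_module R)"
    proof (rule abelian_groupI)
      fix x assume "x \<in> carrier (regular_module R)"
      then show "\<exists>y\<in>carrier (regular_module R). y \<oplus>\<^bsub>regular_module R\<^esub> x = \<zero>\<^bsub>regular_module R\<^esub>"
        by (intro bexI[of _ "\<ominus>\<^bsub>R\<^esub> x"]) (auto simp: R.l_neg)
    qed (auto simp: R.a_ac)
  qed (auto simp: R.l_distr R.r_distr R.m_assoc)
  show "additive_subgroup (B i) (regular_module R)" for i
    using B_subgroup[of i] by (auto simp: additive_subgroup_def subgroup_def a_inv_def m_inv_def)
qed (use B_subgroup B_Suc B_one B_mult in auto)

abbreviation N where "N \<equiv> gr_module M \<Omega>"
abbreviation A where "A \<equiv> gr_ring R B"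

lemma N_carrier: "\<xi> \<in> carrier N \<longleftrightarrow>
    (\<forall>i. \<xi> i \<in> carrier (gr_piece M \<Omega> i)) \<and> finite {i. \<xi> i \<noteq> \<zero>\<^bsub>gr_piece M \<Omega> i\<^esub>}"
  by (simp add: gr_module_def)

lemma N_zero: "\<zero>\<^bsub>N\<^esub> = (\<lambda>i. \<zero>\<^bsub>gr_piece M \<Omega> i\<^esub>)" by (simp add: gr_module_def)
lemma N_add: "\<xi> \<oplus>\<^bsub>N\<^esub> \<eta> = (\<lambda>i. \<xi> i \<oplus>\<^bsub>gr_piece M \<Omega> i\<^esub> \<eta> i)" by (simp add: gr_module_def)

lemma N_abelian_group: "abelian_group N"
proof (rule abelian_groupI)
  note G = piece_abelian_group
  note E = abelian_groupE[OF G]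
  show "\<zero>\<^bsub>N\<^esub> \<in> carrier N" using E(2) by (simp add: N_carrier N_zero)
  fix \<xi> assume x: "\<xi> \<in> carrier N"
  then have xi: "\<xi> i \<in> carrier (gr_piece M \<Omega> i)" for i by (simp add: N_carrier)
  show "\<zero>\<^bsub>N\<^esub> \<oplus>\<^bsub>N\<^esub> \<xi> = \<xi>" using E(5)[OF xi] by (simp add: N_add N_zero)
  have "(\<lambda>i. \<ominus>\<^bsub>gr_piece M \<Omega> i\<^esub> \<xi> i) \<in> carrier N"
  proof -
    have "{i. \<ominus>\<^bsub>gr_piece M \<Omega> i\<^esub> \<xi> i \<noteq> \<zero>\<^bsub>gr_piece M \<Omega> i\<^esub>} \<subseteq> {i. \<xi> i \<noteq> \<zero>\<^bsub>gr_piece M \<Omega> i\<^esub>}"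
    proof -
      have "\<ominus>\<^bsub>gr_piece M \<Omega> i\<^esub> \<zero>\<^bsub>gr_piece M \<Omega> i\<^esub> = \<zero>\<^bsub>gr_piece M \<Omega> i\<^esub>" for i
      proof -
        interpret P: abelian_group "gr_piece M \<Omega> i" by (rule G)
        show ?thesis by (rule P.minus_equality) simp_all
      qed
      then show ?thesis by auto
    qed
    then show ?thesis using x abelian_group.a_inv_closed[OF G] by (auto simp: N_carrier intro: finite_subset)
  qed
  moreover have "(\<lambda>i. \<ominus>\<^bsub>gr_piece M \<Omega> i\<^esub> \<xi> i) \<oplus>\<^bsub>N\<^esub> \<xi> = \<zero>\<^bsub>N\<^esub>"
    using abelian_group.l_neg[OF G xi] by (simp add: N_add N_zero)
  ultimately show "\<exists>\<eta>\<in>carrier N. \<eta> \<oplus>\<^bsub>N\<^esub> \<xi> = \<zero>\<^bsub>N\<^esub>" by blast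
  fix \<eta> assume y: "\<eta> \<in> carrier N"
  then have yi: "\<eta> i \<in> carrier (gr_piece M \<Omega> i)" for i by (simp add: N_carrier)
  have "{i. \<xi> i \<oplus>\<^bsub>gr_piece M \<Omega> i\<^esub> \<eta> i \<noteq> \<zero>\<^bsub>gr_piece M \<Omega> i\<^esub>}
      \<subseteq> {i. \<xi> i \<noteq> \<zero>\<^bsub>gr_piece M \<Omega> i\<^esub>} \<union> {i. \<eta> i \<noteq> \<zero>\<^bsub>gr_piece M \<Omega> i\<^esub>}"
    using E(5)[OF E(2)] by auto
  moreover have "finite ({i. \<xi> i \<noteq> \<zero>\<^bsub>gr_piece M \<Omega> i\<^esub>} \<union> {i. \<eta> i \<noteq> \<zero>\<^bsub>gr_piece M \<Omega> i\<^esub>})"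
    using x y by (simp add: N_carrier)
  ultimately have "finite {i. \<xi> i \<oplus>\<^bsub>gr_piece M \<Omega> i\<^esub> \<eta> i \<noteq> \<zero>\<^bsub>gr_piece M \<Omega> i\<^esub>}" by (rule finite_subset)
  then show "\<xi> \<oplus>\<^bsub>N\<^esub> \<eta> \<in> carrier N"
    using E(1)[OF xi yi] by (simp add: N_carrier N_add)
  show "\<xi> \<oplus>\<^bsub>N\<^esub> \<eta> = \<eta> \<oplus>\<^bsub>N\<^esub> \<xi>" using E(4)[OF xi yi] by (simp add: N_add)
  fix \<zeta> assume "\<zeta> \<in> carrier N"
  then have zi: "\<zeta> i \<in> carrier (gr_piece M \<Omega> i)" for i by (simp add: N_carrier)
  show "\<xi> \<oplus>\<^bsub>N\<^esub> \<eta> \<oplus>\<^bsub>N\<^esub> \<zeta> = \<xi> \<oplus>\<^bsub>N\<^esub> (\<eta> \<oplus>\<^bsub>N\<^esub> \<zeta>)" using E(3)[OF xi yi zi] by (simp add: N_add)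
qed

text \<open>Homogeneous elements of the associated graded module.\<close>

definition component :: "nat \<Rightarrow> 'b \<Rightarrow> nat \<Rightarrow> 'b set" where
  "component d x = (\<lambda>i. if i = d then coset d x else \<zero>\<^bsub>gr_piece M \<Omega> i\<^esub>)"

lemma component_closed: "x \<in> \<Omega> d \<Longrightarrow> component d x \<in> carrier N"
proof -
  assume x: "x \<in> \<Omega> d"
  have "finite {i. component d x i \<noteq> \<zero>\<^bsub>gr_piece M \<Omega> i\<^esub>}"
    by (rule finite_subset[of _ "{d}"]) (auto simp: component_def)
  then show ?thesis
    using x abelian_groupE(2)[OF piece_abelian_group]
    by (auto simp: N_carrier component_def piece_carrier)
qed

text \<open>The module structure. Only the product with homogeneous elements is computed explicitly.\<close>

lemma A_carrier: "\<alpha> \<in> carrier A \<longleftrightarrow>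
    (\<forall>i. \<alpha> i \<in> coset_R i ` B i) \<and> finite {i. \<alpha> i \<noteq> below R B i}"
proof -
  interpret reg: filtered_module R "regular_module R" B B by (rule B_regular)
  have "\<zero>\<^bsub>gr_piece (regular_module R) B i\<^esub> = below R B i" for i by (simp add: gr_piece_def)
  then show ?thesis by (simp add: gr_ring_simps reg.N_carrier reg.piece_carrier)
qed

lemma A_component: "\<alpha> \<in> carrier A \<Longrightarrow> \<exists>r\<in>B i. \<alpha> i = coset_R i r"
  unfolding A_carrier by blast

lemma A_zero: "\<zero>\<^bsub>A\<^esub> = below R B"
  by (simp add: gr_ring_simps gr_module_def gr_piece_def fun_eq_iff)

lemma A_add:
  assumes "\<alpha> i = coset_R i r" "\<beta> i = coset_R i s" "r \<in> carrier R" "s \<in> carrier R"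
  shows "(\<alpha> \<oplus>\<^bsub>A\<^esub> \<beta>) i = coset_R i (r \<oplus>\<^bsub>R\<^esub> s)"
proof -
  interpret reg: filtered_module R "regular_module R" B B by (rule B_regular)
  show ?thesis using assms reg.coset_add[of r s i] by (simp add: gr_ring_simps reg.N_add)
qed

lemma A_abelian_group: "abelian_group A"
proof -
  interpret reg: filtered_module R "regular_module R" B B by (rule B_regular)
  show ?thesis by (rule abelian_group_cong[OF reg.N_abelian_group]) (simp_all add: gr_ring_simps)
qed

lemma coset_R_zero: "coset_R i \<zero>\<^bsub>R\<^esub> = below R B i"
  using below_B_subgroup by (simp add: abelian_subgroup.a_rcos_const additive_subgroup.zero_closed
      abelian_subgroup.axioms(1))

lemma symbol_apply: "symbol R B d r i = coset_R i (if i = d then r else \<zero>\<^bsub>R\<^esub>)"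
  by (simp add: symbol_def coset_R_zero)

lemma symbol_diag: "symbol R B d r d = coset_R d r"
  by (simp add: symbol_def)

lemma symbol_closed: "r \<in> B d \<Longrightarrow> symbol R B d r \<in> carrier A"
proof -
  assume r: "r \<in> B d"
  have "finite {i. symbol R B d r i \<noteq> below R B i}"
    by (rule finite_subset[of _ "{d}"]) (auto simp: symbol_def)
  then show ?thesis
    using r additive_subgroup.zero_closed[OF B_subgroup] by (auto simp: A_carrier symbol_apply)
qed

lemma symbol_add: "r \<in> B d \<Longrightarrow> s \<in> B d \<Longrightarrow> symbol R B d (r \<oplus>\<^bsub>R\<^esub> s) = symbol R B d r \<oplus>\<^bsub>A\<^esub> symbol R B d s"
proof
  fix i assume rs: "r \<in> B d" "s \<in> B d"
  have "(symbol R B d r \<oplus>\<^bsub>A\<^esub> symbol R B d s) i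
      = coset_R i ((if i = d then r else \<zero>\<^bsub>R\<^esub>) \<oplus>\<^bsub>R\<^esub> (if i = d then s else \<zero>\<^bsub>R\<^esub>))"
    using rs by (intro A_add symbol_apply) (auto intro: B_closed)
  then show "symbol R B d (r \<oplus>\<^bsub>R\<^esub> s) i = (symbol R B d r \<oplus>\<^bsub>A\<^esub> symbol R B d s) i"
    by (simp add: symbol_apply)
qed

lemma symbol_zero_iff: "r \<in> carrier R \<Longrightarrow> symbol R B d r = \<zero>\<^bsub>A\<^esub> \<longleftrightarrow> r \<in> below R B d"
proof -
  interpret HR: abelian_subgroup "below R B d" R by (rule below_B_subgroup)
  assume r: "r \<in> carrier R"
  have "coset_R d r = below R B d \<longleftrightarrow> r \<in> below R B d"
    using HR.a_rcos_const HR.a_rcos_self[OF r] by auto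
  then show ?thesis by (auto simp: A_zero symbol_def fun_eq_iff)
qed

lemma one_symbol: "\<one>\<^bsub>A\<^esub> = symbol R B 0 \<one>\<^bsub>R\<^esub>"
  by (auto simp: gr_ring_def Let_def symbol_def)

lemma A_generated: "\<alpha> \<in> carrier A \<Longrightarrow> \<alpha> \<in> add_span A {symbol R B i r | i r. r \<in> B i}"
proof -
  interpret A: abelian_group A by (rule A_abelian_group)
  let ?S = "{symbol R B i r | i r. r \<in> B i}"
  have S: "?S \<subseteq> carrier A" using symbol_closed by blast
  have "\<alpha> \<in> add_span A ?S" if "finite W" "{i. \<alpha> i \<noteq> below R B i} = W" "\<alpha> \<in> carrier A" for W \<alpha>
    using that
  proof (induction W arbitrary: \<alpha> rule: finite_induct)
    case empty
    then have "\<alpha> = \<zero>\<^bsub>A\<^esub>" unfolding A_zero by auto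
    then show ?case by (simp only: add_span.zero)
  next
    case (insert d W)
    define \<beta> where "\<beta> = \<alpha>(d := below R B d)"
    have b: "{i. \<beta> i \<noteq> below R B i} = W" using insert by (auto simp: \<beta>_def)
    have bi: "\<beta> i = \<alpha> i \<or> \<beta> i = coset_R i \<zero>\<^bsub>R\<^esub>" for i by (auto simp: \<beta>_def coset_R_zero)
    have "\<beta> i \<in> coset_R i ` B i" for i
      using bi[of i] insert.prems additive_subgroup.zero_closed[OF B_subgroup] by (auto simp: A_carrier)
    then have bc: "\<beta> \<in> carrier A" using b insert.hyps by (simp add: A_carrier)
    obtain r where r: "r \<in> B d" "\<alpha> d = coset_R d r" using A_component[OF insert.prems(2)] by blast
    have "\<alpha> = \<beta> \<oplus>\<^bsub>A\<^esub> symbol R B d r"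
    proof
      fix i
      obtain s where s: "s \<in> B i" "\<beta> i = coset_R i s" using bc by (auto simp: A_carrier)
      have rz: "(if i = d then r else \<zero>\<^bsub>R\<^esub>) \<in> carrier R" using r B_closed by simp
      have eq: "(\<beta> \<oplus>\<^bsub>A\<^esub> symbol R B d r) i = coset_R i (s \<oplus>\<^bsub>R\<^esub> (if i = d then r else \<zero>\<^bsub>R\<^esub>))"
        by (rule A_add[of \<beta> i s "symbol R B d r", OF s(2) symbol_apply B_closed[OF s(1)] rz])
      show "\<alpha> i = (\<beta> \<oplus>\<^bsub>A\<^esub> symbol R B d r) i"
      proof (cases "i = d")
        case True
        have "(\<beta> \<oplus>\<^bsub>A\<^esub> symbol R B d r) i = coset_R i (\<zero>\<^bsub>R\<^esub> \<oplus>\<^bsub>R\<^esub> r)"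
          using r B_closed True by (intro A_add) (auto simp: \<beta>_def coset_R_zero symbol_def)
        then show ?thesis using True r B_closed by simp
      next
        case False
        then show ?thesis using eq s B_closed by (simp add: \<beta>_def)
      qed
    qed
    moreover have "symbol R B d r \<in> ?S" using r by blast
    ultimately show ?case using insert.IH[OF b bc] by (metis (no_types, lifting) add_span.add)
  qed
  moreover assume "\<alpha> \<in> carrier A"
  ultimately show ?thesis by (auto simp: A_carrier)
qed

lemma N_smult: "\<alpha> \<odot>\<^bsub>N\<^esub> \<xi> = (\<lambda>k. \<Oplus>\<^bsub>gr_piece M \<Omega> k\<^esub>i\<in>{..k}. gr_coset_smult M \<Omega> k (\<alpha> i) (\<xi> (k - i)))"
  by (simp add: gr_module_def)

lemma gr_coset_smult_le:
  assumes "i \<le> k" "r \<in> B i" "x \<in> \<Omega> (k - i)"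
  shows "gr_coset_smult M \<Omega> k (coset_R i r) (coset (k - i) x) = coset k (r \<odot>\<^bsub>M\<^esub> x)"
  using gr_coset_smult_coset[OF assms(2,3)] assms(1) by simp

lemma B_smult_le: "i \<le> k \<Longrightarrow> r \<in> B i \<Longrightarrow> x \<in> \<Omega> (k - i) \<Longrightarrow> r \<odot>\<^bsub>M\<^esub> x \<in> \<Omega> k"
  using B_smult[of r i x "k - i"] by simp

lemma term_closed:
  assumes "\<alpha> \<in> carrier A" "\<xi> \<in> carrier N" "i \<le> k"
  shows "gr_coset_smult M \<Omega> k (\<alpha> i) (\<xi> (k - i)) \<in> carrier (gr_piece M \<Omega> k)"
proof -
  obtain r where "r \<in> B i" "\<alpha> i = coset_R i r" using assms(1) by (auto simp: A_carrier)
  moreover obtain x where "x \<in> \<Omega> (k - i)" "\<xi> (k - i) = coset (k - i) x"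
    using assms(2) by (auto simp: N_carrier piece_carrier)
  ultimately show ?thesis using assms(3) gr_coset_smult_le B_smult_le by (simp add: piece_carrier)
qed

lemma term_zero:
  assumes "\<alpha> \<in> carrier A" "\<xi> \<in> carrier N" "i \<le> k"
    and "\<alpha> i = below R B i \<or> \<xi> (k - i) = \<zero>\<^bsub>gr_piece M \<Omega> (k - i)\<^esub>"
  shows "gr_coset_smult M \<Omega> k (\<alpha> i) (\<xi> (k - i)) = \<zero>\<^bsub>gr_piece M \<Omega> k\<^esub>"
proof -
  obtain r where r: "r \<in> B i" "\<alpha> i = coset_R i r" using assms(1) by (auto simp: A_carrier)
  obtain x where x: "x \<in> \<Omega> (k - i)" "\<xi> (k - i) = coset (k - i) x"
    using assms(2) by (auto simp: N_carrier piece_carrier)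
  have z: "\<zero>\<^bsub>R\<^esub> \<in> B i" "\<zero>\<^bsub>M\<^esub> \<in> \<Omega> (k - i)"
    using additive_subgroup.zero_closed[OF B_subgroup] additive_subgroup.zero_closed[OF Omega_subgroup] by auto
  from assms(4) show ?thesis
  proof
    assume "\<alpha> i = below R B i"
    then show ?thesis using gr_coset_smult_le[OF assms(3) z(1) x(1)] x smult_zero_left[OF Omega_closed]
      by (simp add: coset_R_zero piece_zero)
  next
    assume "\<xi> (k - i) = \<zero>\<^bsub>gr_piece M \<Omega> (k - i)\<^esub>"
    then show ?thesis using gr_coset_smult_le[OF assms(3) r(1) z(2)] r smult_zero_right[OF B_closed]
      by (simp add: piece_zero)
  qed
qed

lemma N_smult_closed:
  assumes "\<alpha> \<in> carrier A" "\<xi> \<in> carrier N" shows "\<alpha> \<odot>\<^bsub>N\<^esub> \<xi> \<in> carrier N"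
proof -
  have c: "(\<alpha> \<odot>\<^bsub>N\<^esub> \<xi>) k \<in> carrier (gr_piece M \<Omega> k)" for k
  proof -
    interpret P: abelian_group "gr_piece M \<Omega> k" by (rule piece_abelian_group)
    show ?thesis unfolding N_smult using term_closed[OF assms] by (intro P.finsum_closed) auto
  qed
  let ?I = "{i. \<alpha> i \<noteq> below R B i}" and ?J = "{j. \<xi> j \<noteq> \<zero>\<^bsub>gr_piece M \<Omega> j\<^esub>}"
  have "{k. (\<alpha> \<odot>\<^bsub>N\<^esub> \<xi>) k \<noteq> \<zero>\<^bsub>gr_piece M \<Omega> k\<^esub>} \<subseteq> (\<lambda>(i, j). i + j) ` (?I \<times> ?J)"
  proof
    fix k assume k: "k \<in> {k. (\<alpha> \<odot>\<^bsub>N\<^esub> \<xi>) k \<noteq> \<zero>\<^bsub>gr_piece M \<Omega> k\<^esub>}"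
    interpret P: abelian_group "gr_piece M \<Omega> k" by (rule piece_abelian_group)
    have "\<exists>i\<le>k. gr_coset_smult M \<Omega> k (\<alpha> i) (\<xi> (k - i)) \<noteq> \<zero>\<^bsub>gr_piece M \<Omega> k\<^esub>"
    proof (rule ccontr)
      assume "\<not> ?thesis"
      then have "(\<alpha> \<odot>\<^bsub>N\<^esub> \<xi>) k = (\<Oplus>\<^bsub>gr_piece M \<Omega> k\<^esub>i\<in>{..k}. \<zero>\<^bsub>gr_piece M \<Omega> k\<^esub>)"
        unfolding N_smult by (intro P.finsum_cong') auto
      then show False using k by simp
    qed
    then obtain i where i: "i \<le> k" "gr_coset_smult M \<Omega> k (\<alpha> i) (\<xi> (k - i)) \<noteq> \<zero>\<^bsub>gr_piece M \<Omega> k\<^esub>" by blast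
    then have "i \<in> ?I" "k - i \<in> ?J" using term_zero[OF assms i(1)] by auto
    then show "k \<in> (\<lambda>(i, j). i + j) ` (?I \<times> ?J)"
      using i(1) by (intro image_eqI[of _ _ "(i, k - i)"]) auto
  qed
  moreover have "finite (?I \<times> ?J)" using assms by (simp add: A_carrier N_carrier)
  then have "finite ((\<lambda>(i, j). i + j) ` (?I \<times> ?J))" by (rule finite_imageI)
  ultimately have "finite {k. (\<alpha> \<odot>\<^bsub>N\<^esub> \<xi>) k \<noteq> \<zero>\<^bsub>gr_piece M \<Omega> k\<^esub>}" by (rule finite_subset)
  then show ?thesis using c by (simp add: N_carrier)
qed

lemma N_smult_l_distr:
  assumes "\<alpha> \<in> carrier A" "\<beta> \<in> carrier A" "\<xi> \<in> carrier N"
  shows "(\<alpha> \<oplus>\<^bsub>A\<^esub> \<beta>) \<odot>\<^bsub>N\<^esub> \<xi> = \<alpha> \<odot>\<^bsub>N\<^esub> \<xi> \<oplus>\<^bsub>N\<^esub> \<beta> \<odot>\<^bsub>N\<^esub> \<xi>"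
proof
  fix k
  interpret P: abelian_group "gr_piece M \<Omega> k" by (rule piece_abelian_group)
  let ?t = "\<lambda>\<alpha> i. gr_coset_smult M \<Omega> k (\<alpha> i) (\<xi> (k - i))"
  have c: "?t \<alpha> \<in> {..k} \<rightarrow> carrier (gr_piece M \<Omega> k)" "?t \<beta> \<in> {..k} \<rightarrow> carrier (gr_piece M \<Omega> k)"
    using term_closed assms by auto
  have "?t (\<alpha> \<oplus>\<^bsub>A\<^esub> \<beta>) i = ?t \<alpha> i \<oplus>\<^bsub>gr_piece M \<Omega> k\<^esub> ?t \<beta> i" if i: "i \<le> k" for i
  proof -
    obtain r where r: "r \<in> B i" "\<alpha> i = coset_R i r" using assms(1) by (auto simp: A_carrier)
    obtain s where s: "s \<in> B i" "\<beta> i = coset_R i s" using assms(2) by (auto simp: A_carrier)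
    obtain x where x: "x \<in> \<Omega> (k - i)" "\<xi> (k - i) = coset (k - i) x"
      using assms(3) by (auto simp: N_carrier piece_carrier)
    note c = B_closed[OF r(1)] B_closed[OF s(1)] Omega_closed[OF x(1)]
    have rs: "r \<oplus>\<^bsub>R\<^esub> s \<in> B i" using r s additive_subgroup.a_closed[OF B_subgroup] by auto
    show ?thesis
      unfolding A_add[of \<alpha> i r \<beta> s, OF r(2) s(2) c(1,2)] x(2) gr_coset_smult_le[OF i rs x(1)]
      unfolding r(2) s(2) gr_coset_smult_le[OF i r(1) x(1)] gr_coset_smult_le[OF i s(1) x(1)]
      using c smult_closed by (simp add: coset_add smult_l_distr)
  qed
  then have "((\<alpha> \<oplus>\<^bsub>A\<^esub> \<beta>) \<odot>\<^bsub>N\<^esub> \<xi>) k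
      = (\<Oplus>\<^bsub>gr_piece M \<Omega> k\<^esub>i\<in>{..k}. ?t \<alpha> i \<oplus>\<^bsub>gr_piece M \<Omega> k\<^esub> ?t \<beta> i)"
    unfolding N_smult using c by (intro P.finsum_cong') auto
  also have "\<dots> = (\<alpha> \<odot>\<^bsub>N\<^esub> \<xi> \<oplus>\<^bsub>N\<^esub> \<beta> \<odot>\<^bsub>N\<^esub> \<xi>) k"
    unfolding N_add N_smult by (rule P.finsum_addf[OF c])
  finally show "((\<alpha> \<oplus>\<^bsub>A\<^esub> \<beta>) \<odot>\<^bsub>N\<^esub> \<xi>) k = (\<alpha> \<odot>\<^bsub>N\<^esub> \<xi> \<oplus>\<^bsub>N\<^esub> \<beta> \<odot>\<^bsub>N\<^esub> \<xi>) k" .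
qed

lemma N_smult_r_distr:
  assumes "\<alpha> \<in> carrier A" "\<xi> \<in> carrier N" "\<eta> \<in> carrier N"
  shows "\<alpha> \<odot>\<^bsub>N\<^esub> (\<xi> \<oplus>\<^bsub>N\<^esub> \<eta>) = \<alpha> \<odot>\<^bsub>N\<^esub> \<xi> \<oplus>\<^bsub>N\<^esub> \<alpha> \<odot>\<^bsub>N\<^esub> \<eta>"
proof
  fix k
  interpret P: abelian_group "gr_piece M \<Omega> k" by (rule piece_abelian_group)
  let ?t = "\<lambda>\<xi> i. gr_coset_smult M \<Omega> k (\<alpha> i) (\<xi> (k - i))"
  have c: "?t \<xi> \<in> {..k} \<rightarrow> carrier (gr_piece M \<Omega> k)" "?t \<eta> \<in> {..k} \<rightarrow> carrier (gr_piece M \<Omega> k)"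
    using term_closed assms by auto
  have "?t (\<xi> \<oplus>\<^bsub>N\<^esub> \<eta>) i = ?t \<xi> i \<oplus>\<^bsub>gr_piece M \<Omega> k\<^esub> ?t \<eta> i" if i: "i \<le> k" for i
  proof -
    obtain r where r: "r \<in> B i" "\<alpha> i = coset_R i r" using assms(1) by (auto simp: A_carrier)
    obtain x where x: "x \<in> \<Omega> (k - i)" "\<xi> (k - i) = coset (k - i) x"
      using assms(2) by (auto simp: N_carrier piece_carrier)
    obtain y where y: "y \<in> \<Omega> (k - i)" "\<eta> (k - i) = coset (k - i) y"
      using assms(3) by (auto simp: N_carrier piece_carrier)
    note c = B_closed[OF r(1)] Omega_closed[OF x(1)] Omega_closed[OF y(1)]
    have xy: "x \<oplus>\<^bsub>M\<^esub> y \<in> \<Omega> (k - i)" using x y additive_subgroup.a_closed[OF Omega_subgroup] by auto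
    show ?thesis
      unfolding N_add x(2) y(2) r(2) coset_add[OF c(2,3)] gr_coset_smult_le[OF i r(1) xy]
        gr_coset_smult_le[OF i r(1) x(1)] gr_coset_smult_le[OF i r(1) y(1)]
      using c smult_closed by (simp add: coset_add smult_r_distr)
  qed
  then have "(\<alpha> \<odot>\<^bsub>N\<^esub> (\<xi> \<oplus>\<^bsub>N\<^esub> \<eta>)) k
      = (\<Oplus>\<^bsub>gr_piece M \<Omega> k\<^esub>i\<in>{..k}. ?t \<xi> i \<oplus>\<^bsub>gr_piece M \<Omega> k\<^esub> ?t \<eta> i)"
    unfolding N_smult using c by (intro P.finsum_cong') auto
  also have "\<dots> = (\<alpha> \<odot>\<^bsub>N\<^esub> \<xi> \<oplus>\<^bsub>N\<^esub> \<alpha> \<odot>\<^bsub>N\<^esub> \<eta>) k"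
    using P.finsum_addf[OF c] unfolding N_smult by (simp add: N_add[of "\<lambda>k. \<Oplus>\<^bsub>gr_piece M \<Omega> k\<^esub>i\<in>{..k}. gr_coset_smult M \<Omega> k (\<alpha> i) (\<xi> (k - i))"])
  finally show "(\<alpha> \<odot>\<^bsub>N\<^esub> (\<xi> \<oplus>\<^bsub>N\<^esub> \<eta>)) k = (\<alpha> \<odot>\<^bsub>N\<^esub> \<xi> \<oplus>\<^bsub>N\<^esub> \<alpha> \<odot>\<^bsub>N\<^esub> \<eta>) k" .
qed

lemma symbol_smult:
  assumes r: "r \<in> B d" and x: "\<xi> \<in> carrier N"
  shows "(symbol R B d r \<odot>\<^bsub>N\<^esub> \<xi>) k
    = (if d \<le> k then gr_coset_smult M \<Omega> k (coset_R d r) (\<xi> (k - d)) else \<zero>\<^bsub>gr_piece M \<Omega> k\<^esub>)"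
proof -
  interpret P: abelian_group "gr_piece M \<Omega> k" by (rule piece_abelian_group)
  let ?t = "\<lambda>i. gr_coset_smult M \<Omega> k (symbol R B d r i) (\<xi> (k - i))"
  note sc = symbol_closed[OF r]
  have z: "?t i = \<zero>\<^bsub>gr_piece M \<Omega> k\<^esub>" if "i \<le> k" "i \<noteq> d" for i
    using that by (intro term_zero[OF sc x]) (auto simp: symbol_def)
  show ?thesis
  proof (cases "d \<le> k")
    case True
    have td: "?t d \<in> carrier (gr_piece M \<Omega> k)" by (rule term_closed[OF sc x True])
    have "(symbol R B d r \<odot>\<^bsub>N\<^esub> \<xi>) k
        = (\<Oplus>\<^bsub>gr_piece M \<Omega> k\<^esub>i\<in>{..k}. if d = i then ?t i else \<zero>\<^bsub>gr_piece M \<Omega> k\<^esub>)"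
      unfolding N_smult using z td by (intro P.finsum_cong') auto
    also have "\<dots> = ?t d" using True term_closed[OF sc x] by (intro P.finsum_singleton) auto
    finally show ?thesis using True by (simp add: symbol_def)
  next
    case False
    have "(symbol R B d r \<odot>\<^bsub>N\<^esub> \<xi>) k = (\<Oplus>\<^bsub>gr_piece M \<Omega> k\<^esub>i\<in>{..k}. \<zero>\<^bsub>gr_piece M \<Omega> k\<^esub>)"
      unfolding N_smult using z False by (intro P.finsum_cong') auto
    then show ?thesis using False by simp
  qed
qed

lemma symbol_symbol_smult:
  assumes r: "r \<in> B d" and s: "s \<in> B e" and x: "\<xi> \<in> carrier N"
  shows "symbol R B d r \<odot>\<^bsub>N\<^esub> (symbol R B e s \<odot>\<^bsub>N\<^esub> \<xi>) = symbol R B (d + e) (r \<otimes>\<^bsub>R\<^esub> s) \<odot>\<^bsub>N\<^esub> \<xi>"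
proof
  fix k
  have sx: "symbol R B e s \<odot>\<^bsub>N\<^esub> \<xi> \<in> carrier N" by (rule N_smult_closed[OF symbol_closed[OF s] x])
  have rs: "r \<otimes>\<^bsub>R\<^esub> s \<in> B (d + e)" using r s by (rule B_mult)
  show "(symbol R B d r \<odot>\<^bsub>N\<^esub> (symbol R B e s \<odot>\<^bsub>N\<^esub> \<xi>)) k = (symbol R B (d + e) (r \<otimes>\<^bsub>R\<^esub> s) \<odot>\<^bsub>N\<^esub> \<xi>) k"
  proof (cases "d + e \<le> k")
    case True
    obtain u where u: "u \<in> \<Omega> (k - d - e)" "\<xi> (k - d - e) = coset (k - d - e) u"
      using x by (auto simp: N_carrier piece_carrier)
    have su: "s \<odot>\<^bsub>M\<^esub> u \<in> \<Omega> (k - d)" using B_smult_le[of e "k - d" s u] u s True by simp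
    have "(symbol R B e s \<odot>\<^bsub>N\<^esub> \<xi>) (k - d) = coset (k - d) (s \<odot>\<^bsub>M\<^esub> u)"
    proof -
      have ek: "e \<le> k - d" using True by simp
      show ?thesis using gr_coset_smult_le[OF ek s u(1)] u(2) ek by (simp add: symbol_smult[OF s x])
    qed
    then have "(symbol R B d r \<odot>\<^bsub>N\<^esub> (symbol R B e s \<odot>\<^bsub>N\<^esub> \<xi>)) k = coset k (r \<odot>\<^bsub>M\<^esub> (s \<odot>\<^bsub>M\<^esub> u))"
      using True gr_coset_smult_le[of d k r] su r by (simp add: symbol_smult[OF r sx])
    moreover have "(symbol R B (d + e) (r \<otimes>\<^bsub>R\<^esub> s) \<odot>\<^bsub>N\<^esub> \<xi>) k = coset k ((r \<otimes>\<^bsub>R\<^esub> s) \<odot>\<^bsub>M\<^esub> u)"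
      using True u gr_coset_smult_le[of "d + e" k "r \<otimes>\<^bsub>R\<^esub> s" u] rs by (simp add: symbol_smult[OF rs x])
    ultimately show ?thesis
      using smult_assoc1[OF B_closed[OF r] B_closed[OF s] Omega_closed[OF u(1)]] by simp
  next
    case False
    have "(symbol R B d r \<odot>\<^bsub>N\<^esub> (symbol R B e s \<odot>\<^bsub>N\<^esub> \<xi>)) k = \<zero>\<^bsub>gr_piece M \<Omega> k\<^esub>"
    proof (cases "d \<le> k")
      case True
      then have "(symbol R B e s \<odot>\<^bsub>N\<^esub> \<xi>) (k - d) = \<zero>\<^bsub>gr_piece M \<Omega> (k - d)\<^esub>"
        using False by (subst symbol_smult[OF s x]) auto
      then show ?thesis
        using True term_zero[OF symbol_closed[OF r] sx True] by (simp add: symbol_smult[OF r sx] symbol_diag)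
    qed (simp add: symbol_smult[OF r sx])
    then show ?thesis using False by (simp add: symbol_smult[OF rs x])
  qed
qed

lemma one_smult: "\<xi> \<in> carrier N \<Longrightarrow> \<one>\<^bsub>A\<^esub> \<odot>\<^bsub>N\<^esub> \<xi> = \<xi>"
proof
  fix k assume x: "\<xi> \<in> carrier N"
  obtain u where u: "u \<in> \<Omega> k" "\<xi> k = coset k u" using x by (auto simp: N_carrier piece_carrier)
  have "(\<one>\<^bsub>A\<^esub> \<odot>\<^bsub>N\<^esub> \<xi>) k = coset k (\<one>\<^bsub>R\<^esub> \<odot>\<^bsub>M\<^esub> u)"
    unfolding one_symbol using u gr_coset_smult_le[of 0 k "\<one>\<^bsub>R\<^esub>" u] B_one by (simp add: symbol_smult[OF B_one x])
  then show "(\<one>\<^bsub>A\<^esub> \<odot>\<^bsub>N\<^esub> \<xi>) k = \<xi> k" using u smult_one Omega_closed by simp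
qed

lemma symbol_component:
  assumes r: "r \<in> B d" and x: "x \<in> \<Omega> e"
  shows "symbol R B d r \<odot>\<^bsub>N\<^esub> component e x = component (d + e) (r \<odot>\<^bsub>M\<^esub> x)"
proof
  fix k
  note c = component_closed[OF x]
  show "(symbol R B d r \<odot>\<^bsub>N\<^esub> component e x) k = component (d + e) (r \<odot>\<^bsub>M\<^esub> x) k"
  proof (cases "k = d + e")
    case True
    then have "(symbol R B d r \<odot>\<^bsub>N\<^esub> component e x) k = gr_coset_smult M \<Omega> k (coset_R d r) (component e x (k - d))"
      by (simp add: symbol_smult[OF r c])
    also have "component e x (k - d) = coset e x" using True by (simp add: component_def)
    finally show ?thesis using gr_coset_smult_coset[OF r x] True by (simp add: component_def)
  next
    case False
    have "(symbol R B d r \<odot>\<^bsub>N\<^esub> component e x) k = \<zero>\<^bsub>gr_piece M \<Omega> k\<^esub>"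
    proof (cases "d \<le> k")
      case True
      then have "component e x (k - d) = \<zero>\<^bsub>gr_piece M \<Omega> (k - d)\<^esub>" using False by (auto simp: component_def)
      then show ?thesis
        using term_zero[OF symbol_closed[OF r] c True] True by (simp add: symbol_smult[OF r c] symbol_diag)
    qed (simp add: symbol_smult[OF r c])
    then show ?thesis using False by (simp add: component_def)
  qed
qed

end

section \<open>Finiteness of first Tor groups\<close>

lemma (in abelian_group) minus_eq_zero_imp_eq:
  assumes "x \<ominus> y = \<zero>" "x \<in> carrier G" "y \<in> carrier G" shows "x = y"
proof -
  have "x = (x \<ominus> y) \<oplus> y" using assms(2,3) by (simp add: a_minus_def a_assoc l_neg)
  then show ?thesis using assms by simp
qed

text \<open>A group with operators \<open>xa a\<close> (multiplication by \<open>x\<^sup>a\<close>) and \<open>Fa b\<close> (multiplication by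
  \<open>x\<^sup>b F\<close>). The instances are left modules over the ring of Frobenius operators and over its
  associated graded ring. By \<open>Fa_reduce\<close> the digit vectors \<open>b\<close> suffice: in the ring of Frobenius
  operators \<open>x\<^sup>b F = x\<^sup>d F x\<^sup>c\<close> for \<open>b = d + p c\<close>, and in the associated graded ring \<open>x\<^sup>b F\<close> vanishes for
  all other \<open>b\<close>.\<close>

locale frobenius_operators = frobenius p n + G: exponent_p_group G p
  for p n :: nat and G :: "('g, 'h) ring_scheme" +
  fixes xa Fa :: "(nat \<Rightarrow> nat) \<Rightarrow> 'g \<Rightarrow> 'g"
  assumes xa_closed: "a \<in> exponents n \<Longrightarrow> u \<in> carrier G \<Longrightarrow> xa a u \<in> carrier G"
    and xa_add: "a \<in> exponents n \<Longrightarrow> u \<in> carrier G \<Longrightarrow> v \<in> carrier G \<Longrightarrow>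
      xa a (u \<oplus>\<^bsub>G\<^esub> v) = xa a u \<oplus>\<^bsub>G\<^esub> xa a v"
    and xa_comp: "a \<in> exponents n \<Longrightarrow> b \<in> exponents n \<Longrightarrow> u \<in> carrier G \<Longrightarrow>
      xa (a + b) u = xa a (xa b u)"
    and xa_0: "u \<in> carrier G \<Longrightarrow> xa 0 u = u"
    and Fa_closed: "a \<in> exponents n \<Longrightarrow> u \<in> carrier G \<Longrightarrow> Fa a u \<in> carrier G"
    and Fa_add: "a \<in> exponents n \<Longrightarrow> u \<in> carrier G \<Longrightarrow> v \<in> carrier G \<Longrightarrow>
      Fa a (u \<oplus>\<^bsub>G\<^esub> v) = Fa a u \<oplus>\<^bsub>G\<^esub> Fa a v"
    and xa_Fa: "a \<in> exponents n \<Longrightarrow> b \<in> exponents n \<Longrightarrow> u \<in> carrier G \<Longrightarrow>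
      xa a (Fa b u) = Fa (a + b) u"
    and Fa_reduce: "b \<in> exponents n \<Longrightarrow> u \<in> carrier G \<Longrightarrow>
      Fa b u = \<zero>\<^bsub>G\<^esub> \<or> (\<exists>d\<in>digits. \<exists>c\<in>exponents n. Fa b u = Fa d (xa c u))"
begin

lemma digits_exponents: "b \<in> digits \<Longrightarrow> b \<in> exponents n"
  by (simp add: digits_def)

lemma additive_zero:
  assumes "f \<zero>\<^bsub>G\<^esub> \<in> carrier G" "f (\<zero>\<^bsub>G\<^esub> \<oplus>\<^bsub>G\<^esub> \<zero>\<^bsub>G\<^esub>) = f \<zero>\<^bsub>G\<^esub> \<oplus>\<^bsub>G\<^esub> f \<zero>\<^bsub>G\<^esub>"
  shows "f \<zero>\<^bsub>G\<^esub> = \<zero>\<^bsub>G\<^esub>"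
  using assms by (metis G.add.r_cancel_one G.l_zero G.zero_closed)

lemma xa_zero: "a \<in> exponents n \<Longrightarrow> xa a \<zero>\<^bsub>G\<^esub> = \<zero>\<^bsub>G\<^esub>"
  by (rule additive_zero[of "xa a"]) (simp_all only: xa_closed xa_add G.zero_closed)

lemma Fa_zero: "a \<in> exponents n \<Longrightarrow> Fa a \<zero>\<^bsub>G\<^esub> = \<zero>\<^bsub>G\<^esub>"
  by (rule additive_zero[of "Fa a"]) (simp_all only: Fa_closed Fa_add G.zero_closed)

text \<open>The map whose kernel and cokernel are the first and zeroth Tor groups.\<close>

definition Psi :: "((nat \<Rightarrow> nat) \<Rightarrow> 'g) \<Rightarrow> 'g" where
  "Psi u = (\<Oplus>\<^bsub>G\<^esub>b\<in>digits. Fa b (u b))"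

lemma Psi_closed: "u \<in> digits \<rightarrow> carrier G \<Longrightarrow> Psi u \<in> carrier G"
  unfolding Psi_def using Fa_closed digits_exponents by (intro G.finsum_closed) auto

lemma Psi_cong: "u \<in> digits \<rightarrow> carrier G \<Longrightarrow> (\<And>b. b \<in> digits \<Longrightarrow> v b = u b) \<Longrightarrow> Psi v = Psi u"
  unfolding Psi_def using Fa_closed digits_exponents by (intro G.finsum_cong') (auto simp: Pi_iff)

lemma Psi_add:
  assumes "u \<in> digits \<rightarrow> carrier G" "v \<in> digits \<rightarrow> carrier G"
  shows "Psi (\<lambda>b. u b \<oplus>\<^bsub>G\<^esub> v b) = Psi u \<oplus>\<^bsub>G\<^esub> Psi v"
proof -
  have c: "(\<lambda>b. Fa b (u b)) \<in> digits \<rightarrow> carrier G" "(\<lambda>b. Fa b (v b)) \<in> digits \<rightarrow> carrier G"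
    using assms Fa_closed digits_exponents by (auto simp: Pi_iff)
  have "Psi (\<lambda>b. u b \<oplus>\<^bsub>G\<^esub> v b) = (\<Oplus>\<^bsub>G\<^esub>b\<in>digits. Fa b (u b) \<oplus>\<^bsub>G\<^esub> Fa b (v b))"
    unfolding Psi_def using assms c digits_exponents by (intro G.finsum_cong') (auto simp: Fa_add Pi_iff)
  also have "\<dots> = Psi u \<oplus>\<^bsub>G\<^esub> Psi v" unfolding Psi_def by (rule G.finsum_addf[OF c])
  finally show ?thesis .
qed

lemma Psi_zero: "Psi (\<lambda>b. \<zero>\<^bsub>G\<^esub>) = \<zero>\<^bsub>G\<^esub>"
proof -
  have "Psi (\<lambda>b. \<zero>\<^bsub>G\<^esub>) = (\<Oplus>\<^bsub>G\<^esub>b\<in>digits. \<zero>\<^bsub>G\<^esub>)"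
    unfolding Psi_def using Fa_zero digits_exponents by (intro G.finsum_cong') auto
  then show ?thesis by simp
qed

lemma Psi_minus:
  assumes "u \<in> digits \<rightarrow> carrier G" "v \<in> digits \<rightarrow> carrier G"
  shows "Psi (\<lambda>b. u b \<ominus>\<^bsub>G\<^esub> v b) = Psi u \<ominus>\<^bsub>G\<^esub> Psi v"
proof -
  have c: "(\<lambda>b. u b \<ominus>\<^bsub>G\<^esub> v b) \<in> digits \<rightarrow> carrier G" using assms by auto
  have "Psi u = Psi (\<lambda>b. (u b \<ominus>\<^bsub>G\<^esub> v b) \<oplus>\<^bsub>G\<^esub> v b)"
    using assms by (intro Psi_cong) (auto simp: Pi_iff a_minus_def G.a_assoc G.l_neg)
  also have "\<dots> = Psi (\<lambda>b. u b \<ominus>\<^bsub>G\<^esub> v b) \<oplus>\<^bsub>G\<^esub> Psi v" by (rule Psi_add[OF c assms(2)])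
  finally show ?thesis
    using Psi_closed[OF c] Psi_closed[OF assms(2)] by (simp add: a_minus_def G.a_assoc G.r_neg)
qed

lemma Psi_single:
  assumes "b \<in> digits" "x \<in> carrier G"
  shows "Psi (\<lambda>d. if d = b then x else \<zero>\<^bsub>G\<^esub>) = Fa b x"
proof -
  have c: "Fa b x \<in> carrier G" using assms Fa_closed digits_exponents by auto
  have "Psi (\<lambda>d. if d = b then x else \<zero>\<^bsub>G\<^esub>) = (\<Oplus>\<^bsub>G\<^esub>d\<in>digits. if b = d then Fa b x else \<zero>\<^bsub>G\<^esub>)"
    unfolding Psi_def using assms c Fa_zero digits_exponents by (intro G.finsum_cong') auto
  also have "\<dots> = Fa b x" using assms(1) c finite_digits by (intro G.add.finprod_singleton) auto
  finally show ?thesis .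
qed

text \<open>The submodule generated by \<open>F K\<close>.\<close>

definition F_span :: "'g set \<Rightarrow> 'g set" where
  "F_span K = add_span G {Fa b k | b k. b \<in> exponents n \<and> k \<in> K}"

context
  fixes K
  assumes K_carrier: "K \<subseteq> carrier G" and K_span: "add_span G K \<subseteq> K"
    and K_xa: "\<And>a k. a \<in> exponents n \<Longrightarrow> k \<in> K \<Longrightarrow> xa a k \<in> K"
begin

lemma F_span_gen: "{Fa b k | b k. b \<in> exponents n \<and> k \<in> K} \<subseteq> carrier G"
  using Fa_closed K_carrier by auto

lemma F_span_carrier: "F_span K \<subseteq> carrier G"
  unfolding F_span_def using G.add_span_closed F_span_gen by blast

lemma F_span_span: "add_span G (F_span K) \<subseteq> F_span K"
  unfolding F_span_def using G.add_span_subset F_span_gen by blast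

lemma F_span_xa:
  assumes a: "a \<in> exponents n" and x: "x \<in> F_span K"
  shows "xa a x \<in> F_span K"
  unfolding F_span_def
proof (rule G.add_span_image[where f = "xa a", OF x[unfolded F_span_def] F_span_gen F_span_gen])
  fix s assume "s \<in> {Fa b k | b k. b \<in> exponents n \<and> k \<in> K}"
  then obtain b k where bk: "b \<in> exponents n" "k \<in> K" "s = Fa b k" by blast
  then have "xa a s = Fa (a + b) k" using a K_carrier by (auto simp: xa_Fa)
  then show "xa a s \<in> add_span G {Fa b k | b k. b \<in> exponents n \<and> k \<in> K}"
    using bk a exponents_plus by (intro G.add_span_base[OF _ F_span_gen]) blast
qed (use a xa_zero xa_add G.abelian_group_axioms in auto)

lemma K_zero: "\<zero>\<^bsub>G\<^esub> \<in> K" using K_span add_span.zero by blast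

lemma K_add: "x \<in> K \<Longrightarrow> y \<in> K \<Longrightarrow> x \<oplus>\<^bsub>G\<^esub> y \<in> K"
  by (rule subsetD[OF K_span]) (rule add_span.add[OF G.add_span_base[OF _ K_carrier]])

lemma F_span_Psi: "x \<in> F_span K \<Longrightarrow> \<exists>k\<in>digits \<rightarrow> K. x = Psi k"
  unfolding F_span_def
proof (induction rule: add_span.induct)
  case zero
  show ?case using Psi_zero K_zero by (intro bexI[of _ "\<lambda>b. \<zero>\<^bsub>G\<^esub>"]) auto
next
  case (add x s)
  then obtain k where k: "k \<in> digits \<rightarrow> K" "x = Psi k" by blast
  obtain b y where bY: "b \<in> exponents n" "y \<in> K" "s = Fa b y" using add by blast
  have kc: "k \<in> digits \<rightarrow> carrier G" using k K_carrier by auto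
  have yc: "y \<in> carrier G" using bY K_carrier by auto
  from Fa_reduce[OF bY(1) yc] show ?case
  proof
    assume "Fa b y = \<zero>\<^bsub>G\<^esub>"
    then have "x \<oplus>\<^bsub>G\<^esub> s = Psi k" using bY k Psi_closed[OF kc] by simp
    then show ?case using k by blast
  next
    assume "\<exists>d\<in>digits. \<exists>c\<in>exponents n. Fa b y = Fa d (xa c y)"
    then obtain d c where dc: "d \<in> digits" "c \<in> exponents n" "Fa b y = Fa d (xa c y)" by blast
    let ?z = "xa c y"
    let ?e = "\<lambda>i. if i = d then ?z else \<zero>\<^bsub>G\<^esub>"
    have z: "?z \<in> K" "?z \<in> carrier G" using K_xa[OF dc(2) bY(2)] K_carrier by auto
    have "?e \<in> digits \<rightarrow> carrier G" using z by auto
    then have "Psi (\<lambda>i. k i \<oplus>\<^bsub>G\<^esub> ?e i) = x \<oplus>\<^bsub>G\<^esub> s"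
      using Psi_add[OF kc] Psi_single[OF dc(1) z(2)] k bY dc by simp
    moreover have "(\<lambda>i. k i \<oplus>\<^bsub>G\<^esub> ?e i) \<in> digits \<rightarrow> K" using k z K_add K_zero by (auto simp: Pi_iff)
    ultimately show ?case by (intro bexI[of _ "\<lambda>i. k i \<oplus>\<^bsub>G\<^esub> ?e i"]) simp_all
  qed
qed

lemma Psi_F_span: "k \<in> digits \<rightarrow> K \<Longrightarrow> Psi k \<in> F_span K"
  unfolding F_span_def Psi_def
  by (intro add_span_finsum G.abelian_group_axioms F_span_gen finite_digits G.add_span_base)
    (auto dest: digits_exponents)

text \<open>If the associated graded relations \<open>x\<^sub>j\<^sup>p F = 0\<close> hold, then \<open>K \<inter> F G\<close> is finite modulo
  \<open>F K\<close>: it is killed by \<open>x\<^sub>j\<^sup>p\<close>, and \<open>T\<close> generates \<open>K / F K\<close> over the polynomial ring.\<close>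

lemma finite_modulo_F_span:
  assumes vanish: "\<And>b u. b \<in> exponents n \<Longrightarrow> b \<notin> digits \<Longrightarrow> u \<in> carrier G \<Longrightarrow> Fa b u = \<zero>\<^bsub>G\<^esub>"
    and T: "finite T" "T \<subseteq> K"
    and gen: "K \<subseteq> add_span G (F_span K \<union> {xa a t | a t. a \<in> exponents n \<and> t \<in> T})"
  shows "\<exists>Q. finite Q \<and> Q \<subseteq> carrier G \<and> (\<forall>u\<in>digits \<rightarrow> carrier G. Psi u \<in> K \<longrightarrow> (\<exists>q\<in>Q. \<exists>j\<in>F_span K. Psi u = j \<oplus>\<^bsub>G\<^esub> q))"
proof -
  obtain r :: nat and g where g: "T = g ` {s. s < r}"
    using finite_imp_nat_seg_image_inj_on[OF T(1)] by blast
  interpret ma: monomial_action G p n xa "F_span K" g r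
  proof
    fix s assume "s < r"
    then show "g s \<in> carrier G" using g T K_carrier by blast
  qed (use xa_closed xa_add xa_comp F_span_carrier F_span_span F_span_xa in auto)
  define Z where "Z = {k \<in> K. \<forall>j<n. xa (var_power j p) k \<in> F_span K}"
  have ZK: "Z \<subseteq> K" by (auto simp: Z_def)
  have Zc: "Z \<subseteq> carrier G" using ZK K_carrier by auto
  have "{xa a t | a t. a \<in> exponents n \<and> t \<in> T} \<subseteq> ma.vec ` ma.indices"
  proof
    fix y assume "y \<in> {xa a t | a t. a \<in> exponents n \<and> t \<in> T}"
    then obtain a s where "a \<in> exponents n" "s < r" "y = xa a (g s)" using g by blast
    then have "y = ma.vec (a, s)" "(a, s) \<in> ma.indices" by (auto simp: ma.vec_def ma.indices_def)
    then show "y \<in> ma.vec ` ma.indices" by blast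
  qed
  then have sub: "F_span K \<union> {xa a t | a t. a \<in> exponents n \<and> t \<in> T} \<subseteq> F_span K \<union> ma.vec ` ma.indices" by blast
  have "\<exists>D. Z \<subseteq> add_span G (F_span K \<union> ma.vec ` {m \<in> ma.indices. total_degree n (fst m) \<le> D})"
  proof (rule ma.finite_torsion)
    show "Z \<subseteq> add_span G (F_span K \<union> ma.vec ` ma.indices)"
      using gen ZK add_span_mono[OF _ sub] by blast
    show "add_span G Z \<subseteq> Z"
    proof
      fix x assume "x \<in> add_span G Z"
      then show "x \<in> Z"
      proof induction
        case zero
        then show ?case using K_zero xa_zero ma.J_zero by (simp add: Z_def exponents_var_power)
      next
        case (add x s)
        have "xa (var_power j p) (x \<oplus>\<^bsub>G\<^esub> s) \<in> F_span K" if "j < n" for j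
        proof -
          have "xa (var_power j p) (x \<oplus>\<^bsub>G\<^esub> s) = xa (var_power j p) x \<oplus>\<^bsub>G\<^esub> xa (var_power j p) s"
            using add Zc that by (intro xa_add exponents_var_power) auto
          moreover have "xa (var_power j p) x \<in> add_span G (F_span K)" "xa (var_power j p) s \<in> F_span K"
            using add that G.add_span_base[OF _ F_span_carrier] by (auto simp: Z_def)
          ultimately show ?thesis using F_span_span add_span.add[of _ G "F_span K"] by auto
        qed
        then show ?case using add K_add by (auto simp: Z_def)
      qed
    qed
    show "xa a x \<in> Z" if a: "a \<in> exponents n" and x: "x \<in> Z" for a x
    proof -
      have xc: "x \<in> carrier G" using x Zc by auto
      have "xa (var_power j p) (xa a x) \<in> F_span K" if "j < n" for j
      proof -
        note vp = exponents_var_power[OF that, of p]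
        have "xa (var_power j p) (xa a x) = xa a (xa (var_power j p) x)"
          using xa_comp[OF vp a xc] xa_comp[OF a vp xc] by (simp add: add.commute)
        then show ?thesis using F_span_xa[OF a] x that by (simp add: Z_def)
      qed
      then show ?thesis using K_xa a x by (simp add: Z_def)
    qed
    show "xa (var_power j p) x \<in> F_span K" if "j < n" "x \<in> Z" for j x
      using that by (simp add: Z_def)
  qed
  then obtain D where D: "Z \<subseteq> add_span G (F_span K \<union> ma.vec ` {m \<in> ma.indices. total_degree n (fst m) \<le> D})" ..
  let ?V = "ma.vec ` {m \<in> ma.indices. total_degree n (fst m) \<le> D}"
  have V: "finite ?V" "?V \<subseteq> carrier G" using ma.finite_degree_le ma.vec_closed by auto
  show ?thesis
  proof (intro exI[of _ "add_span G ?V"] conjI ballI impI)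
    show "finite (add_span G ?V)" by (rule G.finite_add_span[OF V])
    show "add_span G ?V \<subseteq> carrier G" using G.add_span_closed V(2) by blast
    fix u assume u: "u \<in> digits \<rightarrow> carrier G" and uK: "Psi u \<in> K"
    have "xa (var_power j p) (Psi u) \<in> F_span K" if j: "j < n" for j
    proof -
      note vp = exponents_var_power[OF j, of p]
      have "xa (var_power j p) (Psi u) \<in> add_span G {\<zero>\<^bsub>G\<^esub>}"
      proof (rule G.add_span_image[where f = "xa (var_power j p)" and S = "{Fa b (u b) | b. b \<in> digits}"])
        show "Psi u \<in> add_span G {Fa b (u b) | b. b \<in> digits}" unfolding Psi_def
          using u Fa_closed digits_exponents
          by (intro add_span_finsum G.abelian_group_axioms finite_digits G.add_span_base) auto
        show "{Fa b (u b) | b. b \<in> digits} \<subseteq> carrier G" using u Fa_closed digits_exponents by auto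
        fix s assume "s \<in> {Fa b (u b) | b. b \<in> digits}"
        then obtain b where b: "b \<in> digits" "s = Fa b (u b)" by blast
        have "p \<le> (var_power j p + b) j" by (simp add: var_power_def)
        then have nd: "var_power j p + b \<notin> digits" unfolding digits_def using not_less by blast
        have "xa (var_power j p) s = Fa (var_power j p + b) (u b)"
          unfolding b(2) using b u digits_exponents vp by (intro xa_Fa) auto
        also have "\<dots> = \<zero>\<^bsub>G\<^esub>"
          using nd b u digits_exponents vp exponents_plus by (intro vanish) auto
        finally show "xa (var_power j p) s \<in> add_span G {\<zero>\<^bsub>G\<^esub>}" by (simp add: add_span.zero)
      qed (use xa_zero[OF vp] xa_add[OF vp] G.abelian_group_axioms in auto)
      moreover have "add_span G {\<zero>\<^bsub>G\<^esub>} \<subseteq> F_span K"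
        using F_span_span add_span_mono[of _ G "{\<zero>\<^bsub>G\<^esub>}" "F_span K"] ma.J_zero by auto
      ultimately show ?thesis by blast
    qed
    then have "Psi u \<in> Z" using uK by (simp add: Z_def)
    then have "Psi u \<in> add_span G (F_span K \<union> ?V)" using D by blast
    from G.add_span_Un_subgroup[OF this F_span_carrier V(2) F_span_span]
    show "\<exists>q\<in>add_span G ?V. \<exists>j\<in>F_span K. Psi u = j \<oplus>\<^bsub>G\<^esub> q" by blast
  qed
qed

end

end

text \<open>For a module \<open>N\<close> presented as \<open>G / K\<close>, where \<open>G\<close> is free, the kernel of \<open>Psi\<close>
  on \<open>N\<close> embeds into \<open>(K \<inter> F G) / F K\<close>: lift \<open>v\<close> to \<open>u\<close> and take \<open>Psi u\<close>. The map \<open>q\<close> below picks the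
  class of \<open>Psi u\<close> among finitely many representatives.\<close>

lemma finite_Psi_kernel:
  assumes G: "frobenius_operators p n G xa Fa" and N: "frobenius_operators p n N ya Ha"
    and hom: "\<And>u. u \<in> carrier G \<Longrightarrow> \<phi> u \<in> carrier N"
      "\<And>u v. u \<in> carrier G \<Longrightarrow> v \<in> carrier G \<Longrightarrow> \<phi> (u \<oplus>\<^bsub>G\<^esub> v) = \<phi> u \<oplus>\<^bsub>N\<^esub> \<phi> v"
      "\<And>a u. a \<in> exponents n \<Longrightarrow> u \<in> carrier G \<Longrightarrow> \<phi> (xa a u) = ya a (\<phi> u)"
      "\<And>a u. a \<in> exponents n \<Longrightarrow> u \<in> carrier G \<Longrightarrow> \<phi> (Fa a u) = Ha a (\<phi> u)"
    and surj: "carrier N \<subseteq> \<phi> ` carrier G"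
    and K: "K = {u \<in> carrier G. \<phi> u = \<zero>\<^bsub>N\<^esub>}"
    and vanish: "\<And>b u. b \<in> exponents n \<Longrightarrow> b \<notin> frobenius.digits p n \<Longrightarrow> u \<in> carrier G \<Longrightarrow> Fa b u = \<zero>\<^bsub>G\<^esub>"
    and indep: "\<And>u b. u \<in> frobenius.digits p n \<rightarrow> carrier G \<Longrightarrow>
      frobenius_operators.Psi p n G Fa u = \<zero>\<^bsub>G\<^esub> \<Longrightarrow> b \<in> frobenius.digits p n \<Longrightarrow> u b = \<zero>\<^bsub>G\<^esub>"
    and T: "finite T" "T \<subseteq> K"
    and gen: "K \<subseteq> add_span G (frobenius_operators.F_span n G Fa K \<union> {xa a t | a t. a \<in> exponents n \<and> t \<in> T})"
  shows "finite {v \<in> frobenius.digits p n \<rightarrow>\<^sub>E carrier N. frobenius_operators.Psi p n N Ha v = \<zero>\<^bsub>N\<^esub>}"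
proof -
  interpret G: frobenius_operators p n G xa Fa by fact
  interpret N: frobenius_operators p n N ya Ha by fact
  have phi0: "\<phi> \<zero>\<^bsub>G\<^esub> = \<zero>\<^bsub>N\<^esub>"
    using hom(2)[of "\<zero>\<^bsub>G\<^esub>" "\<zero>\<^bsub>G\<^esub>"] hom(1)[of "\<zero>\<^bsub>G\<^esub>"]
    by (metis G.G.l_zero G.G.zero_closed N.G.add.r_cancel_one)
  have Kc: "K \<subseteq> carrier G" using K by auto
  have Ksp: "add_span G K \<subseteq> K"
  proof
    fix x assume "x \<in> add_span G K"
    then show "x \<in> K" by induction (auto simp: K phi0 hom)
  qed
  have Kxa: "xa a k \<in> K" if "a \<in> exponents n" "k \<in> K" for a k
    using that by (auto simp: K hom G.xa_closed N.xa_zero)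
  obtain Q where Q: "finite Q" "Q \<subseteq> carrier G" "\<forall>u\<in>G.digits \<rightarrow> carrier G. G.Psi u \<in> K \<longrightarrow>
      (\<exists>q\<in>Q. \<exists>j\<in>G.F_span K. G.Psi u = j \<oplus>\<^bsub>G\<^esub> q)"
    using G.finite_modulo_F_span[OF Kc Ksp Kxa vanish T gen] by blast
  have phi_Psi: "\<phi> (G.Psi u) = N.Psi (\<lambda>b. \<phi> (u b))" if u: "u \<in> G.digits \<rightarrow> carrier G" for u
  proof -
    have "\<phi> (\<Oplus>\<^bsub>G\<^esub>b\<in>B. Fa b (u b)) = (\<Oplus>\<^bsub>N\<^esub>b\<in>B. Ha b (\<phi> (u b)))" if "B \<subseteq> G.digits" for B
      using finite_subset[OF that G.finite_digits] that
    proof (induction B rule: finite_induct)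
      case (insert b B)
      have e: "d \<in> exponents n" "u d \<in> carrier G" if "d \<in> insert b B" for d
        using that insert.prems u G.digits_exponents by blast+
      have c: "(\<lambda>d. Fa d (u d)) \<in> B \<rightarrow> carrier G" "Fa b (u b) \<in> carrier G"
        "(\<lambda>d. Ha d (\<phi> (u d))) \<in> B \<rightarrow> carrier N" "Ha b (\<phi> (u b)) \<in> carrier N"
        using e by (auto intro!: G.Fa_closed N.Fa_closed hom(1))
      then show ?case using insert e by (simp add: hom)
    qed (simp add: phi0)
    then show ?thesis unfolding G.Psi_def N.Psi_def by blast
  qed
  let ?Z = "{v \<in> G.digits \<rightarrow>\<^sub>E carrier N. N.Psi v = \<zero>\<^bsub>N\<^esub>}"
  have "\<exists>u q. u \<in> G.digits \<rightarrow> carrier G \<and> (\<forall>b\<in>G.digits. \<phi> (u b) = v b) \<and> q \<in> Q \<and>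
      (\<exists>j\<in>G.F_span K. G.Psi u = j \<oplus>\<^bsub>G\<^esub> q)" if v: "v \<in> ?Z" for v
  proof -
    have "\<forall>b\<in>G.digits. \<exists>x\<in>carrier G. \<phi> x = v b"
    proof
      fix b assume "b \<in> G.digits"
      then have "v b \<in> carrier N" using v by (auto simp: PiE_iff)
      then show "\<exists>x\<in>carrier G. \<phi> x = v b" using surj by (metis imageE subsetD)
    qed
    then obtain u where u: "\<forall>b\<in>G.digits. u b \<in> carrier G \<and> \<phi> (u b) = v b" by metis
    then have uc: "u \<in> G.digits \<rightarrow> carrier G" by auto
    have "N.Psi (\<lambda>b. \<phi> (u b)) = N.Psi v" using u v by (intro N.Psi_cong) (auto simp: PiE_iff)
    then have "G.Psi u \<in> K" using phi_Psi[OF uc] v G.Psi_closed[OF uc] by (simp add: K)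
    then show ?thesis using Q(3) uc u by blast
  qed
  then have "\<forall>v\<in>?Z. \<exists>uq. fst uq \<in> G.digits \<rightarrow> carrier G \<and> (\<forall>b\<in>G.digits. \<phi> (fst uq b) = v b) \<and>
      snd uq \<in> Q \<and> (\<exists>j\<in>G.F_span K. G.Psi (fst uq) = j \<oplus>\<^bsub>G\<^esub> snd uq)"
    by simp
  from bchoice[OF this] obtain W where W: "\<forall>v\<in>?Z. fst (W v) \<in> G.digits \<rightarrow> carrier G \<and>
      (\<forall>b\<in>G.digits. \<phi> (fst (W v) b) = v b) \<and>
      snd (W v) \<in> Q \<and> (\<exists>j\<in>G.F_span K. G.Psi (fst (W v)) = j \<oplus>\<^bsub>G\<^esub> snd (W v))" ..
  define U where "U = (\<lambda>v. fst (W v))"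
  define q where "q = (\<lambda>v. snd (W v))"
  have U: "U v \<in> G.digits \<rightarrow> carrier G" "b \<in> G.digits \<Longrightarrow> \<phi> (U v b) = v b" "q v \<in> Q"
    "\<exists>j\<in>G.F_span K. G.Psi (U v) = j \<oplus>\<^bsub>G\<^esub> q v" if "v \<in> ?Z" for v b
    using bspec[OF W that] unfolding U_def q_def by simp_all
  have "inj_on q ?Z"
  proof (rule inj_onI)
    fix v w assume v: "v \<in> ?Z" and w: "w \<in> ?Z" and eq: "q v = q w"
    obtain i where i: "i \<in> G.F_span K" "G.Psi (U v) = i \<oplus>\<^bsub>G\<^esub> q v" using U(4)[OF v] by blast
    obtain j where j: "j \<in> G.F_span K" "G.Psi (U w) = j \<oplus>\<^bsub>G\<^esub> q v" using U(4)[OF w] eq by auto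
    obtain k where k: "k \<in> G.digits \<rightarrow> K" "i = G.Psi k" using G.F_span_Psi[OF Kc Ksp Kxa i(1)] by blast
    obtain l where l: "l \<in> G.digits \<rightarrow> K" "j = G.Psi l" using G.F_span_Psi[OF Kc Ksp Kxa j(1)] by blast
    have kl: "k \<in> G.digits \<rightarrow> carrier G" "l \<in> G.digits \<rightarrow> carrier G" using k l Kc by auto
    have sum: "(\<lambda>b. U v b \<oplus>\<^bsub>G\<^esub> l b) \<in> G.digits \<rightarrow> carrier G" "(\<lambda>b. U w b \<oplus>\<^bsub>G\<^esub> k b) \<in> G.digits \<rightarrow> carrier G"
      using U(1)[OF v] U(1)[OF w] kl by (auto simp: Pi_iff)
    have ij: "i \<in> carrier G" "j \<in> carrier G" using k l kl G.Psi_closed by auto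
    have qc: "q v \<in> carrier G" using U(3)[OF v] Q(2) by blast
    have "G.Psi (\<lambda>b. U v b \<oplus>\<^bsub>G\<^esub> l b) = (i \<oplus>\<^bsub>G\<^esub> q v) \<oplus>\<^bsub>G\<^esub> j"
      using G.Psi_add[OF U(1)[OF v] kl(2)] i l by simp
    also have "\<dots> = (j \<oplus>\<^bsub>G\<^esub> q v) \<oplus>\<^bsub>G\<^esub> i" using ij qc by (simp add: G.G.a_ac)
    also have "\<dots> = G.Psi (\<lambda>b. U w b \<oplus>\<^bsub>G\<^esub> k b)"
      using G.Psi_add[OF U(1)[OF w] kl(1)] j k by simp
    finally have "G.Psi (\<lambda>b. (U v b \<oplus>\<^bsub>G\<^esub> l b) \<ominus>\<^bsub>G\<^esub> (U w b \<oplus>\<^bsub>G\<^esub> k b)) = \<zero>\<^bsub>G\<^esub>"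
      using G.Psi_minus[OF sum] G.Psi_closed[OF sum(2)] by (simp add: a_minus_def G.G.r_neg)
    moreover have dc: "(\<lambda>b. (U v b \<oplus>\<^bsub>G\<^esub> l b) \<ominus>\<^bsub>G\<^esub> (U w b \<oplus>\<^bsub>G\<^esub> k b)) \<in> G.digits \<rightarrow> carrier G"
      using sum by (auto simp: Pi_iff)
    ultimately have z: "(U v b \<oplus>\<^bsub>G\<^esub> l b) \<ominus>\<^bsub>G\<^esub> (U w b \<oplus>\<^bsub>G\<^esub> k b) = \<zero>\<^bsub>G\<^esub>" if "b \<in> G.digits" for b
      using indep[OF dc] that by blast
    show "v = w"
    proof (rule PiE_ext)
      show "v \<in> G.digits \<rightarrow>\<^sub>E carrier N" "w \<in> G.digits \<rightarrow>\<^sub>E carrier N" using v w by auto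
      fix b assume b: "b \<in> G.digits"
      have c: "U v b \<in> carrier G" "U w b \<in> carrier G" "l b \<in> carrier G" "k b \<in> carrier G"
        using b U(1)[OF v] U(1)[OF w] kl by (auto simp: Pi_iff)
      have kl0: "\<phi> (k b) = \<zero>\<^bsub>N\<^esub>" "\<phi> (l b) = \<zero>\<^bsub>N\<^esub>" using b k l K by (auto simp: Pi_iff)
      have "U v b \<oplus>\<^bsub>G\<^esub> l b = U w b \<oplus>\<^bsub>G\<^esub> k b" using G.G.minus_eq_zero_imp_eq[OF z[OF b]] c by simp
      then have "\<phi> (U v b \<oplus>\<^bsub>G\<^esub> l b) = \<phi> (U w b \<oplus>\<^bsub>G\<^esub> k b)" by simp
      then show "v b = w b" using c kl0 b U(2)[OF v] U(2)[OF w] hom(1)[OF c(1)] hom(1)[OF c(2)]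
        by (simp add: hom(2))
    qed
  qed
  moreover have "q ` ?Z \<subseteq> Q" using U(3) by (rule image_subsetI)
  then have "finite (q ` ?Z)" using Q(1) by (rule finite_subset)
  ultimately show ?thesis by (rule finite_imageD[rotated])
qed

section \<open>The associated graded ring of the ring of Frobenius operators\<close>

lemma (in filtered_module) finsum_coset:
  assumes "finite C" "\<And>c. c \<in> C \<Longrightarrow> f c \<in> carrier N" "\<And>c. c \<in> C \<Longrightarrow> y c \<in> \<Omega> k"
    "\<And>c. c \<in> C \<Longrightarrow> f c k = coset k (y c)"
  shows "(\<Oplus>\<^bsub>N\<^esub>c\<in>C. f c) k = coset k (\<Oplus>\<^bsub>M\<^esub>c\<in>C. y c)"
proof -
  interpret N: abelian_group N by (rule N_abelian_group)
  show ?thesis using assms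
  proof (induction C)
    case empty then show ?case by (simp add: N_zero piece_zero)
  next
    case (insert c C)
    have y: "y \<in> C \<rightarrow> carrier M" "y c \<in> carrier M" using insert.prems(2) Omega_closed by auto
    then have ys: "(\<Oplus>\<^bsub>M\<^esub>c\<in>C. y c) \<in> carrier M" by (intro M.finsum_closed)
    have "(\<Oplus>\<^bsub>N\<^esub>c\<in>insert c C. f c) k = f c k \<oplus>\<^bsub>gr_piece M \<Omega> k\<^esub> (\<Oplus>\<^bsub>N\<^esub>c\<in>C. f c) k"
      using insert.hyps insert.prems(1) by (simp add: N_add Pi_iff)
    also have "\<dots> = coset k (y c \<oplus>\<^bsub>M\<^esub> (\<Oplus>\<^bsub>M\<^esub>c\<in>C. y c))"
      using insert y ys by (simp add: coset_add)
    also have "\<dots> = coset k (\<Oplus>\<^bsub>M\<^esub>c\<in>insert c C. y c)"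
      using insert.hyps y by simp
    finally show ?case .
  qed
qed

lemma (in frobenius) below_bernstein: "below F (bernstein p n) i = word_span i"
  by (cases i) (simp_all add: below_def word_span_0 bernstein_eq_word_span)

lemma (in frobenius) word_span_subgroup: "additive_subgroup (word_span k) F"
  unfolding additive_subgroup_def
proof (rule F.add.subgroupI)
  show "word_span k \<subseteq> carrier F" using word_span_closed by blast
  show "word_span k \<noteq> {}" unfolding word_span_def using add_span.zero by blast
  fix x y assume "x \<in> word_span k" "y \<in> word_span k"
  then show "\<ominus>\<^bsub>F\<^esub> x \<in> word_span k" "x \<oplus>\<^bsub>F\<^esub> y \<in> word_span k"
    unfolding word_span_def using Fp.add_span_neg F.add_span_plus word_span_gen by blast+
qed

lemma (in frobenius) filtered_moduleI:
  assumes "left_module F M" "\<And>i. additive_subgroup (\<Omega> i) M" "\<And>i. \<Omega> i \<subseteq> \<Omega> (Suc i)"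
    "\<And>i j r x. r \<in> bernstein p n i \<Longrightarrow> x \<in> \<Omega> j \<Longrightarrow> r \<odot>\<^bsub>M\<^esub> x \<in> \<Omega> (i + j)"
  shows "filtered_module F M (bernstein p n) \<Omega>"
proof (intro filtered_module.intro filtered_module_axioms.intro assms)
  fix i j r s
  show "additive_subgroup (bernstein p n i) F" unfolding bernstein_eq_word_span by (rule word_span_subgroup)
  show "bernstein p n i \<subseteq> bernstein p n (Suc i)"
    unfolding bernstein_eq_word_span by (rule word_span_mono) simp
  show "\<one>\<^bsub>F\<^esub> \<in> bernstein p n 0"
    unfolding bernstein_eq_word_span frob_word_Nil[symmetric] by (rule word_span_word) simp_all
  assume "r \<in> bernstein p n i" "s \<in> bernstein p n j"
  then show "r \<otimes>\<^bsub>F\<^esub> s \<in> bernstein p n (i + j)"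
    using word_span_mult[of r i s "Suc j"] by (simp add: bernstein_eq_word_span)
qed

text \<open>A filtered module over the ring of Frobenius operators with its Bernstein filtration.\<close>

locale frobenius_graded = frobenius p n + fm: filtered_module "frob_ring p n" M "bernstein p n" \<Omega>
  for p n :: nat and M :: "(frob, 'm, 'd) module_scheme" and \<Omega> :: "nat \<Rightarrow> 'm set"
begin

abbreviation gr where "gr \<equiv> gr_module M \<Omega>"
abbreviation grF where "grF \<equiv> gr_ring F (bernstein p n)"

text \<open>The class of a word in the degree of its length. It vanishes if the word is not of minimal
  length among those of its value.\<close>

definition word_symbol :: "letter list \<Rightarrow> nat \<Rightarrow> frob set" where
  "word_symbol w = symbol F (bernstein p n) (length w) (frob_word p n w)"

lemma word_bernstein: "w \<in> lists (letters n) \<Longrightarrow> frob_word p n w \<in> bernstein p n (length w)"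
  unfolding bernstein_eq_word_span by (rule word_span_word) simp_all

lemma word_symbol_closed: "w \<in> lists (letters n) \<Longrightarrow> word_symbol w \<in> carrier grF"
  unfolding word_symbol_def by (rule fm.symbol_closed[OF word_bernstein])

lemma word_symbol_append:
  assumes "u \<in> lists (letters n)" "v \<in> lists (letters n)" "\<xi> \<in> carrier gr"
  shows "word_symbol (u @ v) \<odot>\<^bsub>gr\<^esub> \<xi> = word_symbol u \<odot>\<^bsub>gr\<^esub> (word_symbol v \<odot>\<^bsub>gr\<^esub> \<xi>)"
  unfolding word_symbol_def fm.symbol_symbol_smult[OF word_bernstein[OF assms(1)] word_bernstein[OF assms(2)] assms(3)]
  using assms by (simp add: frob_word_append)

lemma word_symbol_eqI:
  assumes "u \<in> lists (letters n)" "v \<in> lists (letters n)" "word_value p u = word_value p v" "length u = length v"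
  shows "word_symbol u = word_symbol v"
  using frob_word_eqI[OF assms(1-3)] assms(4) by (simp add: word_symbol_def)

lemma word_symbol_zeroI:
  assumes "u \<in> lists (letters n)" "v \<in> lists (letters n)" "word_value p u = word_value p v" "length v < length u"
  shows "word_symbol u = \<zero>\<^bsub>grF\<^esub>"
proof -
  have "frob_word p n u \<in> word_span (length u)"
    unfolding frob_word_eqI[OF assms(1-3)] by (rule word_span_word[OF assms(2,4)])
  then show ?thesis
    unfolding word_symbol_def using fm.symbol_zero_iff[OF frob_word_closed[OF assms(1)]]
    by (simp add: below_bernstein)
qed

lemma grF_words: "\<alpha> \<in> carrier grF \<Longrightarrow> \<alpha> \<in> add_span grF (word_symbol ` lists (letters n))"
proof -
  interpret A: abelian_group grF by (rule fm.A_abelian_group)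
  have c: "word_symbol ` lists (letters n) \<subseteq> carrier grF" using word_symbol_closed by blast
  have "symbol F (bernstein p n) i r \<in> add_span grF (word_symbol ` lists (letters n))"
    if r: "r \<in> bernstein p n i" for i r
    using r[unfolded bernstein_eq_word_span word_span_def]
  proof (induction rule: add_span.induct)
    case zero
    have "symbol F (bernstein p n) i \<zero>\<^bsub>F\<^esub> = \<zero>\<^bsub>grF\<^esub>"
      using fm.symbol_zero_iff[of "\<zero>\<^bsub>F\<^esub>" i] add_span.zero
      by (simp add: below_bernstein word_span_def)
    then show ?case by (simp only: add_span.zero)
  next
    case (add r s)
    then obtain w where w: "w \<in> lists (letters n)" "length w < Suc i" "s = frob_word p n w" by blast
    have r: "r \<in> bernstein p n i" using add by (simp add: bernstein_eq_word_span word_span_def)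
    have s: "s \<in> bernstein p n i" unfolding bernstein_eq_word_span w(3) by (rule word_span_word[OF w(1,2)])
    have "symbol F (bernstein p n) i s \<in> add_span grF (word_symbol ` lists (letters n))"
    proof (cases "length w = i")
      case True
      then show ?thesis using w A.add_span_base[OF _ c] by (auto simp: word_symbol_def)
    next
      case False
      then have "s \<in> word_span i" unfolding w(3) using w by (intro word_span_word) auto
      then have "symbol F (bernstein p n) i s = \<zero>\<^bsub>grF\<^esub>"
        using fm.symbol_zero_iff[OF fm.B_closed[OF s]] by (simp add: below_bernstein)
      then show ?thesis by (simp only: add_span.zero)
    qed
    then show ?case using add.IH A.add_span_plus[OF _ _ c] by (simp add: fm.symbol_add[OF r s])
  qed
  moreover assume "\<alpha> \<in> carrier grF"
  then have "\<alpha> \<in> add_span grF {symbol F (bernstein p n) i r | i r. r \<in> bernstein p n i}"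
    by (rule fm.A_generated)
  ultimately show ?thesis using A.add_span_subset[OF _ _ c] by blast
qed

text \<open>The operators \<open>x\<^sup>a\<close> and \<open>x\<^sup>b F\<close> on the associated graded module.\<close>

definition gr_x :: "(nat \<Rightarrow> nat) \<Rightarrow> (nat \<Rightarrow> 'm set) \<Rightarrow> nat \<Rightarrow> 'm set" where
  "gr_x a \<xi> = word_symbol (monomial_word n a) \<odot>\<^bsub>gr\<^esub> \<xi>"

definition gr_F :: "(nat \<Rightarrow> nat) \<Rightarrow> (nat \<Rightarrow> 'm set) \<Rightarrow> nat \<Rightarrow> 'm set" where
  "gr_F b \<xi> = word_symbol (monomial_word n b @ [Frob]) \<odot>\<^bsub>gr\<^esub> \<xi>"

lemma zero_smult: "\<xi> \<in> carrier gr \<Longrightarrow> \<zero>\<^bsub>grF\<^esub> \<odot>\<^bsub>gr\<^esub> \<xi> = \<zero>\<^bsub>gr\<^esub>"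
proof -
  interpret A: abelian_group grF by (rule fm.A_abelian_group)
  interpret N: abelian_group gr by (rule fm.N_abelian_group)
  assume x: "\<xi> \<in> carrier gr"
  have "\<zero>\<^bsub>grF\<^esub> \<odot>\<^bsub>gr\<^esub> \<xi> = \<zero>\<^bsub>grF\<^esub> \<odot>\<^bsub>gr\<^esub> \<xi> \<oplus>\<^bsub>gr\<^esub> \<zero>\<^bsub>grF\<^esub> \<odot>\<^bsub>gr\<^esub> \<xi>"
    using fm.N_smult_l_distr[OF A.zero_closed A.zero_closed x] by simp
  then show ?thesis using fm.N_smult_closed[OF A.zero_closed x] by (metis N.add.r_cancel_one')
qed

lemma xF_word_value:
  "b \<in> exponents n \<Longrightarrow> word_value p (monomial_word n b @ [Frob]) = (b, 1)"
  using word_value_shift[of b "[]"] by (simp add: shift_def fun_eq_iff)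

text \<open>For \<open>b\<^sub>j \<ge> p\<close> the word \<open>x\<^sup>b F\<close> is not of minimal length, as \<open>x\<^sub>j\<^sup>p F = F x\<^sub>j\<close>.\<close>

lemma xF_symbol_zero:
  assumes b: "b \<in> exponents n" "b \<notin> digits"
  shows "word_symbol (monomial_word n b @ [Frob]) = \<zero>\<^bsub>grF\<^esub>"
proof -
  obtain j where j: "p \<le> b j" using b by (auto simp: digits_def not_less)
  have jn: "j < n"
  proof (rule ccontr)
    assume "\<not> j < n"
    then have "b j = 0" using b(1) by (simp add: exponents_def)
    then show False using j p_gt_1 by simp
  qed
  define c where "c = b - var_power j p"
  have "var_power j p \<le> b" using j by (auto simp: le_fun_def var_power_def)
  then have bc: "b = var_power j p + c" unfolding c_def by (rule exponents_split)
  have c: "c \<in> exponents n" unfolding c_def by (rule exponents_minus[OF b(1)])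
  let ?v = "monomial_word n c @ [Frob, X j]"
  show ?thesis
  proof (rule word_symbol_zeroI[OF xF_letters])
    show "?v \<in> lists (letters n)" using monomial_word_letters letter_Frob letter_X[OF jn] by auto
    show "word_value p (monomial_word n b @ [Frob]) = word_value p ?v"
      unfolding xF_word_value[OF b(1)]
      using word_value_shift[OF c, of "[X j]"] bc by (auto simp: shift_def var_power_def fun_eq_iff)
    show "length ?v < length (monomial_word n b @ [Frob])"
      using p_gt_1 jn by (simp add: length_monomial_word bc total_degree_plus total_degree_var_power)
  qed
qed

lemma monomial_word_0: "monomial_word m 0 = []" by (induction m) auto

lemma gr_multiple:
  assumes "\<xi> \<in> carrier gr"
  shows "[(k::nat)] \<cdot>\<^bsub>gr\<^esub> \<xi> = symbol F (bernstein p n) 0 ([k] \<cdot>\<^bsub>F\<^esub> \<one>\<^bsub>F\<^esub>) \<odot>\<^bsub>gr\<^esub> \<xi> \<and>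
    [k] \<cdot>\<^bsub>F\<^esub> \<one>\<^bsub>F\<^esub> \<in> bernstein p n 0"
proof (induction k)
  interpret N: abelian_group gr by (rule fm.N_abelian_group)
  case 0
  have z: "\<zero>\<^bsub>F\<^esub> \<in> bernstein p n 0" using additive_subgroup.zero_closed[OF fm.B_subgroup] .
  have "symbol F (bernstein p n) 0 \<zero>\<^bsub>F\<^esub> = \<zero>\<^bsub>grF\<^esub>"
    using fm.symbol_zero_iff[of "\<zero>\<^bsub>F\<^esub>" 0] by (simp add: below_def)
  then show ?case using z zero_smult[OF assms] by simp
next
  interpret N: abelian_group gr by (rule fm.N_abelian_group)
  case (Suc k)
  have "symbol F (bernstein p n) 0 \<one>\<^bsub>F\<^esub> \<odot>\<^bsub>gr\<^esub> \<xi> = \<xi>"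
    using fm.one_smult[OF assms] by (simp add: fm.one_symbol)
  then show ?case
    using Suc fm.B_one fm.symbol_add[of _ 0 "\<one>\<^bsub>F\<^esub>"] additive_subgroup.a_closed[OF fm.B_subgroup]
      fm.N_smult_l_distr[OF fm.symbol_closed fm.symbol_closed assms, of _ 0 "\<one>\<^bsub>F\<^esub>" 0]
    by simp
qed

lemma gr_exponent: "exponent_p_group gr p"
proof (intro exponent_p_group.intro exponent_p_group_axioms.intro fm.N_abelian_group prime_p)
  fix \<xi> assume x: "\<xi> \<in> carrier gr"
  have "[p] \<cdot>\<^bsub>F\<^esub> \<one>\<^bsub>F\<^esub> = \<zero>\<^bsub>F\<^esub>" by (rule Fp.exponent) simp
  moreover have "symbol F (bernstein p n) 0 \<zero>\<^bsub>F\<^esub> = \<zero>\<^bsub>grF\<^esub>"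
    using fm.symbol_zero_iff[of "\<zero>\<^bsub>F\<^esub>" 0] by (simp add: below_def)
  ultimately show "[p] \<cdot>\<^bsub>gr\<^esub> \<xi> = \<zero>\<^bsub>gr\<^esub>" using gr_multiple[OF x, of p] zero_smult[OF x] by simp
qed

lemma gr_operators: "frobenius_operators p n gr gr_x gr_F"
proof (intro frobenius_operators.intro frobenius_operators_axioms.intro frobenius_axioms gr_exponent)
  note mw = monomial_word_letters
  fix a u assume u: "u \<in> carrier gr"
  show "gr_x a u \<in> carrier gr" "gr_F a u \<in> carrier gr"
    unfolding gr_x_def gr_F_def using fm.N_smult_closed word_symbol_closed mw xF_letters u by blast+
  show "gr_x 0 u = u"
    using fm.one_smult[OF u] by (simp add: gr_x_def monomial_word_0 word_symbol_def fm.one_symbol frob_word_Nil)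
  fix v assume v: "v \<in> carrier gr"
  show "gr_x a (u \<oplus>\<^bsub>gr\<^esub> v) = gr_x a u \<oplus>\<^bsub>gr\<^esub> gr_x a v"
    unfolding gr_x_def by (rule fm.N_smult_r_distr[OF word_symbol_closed[OF mw] u v])
  show "gr_F a (u \<oplus>\<^bsub>gr\<^esub> v) = gr_F a u \<oplus>\<^bsub>gr\<^esub> gr_F a v"
    unfolding gr_F_def by (rule fm.N_smult_r_distr[OF word_symbol_closed[OF xF_letters] u v])
next
  note mw = monomial_word_letters
  fix a b u assume a: "a \<in> exponents n" and b: "b \<in> exponents n" and u: "u \<in> carrier gr"
  have "word_symbol (monomial_word n (a + b)) = word_symbol (monomial_word n a @ monomial_word n b)"
    using a b exponents_plus mw
    by (intro word_symbol_eqI)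
      (auto simp: word_value_append word_value_exponents length_monomial_word total_degree_plus fun_eq_iff)
  then show "gr_x (a + b) u = gr_x a (gr_x b u)"
    unfolding gr_x_def using word_symbol_append[OF mw mw u] by simp
  have "word_symbol (monomial_word n (a + b) @ [Frob]) = word_symbol (monomial_word n a @ monomial_word n b @ [Frob])"
    using a b exponents_plus mw letter_Frob
    by (intro word_symbol_eqI)
      (auto simp: word_value_append word_value_exponents length_monomial_word total_degree_plus fun_eq_iff)
  then show "gr_x a (gr_F b u) = gr_F (a + b) u"
    unfolding gr_x_def gr_F_def using word_symbol_append[OF mw xF_letters u] by simp
next
  fix b u assume b: "b \<in> exponents n" and u: "u \<in> carrier gr"
  have u0: "gr_x 0 u = u"
    using fm.one_smult[OF u] by (simp add: gr_x_def monomial_word_0 word_symbol_def fm.one_symbol frob_word_Nil)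
  show "gr_F b u = \<zero>\<^bsub>gr\<^esub> \<or> (\<exists>d\<in>digits. \<exists>c\<in>exponents n. gr_F b u = gr_F d (gr_x c u))"
  proof (cases "b \<in> digits")
    case True
    then show ?thesis using u0 exponents_zero by metis
  next
    case False
    then show ?thesis using xF_symbol_zero[OF b] zero_smult[OF u] by (simp add: gr_F_def)
  qed
qed

sublocale go: frobenius_operators p n gr gr_x gr_F
  by (rule gr_operators)

lemma gr_F_vanish: "b \<in> exponents n \<Longrightarrow> b \<notin> digits \<Longrightarrow> u \<in> carrier gr \<Longrightarrow> gr_F b u = \<zero>\<^bsub>gr\<^esub>"
  using xF_symbol_zero zero_smult by (simp add: gr_F_def)

lemma gr_F_component:
  assumes "\<xi> \<in> carrier gr" "y \<in> \<Omega> k" "\<xi> k = fm.coset k y"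
  shows "gr_F b \<xi> (Suc (total_degree n b) + k) = fm.coset (Suc (total_degree n b) + k) (xF b \<odot>\<^bsub>M\<^esub> y)"
proof -
  have len: "length (monomial_word n b @ [Frob]) = Suc (total_degree n b)"
    by (simp add: length_monomial_word)
  have B: "xF b \<in> bernstein p n (Suc (total_degree n b))"
    using word_bernstein[OF xF_letters, of b] unfolding len .
  show ?thesis
    unfolding gr_F_def word_symbol_def len fm.symbol_smult[OF B assms(1)]
    using fm.gr_coset_smult_coset[OF B assms(2)] assms(3) by simp
qed

lemma gr_F_low:
  assumes "\<xi> \<in> carrier gr" "k \<le> total_degree n b"
  shows "gr_F b \<xi> k = fm.coset k \<zero>\<^bsub>M\<^esub>"
proof -
  have len: "length (monomial_word n b @ [Frob]) = Suc (total_degree n b)"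
    by (simp add: length_monomial_word)
  have B: "xF b \<in> bernstein p n (Suc (total_degree n b))"
    using word_bernstein[OF xF_letters, of b] unfolding len .
  show ?thesis
    unfolding gr_F_def word_symbol_def len fm.symbol_smult[OF B assms(1)]
    using assms(2) by (simp add: fm.piece_zero)
qed

text \<open>The degree \<open>k\<close> component of \<open>\<Sum> x\<^sup>b F u\<^sub>b\<close>, from representatives.\<close>

lemma gr_Psi_component:
  assumes u: "u \<in> digits \<rightarrow> carrier gr"
    and y: "\<And>b. b \<in> digits \<Longrightarrow> total_degree n b < k \<Longrightarrow>
      y b \<in> \<Omega> (k - Suc (total_degree n b)) \<and> u b (k - Suc (total_degree n b)) = fm.coset (k - Suc (total_degree n b)) (y b)"
    and y0: "\<And>b. b \<in> digits \<Longrightarrow> k \<le> total_degree n b \<Longrightarrow> y b = \<zero>\<^bsub>M\<^esub>"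
  shows "go.Psi u k = fm.coset k (\<Oplus>\<^bsub>M\<^esub>b\<in>digits. xF b \<odot>\<^bsub>M\<^esub> y b)"
  unfolding go.Psi_def
proof (rule fm.finsum_coset[OF finite_digits])
  fix b assume b: "b \<in> digits"
  have ub: "u b \<in> carrier gr" using u b by auto
  show "gr_F b (u b) \<in> carrier gr" using go.Fa_closed go.digits_exponents b ub by blast
  have len: "length (monomial_word n b @ [Frob]) = Suc (total_degree n b)"
    by (simp add: length_monomial_word)
  have B: "xF b \<in> bernstein p n (Suc (total_degree n b))"
    using word_bernstein[OF xF_letters, of b] unfolding len .
  show "xF b \<odot>\<^bsub>M\<^esub> y b \<in> \<Omega> k"
  proof (cases "total_degree n b < k")
    case True
    then show ?thesis using fm.B_smult_le[OF _ B, of k "y b"] y[OF b] by simp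
  next
    case False
    then show ?thesis using y0[OF b] fm.smult_zero_right[OF xF_closed]
        additive_subgroup.zero_closed[OF fm.Omega_subgroup] by simp
  qed
  show "gr_F b (u b) k = fm.coset k (xF b \<odot>\<^bsub>M\<^esub> y b)"
  proof (cases "total_degree n b < k")
    case True
    then show ?thesis
      using gr_F_component[OF ub, of "y b" "k - Suc (total_degree n b)" b] y[OF b True] by simp
  next
    case False
    then show ?thesis using gr_F_low[OF ub, of k b] y0[OF b] fm.smult_zero_right[OF xF_closed] by simp
  qed
qed

end

lemma (in frobenius) regular_graded: "frobenius_graded p n (regular_module F) (bernstein p n)"
proof -
  have "left_module F (regular_module F)"
  proof (intro left_module.intro left_module_axioms.intro F.ring_axioms)
    show "abelian_group (regular_module F)"
      by (rule abelian_group_cong[OF F.abelian_group_axioms]) simp_all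
  qed (auto simp: F.l_distr F.r_distr F.m_assoc)
  then have "filtered_module F (regular_module F) (bernstein p n) (bernstein p n)"
  proof (rule filtered_moduleI)
    fix i j r s
    show "additive_subgroup (bernstein p n i) (regular_module F)"
      using word_span_subgroup[of "Suc i"] unfolding bernstein_eq_word_span
      by (auto simp: additive_subgroup_def subgroup_def a_inv_def m_inv_def)
    show "bernstein p n i \<subseteq> bernstein p n (Suc i)"
      unfolding bernstein_eq_word_span by (rule word_span_mono) simp
    assume "r \<in> bernstein p n i" "s \<in> bernstein p n j"
    then show "r \<odot>\<^bsub>regular_module F\<^esub> s \<in> bernstein p n (i + j)"
      using word_span_mult[of r i s "Suc j"] by (simp add: bernstein_eq_word_span)
  qed
  then show ?thesis by (intro frobenius_graded.intro frobenius_axioms)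
qed

sublocale frobenius \<subseteq> reg: frobenius_graded p n "regular_module (frob_ring p n)" "bernstein p n"
  by (rule regular_graded)

text \<open>Over the associated graded ring itself the elements \<open>x\<^sup>b F\<close> are independent, so the first Tor
  group of a free module vanishes.\<close>

lemma (in frobenius) regular_Psi_inj:
  assumes u: "u \<in> digits \<rightarrow> carrier reg.gr" and z: "reg.go.Psi u = \<zero>\<^bsub>reg.gr\<^esub>" and b: "b \<in> digits"
  shows "u b = \<zero>\<^bsub>reg.gr\<^esub>"
proof
  fix k
  define e where "e = Suc (total_degree n b) + k"
  have "\<forall>d\<in>digits. \<exists>y. (total_degree n d < e \<longrightarrow> y \<in> bernstein p n (e - Suc (total_degree n d)) \<and>
      u d (e - Suc (total_degree n d)) = reg.fm.coset (e - Suc (total_degree n d)) y) \<and>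
      (e \<le> total_degree n d \<longrightarrow> y = \<zero>\<^bsub>F\<^esub>)"
  proof
    fix d assume "d \<in> digits"
    then have "u d \<in> carrier reg.gr" using u by auto
    then have "u d (e - Suc (total_degree n d)) \<in> reg.fm.coset (e - Suc (total_degree n d)) ` bernstein p n (e - Suc (total_degree n d))"
      using reg.fm.N_carrier reg.fm.piece_carrier by blast
    then show "\<exists>y. (total_degree n d < e \<longrightarrow> y \<in> bernstein p n (e - Suc (total_degree n d)) \<and>
      u d (e - Suc (total_degree n d)) = reg.fm.coset (e - Suc (total_degree n d)) y) \<and>
      (e \<le> total_degree n d \<longrightarrow> y = \<zero>\<^bsub>F\<^esub>)"
      by (cases "total_degree n d < e") auto
  qed
  from bchoice[OF this] obtain y where y: "\<forall>d\<in>digits. (total_degree n d < e \<longrightarrow> y d \<in> bernstein p n (e - Suc (total_degree n d)) \<and>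
      u d (e - Suc (total_degree n d)) = reg.fm.coset (e - Suc (total_degree n d)) (y d)) \<and>
      (e \<le> total_degree n d \<longrightarrow> y d = \<zero>\<^bsub>F\<^esub>)" ..
  have yc: "y d \<in> carrier F" if "d \<in> digits" for d
    using bspec[OF y that] reg.fm.B_closed by (cases "total_degree n d < e") auto
  have "reg.go.Psi u e = reg.fm.coset e (\<Oplus>\<^bsub>regular_module F\<^esub>d\<in>digits. xF d \<odot>\<^bsub>regular_module F\<^esub> y d)"
    using y by (intro reg.gr_Psi_component[OF u]) auto
  also have "(\<Oplus>\<^bsub>regular_module F\<^esub>d\<in>digits. xF d \<odot>\<^bsub>regular_module F\<^esub> y d) = (\<Oplus>\<^bsub>F\<^esub>d\<in>digits. xF d \<otimes>\<^bsub>F\<^esub> y d)"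
    using finsum_cong_structure[of "regular_module F" F] by simp
  finally have "reg.fm.coset e (\<Oplus>\<^bsub>F\<^esub>d\<in>digits. xF d \<otimes>\<^bsub>F\<^esub> y d) = \<zero>\<^bsub>gr_piece (regular_module F) (bernstein p n) e\<^esub>"
    using z by (simp add: reg.fm.N_zero)
  moreover have "(\<Oplus>\<^bsub>F\<^esub>d\<in>digits. xF d \<otimes>\<^bsub>F\<^esub> y d) \<in> carrier F"
    using xF_closed yc by (intro F.finsum_closed) auto
  ultimately have "(\<Oplus>\<^bsub>F\<^esub>d\<in>digits. xF d \<otimes>\<^bsub>F\<^esub> y d) \<in> word_span e"
    using reg.fm.coset_zero_iff[of _ e] by (simp add: below_bernstein)
  from xF_independent[OF yc this b] have "y b \<in> word_span k" by (simp add: e_def)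
  moreover have "u b k = reg.fm.coset k (y b)" using bspec[OF y b] by (simp add: e_def)
  ultimately show "u b k = \<zero>\<^bsub>reg.gr\<^esub> k"
    using reg.fm.coset_zero_iff[of "y b" k] yc[OF b] by (simp add: below_bernstein reg.fm.N_zero)
qed

section \<open>Consequences of finite presentation\<close>

context frobenius
begin

text \<open>The free module of rank \<open>m\<close> over the associated graded ring, with its operators \<open>free_x\<close> and
  \<open>free_F\<close> acting on each coordinate.\<close>

abbreviation free_gr where "free_gr m \<equiv> free_module (gr_ring F (bernstein p n)) m"

lemma free_gr_carrier: "carrier (free_gr m) = {..<m} \<rightarrow>\<^sub>E carrier reg.gr"
  by (simp add: free_module_def gr_ring_simps)

lemma free_gr_zero: "\<zero>\<^bsub>free_gr m\<^esub> = (\<lambda>i\<in>{..<m}. \<zero>\<^bsub>reg.gr\<^esub>)"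
  by (simp add: free_module_def gr_ring_simps)

lemma free_gr_add: "u \<oplus>\<^bsub>free_gr m\<^esub> v = (\<lambda>i\<in>{..<m}. u i \<oplus>\<^bsub>reg.gr\<^esub> v i)"
  by (simp add: free_module_def gr_ring_simps)

lemma free_gr_smult: "c \<odot>\<^bsub>free_gr m\<^esub> u = (\<lambda>i\<in>{..<m}. c \<odot>\<^bsub>reg.gr\<^esub> u i)"
  by (simp add: free_module_def gr_ring_simps)

lemma free_gr_eqI:
  "u \<in> carrier (free_gr m) \<Longrightarrow> v \<in> carrier (free_gr m) \<Longrightarrow> (\<And>i. i < m \<Longrightarrow> u i = v i) \<Longrightarrow> u = v"
  unfolding free_gr_carrier by (rule PiE_ext) auto

lemma free_gr_coord: "u \<in> carrier (free_gr m) \<Longrightarrow> i < m \<Longrightarrow> u i \<in> carrier reg.gr"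
  unfolding free_gr_carrier by auto

lemma free_gr_restrict: "(\<And>i. i < m \<Longrightarrow> f i \<in> carrier reg.gr) \<Longrightarrow> (\<lambda>i\<in>{..<m}. f i) \<in> carrier (free_gr m)"
  unfolding free_gr_carrier by auto

lemma free_gr_abelian_group: "abelian_group (free_gr m)"
proof (rule abelian_groupI)
  show "\<zero>\<^bsub>free_gr m\<^esub> \<in> carrier (free_gr m)" unfolding free_gr_zero by (rule free_gr_restrict) simp
  fix u assume u: "u \<in> carrier (free_gr m)"
  note uc = free_gr_coord[OF u]
  show "\<zero>\<^bsub>free_gr m\<^esub> \<oplus>\<^bsub>free_gr m\<^esub> u = u"
    by (rule free_gr_eqI[OF _ u]) (use uc in \<open>auto simp: free_gr_zero free_gr_add intro: free_gr_restrict\<close>)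
  have "(\<lambda>i\<in>{..<m}. \<ominus>\<^bsub>reg.gr\<^esub> u i) \<oplus>\<^bsub>free_gr m\<^esub> u = \<zero>\<^bsub>free_gr m\<^esub>"
    unfolding free_gr_zero free_gr_add using uc by (intro restrict_ext) (auto simp: reg.go.G.l_neg)
  then show "\<exists>v\<in>carrier (free_gr m). v \<oplus>\<^bsub>free_gr m\<^esub> u = \<zero>\<^bsub>free_gr m\<^esub>"
    using uc free_gr_restrict[of m "\<lambda>i. \<ominus>\<^bsub>reg.gr\<^esub> u i"] by (metis reg.go.G.a_inv_closed)
  fix v assume v: "v \<in> carrier (free_gr m)"
  note vc = free_gr_coord[OF v]
  show "u \<oplus>\<^bsub>free_gr m\<^esub> v \<in> carrier (free_gr m)"
    unfolding free_gr_add using uc vc by (intro free_gr_restrict) auto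
  show "u \<oplus>\<^bsub>free_gr m\<^esub> v = v \<oplus>\<^bsub>free_gr m\<^esub> u"
    unfolding free_gr_add using uc vc by (intro restrict_ext) (auto simp: reg.go.G.a_comm)
  fix w assume w: "w \<in> carrier (free_gr m)"
  note wc = free_gr_coord[OF w]
  show "u \<oplus>\<^bsub>free_gr m\<^esub> v \<oplus>\<^bsub>free_gr m\<^esub> w = u \<oplus>\<^bsub>free_gr m\<^esub> (v \<oplus>\<^bsub>free_gr m\<^esub> w)"
    unfolding free_gr_add using uc vc wc by (intro restrict_ext) (auto simp: reg.go.G.a_assoc)
qed

lemma free_gr_exponent: "exponent_p_group (free_gr m) p"
proof (intro exponent_p_group.intro exponent_p_group_axioms.intro free_gr_abelian_group prime_p)
  interpret G: abelian_group "free_gr m" by (rule free_gr_abelian_group)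
  fix u assume u: "u \<in> carrier (free_gr m)"
  have "([k] \<cdot>\<^bsub>free_gr m\<^esub> u) i = [k] \<cdot>\<^bsub>reg.gr\<^esub> u i" if i: "i < m" for k :: nat and i
    by (induction k) (use i in \<open>simp_all add: free_gr_zero free_gr_add\<close>)
  then show "[p] \<cdot>\<^bsub>free_gr m\<^esub> u = \<zero>\<^bsub>free_gr m\<^esub>"
    using u reg.go.G.exponent free_gr_coord[OF u] G.zero_closed
    by (intro free_gr_eqI) (auto simp: free_gr_zero)
qed

definition free_x where "free_x m a u = (\<lambda>i\<in>{..<m}. reg.gr_x a (u i))"
definition free_F where "free_F m a u = (\<lambda>i\<in>{..<m}. reg.gr_F a (u i))"

lemma free_x_smult: "free_x m a u = reg.word_symbol (monomial_word n a) \<odot>\<^bsub>free_gr m\<^esub> u"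
  by (simp add: free_x_def free_gr_smult reg.gr_x_def)

lemma free_F_smult: "free_F m a u = reg.word_symbol (monomial_word n a @ [Frob]) \<odot>\<^bsub>free_gr m\<^esub> u"
  by (simp add: free_F_def free_gr_smult reg.gr_F_def)

lemma free_F_vanish:
  "b \<in> exponents n \<Longrightarrow> b \<notin> digits \<Longrightarrow> u \<in> carrier (free_gr m) \<Longrightarrow> free_F m b u = \<zero>\<^bsub>free_gr m\<^esub>"
  unfolding free_F_def free_gr_zero using reg.gr_F_vanish free_gr_coord by (intro restrict_ext) auto

lemma free_operators: "frobenius_operators p n (free_gr m) (free_x m) (free_F m)"
proof (intro frobenius_operators.intro frobenius_operators_axioms.intro frobenius_axioms free_gr_exponent)
  fix a u assume a: "a \<in> exponents n" and u: "u \<in> carrier (free_gr m)"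
  note uc = free_gr_coord[OF u]
  show "free_x m a u \<in> carrier (free_gr m)" "free_F m a u \<in> carrier (free_gr m)"
    unfolding free_x_def free_F_def
    using reg.go.xa_closed[OF a] reg.go.Fa_closed[OF a] uc by (auto intro: free_gr_restrict)
  fix v assume v: "v \<in> carrier (free_gr m)"
  note vc = free_gr_coord[OF v]
  show "free_x m a (u \<oplus>\<^bsub>free_gr m\<^esub> v) = free_x m a u \<oplus>\<^bsub>free_gr m\<^esub> free_x m a v"
    unfolding free_gr_add free_x_def
    using reg.go.xa_add[OF a] uc vc by (intro restrict_ext) auto
  show "free_F m a (u \<oplus>\<^bsub>free_gr m\<^esub> v) = free_F m a u \<oplus>\<^bsub>free_gr m\<^esub> free_F m a v"
    unfolding free_gr_add free_F_def
    using reg.go.Fa_add[OF a] uc vc by (intro restrict_ext) auto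
next
  fix a b u assume ab: "a \<in> exponents n" "b \<in> exponents n" and u: "u \<in> carrier (free_gr m)"
  note uc = free_gr_coord[OF u]
  show "free_x m (a + b) u = free_x m a (free_x m b u)"
    unfolding free_x_def using reg.go.xa_comp[OF ab] uc by (intro restrict_ext) auto
  show "free_x m a (free_F m b u) = free_F m (a + b) u"
    unfolding free_x_def free_F_def using reg.go.xa_Fa[OF ab] uc by (intro restrict_ext) auto
next
  fix u assume u: "u \<in> carrier (free_gr m)"
  have "free_x m 0 u \<in> carrier (free_gr m)"
    unfolding free_x_def by (intro free_gr_restrict reg.go.xa_closed[OF exponents_zero] free_gr_coord[OF u])
  then show u0: "free_x m 0 u = u"
    by (rule free_gr_eqI[OF _ u]) (use free_gr_coord[OF u] reg.go.xa_0 in \<open>simp add: free_x_def\<close>)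
  fix b assume b: "b \<in> exponents n"
  show "free_F m b u = \<zero>\<^bsub>free_gr m\<^esub> \<or> (\<exists>d\<in>digits. \<exists>c\<in>exponents n. free_F m b u = free_F m d (free_x m c u))"
  proof (cases "b \<in> digits")
    case True
    then show ?thesis using u0 exponents_zero by (intro disjI2 bexI[of _ b] bexI[of _ 0]) simp_all
  next
    case False
    then show ?thesis using free_F_vanish[OF b _ u] by blast
  qed
qed

lemma free_Psi_inj:
  assumes u: "u \<in> digits \<rightarrow> carrier (free_gr m)"
    and z: "frobenius_operators.Psi p n (free_gr m) (free_F m) u = \<zero>\<^bsub>free_gr m\<^esub>" and b: "b \<in> digits"
  shows "u b = \<zero>\<^bsub>free_gr m\<^esub>"
proof -
  interpret fo: frobenius_operators p n "free_gr m" "free_x m" "free_F m" by (rule free_operators)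
  have ub: "u b \<in> carrier (free_gr m)" using u b by auto
  have coord: "(\<Oplus>\<^bsub>free_gr m\<^esub>c\<in>C. free_F m c (u c)) i = (\<Oplus>\<^bsub>reg.gr\<^esub>c\<in>C. reg.gr_F c (u c i))"
    if "C \<subseteq> digits" "i < m" for C i
    using finite_subset[OF that(1) finite_digits] that
  proof (induction C rule: finite_induct)
    case empty then show ?case by (simp add: free_gr_zero)
  next
    case (insert c C)
    have uc: "u d \<in> carrier (free_gr m)" "d \<in> exponents n" if "d \<in> insert c C" for d
      using that insert.prems u fo.digits_exponents by blast+
    have 1: "(\<lambda>d. free_F m d (u d)) \<in> C \<rightarrow> carrier (free_gr m)" "free_F m c (u c) \<in> carrier (free_gr m)"
      using uc fo.Fa_closed by auto
    have "reg.gr_F d (u d i) \<in> carrier reg.gr" if "d \<in> insert c C" for d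
      by (rule reg.go.Fa_closed[OF uc(2)[OF that] free_gr_coord[OF uc(1)[OF that] insert.prems(2)]])
    then have 2: "(\<lambda>d. reg.gr_F d (u d i)) \<in> C \<rightarrow> carrier reg.gr" "reg.gr_F c (u c i) \<in> carrier reg.gr"
      by auto
    show ?case
      using insert 1 2 by (simp add: free_gr_add) (simp add: free_F_def)
  qed
  show ?thesis
  proof (rule free_gr_eqI[OF ub fo.G.zero_closed])
    fix i assume i: "i < m"
    have "reg.go.Psi (\<lambda>c. u c i) = \<zero>\<^bsub>reg.gr\<^esub>"
      using coord[OF order_refl i] z i unfolding fo.Psi_def reg.go.Psi_def by (simp add: free_gr_zero)
    moreover have "(\<lambda>c. u c i) \<in> digits \<rightarrow> carrier reg.gr"
      using u free_gr_coord i by (auto simp: Pi_iff)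
    ultimately have "u b i = \<zero>\<^bsub>reg.gr\<^esub>" using regular_Psi_inj b by blast
    then show "u b i = \<zero>\<^bsub>free_gr m\<^esub> i" using i by (simp add: free_gr_zero)
  qed
qed

lemma X_word_split:
  assumes "w \<in> lists (letters n)"
  shows "w \<in> lists (X ` {..<n}) \<or> (\<exists>u v. w = u @ Frob # v \<and> u \<in> lists (X ` {..<n}) \<and> v \<in> lists (letters n))"
proof (cases "Frob \<in> set w")
  case True
  then obtain u v where uv: "w = u @ Frob # v" "Frob \<notin> set u" by (meson split_list_first)
  have "x \<in> X ` {..<n}" if "x \<in> set u" for x
  proof -
    have "x \<in> letters n" "x \<noteq> Frob" using that assms uv by auto
    then show ?thesis by (simp add: letters_def)
  qed
  then have "u \<in> lists (X ` {..<n})" by auto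
  moreover have "v \<in> lists (letters n)" using uv assms by simp
  ultimately show ?thesis using uv(1) by blast
next
  case False
  have "x \<in> X ` {..<n}" if "x \<in> set w" for x
  proof -
    have "x \<in> letters n" "x \<noteq> Frob" using that assms False by auto
    then show ?thesis by (simp add: letters_def)
  qed
  then show ?thesis by auto
qed

end

text \<open>A filtered module whose associated graded module is finitely presented.\<close>

locale frobenius_presented = frobenius_graded p n M \<Omega>
  for p n :: nat and M :: "(frob, 'm, 'd) module_scheme" and \<Omega> :: "nat \<Rightarrow> 'm set" +
  assumes presented: "finitely_presented (gr_ring F (bernstein p n)) (gr_module M \<Omega>)"
begin

lemma word_symbol_X:
  assumes "u \<in> lists (X ` {..<n})"
  shows "word_symbol u = word_symbol (monomial_word n (fst (word_value p u)))"
proof (rule word_symbol_eqI)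
  note ul = X_letters[OF assms]
  show "word_value p u = word_value p (monomial_word n (fst (word_value p u)))"
    unfolding word_value_exponents[OF fst_word_value[OF ul]]
    using word_value_X_word[OF assms] by (auto simp: prod_eq_iff)
  show "length u = length (monomial_word n (fst (word_value p u)))"
    using word_value_X_word[OF assms] by (simp add: length_monomial_word)
qed (use X_letters[OF assms] monomial_word_letters in auto)

text \<open>A finite set generating the relations over the associated graded ring generates them over the
  polynomial ring modulo \<open>F K\<close>, because every word is a word in the variables or has the
  form \<open>x\<^sup>a F v\<close>.\<close>

lemma finite_gr_Psi_kernel:
  "finite {v \<in> digits \<rightarrow>\<^sub>E carrier gr. go.Psi v = \<zero>\<^bsub>gr\<^esub>}"
proof -
  obtain m \<phi> where \<phi>: "\<phi> \<in> left_module_hom grF (free_gr m) gr" "\<phi> ` carrier (free_gr m) = carrier gr"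
    and fg: "finitely_generated grF ((free_gr m)\<lparr>carrier := a_kernel (free_gr m) gr \<phi>\<rparr>)"
    using presented unfolding finitely_presented_def by blast
  interpret fo: frobenius_operators p n "free_gr m" "free_x m" "free_F m" by (rule free_operators)
  define K where "K = a_kernel (free_gr m) gr \<phi>"
  have K: "K = {u \<in> carrier (free_gr m). \<phi> u = \<zero>\<^bsub>gr\<^esub>}" unfolding K_def a_kernel_def' ..
  have hom: "\<And>u. u \<in> carrier (free_gr m) \<Longrightarrow> \<phi> u \<in> carrier gr"
    "\<And>u v. u \<in> carrier (free_gr m) \<Longrightarrow> v \<in> carrier (free_gr m) \<Longrightarrow> \<phi> (u \<oplus>\<^bsub>free_gr m\<^esub> v) = \<phi> u \<oplus>\<^bsub>gr\<^esub> \<phi> v"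
    "\<And>c u. c \<in> carrier grF \<Longrightarrow> u \<in> carrier (free_gr m) \<Longrightarrow> \<phi> (c \<odot>\<^bsub>free_gr m\<^esub> u) = c \<odot>\<^bsub>gr\<^esub> \<phi> u"
    using \<phi>(1) by (auto simp: left_module_hom_def)
  have smult_closed: "c \<odot>\<^bsub>free_gr m\<^esub> u \<in> carrier (free_gr m)" if "c \<in> carrier grF" "u \<in> carrier (free_gr m)" for c u
    unfolding free_gr_smult using that reg.fm.N_smult_closed free_gr_coord by (intro free_gr_restrict) blast
  have phi0: "\<phi> \<zero>\<^bsub>free_gr m\<^esub> = \<zero>\<^bsub>gr\<^esub>"
    using hom(2)[of "\<zero>\<^bsub>free_gr m\<^esub>" "\<zero>\<^bsub>free_gr m\<^esub>"] hom(1)[of "\<zero>\<^bsub>free_gr m\<^esub>"]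
    by (metis fo.G.l_zero fo.G.zero_closed go.G.add.r_cancel_one)
  have gr_smult_zero: "c \<odot>\<^bsub>gr\<^esub> \<zero>\<^bsub>gr\<^esub> = \<zero>\<^bsub>gr\<^esub>" if "c \<in> carrier grF" for c
    using fm.N_smult_r_distr[OF that go.G.zero_closed go.G.zero_closed]
      fm.N_smult_closed[OF that go.G.zero_closed]
    by (metis go.G.l_zero go.G.zero_closed go.G.add.r_cancel_one)
  have Kc: "K \<subseteq> carrier (free_gr m)" using K by auto
  have Ksp: "add_span (free_gr m) K \<subseteq> K"
  proof
    fix x assume "x \<in> add_span (free_gr m) K"
    then show "x \<in> K" by induction (auto simp: K phi0 hom)
  qed
  have K_smult: "c \<odot>\<^bsub>free_gr m\<^esub> u \<in> K" if "c \<in> carrier grF" "u \<in> K" for c u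
    using that smult_closed by (auto simp: K hom gr_smult_zero)
  obtain T where T: "finite T" "T \<subseteq> K" "linear_span grF ((free_gr m)\<lparr>carrier := K\<rparr>) T = K"
    using fg unfolding finitely_generated_def K_def[symmetric] by auto
  let ?S = "fo.F_span K \<union> {free_x m a t | a t. a \<in> exponents n \<and> t \<in> T}"
  have K_x: "free_x m a k \<in> K" if "k \<in> K" for a k
    unfolding free_x_smult by (rule K_smult[OF _ that]) (rule reg.word_symbol_closed[OF monomial_word_letters])
  have S: "?S \<subseteq> carrier (free_gr m)"
    using fo.F_span_carrier[OF Kc Ksp K_x] subsetD[OF Kc K_x] T(2) by blast
  have gens: "c \<odot>\<^bsub>free_gr m\<^esub> v \<in> add_span (free_gr m) ?S" if c: "c \<in> carrier grF" and v: "v \<in> T" for c v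
  proof (rule abelian_group.add_span_image[where f = "\<lambda>c. c \<odot>\<^bsub>free_gr m\<^esub> v",
        OF fm.A_abelian_group grF_words[OF c] _ S free_gr_abelian_group])
    have vK: "v \<in> K" "v \<in> carrier (free_gr m)" using v T Kc by auto
    show "word_symbol ` lists (letters n) \<subseteq> carrier grF" using word_symbol_closed by blast
    show "\<zero>\<^bsub>grF\<^esub> \<odot>\<^bsub>free_gr m\<^esub> v = \<zero>\<^bsub>free_gr m\<^esub>"
      unfolding free_gr_smult free_gr_zero using reg.zero_smult free_gr_coord[OF vK(2)]
      by (intro restrict_ext) auto
    show "(c \<oplus>\<^bsub>grF\<^esub> d) \<odot>\<^bsub>free_gr m\<^esub> v = c \<odot>\<^bsub>free_gr m\<^esub> v \<oplus>\<^bsub>free_gr m\<^esub> d \<odot>\<^bsub>free_gr m\<^esub> v"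
      if "c \<in> carrier grF" "d \<in> carrier grF" for c d
      unfolding free_gr_smult free_gr_add
      using that reg.fm.N_smult_l_distr free_gr_coord[OF vK(2)] by (intro restrict_ext) auto
    fix s assume "s \<in> word_symbol ` lists (letters n)"
    then obtain w where w: "w \<in> lists (letters n)" "s = word_symbol w" by blast
    have "s \<odot>\<^bsub>free_gr m\<^esub> v \<in> ?S"
      using X_word_split[OF w(1)]
    proof
      assume x: "w \<in> lists (X ` {..<n})"
      have "s \<odot>\<^bsub>free_gr m\<^esub> v = free_x m (fst (word_value p w)) v"
        unfolding w(2) word_symbol_X[OF x] free_x_smult ..
      then show ?thesis using fst_word_value[OF w(1)] v by blast
    next
      assume "\<exists>u t. w = u @ Frob # t \<and> u \<in> lists (X ` {..<n}) \<and> t \<in> lists (letters n)"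
      then obtain u t where ut: "w = u @ Frob # t" "u \<in> lists (X ` {..<n})" "t \<in> lists (letters n)" by blast
      let ?a = "fst (word_value p u)"
      have a: "?a \<in> exponents n" by (rule fst_word_value[OF X_letters[OF ut(2)]])
      have s: "s = word_symbol ((monomial_word n ?a @ [Frob]) @ t)"
        unfolding w(2)
      proof (rule word_symbol_eqI[OF w(1)])
        show "(monomial_word n ?a @ [Frob]) @ t \<in> lists (letters n)" using xF_letters[of ?a] ut by auto
        show "word_value p w = word_value p ((monomial_word n ?a @ [Frob]) @ t)"
          unfolding ut(1) using word_value_X_word[OF ut(2)]
          by (simp add: word_value_append word_value_exponents[OF a] prod_eq_iff)
        show "length w = length ((monomial_word n ?a @ [Frob]) @ t)"
          unfolding ut(1) using word_value_X_word[OF ut(2)] by (simp add: length_monomial_word)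
      qed
      have "s \<odot>\<^bsub>free_gr m\<^esub> v = free_F m ?a (word_symbol t \<odot>\<^bsub>free_gr m\<^esub> v)"
        unfolding s free_F_smult unfolding free_gr_smult
        using reg.word_symbol_append[OF xF_letters ut(3)] free_gr_coord[OF vK(2)]
        by (intro restrict_ext) auto
      moreover have "word_symbol t \<odot>\<^bsub>free_gr m\<^esub> v \<in> K"
        by (rule K_smult[OF word_symbol_closed[OF ut(3)] vK(1)])
      moreover have "free_F m ?a k \<in> fo.F_span K" if "k \<in> K" for k
        unfolding fo.F_span_def using a that
        by (intro fo.G.add_span_base[OF _ fo.F_span_gen[OF Kc Ksp K_x]]) blast+
      ultimately show ?thesis by auto
    qed
    then show "s \<odot>\<^bsub>free_gr m\<^esub> v \<in> add_span (free_gr m) ?S" by (rule fo.G.add_span_base[OF _ S])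
  qed
  have KG: "abelian_group ((free_gr m)\<lparr>carrier := K\<rparr>)"
  proof (rule abelian_groupI)
    fix x assume x: "x \<in> carrier ((free_gr m)\<lparr>carrier := K\<rparr>)"
    have "\<ominus>\<^bsub>free_gr m\<^esub> x \<in> K"
      using x Ksp fo.G.add_span_neg[OF fo.G.add_span_base[OF _ Kc] Kc, of x] by auto
    then show "\<exists>y\<in>carrier ((free_gr m)\<lparr>carrier := K\<rparr>). y \<oplus>\<^bsub>(free_gr m)\<lparr>carrier := K\<rparr>\<^esub> x = \<zero>\<^bsub>(free_gr m)\<lparr>carrier := K\<rparr>\<^esub>"
      using x Kc by (intro bexI[of _ "\<ominus>\<^bsub>free_gr m\<^esub> x"]) (auto simp: fo.G.l_neg)
    show "\<zero>\<^bsub>(free_gr m)\<lparr>carrier := K\<rparr>\<^esub> \<oplus>\<^bsub>(free_gr m)\<lparr>carrier := K\<rparr>\<^esub> x = x" using x Kc by auto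
  qed (use fo.K_add[OF Kc Ksp K_x] fo.K_zero[OF Kc Ksp K_x] Kc in \<open>auto simp: fo.G.a_ac subset_iff\<close>)
  have gen: "K \<subseteq> add_span (free_gr m) ?S"
  proof
    fix k assume "k \<in> K"
    then have "k \<in> linear_span grF ((free_gr m)\<lparr>carrier := K\<rparr>) T" using T(3) by simp
    then obtain T' c where T': "finite T'" "T' \<subseteq> T" "c \<in> T' \<rightarrow> carrier grF"
      "k = (\<Oplus>\<^bsub>(free_gr m)\<lparr>carrier := K\<rparr>\<^esub>v\<in>T'. c v \<odot>\<^bsub>(free_gr m)\<lparr>carrier := K\<rparr>\<^esub> v)"
      unfolding linear_span_def by blast
    let ?C = "{c \<odot>\<^bsub>free_gr m\<^esub> v | c v. c \<in> carrier grF \<and> v \<in> T}"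
    have C: "?C \<subseteq> K" using K_smult T(2) by blast
    have "k \<in> add_span ((free_gr m)\<lparr>carrier := K\<rparr>) ?C"
      unfolding T'(4)
    proof (rule add_span_finsum[OF KG _ T'(1)])
      show "?C \<subseteq> carrier ((free_gr m)\<lparr>carrier := K\<rparr>)" using C by simp
      fix v assume v: "v \<in> T'"
      then have "c v \<odot>\<^bsub>free_gr m\<^esub> v \<in> ?C" using T'(2,3) by blast
      then show "c v \<odot>\<^bsub>(free_gr m)\<lparr>carrier := K\<rparr>\<^esub> v \<in> add_span ((free_gr m)\<lparr>carrier := K\<rparr>) ?C"
        using C by (intro abelian_group.add_span_base[OF KG]) simp_all
    qed
    then have "k \<in> add_span (free_gr m) ?C" using add_span_cong[of "(free_gr m)\<lparr>carrier := K\<rparr>" "free_gr m" ?C] by simp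
    moreover have "?C \<subseteq> add_span (free_gr m) ?S" using gens by blast
    ultimately show "k \<in> add_span (free_gr m) ?S" by (rule fo.G.add_span_subset[OF _ _ S])
  qed
  show ?thesis
  proof (rule finite_Psi_kernel[where \<phi> = \<phi> and K = K and T = T, OF free_operators gr_operators])
    show "\<phi> u \<in> carrier gr" if "u \<in> carrier (free_gr m)" for u by (rule hom(1)[OF that])
    show "\<phi> (u \<oplus>\<^bsub>free_gr m\<^esub> v) = \<phi> u \<oplus>\<^bsub>gr\<^esub> \<phi> v"
      if "u \<in> carrier (free_gr m)" "v \<in> carrier (free_gr m)" for u v by (rule hom(2)[OF that])
    show "K = {u \<in> carrier (free_gr m). \<phi> u = \<zero>\<^bsub>gr\<^esub>}" by (rule K)
    show "free_F m b u = \<zero>\<^bsub>free_gr m\<^esub>" if "b \<in> exponents n" "b \<notin> digits" "u \<in> carrier (free_gr m)" for b u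
      by (rule free_F_vanish[OF that])
    show "u b = \<zero>\<^bsub>free_gr m\<^esub>" if "u \<in> digits \<rightarrow> carrier (free_gr m)"
      "fo.Psi u = \<zero>\<^bsub>free_gr m\<^esub>" "b \<in> digits" for u b by (rule free_Psi_inj[OF that])
    show "finite T" "T \<subseteq> K" by (rule T)+
    show "K \<subseteq> add_span (free_gr m) ?S" by (rule gen)
    show "carrier gr \<subseteq> \<phi> ` carrier (free_gr m)" using \<phi>(2) by simp
    fix a u assume u: "u \<in> carrier (free_gr m)"
    show "\<phi> (free_x m a u) = gr_x a (\<phi> u)"
      unfolding free_x_smult gr_x_def using u by (intro hom(3) word_symbol_closed monomial_word_letters)
    show "\<phi> (free_F m a u) = gr_F a (\<phi> u)"
      unfolding free_F_smult gr_F_def using u by (intro hom(3) word_symbol_closed xF_letters)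
  qed
qed

text \<open>The filtered form of the finiteness of \<open>Tor\<^sub>1\<close>: above some degree, a sum \<open>\<Sum> x\<^sup>b F y\<^sub>b\<close> lies in a
  lower step of the filtration only if its terms do.\<close>

lemma strictness:
  "\<exists>D. \<forall>i\<ge>D. \<forall>y. (\<forall>b\<in>digits. y b \<in> below M \<Omega> (i - total_degree n b)) \<longrightarrow>
      (\<Oplus>\<^bsub>M\<^esub>b\<in>digits. xF b \<odot>\<^bsub>M\<^esub> y b) \<in> below M \<Omega> i \<longrightarrow>
      (\<forall>b\<in>digits. y b \<in> below M \<Omega> (i - Suc (total_degree n b)))"
proof -
  let ?Z = "{v \<in> digits \<rightarrow>\<^sub>E carrier gr. go.Psi v = \<zero>\<^bsub>gr\<^esub>}"
  let ?J = "\<Union>v\<in>?Z. \<Union>b\<in>digits. {i. v b i \<noteq> \<zero>\<^bsub>gr_piece M \<Omega> i\<^esub>}"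
  have "finite ?J"
  proof (intro finite_UN_I finite_gr_Psi_kernel finite_digits)
    fix v b assume "v \<in> ?Z" "b \<in> digits"
    then have "v b \<in> carrier gr" by auto
    then show "finite {i. v b i \<noteq> \<zero>\<^bsub>gr_piece M \<Omega> i\<^esub>}" unfolding fm.N_carrier by blast
  qed
  then obtain D0 where D0: "\<forall>j\<in>?J. j < D0" using finite_nat_set_iff_bounded by blast
  have dg: "total_degree n b \<le> n * p" if "b \<in> digits" for b
  proof -
    have "(\<Sum>i<n. b i) \<le> (\<Sum>i<n. p)" using that by (intro sum_mono) (simp add: digits_def less_imp_le)
    then show ?thesis by (simp add: total_degree_def)
  qed
  have zO: "\<zero>\<^bsub>M\<^esub> \<in> \<Omega> k" for k by (rule additive_subgroup.zero_closed[OF fm.Omega_subgroup])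
  show ?thesis
  proof (intro exI[of _ "D0 + Suc (n * p)"] allI impI ballI)
    fix i y b
    assume i: "D0 + Suc (n * p) \<le> i"
      and y: "\<forall>b\<in>digits. y b \<in> below M \<Omega> (i - total_degree n b)"
      and sum: "(\<Oplus>\<^bsub>M\<^esub>b\<in>digits. xF b \<odot>\<^bsub>M\<^esub> y b) \<in> below M \<Omega> i" and b: "b \<in> digits"
    have lt: "total_degree n d < i" if "d \<in> digits" for d using dg[OF that] i by simp
    have yO: "y d \<in> \<Omega> (i - Suc (total_degree n d))" if d: "d \<in> digits" for d
    proof -
      have "i - total_degree n d = Suc (i - Suc (total_degree n d))" using lt[OF d] by simp
      then show ?thesis using bspec[OF y d] by (simp add: below_def)
    qed
    \<comment> \<open>The symbols of the \<open>y d\<close> form an element of the kernel of \<open>Psi\<close> on the graded module;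
        it lives in degrees beyond all nonzero kernel elements, so it is zero.\<close>
    define v where "v = (\<lambda>d\<in>digits. fm.component (i - Suc (total_degree n d)) (y d))"
    have v: "v \<in> digits \<rightarrow>\<^sub>E carrier gr" using fm.component_closed[OF yO] by (auto simp: v_def)
    then have v': "v \<in> digits \<rightarrow> carrier gr" by auto
    have "go.Psi v k = \<zero>\<^bsub>gr\<^esub> k" for k
    proof (cases "k = i")
      case True
      have "go.Psi v i = fm.coset i (\<Oplus>\<^bsub>M\<^esub>b\<in>digits. xF b \<odot>\<^bsub>M\<^esub> y b)"
      proof (rule gr_Psi_component[OF v'])
        fix d assume d: "d \<in> digits"
        show "y d \<in> \<Omega> (i - Suc (total_degree n d)) \<and>
          v d (i - Suc (total_degree n d)) = fm.coset (i - Suc (total_degree n d)) (y d)"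
          using yO[OF d] d by (simp add: v_def fm.component_def)
      next
        fix d assume "d \<in> digits" "i \<le> total_degree n d"
        then show "y d = \<zero>\<^bsub>M\<^esub>" using lt by fastforce
      qed
      also have "(\<Oplus>\<^bsub>M\<^esub>b\<in>digits. xF b \<odot>\<^bsub>M\<^esub> y b) \<in> carrier M"
        using fm.smult_closed[OF xF_closed fm.Omega_closed[OF yO]] by (intro fm.M.finsum_closed) auto
      then have "fm.coset i (\<Oplus>\<^bsub>M\<^esub>b\<in>digits. xF b \<odot>\<^bsub>M\<^esub> y b) = \<zero>\<^bsub>gr_piece M \<Omega> i\<^esub>"
        using sum fm.coset_zero_iff by blast
      finally show ?thesis using True by (simp add: fm.N_zero)
    next
      case False
      have "go.Psi v k = fm.coset k (\<Oplus>\<^bsub>M\<^esub>b\<in>digits. xF b \<odot>\<^bsub>M\<^esub> \<zero>\<^bsub>M\<^esub>)"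
      proof (rule gr_Psi_component[OF v'])
        fix d assume d: "d \<in> digits" "total_degree n d < k"
        then have "k - Suc (total_degree n d) \<noteq> i - Suc (total_degree n d)" using False lt[OF d(1)] by auto
        then show "\<zero>\<^bsub>M\<^esub> \<in> \<Omega> (k - Suc (total_degree n d)) \<and>
          v d (k - Suc (total_degree n d)) = fm.coset (k - Suc (total_degree n d)) \<zero>\<^bsub>M\<^esub>"
          using d zO by (simp add: v_def fm.component_def fm.piece_zero)
      qed simp
      also have "(\<Oplus>\<^bsub>M\<^esub>b\<in>digits. xF b \<odot>\<^bsub>M\<^esub> \<zero>\<^bsub>M\<^esub>) = (\<Oplus>\<^bsub>M\<^esub>b\<in>digits. \<zero>\<^bsub>M\<^esub>)"
        using fm.smult_zero_right[OF xF_closed] by (intro fm.M.finsum_cong') auto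
      finally show ?thesis by (simp add: fm.N_zero fm.piece_zero)
    qed
    then have "go.Psi v = \<zero>\<^bsub>gr\<^esub>" by (rule ext)
    then have vZ: "v \<in> ?Z" using v by blast
    let ?j = "i - Suc (total_degree n b)"
    have "?j \<ge> D0" using dg[OF b] i by simp
    then have "?j \<notin> ?J" using D0 by (meson linorder_not_less)
    then have "v b ?j = \<zero>\<^bsub>gr_piece M \<Omega> ?j\<^esub>" using vZ b by blast
    then have "fm.coset ?j (y b) = \<zero>\<^bsub>gr_piece M \<Omega> ?j\<^esub>" using b by (simp add: v_def fm.component_def)
    then show "y b \<in> below M \<Omega> ?j" using fm.coset_zero_iff fm.Omega_closed[OF yO[OF b]] by blast
  qed
qed

text \<open>The filtration is generated by one of its steps.\<close>

lemma filtration_generated: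
  "\<exists>k0. \<forall>d. \<Omega> (k0 + d) \<subseteq>
    add_span M {frob_word p n w \<odot>\<^bsub>M\<^esub> t | w t. w \<in> lists (letters n) \<and> length w \<le> d \<and> t \<in> \<Omega> k0}"
proof -
  obtain m \<phi> where \<phi>: "\<phi> \<in> left_module_hom grF (free_gr m) gr" "\<phi> ` carrier (free_gr m) = carrier gr"
    using presented unfolding finitely_presented_def by blast
  interpret G: abelian_group "free_gr m" by (rule free_gr_abelian_group)
  have hom: "\<And>u. u \<in> carrier (free_gr m) \<Longrightarrow> \<phi> u \<in> carrier gr"
    "\<And>u v. u \<in> carrier (free_gr m) \<Longrightarrow> v \<in> carrier (free_gr m) \<Longrightarrow> \<phi> (u \<oplus>\<^bsub>free_gr m\<^esub> v) = \<phi> u \<oplus>\<^bsub>gr\<^esub> \<phi> v"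
    "\<And>c u. c \<in> carrier grF \<Longrightarrow> u \<in> carrier (free_gr m) \<Longrightarrow> \<phi> (c \<odot>\<^bsub>free_gr m\<^esub> u) = c \<odot>\<^bsub>gr\<^esub> \<phi> u"
    using \<phi>(1) by (auto simp: left_module_hom_def)
  have phi0: "\<phi> \<zero>\<^bsub>free_gr m\<^esub> = \<zero>\<^bsub>gr\<^esub>"
    using hom(2)[of "\<zero>\<^bsub>free_gr m\<^esub>" "\<zero>\<^bsub>free_gr m\<^esub>"] hom(1)[of "\<zero>\<^bsub>free_gr m\<^esub>"]
    by (metis G.l_zero G.zero_closed go.G.add.r_cancel_one)
  define e where "e = (\<lambda>s. \<lambda>i\<in>{..<m}. if i = s then \<one>\<^bsub>grF\<^esub> else \<zero>\<^bsub>reg.gr\<^esub>)"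
  have e: "e s \<in> carrier (free_gr m)" for s
    unfolding e_def using fm.symbol_closed[OF fm.B_one]
    by (intro free_gr_restrict) (auto simp: fm.one_symbol gr_ring_simps)
  \<comment> \<open>Only finitely many degrees occur in the images of the free generators.\<close>
  have "finite (\<Union>s\<in>{..<m}. {l. \<phi> (e s) l \<noteq> \<zero>\<^bsub>gr_piece M \<Omega> l\<^esub>})"
    using hom(1)[OF e] by (intro finite_UN_I) (auto simp: fm.N_carrier)
  then obtain k0 where "\<forall>l\<in>(\<Union>s\<in>{..<m}. {l. \<phi> (e s) l \<noteq> \<zero>\<^bsub>gr_piece M \<Omega> l\<^esub>}). l < k0"
    using finite_nat_set_iff_bounded by blast
  then have k0: "\<phi> (e s) l = \<zero>\<^bsub>gr_piece M \<Omega> l\<^esub>" if "s < m" "k0 < l" for s l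
    using that by force
  define Y0 where "Y0 = (\<lambda>d. {frob_word p n w \<odot>\<^bsub>M\<^esub> t | w t. w \<in> lists (letters n) \<and> length w \<le> d \<and> t \<in> \<Omega> k0})"
  have Y0: "Y0 d \<subseteq> carrier M" for d
    unfolding Y0_def using frob_word_closed fm.Omega_closed fm.smult_closed by blast
  have Y0_mono: "Y0 d \<subseteq> Y0 (Suc d)" for d unfolding Y0_def by fastforce
  have Omega_mono: "\<Omega> i \<subseteq> \<Omega> j" if "i \<le> j" for i j
    using lift_Suc_mono_le[of \<Omega>, OF fm.Omega_Suc that] .
  have words: "r \<odot>\<^bsub>M\<^esub> z \<in> add_span M (Y0 d)"
    if r: "r \<in> bernstein p n i" and z: "z \<in> \<Omega> j" and ij: "i + j = k0 + d" "j \<le> k0" for r z i j d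
  proof (rule F.add_span_image[where f = "\<lambda>r. r \<odot>\<^bsub>M\<^esub> z",
        OF r[unfolded bernstein_eq_word_span word_span_def] word_span_gen Y0 fm.M.abelian_group_axioms])
    have zc: "z \<in> carrier M" by (rule fm.Omega_closed[OF z])
    show "\<zero>\<^bsub>F\<^esub> \<odot>\<^bsub>M\<^esub> z = \<zero>\<^bsub>M\<^esub>" by (rule fm.smult_zero_left[OF zc])
    show "(x \<oplus>\<^bsub>F\<^esub> y) \<odot>\<^bsub>M\<^esub> z = x \<odot>\<^bsub>M\<^esub> z \<oplus>\<^bsub>M\<^esub> y \<odot>\<^bsub>M\<^esub> z" if "x \<in> carrier F" "y \<in> carrier F" for x y
      by (rule fm.smult_l_distr[OF that zc])
    fix s assume "s \<in> frob_word p n ` {w \<in> lists (letters n). length w < Suc i}"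
    then obtain w where w: "w \<in> lists (letters n)" "length w \<le> i" "s = frob_word p n w"
      using less_Suc_eq_le by blast
    \<comment> \<open>The last letters of \<open>w\<close> are absorbed into the step \<open>k0\<close>.\<close>
    let ?u = "take d w" and ?v = "drop d w"
    have uv: "?u \<in> lists (letters n)" "?v \<in> lists (letters n)"
      using w(1) by (auto dest: in_set_takeD in_set_dropD)
    have "frob_word p n ?v \<odot>\<^bsub>M\<^esub> z \<in> \<Omega> (length ?v + j)" by (rule fm.B_smult[OF word_bernstein[OF uv(2)] z])
    moreover have "length ?v + j \<le> k0" using w(2) ij by simp
    ultimately have t: "frob_word p n ?v \<odot>\<^bsub>M\<^esub> z \<in> \<Omega> k0" using Omega_mono by blast
    have "s \<odot>\<^bsub>M\<^esub> z = frob_word p n ?u \<odot>\<^bsub>M\<^esub> (frob_word p n ?v \<odot>\<^bsub>M\<^esub> z)"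
      using fm.smult_assoc1[OF frob_word_closed[OF uv(1)] frob_word_closed[OF uv(2)] zc]
        frob_word_append[OF uv] w(3) by simp
    then have "s \<odot>\<^bsub>M\<^esub> z \<in> Y0 d" unfolding Y0_def using uv(1) t by fastforce
    then show "s \<odot>\<^bsub>M\<^esub> z \<in> add_span M (Y0 d)" by (rule fm.M.add_span_base[OF _ Y0])
  qed
  have Ycl: "x \<in> carrier M" if "x \<in> add_span M (Y0 d)" for x d
    by (rule fm.M.add_span_closed[OF that Y0])
  have homog: "\<exists>y\<in>add_span M (Y0 d). (\<alpha> \<odot>\<^bsub>gr\<^esub> \<phi> (e s)) (k0 + d) = fm.coset (k0 + d) y"
    if \<alpha>: "\<alpha> \<in> carrier grF" and s: "s < m" for \<alpha> s d
  proof -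
    have nu: "\<phi> (e s) \<in> carrier gr" by (rule hom(1)[OF e])
    let ?k = "k0 + d"
    have sub: "{symbol F (bernstein p n) i r | i r. r \<in> bernstein p n i} \<subseteq> carrier grF"
      using fm.symbol_closed by blast
    interpret AA: abelian_group grF by (rule fm.A_abelian_group)
    show ?thesis using fm.A_generated[OF \<alpha>]
    proof induction
      case zero
      show ?case using zero_smult[OF nu] fm.piece_zero
        by (intro bexI[of _ "\<zero>\<^bsub>M\<^esub>"]) (simp_all add: fm.N_zero add_span.zero)
    next
      case (add \<beta> \<sigma>)
      have bc: "\<beta> \<in> carrier grF" "\<sigma> \<in> carrier grF" using AA.add_span_closed[OF add(1) sub] add(2) sub by auto
      obtain y where y: "y \<in> add_span M (Y0 d)" "(\<beta> \<odot>\<^bsub>gr\<^esub> \<phi> (e s)) ?k = fm.coset ?k y"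
        using add.IH by blast
      obtain i r where ir: "r \<in> bernstein p n i" "\<sigma> = symbol F (bernstein p n) i r" using add(2) by blast
      have "\<exists>y'\<in>add_span M (Y0 d). (\<sigma> \<odot>\<^bsub>gr\<^esub> \<phi> (e s)) ?k = fm.coset ?k y'"
      proof (cases "i \<le> ?k \<and> ?k - i \<le> k0")
        case True
        obtain z where z: "z \<in> \<Omega> (?k - i)" "\<phi> (e s) (?k - i) = fm.coset (?k - i) z"
          using nu unfolding fm.N_carrier fm.piece_carrier by blast
        have "(\<sigma> \<odot>\<^bsub>gr\<^esub> \<phi> (e s)) ?k = fm.coset ?k (r \<odot>\<^bsub>M\<^esub> z)"
          unfolding ir(2) fm.symbol_smult[OF ir(1) nu] using True z fm.gr_coset_smult_le[of i ?k r z] ir(1) by simp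
        moreover have "r \<odot>\<^bsub>M\<^esub> z \<in> add_span M (Y0 d)" using True by (intro words[OF ir(1) z(1)]) auto
        ultimately show ?thesis by blast
      next
        case False
        have "(\<sigma> \<odot>\<^bsub>gr\<^esub> \<phi> (e s)) ?k = \<zero>\<^bsub>gr_piece M \<Omega> ?k\<^esub>"
        proof (cases "i \<le> ?k")
          case True
          then have "\<phi> (e s) (?k - i) = \<zero>\<^bsub>gr_piece M \<Omega> (?k - i)\<^esub>" using False by (intro k0[OF s]) auto
          then show ?thesis
            using fm.term_zero[OF fm.symbol_closed[OF ir(1)] nu True] True
            by (simp add: ir(2) fm.symbol_smult[OF ir(1) nu] fm.symbol_diag)
        qed (simp add: ir(2) fm.symbol_smult[OF ir(1) nu])
        then show ?thesis using add_span.zero fm.piece_zero by metis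
      qed
      then obtain y' where y': "y' \<in> add_span M (Y0 d)" "(\<sigma> \<odot>\<^bsub>gr\<^esub> \<phi> (e s)) ?k = fm.coset ?k y'" by blast
      have "((\<beta> \<oplus>\<^bsub>grF\<^esub> \<sigma>) \<odot>\<^bsub>gr\<^esub> \<phi> (e s)) ?k = fm.coset ?k (y \<oplus>\<^bsub>M\<^esub> y')"
        unfolding fm.N_smult_l_distr[OF bc nu] fm.N_add y(2) y'(2) by (rule fm.coset_add[OF Ycl[OF y(1)] Ycl[OF y'(1)]])
      moreover have "y \<oplus>\<^bsub>M\<^esub> y' \<in> add_span M (Y0 d)" by (rule fm.M.add_span_plus[OF y'(1) y(1) Y0])
      ultimately show ?case by blast
    qed
  qed
  have one: "\<alpha> \<odot>\<^bsub>reg.gr\<^esub> \<one>\<^bsub>grF\<^esub> = \<alpha>" if \<alpha>: "\<alpha> \<in> carrier grF" for \<alpha>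
  proof -
    have comp: "reg.fm.component d r = symbol F (bernstein p n) d r" for d r
      by (auto simp: reg.fm.component_def symbol_def gr_piece_def fun_eq_iff)
    have 1: "\<one>\<^bsub>grF\<^esub> = reg.fm.component 0 \<one>\<^bsub>F\<^esub>" by (simp add: comp fm.one_symbol)
    have 1: "\<one>\<^bsub>grF\<^esub> = reg.fm.component 0 \<one>\<^bsub>F\<^esub>" "\<one>\<^bsub>grF\<^esub> \<in> carrier reg.gr"
      unfolding 1 using reg.fm.component_closed[OF fm.B_one] by auto
    have sub: "{symbol F (bernstein p n) i r | i r. r \<in> bernstein p n i} \<subseteq> carrier grF"
      using fm.symbol_closed by blast
    interpret AA: abelian_group grF by (rule fm.A_abelian_group)
    show ?thesis using fm.A_generated[OF \<alpha>]
    proof induction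
      case zero then show ?case using reg.zero_smult[OF 1(2)] by (simp add: gr_ring_simps)
    next
      case (add \<beta> \<sigma>)
      have bc: "\<beta> \<in> carrier grF" "\<sigma> \<in> carrier grF" using AA.add_span_closed[OF add(1) sub] add(2) sub by auto
      obtain i r where ir: "r \<in> bernstein p n i" "\<sigma> = symbol F (bernstein p n) i r" using add(2) by blast
      have "\<sigma> \<odot>\<^bsub>reg.gr\<^esub> \<one>\<^bsub>grF\<^esub> = \<sigma>"
        unfolding 1(1) ir(2) reg.fm.symbol_component[OF ir(1) fm.B_one]
        using fm.B_closed[OF ir(1)] by (simp add: comp)
      then show ?case
        using reg.fm.N_smult_l_distr[OF bc 1(2)] add.IH by (simp add: gr_ring_simps)
    qed
  qed
  have gens: "u \<in> add_span (free_gr m) {\<alpha> \<odot>\<^bsub>free_gr m\<^esub> e s | \<alpha> s. \<alpha> \<in> carrier grF \<and> s < m}"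
    if u: "u \<in> carrier (free_gr m)" for u
  proof -
    let ?S = "{\<alpha> \<odot>\<^bsub>free_gr m\<^esub> e s | \<alpha> s. \<alpha> \<in> carrier grF \<and> s < m}"
    note uc = free_gr_coord[OF u]
    have "(\<lambda>i\<in>{..<m}. if i < k then u i else \<zero>\<^bsub>reg.gr\<^esub>) \<in> add_span (free_gr m) ?S" if "k \<le> m" for k
      using that
    proof (induction k)
      case 0
      have "(\<lambda>i\<in>{..<m}. if i < 0 then u i else \<zero>\<^bsub>reg.gr\<^esub>) = \<zero>\<^bsub>free_gr m\<^esub>" by (simp add: free_gr_zero)
      then show ?case by (simp only: add_span.zero)
    next
      case (Suc k)
      have k: "k < m" using Suc.prems by simp
      have uk: "u k \<in> carrier grF" using uc[OF k] by (simp add: gr_ring_simps)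
      have z: "u k \<odot>\<^bsub>reg.gr\<^esub> \<zero>\<^bsub>reg.gr\<^esub> = \<zero>\<^bsub>reg.gr\<^esub>"
        using reg.fm.N_smult_r_distr[OF uk reg.go.G.zero_closed reg.go.G.zero_closed]
          reg.fm.N_smult_closed[OF uk reg.go.G.zero_closed]
        by (metis reg.go.G.l_zero reg.go.G.zero_closed reg.go.G.add.r_cancel_one)
      have ue: "u k \<odot>\<^bsub>free_gr m\<^esub> e k = (\<lambda>i\<in>{..<m}. if i = k then u k else \<zero>\<^bsub>reg.gr\<^esub>)"
        unfolding free_gr_smult e_def using one[OF uk] z by (intro restrict_ext) simp
      have "(\<lambda>i\<in>{..<m}. if i < Suc k then u i else \<zero>\<^bsub>reg.gr\<^esub>)
        = (\<lambda>i\<in>{..<m}. if i < k then u i else \<zero>\<^bsub>reg.gr\<^esub>) \<oplus>\<^bsub>free_gr m\<^esub> (u k \<odot>\<^bsub>free_gr m\<^esub> e k)"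
        unfolding free_gr_add ue using uc by (intro restrict_ext) (auto simp: less_Suc_eq)
      moreover have "u k \<odot>\<^bsub>free_gr m\<^esub> e k \<in> ?S" using uk k by blast
      ultimately show ?case using Suc.IH k by (simp only: add_span.add less_imp_le)
    qed
    from this[of m] have "(\<lambda>i\<in>{..<m}. if i < m then u i else \<zero>\<^bsub>reg.gr\<^esub>) \<in> add_span (free_gr m) ?S" by simp
    moreover have "(\<lambda>i\<in>{..<m}. if i < m then u i else \<zero>\<^bsub>reg.gr\<^esub>) = u"
      using u uc by (intro free_gr_eqI) (auto intro: free_gr_restrict)
    ultimately show ?thesis by simp
  qed
  have smult_closed: "c \<odot>\<^bsub>free_gr m\<^esub> u \<in> carrier (free_gr m)" if "c \<in> carrier grF" "u \<in> carrier (free_gr m)" for c u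
    unfolding free_gr_smult using that reg.fm.N_smult_closed free_gr_coord by (intro free_gr_restrict) blast
  have comp: "\<exists>y\<in>add_span M (Y0 d). \<phi> u (k0 + d) = fm.coset (k0 + d) y"
    if u: "u \<in> carrier (free_gr m)" for u d
    using gens[OF u]
  proof induction
    case zero
    show ?case using fm.piece_zero
      by (intro bexI[of _ "\<zero>\<^bsub>M\<^esub>"]) (simp_all add: phi0 fm.N_zero add_span.zero)
  next
    case (add v s)
    have sub: "{\<alpha> \<odot>\<^bsub>free_gr m\<^esub> e s | \<alpha> s. \<alpha> \<in> carrier grF \<and> s < m} \<subseteq> carrier (free_gr m)"
      using smult_closed e by blast
    have c: "v \<in> carrier (free_gr m)" "s \<in> carrier (free_gr m)"
      using G.add_span_closed[OF add(1) sub] add(2) sub by auto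
    obtain \<alpha> j where s: "\<alpha> \<in> carrier grF" "j < m" "s = \<alpha> \<odot>\<^bsub>free_gr m\<^esub> e j" using add(2) by blast
    obtain y where y: "y \<in> add_span M (Y0 d)" "\<phi> v (k0 + d) = fm.coset (k0 + d) y" using add.IH by blast
    obtain y' where y': "y' \<in> add_span M (Y0 d)" "\<phi> s (k0 + d) = fm.coset (k0 + d) y'"
      using homog[OF s(1,2)] unfolding s(3) hom(3)[OF s(1) e] by blast
    have "\<phi> (v \<oplus>\<^bsub>free_gr m\<^esub> s) (k0 + d) = fm.coset (k0 + d) (y \<oplus>\<^bsub>M\<^esub> y')"
      unfolding hom(2)[OF c] fm.N_add y(2) y'(2) by (rule fm.coset_add[OF Ycl[OF y(1)] Ycl[OF y'(1)]])
    moreover have "y \<oplus>\<^bsub>M\<^esub> y' \<in> add_span M (Y0 d)" by (rule fm.M.add_span_plus[OF y'(1) y(1) Y0])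
    ultimately show ?case by blast
  qed
  have "x \<in> add_span M (Y0 d)" if "x \<in> \<Omega> (k0 + d)" for d x
    using that
  proof (induction d arbitrary: x)
    case 0
    have "frob_word p n [] \<odot>\<^bsub>M\<^esub> x = x"
      unfolding frob_word_Nil using 0 fm.Omega_closed by (intro fm.smult_one) simp
    then have "x \<in> Y0 0" unfolding Y0_def using 0 by (intro CollectI exI[of _ "[]"] exI[of _ x]) simp
    then show ?case by (rule fm.M.add_span_base[OF _ Y0])
  next
    case (Suc d)
    have xc: "x \<in> carrier M" by (rule fm.Omega_closed[OF Suc.prems])
    have "fm.component (k0 + Suc d) x \<in> \<phi> ` carrier (free_gr m)"
      unfolding \<phi>(2) by (rule fm.component_closed[OF Suc.prems])
    then obtain u where u: "u \<in> carrier (free_gr m)" "\<phi> u = fm.component (k0 + Suc d) x" by auto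
    obtain y where y: "y \<in> add_span M (Y0 (Suc d))" "\<phi> u (k0 + Suc d) = fm.coset (k0 + Suc d) y"
      using comp[OF u(1)] by blast
    have yc: "y \<in> carrier M" by (rule Ycl[OF y(1)])
    have "fm.coset (k0 + Suc d) x = fm.coset (k0 + Suc d) y" using u(2) y(2) by (simp add: fm.component_def)
    then have "x \<ominus>\<^bsub>M\<^esub> y \<in> below M \<Omega> (k0 + Suc d)" using fm.coset_eq_iff[OF xc yc] by blast
    then have "x \<ominus>\<^bsub>M\<^esub> y \<in> \<Omega> (k0 + d)" by (simp add: below_def)
    then have "x \<ominus>\<^bsub>M\<^esub> y \<in> add_span M (Y0 (Suc d))" using Suc.IH add_span_mono[OF _ Y0_mono] by blast
    from fm.M.add_span_plus[OF y(1) this Y0] show ?case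
      using xc yc by (simp add: a_minus_def fm.M.a_assoc fm.M.l_neg)
  qed
  then show ?thesis unfolding Y0_def by blast
qed

end

section \<open>Dimensions and cardinalities\<close>

lemma exponent_p_group_subgroup:
  assumes "exponent_p_group G p" "additive_subgroup H G"
  shows "exponent_p_group (G\<lparr>carrier := H\<rparr>) p"
proof -
  interpret exponent_p_group G p by fact
  interpret H: additive_subgroup H G by fact
  let ?H = "G\<lparr>carrier := H\<rparr>"
  have c: "H \<subseteq> carrier G" by (rule H.a_subset)
  have "abelian_group ?H"
  proof (rule abelian_groupI)
    fix x assume x: "x \<in> carrier ?H"
    then have "\<ominus>\<^bsub>G\<^esub> x \<in> H" by simp
    then show "\<exists>y\<in>carrier ?H. y \<oplus>\<^bsub>?H\<^esub> x = \<zero>\<^bsub>?H\<^esub>"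
      using x c by (intro bexI[of _ "\<ominus>\<^bsub>G\<^esub> x"]) (auto simp: l_neg)
    show "\<zero>\<^bsub>?H\<^esub> \<oplus>\<^bsub>?H\<^esub> x = x" using x c by auto
  qed (use c in \<open>auto simp: a_ac subset_iff\<close>)
  then show ?thesis
  proof (intro exponent_p_group.intro exponent_p_group_axioms.intro prime_p)
    fix x assume "x \<in> carrier ?H"
    then show "[p] \<cdot>\<^bsub>?H\<^esub> x = \<zero>\<^bsub>?H\<^esub>"
      using exponent[of x] c add_pow_cong[of ?H G p x] by auto
  qed
qed

lemma card_fibers:
  assumes "finite S" "\<And>x. x \<in> S \<Longrightarrow> card {y \<in> S. f y = f x} = c"
  shows "card S = c * card (f ` S)"
proof -
  have "card S = (\<Sum>y\<in>f ` S. card {x \<in> S. f x = y})"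
    using sum.image_gen[OF assms(1), of "\<lambda>_. 1::nat" f] by simp
  also have "\<dots> = (\<Sum>y\<in>f ` S. c)" using assms(2) by (intro sum.cong) auto
  finally show ?thesis by simp
qed

context
  fixes V :: "(int, 'b, 'd) module_scheme" and p :: nat
  assumes V: "exponent_p_group V p" and fin: "finite (carrier V)"
    and smult: "\<And>c v. c \<in> carrier (GFp p) \<Longrightarrow> v \<in> carrier V \<Longrightarrow> c \<odot>\<^bsub>V\<^esub> v = [nat c] \<cdot>\<^bsub>V\<^esub> v"
begin

interpretation exponent_p_group V p by (rule V)

lemma GFp_carrier: "carrier (GFp p) = {0..<int p}"
  by (auto simp: residue_ring_def)

lemma GFp_zero: "\<zero>\<^bsub>GFp p\<^esub> = 0"
  by (simp add: residue_ring_def)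

text \<open>A generating set of minimal cardinality is a basis.\<close>

lemma vs_basis_exists: "\<exists>S. vs_basis (GFp p) V S"
proof -
  have ls: "linear_span (GFp p) V S = add_span V S" if "S \<subseteq> carrier V" for S
    by (rule linear_span_prime_field[OF V smult that])
  have "add_span V (carrier V) = carrier V"
    using add_span_closed add_span_base by blast
  then have ex: "\<exists>k. \<exists>S\<subseteq>carrier V. add_span V S = carrier V \<and> card S = k" by blast
  define k where "k = (LEAST k. \<exists>S\<subseteq>carrier V. add_span V S = carrier V \<and> card S = k)"
  obtain S where S: "S \<subseteq> carrier V" "add_span V S = carrier V" "card S = k"
    using LeastI_ex[OF ex] unfolding k_def by blast
  have min: "k \<le> card T" if "T \<subseteq> carrier V" "add_span V T = carrier V" for T
    unfolding k_def by (rule Least_le) (use that in blast)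
  have finS: "finite S" using S(1) fin finite_subset by blast
  have "linearly_independent (GFp p) V S"
    unfolding linearly_independent_def
  proof (intro allI impI ballI)
    fix T c v
    assume a: "finite T \<and> T \<subseteq> S \<and> c \<in> T \<rightarrow> carrier (GFp p) \<and> (\<Oplus>\<^bsub>V\<^esub>v\<in>T. c v \<odot>\<^bsub>V\<^esub> v) = \<zero>\<^bsub>V\<^esub>"
      and v: "v \<in> T"
    have Tc: "T \<subseteq> carrier V" using a S by auto
    have cT: "0 \<le> c u" "c u < int p" "c u \<odot>\<^bsub>V\<^esub> u = [(nat (c u))] \<cdot>\<^bsub>V\<^esub> u" if "u \<in> T" for u
      using a that Tc smult[of "c u" u] by (auto simp: GFp_carrier Pi_iff)
    show "c v = \<zero>\<^bsub>GFp p\<^esub>"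
    proof (rule ccontr)
      assume "c v \<noteq> \<zero>\<^bsub>GFp p\<^esub>"
      then have pos: "0 < nat (c v)" "nat (c v) < p" using cT[OF v] by (auto simp: GFp_zero)
      let ?r = "\<Oplus>\<^bsub>V\<^esub>u\<in>T - {v}. c u \<odot>\<^bsub>V\<^esub> u"
      have Sv: "S - {v} \<subseteq> carrier V" using S by auto
      have r: "?r \<in> add_span V (S - {v})"
      proof (rule add_span_finsum[OF abelian_group_axioms Sv])
        show "finite (T - {v})" using a by simp
        fix u assume u: "u \<in> T - {v}"
        then have "u \<in> add_span V (S - {v})" using a Sv by (intro add_span_base) auto
        then show "c u \<odot>\<^bsub>V\<^esub> u \<in> add_span V (S - {v})"
          using cT(3)[of u] u add_span_multiple[OF _ Sv] by auto
      qed
      then have rc: "?r \<in> carrier V" using add_span_closed Sv by blast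
      have vc: "c v \<odot>\<^bsub>V\<^esub> v \<in> carrier V" using cT(3)[OF v] v Tc by auto
      have "(\<Oplus>\<^bsub>V\<^esub>u\<in>insert v (T - {v}). c u \<odot>\<^bsub>V\<^esub> u) = c v \<odot>\<^bsub>V\<^esub> v \<oplus>\<^bsub>V\<^esub> ?r"
        using a vc cT(3) Tc by (intro finsum_insert) auto
      moreover have "insert v (T - {v}) = T" using v by auto
      ultimately have "c v \<odot>\<^bsub>V\<^esub> v \<oplus>\<^bsub>V\<^esub> ?r = \<zero>\<^bsub>V\<^esub>" using a by simp
      then have "c v \<odot>\<^bsub>V\<^esub> v = \<ominus>\<^bsub>V\<^esub> ?r" using vc rc by (simp add: minus_equality)
      then have "[(nat (c v))] \<cdot>\<^bsub>V\<^esub> v \<in> add_span V (S - {v})"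
        using cT(3)[OF v] add_span_neg[OF r Sv] by simp
      then have vs: "v \<in> add_span V (S - {v})"
        using multiple_in_span_imp[OF _ pos Sv] v Tc by blast
      have "insert v (S - {v}) = S" using v a by auto
      then have "add_span V (S - {v}) = carrier V" using add_span_redundant[OF vs Sv] S(2) by simp
      then have "k \<le> card (S - {v})" using min[OF Sv] by blast
      moreover have "card (S - {v}) < card S" using finS v a by (intro psubset_card_mono) auto
      ultimately show False using S(3) by simp
    qed
  qed
  then show ?thesis using S ls[OF S(1)] unfolding vs_basis_def by blast
qed

lemma card_vs_basis:
  assumes "vs_basis (GFp p) V S" shows "p ^ card S = card (carrier V)"
proof -
  have S: "S \<subseteq> carrier V" "linear_span (GFp p) V S = carrier V" and ind: "linearly_independent (GFp p) V S"
    using assms by (auto simp: vs_basis_def)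
  have finS: "finite S" using S(1) fin finite_subset by blast
  have "card (add_span V T) = p ^ card T" if "T \<subseteq> S" for T
    using finite_subset[OF that finS] that
  proof (induction T rule: finite_induct)
    case empty then show ?case by (simp add: add_span_empty)
  next
    case (insert v T)
    have Tc: "T \<subseteq> carrier V" "v \<in> carrier V" using insert.prems S by auto
    have "v \<notin> add_span V T"
    proof
      assume "v \<in> add_span V T"
      then have "v \<in> linear_span (GFp p) V T" using linear_span_prime_field[OF V smult Tc(1)] by simp
      then obtain U c where U: "finite U" "U \<subseteq> T" "c \<in> U \<rightarrow> carrier (GFp p)" "v = (\<Oplus>\<^bsub>V\<^esub>u\<in>U. c u \<odot>\<^bsub>V\<^esub> u)"
        unfolding linear_span_def by blast
      have vU: "v \<notin> U" using U insert.hyps by auto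
      \<comment> \<open>The coefficient \<open>p - 1\<close> stands for \<open>-1\<close>.\<close>
      define d where "d = c(v := int (p - 1))"
      have dU: "d u = c u" if "u \<in> U" for u using that vU by (auto simp: d_def)
      have pm: "int (p - 1) \<in> carrier (GFp p)" using p_pos by (simp add: GFp_carrier)
      have dc: "d \<in> insert v U \<rightarrow> carrier (GFp p)" using U(3) dU pm by (auto simp: d_def)
      have uc: "c u \<odot>\<^bsub>V\<^esub> u \<in> carrier V" if "u \<in> U" for u
        using smult[of "c u" u] that U Tc by (auto simp: Pi_iff)
      have dv: "d v \<odot>\<^bsub>V\<^esub> v = \<ominus>\<^bsub>V\<^esub> v"
        using smult[OF pm Tc(2)] a_inv_multiple[OF Tc(2)] by (simp add: d_def)
      have "(\<Oplus>\<^bsub>V\<^esub>u\<in>insert v U. d u \<odot>\<^bsub>V\<^esub> u) = d v \<odot>\<^bsub>V\<^esub> v \<oplus>\<^bsub>V\<^esub> (\<Oplus>\<^bsub>V\<^esub>u\<in>U. d u \<odot>\<^bsub>V\<^esub> u)"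
        using U(1) vU uc dU dv Tc by (intro finsum_insert) auto
      also have "(\<Oplus>\<^bsub>V\<^esub>u\<in>U. d u \<odot>\<^bsub>V\<^esub> u) = v"
        unfolding U(4) using uc dU by (intro finsum_cong') auto
      finally have "(\<Oplus>\<^bsub>V\<^esub>u\<in>insert v U. d u \<odot>\<^bsub>V\<^esub> u) = \<zero>\<^bsub>V\<^esub>" using dv Tc by (simp add: l_neg)
      moreover have "insert v U \<subseteq> S" using U(2) insert.prems by blast
      ultimately have all: "finite (insert v U) \<and> insert v U \<subseteq> S \<and> d \<in> insert v U \<rightarrow> carrier (GFp p) \<and>
          (\<Oplus>\<^bsub>V\<^esub>u\<in>insert v U. d u \<odot>\<^bsub>V\<^esub> u) = \<zero>\<^bsub>V\<^esub>" using U(1) dc by simp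
      have "d v = \<zero>\<^bsub>GFp p\<^esub>"
        by (rule bspec[OF ind[unfolded linearly_independent_def, THEN spec, THEN spec, THEN mp, OF all]]) simp
      then show False using prime_gt_1_nat[OF prime_p] by (simp add: d_def GFp_zero)
    qed
    then show ?case
      using card_add_span_insert[OF finite_add_span[OF insert.hyps(1) Tc(1)] Tc] insert by simp
  qed
  then show ?thesis using S linear_span_prime_field[OF V smult S(1)] by (metis order_refl)
qed

lemma card_vs_dim: "p ^ vs_dim (GFp p) V = card (carrier V)"
  unfolding vs_dim_def by (rule card_vs_basis[OF someI_ex[OF vs_basis_exists]])

end

context frobenius
begin

lemma smult_multiple:
  assumes "left_module F M" "x \<in> carrier M"
  shows "([(k::nat)] \<cdot>\<^bsub>F\<^esub> \<one>\<^bsub>F\<^esub>) \<odot>\<^bsub>M\<^esub> x = [k] \<cdot>\<^bsub>M\<^esub> x"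
proof -
  interpret M: left_module F M by fact
  have z: "\<zero>\<^bsub>F\<^esub> \<odot>\<^bsub>M\<^esub> x = \<zero>\<^bsub>M\<^esub>"
    using M.smult_l_distr[of "\<zero>\<^bsub>F\<^esub>" "\<zero>\<^bsub>F\<^esub>" x] M.smult_closed[of "\<zero>\<^bsub>F\<^esub>" x] assms(2)
    by (metis M.M.add.r_cancel_one F.l_zero F.zero_closed)
  show ?thesis
    by (induction k) (use assms(2) z in \<open>simp_all add: M.smult_l_distr M.smult_one\<close>)
qed

lemma module_exponent:
  assumes "left_module F M" shows "exponent_p_group M p"
proof -
  interpret M: left_module F M by fact
  show ?thesis
  proof (intro exponent_p_group.intro exponent_p_group_axioms.intro M.M.abelian_group_axioms prime_p)
    fix x assume x: "x \<in> carrier M"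
    have "[p] \<cdot>\<^bsub>F\<^esub> \<one>\<^bsub>F\<^esub> = [(0::nat)] \<cdot>\<^bsub>F\<^esub> \<one>\<^bsub>F\<^esub>" using Fp.exponent[of "\<one>\<^bsub>F\<^esub>"] by simp
    then show "[p] \<cdot>\<^bsub>M\<^esub> x = \<zero>\<^bsub>M\<^esub>"
      using smult_multiple[OF assms x, of p] smult_multiple[OF assms x, of 0] by simp
  qed
qed

lemma underlying_simps:
  "carrier (underlying_vs p n M) = carrier M" "\<zero>\<^bsub>underlying_vs p n M\<^esub> = \<zero>\<^bsub>M\<^esub>"
  "add (underlying_vs p n M) = add M"
  by (simp_all add: underlying_vs_def)

lemma underlying_smult:
  assumes "left_module F M" "c \<in> carrier (GFp p)" "x \<in> carrier M"
  shows "c \<odot>\<^bsub>underlying_vs p n M\<^esub> x = [nat c] \<cdot>\<^bsub>M\<^esub> x"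
  using frob_scalar_multiple[OF assms(2)] smult_multiple[OF assms(1,3)] by (simp add: underlying_vs_def)

lemma underlying_subgroup:
  assumes "submodule H (GFp p) (underlying_vs p n M)" shows "additive_subgroup H M"
  using submodule.axioms(1)[OF assms]
  by (auto simp: additive_subgroup_def subgroup_def underlying_simps m_inv_def)

lemma great_filtrationD:
  assumes M: "left_module F M" and g: "great_filtration p n M \<Omega>"
  shows "frobenius_presented p n M \<Omega>" "\<And>i. finite (\<Omega> i)" "(\<Union>i. \<Omega> i) = carrier M"
proof -
  have c: "compatible_filtration p n M \<Omega>" and fp: "finitely_presented (gr_ring F (bernstein p n)) (gr_module M \<Omega>)"
    using g by (auto simp: great_filtration_def gr_frob_def)
  have sub: "additive_subgroup (\<Omega> i) M" for i
    using c underlying_subgroup by (auto simp: compatible_filtration_def)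
  have "filtered_module F M (bernstein p n) \<Omega>"
    by (rule filtered_moduleI[OF M sub]) (use c in \<open>auto simp: compatible_filtration_def\<close>)
  then show "frobenius_presented p n M \<Omega>"
    using fp by (intro frobenius_presented.intro frobenius_graded.intro frobenius_presented_axioms.intro frobenius_axioms)
  show "(\<Union>i. \<Omega> i) = carrier M" using c by (auto simp: compatible_filtration_def)
  fix i
  let ?V = "(underlying_vs p n M)\<lparr>carrier := \<Omega> i\<rparr>"
  have V: "exponent_p_group ?V p"
    by (rule exponent_p_group_cong[OF exponent_p_group_subgroup[OF module_exponent[OF M] sub[of i]]])
      (simp_all add: underlying_simps)
  have "finitely_generated (GFp p) ?V" using c by (simp add: compatible_filtration_def)
  then obtain S where S: "finite S" "S \<subseteq> \<Omega> i" "linear_span (GFp p) ?V S = \<Omega> i"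
    by (auto simp: finitely_generated_def)
  have "linear_span (GFp p) ?V S = add_span ?V S"
  proof (rule linear_span_prime_field[OF V])
    fix c v assume "c \<in> carrier (GFp p)" "v \<in> carrier ?V"
    then have "c \<odot>\<^bsub>underlying_vs p n M\<^esub> v = [nat c] \<cdot>\<^bsub>M\<^esub> v"
      using additive_subgroup.a_subset[OF sub[of i]] by (intro underlying_smult[OF M]) auto
    moreover have "[nat c] \<cdot>\<^bsub>?V\<^esub> v = [nat c] \<cdot>\<^bsub>M\<^esub> v" by (rule add_pow_cong) (simp_all add: underlying_simps)
    ultimately show "c \<odot>\<^bsub>?V\<^esub> v = [nat c] \<cdot>\<^bsub>?V\<^esub> v" by simp
  qed (use S in simp)
  then show "finite (\<Omega> i)" using exponent_p_group.finite_add_span[OF V S(1)] S by simp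
qed

end

text \<open>A great filtration: finite dimension of the steps is stated as finiteness of the sets.\<close>

locale frobenius_great = frobenius_presented p n M \<Omega>
  for p n :: nat and M :: "(frob, 'm, 'd) module_scheme" and \<Omega> :: "nat \<Rightarrow> 'm set" +
  assumes Omega_finite: "finite (\<Omega> i)"
    and Omega_union: "(\<Union>i. \<Omega> i) = carrier M"
begin

lemma Omega_mono: "i \<le> j \<Longrightarrow> \<Omega> i \<subseteq> \<Omega> j"
  by (rule lift_Suc_mono_le[of \<Omega>, OF fm.Omega_Suc])

lemma fm_module: "left_module F M"
  by (rule fm.left_module_axioms)

lemma M_exponent: "exponent_p_group M p"
  by (rule module_exponent[OF fm_module])

lemma card_piece: "card (\<Omega> i) = card (carrier (gr_piece M \<Omega> i)) * card (below M \<Omega> i)"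
proof -
  have sub: "below M \<Omega> i \<subseteq> \<Omega> i" by (rule fm.below_subset)
  have "card (\<Omega> i) = card (below M \<Omega> i) * card (fm.coset i ` \<Omega> i)"
  proof (rule card_fibers[OF Omega_finite])
    fix x assume x: "x \<in> \<Omega> i"
    have xc: "x \<in> carrier M" by (rule fm.Omega_closed[OF x])
    interpret O: additive_subgroup "\<Omega> i" M by (rule fm.Omega_subgroup)
    have bc: "h \<in> \<Omega> i" "h \<in> carrier M" if "h \<in> below M \<Omega> i" for h
      using that sub fm.Omega_closed by auto
    have "bij_betw (\<lambda>h. h \<oplus>\<^bsub>M\<^esub> x) (below M \<Omega> i) {y \<in> \<Omega> i. fm.coset i y = fm.coset i x}"
    proof (rule bij_betw_imageI)
      show "inj_on (\<lambda>h. h \<oplus>\<^bsub>M\<^esub> x) (below M \<Omega> i)"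
        using bc xc by (auto simp: inj_on_def)
      show "(\<lambda>h. h \<oplus>\<^bsub>M\<^esub> x) ` below M \<Omega> i = {y \<in> \<Omega> i. fm.coset i y = fm.coset i x}"
      proof (intro equalityI subsetI)
        fix y assume "y \<in> (\<lambda>h. h \<oplus>\<^bsub>M\<^esub> x) ` below M \<Omega> i"
        then obtain h where h: "h \<in> below M \<Omega> i" "y = h \<oplus>\<^bsub>M\<^esub> x" by blast
        then have yO: "y \<in> \<Omega> i" using bc x by auto
        have "y \<ominus>\<^bsub>M\<^esub> x = h" using h bc xc by (simp add: a_minus_def fm.M.a_assoc fm.M.r_neg)
        then show "y \<in> {y \<in> \<Omega> i. fm.coset i y = fm.coset i x}"
          using yO h fm.coset_eq_iff[OF fm.Omega_closed[OF yO] xc] by simp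
      next
        fix y assume y: "y \<in> {y \<in> \<Omega> i. fm.coset i y = fm.coset i x}"
        then have yc: "y \<in> carrier M" using fm.Omega_closed by auto
        then have "y \<ominus>\<^bsub>M\<^esub> x \<in> below M \<Omega> i" using y fm.coset_eq_iff[OF yc xc] by simp
        moreover have "y = (y \<ominus>\<^bsub>M\<^esub> x) \<oplus>\<^bsub>M\<^esub> x" using yc xc by (simp add: a_minus_def fm.M.a_assoc fm.M.l_neg)
        ultimately show "y \<in> (\<lambda>h. h \<oplus>\<^bsub>M\<^esub> x) ` below M \<Omega> i" by blast
      qed
    qed
    then show "card {y \<in> \<Omega> i. fm.coset i y = fm.coset i x} = card (below M \<Omega> i)"
      by (simp add: bij_betw_same_card)
  qed
  then show ?thesis by (simp add: fm.piece_carrier mult.commute)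
qed

lemma card_gr_piece_vs_dim:
  "p ^ vs_dim (GFp p) (gr_piece (underlying_vs p n M) \<Omega> i) = card (carrier (gr_piece M \<Omega> i))"
proof -
  let ?U = "underlying_vs p n M"
  let ?V = "gr_piece ?U \<Omega> i" and ?W = "gr_piece M \<Omega> i"
  have bl: "below ?U \<Omega> i = below M \<Omega> i" by (simp add: below_def underlying_simps split: nat.split)
  have co: "H +>\<^bsub>?U\<^esub> x = H +>\<^bsub>M\<^esub> x" for H x by (simp add: a_r_coset_def' underlying_simps)
  have eq: "carrier ?W = carrier ?V" "\<zero>\<^bsub>?W\<^esub> = \<zero>\<^bsub>?V\<^esub>" "add ?W = add ?V"
    by (simp_all add: gr_piece_def A_RCOSETS_def' a_r_coset_def' bl underlying_simps set_add_def')
  interpret M: exponent_p_group M p by (rule M_exponent)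
  have mult: "[k] \<cdot>\<^bsub>?W\<^esub> fm.coset i x = fm.coset i ([k] \<cdot>\<^bsub>M\<^esub> x)" if "x \<in> carrier M" for k :: nat and x
  proof -
    interpret W: abelian_group ?W by (rule fm.piece_abelian_group)
    show ?thesis by (induction k) (use that fm.coset_add in \<open>simp_all add: fm.piece_zero\<close>)
  qed
  have W: "exponent_p_group ?W p"
  proof (intro exponent_p_group.intro exponent_p_group_axioms.intro fm.piece_abelian_group prime_p)
    fix x assume "x \<in> carrier ?W"
    then obtain u where "u \<in> \<Omega> i" "x = fm.coset i u" by (auto simp: fm.piece_carrier)
    then show "[p] \<cdot>\<^bsub>?W\<^esub> x = \<zero>\<^bsub>?W\<^esub>"
      using mult[of u p] M.exponent fm.Omega_closed by (simp add: fm.piece_zero)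
  qed
  have V: "exponent_p_group ?V p" by (rule exponent_p_group_cong[OF W eq])
  have "p ^ vs_dim (GFp p) ?V = card (carrier ?V)"
  proof (rule card_vs_dim[OF V])
    show "finite (carrier ?V)" unfolding eq(1)[symmetric] fm.piece_carrier using Omega_finite by simp
    fix c x assume c: "c \<in> carrier (GFp p)" and x: "x \<in> carrier ?V"
    obtain u where u: "u \<in> \<Omega> i" "x = fm.coset i u" using x unfolding eq(1)[symmetric] fm.piece_carrier by blast
    have uc: "u \<in> carrier M" by (rule fm.Omega_closed[OF u(1)])
    interpret H: abelian_subgroup "below M \<Omega> i" M by (rule fm.below_subgroup)
    have cs: "below M \<Omega> i +>\<^bsub>M\<^esub> (c \<odot>\<^bsub>?U\<^esub> y) = fm.coset i ([nat c] \<cdot>\<^bsub>M\<^esub> u)" if y: "y \<in> x" for y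
    proof -
      obtain h where h: "h \<in> below M \<Omega> i" "y = h \<oplus>\<^bsub>M\<^esub> u" using y unfolding u(2) a_r_coset_def' by blast
      have hc: "h \<in> carrier M" using h(1) by (rule H.a_Hcarr)
      have yc: "y \<in> carrier M" using h hc uc by simp
      have "fm.coset i y = fm.coset i u"
        using h hc uc by (subst fm.coset_eq_iff) (simp_all add: a_minus_def fm.M.a_assoc fm.M.r_neg)
      then show ?thesis
        using mult[OF yc, of "nat c"] mult[OF uc, of "nat c"] underlying_smult[OF fm_module c yc] by simp
    qed
    have "x \<noteq> {}" using H.a_rcos_self[OF uc] u(2) by auto
    then have "c \<odot>\<^bsub>?V\<^esub> x = fm.coset i ([nat c] \<cdot>\<^bsub>M\<^esub> u)"
      using cs by (simp add: gr_piece_def bl co)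
    also have "\<dots> = [nat c] \<cdot>\<^bsub>?W\<^esub> x" using mult[OF uc] u(2) by simp
    also have "\<dots> = [nat c] \<cdot>\<^bsub>?V\<^esub> x" by (rule add_pow_cong) (simp_all add: eq)
    finally show "c \<odot>\<^bsub>?V\<^esub> x = [nat c] \<cdot>\<^bsub>?V\<^esub> x" .
  qed
  then show ?thesis unfolding eq(1) .
qed

text \<open>The dimension of \<open>\<Omega>\<^sub>i\<close>, as a partial sum of the coefficients of the Hilbert series.\<close>

definition dim_upto :: "nat \<Rightarrow> nat" where
  "dim_upto i = (\<Sum>j\<le>i. vs_dim (GFp p) (gr_piece (underlying_vs p n M) \<Omega> j))"

lemma card_Omega: "card (\<Omega> i) = p ^ dim_upto i"
proof (induction i)
  case 0
  then show ?case using card_piece[of 0] card_gr_piece_vs_dim[of 0] by (simp add: dim_upto_def below_def)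
next
  case (Suc i)
  then show ?case using card_piece[of "Suc i"] card_gr_piece_vs_dim[of "Suc i"]
    by (simp add: dim_upto_def below_def power_add mult.commute)
qed

end

section \<open>Growth of a great filtration modulo the image of Frobenius\<close>

context frobenius
begin

text \<open>The operators \<open>x\<^sup>a\<close> and \<open>x\<^sup>b F\<close> on a left module.\<close>

definition module_x :: "(frob, 'm, 'd) module_scheme \<Rightarrow> (nat \<Rightarrow> nat) \<Rightarrow> 'm \<Rightarrow> 'm" where
  "module_x M a x = frob_word p n (monomial_word n a) \<odot>\<^bsub>M\<^esub> x"

definition module_F :: "(frob, 'm, 'd) module_scheme \<Rightarrow> (nat \<Rightarrow> nat) \<Rightarrow> 'm \<Rightarrow> 'm" where
  "module_F M b x = xF b \<odot>\<^bsub>M\<^esub> x"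

lemma module_operators:
  assumes M: "left_module F M" shows "frobenius_operators p n M (module_x M) (module_F M)"
proof (intro frobenius_operators.intro frobenius_operators_axioms.intro frobenius_axioms module_exponent M)
  interpret M: left_module F M by fact
  note mw = monomial_word_letters and mwc = frob_word_closed[OF monomial_word_letters]
  fix a u assume u: "u \<in> carrier M"
  show "module_x M a u \<in> carrier M" "module_F M a u \<in> carrier M"
    unfolding module_x_def module_F_def using M.smult_closed mwc xF_closed u by blast+
  show "module_x M 0 u = u"
    using M.smult_one[OF u] by (simp add: module_x_def reg.monomial_word_0 frob_word_Nil)
  fix v assume v: "v \<in> carrier M"
  show "module_x M a (u \<oplus>\<^bsub>M\<^esub> v) = module_x M a u \<oplus>\<^bsub>M\<^esub> module_x M a v"
    unfolding module_x_def by (rule M.smult_r_distr[OF mwc u v])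
  show "module_F M a (u \<oplus>\<^bsub>M\<^esub> v) = module_F M a u \<oplus>\<^bsub>M\<^esub> module_F M a v"
    unfolding module_F_def by (rule M.smult_r_distr[OF xF_closed u v])
next
  interpret M: left_module F M by fact
  note mw = monomial_word_letters and mwc = frob_word_closed[OF monomial_word_letters]
  fix a b u assume a: "a \<in> exponents n" and b: "b \<in> exponents n" and u: "u \<in> carrier M"
  have "frob_word p n (monomial_word n (a + b)) = frob_word p n (monomial_word n a @ monomial_word n b)"
    using a b exponents_plus mw
    by (intro frob_word_eqI) (auto simp: word_value_append word_value_exponents fun_eq_iff)
  then show "module_x M (a + b) u = module_x M a (module_x M b u)"
    unfolding module_x_def using M.smult_assoc1[OF mwc mwc u] frob_word_append[OF mw mw] by simp
  have "xF (a + b) = frob_word p n (monomial_word n a @ monomial_word n b @ [Frob])"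
    using a b exponents_plus mw letter_Frob
    by (intro frob_word_eqI) (auto simp: word_value_append word_value_exponents fun_eq_iff)
  then show "module_x M a (module_F M b u) = module_F M (a + b) u"
    unfolding module_x_def module_F_def
    using M.smult_assoc1[OF mwc xF_closed u] frob_word_append[OF mw xF_letters] by simp
next
  interpret M: left_module F M by fact
  fix b u assume b: "b \<in> exponents n" and u: "u \<in> carrier M"
  define d where "d = (\<lambda>i. b i mod p)"
  define c where "c = (\<lambda>i. b i div p)"
  have d: "d \<in> digits" using b p_gt_1 by (auto simp: digits_def exponents_def d_def)
  have de: "d \<in> exponents n" and c: "c \<in> exponents n" using b by (auto simp: exponents_def c_def d_def)
  have "xF b = frob_word p n ((monomial_word n d @ [Frob]) @ monomial_word n c)"
  proof (rule frob_word_eqI[OF xF_letters])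
    show "(monomial_word n d @ [Frob]) @ monomial_word n c \<in> lists (letters n)"
      using xF_letters[of d] monomial_word_letters[of c] by auto
    have "b i = d i + p * c i" for i by (simp add: c_def d_def)
    then show "word_value p (monomial_word n b @ [Frob]) = word_value p ((monomial_word n d @ [Frob]) @ monomial_word n c)"
      by (auto simp: word_value_append word_value_exponents[OF b] word_value_exponents[OF de]
          word_value_exponents[OF c] fun_eq_iff)
  qed
  then have "module_F M b u = module_F M d (module_x M c u)"
    unfolding module_F_def module_x_def
    using frob_word_append[OF xF_letters monomial_word_letters]
      M.smult_assoc1[OF xF_closed frob_word_closed[OF monomial_word_letters] u] by simp
  then show "module_F M b u = \<zero>\<^bsub>M\<^esub> \<or>
      (\<exists>d\<in>digits. \<exists>c\<in>exponents n. module_F M b u = module_F M d (module_x M c u))"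
    using d c by blast
qed

text \<open>The submodule \<open>R F M\<close> over the polynomial ring \<open>R\<close> generated by the image of \<open>F\<close>, and the kernel of
  \<open>(u\<^sub>b)\<^sub>b \<mapsto> \<Sum> x\<^sup>b F u\<^sub>b\<close>. Both depend on \<open>M\<close> only.\<close>

definition F_image :: "(frob, 'm, 'd) module_scheme \<Rightarrow> 'm set" where
  "F_image M = frobenius_operators.F_span n M (module_F M) (carrier M)"

definition F_kernel :: "(frob, 'm, 'd) module_scheme \<Rightarrow> ((nat \<Rightarrow> nat) \<Rightarrow> 'm) set" where
  "F_kernel M = {u \<in> digits \<rightarrow>\<^sub>E carrier M. frobenius_operators.Psi p n M (module_F M) u = \<zero>\<^bsub>M\<^esub>}"

end

context frobenius_great
begin

sublocale mo: frobenius_operators p n M "module_x M" "module_F M"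
  by (rule module_operators[OF fm_module])

lemma carrier_span: "carrier M \<subseteq> carrier M" "add_span M (carrier M) \<subseteq> carrier M"
  "\<And>a k. a \<in> exponents n \<Longrightarrow> k \<in> carrier M \<Longrightarrow> module_x M a k \<in> carrier M"
  using fm.M.add_span_closed mo.xa_closed by auto

lemma Omega_span: "add_span M (\<Omega> i) \<subseteq> \<Omega> i"
proof
  interpret O: additive_subgroup "\<Omega> i" M by (rule fm.Omega_subgroup)
  fix x assume "x \<in> add_span M (\<Omega> i)"
  then show "x \<in> \<Omega> i" by induction auto
qed

text \<open>The step of the filtration of the source of \<open>Psi\<close> that \<open>Psi\<close> maps to \<open>\<Omega>\<^sub>i\<close>: the component at \<open>b\<close>
  lies in \<open>\<Omega>\<^sub>i\<^sub>-\<^sub>1\<^sub>-\<^sub>|\<^sub>b\<^sub>|\<close>.\<close>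

definition source :: "nat \<Rightarrow> ((nat \<Rightarrow> nat) \<Rightarrow> 'm) set" where
  "source i = (\<Pi>\<^sub>E b\<in>digits. below M \<Omega> (i - total_degree n b))"

lemma below_carrier: "below M \<Omega> i \<subseteq> carrier M"
  using fm.below_subset(1) fm.Omega_closed by blast

lemma below_mono: "i \<le> j \<Longrightarrow> below M \<Omega> i \<subseteq> below M \<Omega> j"
  using Omega_mono additive_subgroup.zero_closed[OF fm.Omega_subgroup]
  by (cases i; cases j) (auto simp: below_def)

lemma source_carrier: "u \<in> source i \<Longrightarrow> u \<in> digits \<rightarrow>\<^sub>E carrier M"
  unfolding source_def using below_carrier by (blast intro: PiE_mono[THEN subsetD])

lemma finite_source: "finite (source i)"
  unfolding source_def
  by (intro finite_PiE finite_digits) (rule finite_subset[OF fm.below_subset(1) Omega_finite])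

lemma Psi_source: "u \<in> source i \<Longrightarrow> mo.Psi u \<in> \<Omega> i"
proof -
  assume u: "u \<in> source i"
  have "(\<Oplus>\<^bsub>M\<^esub>b\<in>digits. module_F M b (u b)) \<in> add_span M (\<Omega> i)"
  proof (rule add_span_finsum[OF fm.M.abelian_group_axioms _ finite_digits])
    show sub: "\<Omega> i \<subseteq> carrier M" using fm.Omega_closed by blast
    fix b assume b: "b \<in> digits"
    have ub: "u b \<in> below M \<Omega> (i - total_degree n b)" using u b by (auto simp: source_def)
    have "xF b \<odot>\<^bsub>M\<^esub> u b \<in> \<Omega> i"
    proof (cases "total_degree n b < i")
      case True
      have "xF b \<in> bernstein p n (Suc (total_degree n b))"
        using word_bernstein[OF xF_letters, of b] by (simp add: length_monomial_word)
      moreover have "u b \<in> \<Omega> (i - Suc (total_degree n b))"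
        using ub True by (simp add: below_def split: nat.splits) (metis Suc_diff_Suc nat.inject)
      ultimately show ?thesis using True fm.B_smult_le[of "Suc (total_degree n b)" i] by simp
    next
      case False
      then have "u b = \<zero>\<^bsub>M\<^esub>" using ub by (simp add: below_def)
      then show ?thesis using fm.smult_zero_right[OF xF_closed]
          additive_subgroup.zero_closed[OF fm.Omega_subgroup] by simp
    qed
    then show "module_F M b (u b) \<in> add_span M (\<Omega> i)"
      unfolding module_F_def by (rule fm.M.add_span_base[OF _ sub])
  qed
  then show ?thesis unfolding mo.Psi_def using Omega_span by blast
qed

lemma source_exhausts: "u \<in> digits \<rightarrow>\<^sub>E carrier M \<Longrightarrow> \<exists>j. u \<in> source (i + j)"
proof -
  assume u: "u \<in> digits \<rightarrow>\<^sub>E carrier M"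
  have "\<forall>b\<in>digits. \<exists>l. u b \<in> \<Omega> l" using u Omega_union by blast
  from bchoice[OF this] obtain l where l: "\<forall>b\<in>digits. u b \<in> \<Omega> (l b)" ..
  define L where "L = (\<Sum>b\<in>digits. Suc (l b) + total_degree n b)"
  have "u b \<in> below M \<Omega> (i + L - total_degree n b)" if b: "b \<in> digits" for b
  proof -
    have "Suc (l b) + total_degree n b \<le> L"
      unfolding L_def using finite_digits b by (intro member_le_sum) auto
    then have "Suc (l b) \<le> i + L - total_degree n b" by simp
    moreover have "u b \<in> below M \<Omega> (Suc (l b))" using l b by (simp add: below_def)
    ultimately show ?thesis using below_mono by blast
  qed
  then have "u \<in> source (i + L)" using u by (auto simp: source_def PiE_iff)
  then show ?thesis by blast
qed

lemma source_strict: "\<exists>D. \<forall>i\<ge>D. \<forall>j. \<forall>u\<in>source (i + j). mo.Psi u \<in> \<Omega> i \<longrightarrow> u \<in> source i"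
proof -
  obtain D where D: "\<forall>i\<ge>D. \<forall>y. (\<forall>b\<in>digits. y b \<in> below M \<Omega> (i - total_degree n b)) \<longrightarrow>
      (\<Oplus>\<^bsub>M\<^esub>b\<in>digits. xF b \<odot>\<^bsub>M\<^esub> y b) \<in> below M \<Omega> i \<longrightarrow>
      (\<forall>b\<in>digits. y b \<in> below M \<Omega> (i - Suc (total_degree n b)))"
    using strictness ..
  have "u \<in> source i" if "D \<le> i" "u \<in> source (i + j)" "mo.Psi u \<in> \<Omega> i" for i j u
    using that(2)
  proof (induction j)
    case (Suc j)
    have "\<forall>b\<in>digits. u b \<in> below M \<Omega> (Suc (i + j) - total_degree n b)"
      using Suc.prems by (auto simp: source_def)
    moreover have "(\<Oplus>\<^bsub>M\<^esub>b\<in>digits. xF b \<odot>\<^bsub>M\<^esub> u b) \<in> below M \<Omega> (Suc (i + j))"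
      using that(3) Omega_mono[of i "i + j"] by (auto simp: below_def mo.Psi_def module_F_def)
    moreover have "D \<le> Suc (i + j)" using that(1) by simp
    ultimately have "\<forall>b\<in>digits. u b \<in> below M \<Omega> (Suc (i + j) - Suc (total_degree n b))"
      using D by blast
    then have "u \<in> source (i + j)" using Suc.prems by (auto simp: source_def PiE_iff)
    then show ?case by (rule Suc.IH)
  qed simp
  then show ?thesis by blast
qed

lemma F_image_eq: "F_image M = mo.Psi ` (digits \<rightarrow>\<^sub>E carrier M)"
proof (intro equalityI subsetI)
  fix x assume "x \<in> F_image M"
  then obtain k where k: "k \<in> digits \<rightarrow> carrier M" "x = mo.Psi k"
    unfolding F_image_def using mo.F_span_Psi[OF carrier_span] by blast
  have "mo.Psi (restrict k digits) = mo.Psi k" by (rule mo.Psi_cong[OF k(1)]) simp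
  moreover have "restrict k digits \<in> digits \<rightarrow>\<^sub>E carrier M" using k by auto
  ultimately show "x \<in> mo.Psi ` (digits \<rightarrow>\<^sub>E carrier M)" using k by (metis imageI)
next
  fix x assume "x \<in> mo.Psi ` (digits \<rightarrow>\<^sub>E carrier M)"
  then obtain k where "k \<in> digits \<rightarrow> carrier M" "x = mo.Psi k" by auto
  then show "x \<in> F_image M" unfolding F_image_def using mo.Psi_F_span[OF carrier_span] by blast
qed

lemma F_image_subgroup: "additive_subgroup (F_image M) M"
  unfolding additive_subgroup_def
proof (rule fm.M.add.subgroupI)
  have c: "F_image M \<subseteq> carrier M" unfolding F_image_def by (rule mo.F_span_carrier[OF carrier_span])
  have sp: "add_span M (F_image M) \<subseteq> F_image M" unfolding F_image_def by (rule mo.F_span_span[OF carrier_span])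
  show "F_image M \<subseteq> carrier M" by (rule c)
  show "F_image M \<noteq> {}" using sp add_span.zero by blast
  fix x y assume x: "x \<in> F_image M" and y: "y \<in> F_image M"
  show "\<ominus>\<^bsub>M\<^esub> x \<in> F_image M" using sp mo.G.add_span_neg[OF fm.M.add_span_base[OF x c] c] by blast
  show "x \<oplus>\<^bsub>M\<^esub> y \<in> F_image M"
    using sp fm.M.add_span_plus[OF fm.M.add_span_base[OF y c] fm.M.add_span_base[OF x c] c] by blast
qed

text \<open>For large \<open>i\<close> the sequence of the kernel of \<open>Psi\<close>, the step \<open>source i\<close> and \<open>\<Omega> i \<inter> F_image M\<close> is
  exact; in particular the kernel is finite.\<close>

lemma card_source:
  "\<exists>D. \<forall>i\<ge>D. card (source i) = card (F_kernel M) * card (\<Omega> i \<inter> F_image M) \<and> card (F_kernel M) \<noteq> 0"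
proof -
  obtain D where D: "\<forall>i\<ge>D. \<forall>j. \<forall>u\<in>source (i + j). mo.Psi u \<in> \<Omega> i \<longrightarrow> u \<in> source i"
    using source_strict ..
  have D': "u \<in> source i" if "D \<le> i" "u \<in> digits \<rightarrow>\<^sub>E carrier M" "mo.Psi u \<in> \<Omega> i" for i u
    using D source_exhausts[OF that(2), of i] that by blast
  have zO: "\<zero>\<^bsub>M\<^esub> \<in> \<Omega> i" for i by (rule additive_subgroup.zero_closed[OF fm.Omega_subgroup])
  have ker: "F_kernel M \<subseteq> source i" if "D \<le> i" for i
    using D'[OF that] zO by (auto simp: F_kernel_def)
  have "(\<lambda>b\<in>digits. \<zero>\<^bsub>M\<^esub>) \<in> F_kernel M"
  proof -
    have "mo.Psi (\<lambda>b\<in>digits. \<zero>\<^bsub>M\<^esub>) = mo.Psi (\<lambda>b. \<zero>\<^bsub>M\<^esub>)" by (rule mo.Psi_cong) auto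
    then show ?thesis by (auto simp: F_kernel_def mo.Psi_zero)
  qed
  then have ne: "card (F_kernel M) \<noteq> 0"
    using finite_subset[OF ker[OF order_refl] finite_source] by auto
  have "card (source i) = card (F_kernel M) * card (\<Omega> i \<inter> F_image M)" if i: "D \<le> i" for i
  proof -
    have "mo.Psi ` source i = \<Omega> i \<inter> F_image M"
    proof (intro equalityI subsetI)
      fix x assume "x \<in> mo.Psi ` source i"
      then show "x \<in> \<Omega> i \<inter> F_image M" unfolding F_image_eq using Psi_source source_carrier by blast
    next
      fix x assume "x \<in> \<Omega> i \<inter> F_image M"
      then obtain u where "u \<in> digits \<rightarrow>\<^sub>E carrier M" "x = mo.Psi u" "x \<in> \<Omega> i" unfolding F_image_eq by blast
      then show "x \<in> mo.Psi ` source i" using D'[OF i] by blast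
    qed
    moreover have "card (source i) = card (F_kernel M) * card (mo.Psi ` source i)"
    proof (rule card_fibers[OF finite_source])
      fix u assume u: "u \<in> source i"
      have uc: "u \<in> digits \<rightarrow>\<^sub>E carrier M" by (rule source_carrier[OF u])
      then have uc': "u \<in> digits \<rightarrow> carrier M" by auto
      let ?f = "\<lambda>k. \<lambda>b\<in>digits. u b \<oplus>\<^bsub>M\<^esub> k b" and ?g = "\<lambda>v. \<lambda>b\<in>digits. v b \<ominus>\<^bsub>M\<^esub> u b"
      have f: "?f k \<in> digits \<rightarrow>\<^sub>E carrier M" "mo.Psi (?f k) = mo.Psi u \<oplus>\<^bsub>M\<^esub> mo.Psi k"
        if k: "k \<in> digits \<rightarrow>\<^sub>E carrier M" for k
      proof -
        have k': "k \<in> digits \<rightarrow> carrier M" using k by auto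
        show "?f k \<in> digits \<rightarrow>\<^sub>E carrier M" using uc' k' by auto
        have "(\<lambda>b. u b \<oplus>\<^bsub>M\<^esub> k b) \<in> digits \<rightarrow> carrier M" using uc' k' by auto
        then have "mo.Psi (?f k) = mo.Psi (\<lambda>b. u b \<oplus>\<^bsub>M\<^esub> k b)" by (rule mo.Psi_cong) simp
        then show "mo.Psi (?f k) = mo.Psi u \<oplus>\<^bsub>M\<^esub> mo.Psi k" using mo.Psi_add[OF uc' k'] by simp
      qed
      have g: "?g v \<in> digits \<rightarrow>\<^sub>E carrier M" "mo.Psi (?g v) = mo.Psi v \<ominus>\<^bsub>M\<^esub> mo.Psi u"
        if v: "v \<in> digits \<rightarrow>\<^sub>E carrier M" for v
      proof -
        have v': "v \<in> digits \<rightarrow> carrier M" using v by auto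
        show "?g v \<in> digits \<rightarrow>\<^sub>E carrier M" using uc' v' by auto
        have "(\<lambda>b. v b \<ominus>\<^bsub>M\<^esub> u b) \<in> digits \<rightarrow> carrier M" using uc' v' by auto
        then have "mo.Psi (?g v) = mo.Psi (\<lambda>b. v b \<ominus>\<^bsub>M\<^esub> u b)" by (rule mo.Psi_cong) simp
        then show "mo.Psi (?g v) = mo.Psi v \<ominus>\<^bsub>M\<^esub> mo.Psi u" using mo.Psi_minus[OF v' uc'] by simp
      qed
      have "bij_betw ?f (F_kernel M) {v \<in> source i. mo.Psi v = mo.Psi u}"
      proof (rule bij_betw_byWitness[of _ ?g])
        show "\<forall>k\<in>F_kernel M. ?g (?f k) = k"
        proof
          fix k assume "k \<in> F_kernel M"
          then have k: "k \<in> digits \<rightarrow>\<^sub>E carrier M" by (simp add: F_kernel_def)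
          show "?g (?f k) = k"
          proof (rule PiE_ext[OF g(1)[OF f(1)[OF k]] k])
            fix b assume b: "b \<in> digits"
            have "u b \<in> carrier M" "k b \<in> carrier M" using b uc' k by auto
            then show "?g (?f k) b = k b"
              using b by (simp add: a_minus_def fm.M.a_comm[of "u b"] fm.M.a_assoc fm.M.r_neg)
          qed
        qed
        show "\<forall>v\<in>{v \<in> source i. mo.Psi v = mo.Psi u}. ?f (?g v) = v"
        proof
          fix v assume "v \<in> {v \<in> source i. mo.Psi v = mo.Psi u}"
          then have v: "v \<in> digits \<rightarrow>\<^sub>E carrier M" using source_carrier by auto
          show "?f (?g v) = v"
          proof (rule PiE_ext[OF f(1)[OF g(1)[OF v]] v])
            fix b assume b: "b \<in> digits"
            have "u b \<in> carrier M" "v b \<in> carrier M" using b uc' v by auto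
            then show "?f (?g v) b = v b"
              using b by (simp add: a_minus_def fm.M.a_comm[of "u b"] fm.M.a_assoc fm.M.l_neg)
          qed
        qed
        have Pu: "mo.Psi u \<in> carrier M" "mo.Psi u \<in> \<Omega> i" using mo.Psi_closed[OF uc'] Psi_source[OF u] by auto
        show "?f ` F_kernel M \<subseteq> {v \<in> source i. mo.Psi v = mo.Psi u}"
        proof
          fix v assume "v \<in> ?f ` F_kernel M"
          then obtain k where k: "k \<in> digits \<rightarrow>\<^sub>E carrier M" "mo.Psi k = \<zero>\<^bsub>M\<^esub>" "v = ?f k"
            unfolding F_kernel_def by blast
          have "mo.Psi v = mo.Psi u" using f(2)[OF k(1)] k(2,3) Pu by simp
          then show "v \<in> {v \<in> source i. mo.Psi v = mo.Psi u}"
            using D'[OF i f(1)[OF k(1)]] k(3) Pu by simp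
        qed
        show "?g ` {v \<in> source i. mo.Psi v = mo.Psi u} \<subseteq> F_kernel M"
        proof
          fix k assume "k \<in> ?g ` {v \<in> source i. mo.Psi v = mo.Psi u}"
          then obtain v where v: "v \<in> source i" "mo.Psi v = mo.Psi u" "k = ?g v" by blast
          note vc = source_carrier[OF v(1)]
          have "mo.Psi k = \<zero>\<^bsub>M\<^esub>" using g(2)[OF vc] v(2,3) Pu by (simp add: a_minus_def fm.M.r_neg)
          then show "k \<in> F_kernel M" using g(1)[OF vc] v(3) by (simp add: F_kernel_def)
        qed
      qed
      then show "card {v \<in> source i. mo.Psi v = mo.Psi u} = card (F_kernel M)"
        by (simp add: bij_betw_same_card)
    qed
    ultimately show ?thesis by simp
  qed
  then show ?thesis using ne by blast
qed

text \<open>The filtration induced on \<open>M / R F M\<close> has a rational Hilbert series: every word is a monomial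
  in the variables or maps \<open>M\<close> into \<open>R F M\<close>, so \<open>\<Omega>\<^sub>k\<^sub>0\<close> generates the filtration over the polynomial ring.\<close>

lemma growth_modulo_F_image:
  "\<exists>h k0. pole_order_le (Suc n) (Abs_fps (\<lambda>i. of_nat (h i))) \<and>
    (\<forall>i\<ge>k0. card (\<Omega> i) = p ^ h i * card (\<Omega> i \<inter> F_image M))"
proof -
  obtain k0 where k0: "\<forall>d. \<Omega> (k0 + d) \<subseteq>
      add_span M {frob_word p n w \<odot>\<^bsub>M\<^esub> t | w t. w \<in> lists (letters n) \<and> length w \<le> d \<and> t \<in> \<Omega> k0}"
    using filtration_generated ..
  obtain r :: nat and g where g: "\<Omega> k0 = g ` {s. s < r}"
    using finite_imp_nat_seg_image_inj_on[OF Omega_finite] by blast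
  interpret ma: monomial_action M p n "module_x M" "F_image M" g r
  proof
    show "F_image M \<subseteq> carrier M" unfolding F_image_def by (rule mo.F_span_carrier[OF carrier_span])
    show "add_span M (F_image M) \<subseteq> F_image M" unfolding F_image_def by (rule mo.F_span_span[OF carrier_span])
    fix a x assume a: "a \<in> exponents n" and x: "x \<in> F_image M"
    show "module_x M a x \<in> F_image M"
      using mo.F_span_xa[of "carrier M" a x] carrier_span a x unfolding F_image_def by simp
  next
    fix s assume "s < r"
    then show "g s \<in> carrier M" using g fm.Omega_closed by blast
  qed (use mo.xa_closed mo.xa_add mo.xa_comp in auto)
  have eq: "card (\<Omega> (k0 + d)) = p ^ card {m \<in> ma.standard. total_degree n (fst m) \<le> d} * card (\<Omega> (k0 + d) \<inter> F_image M)" for d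
  proof (rule ma.card_filtered_piece[OF Omega_finite _ Omega_span])
    show "\<Omega> (k0 + d) \<subseteq> carrier M" using fm.Omega_closed by blast
    let ?E = "{m \<in> ma.indices. total_degree n (fst m) \<le> d}"
    show "ma.vec ` ?E \<subseteq> \<Omega> (k0 + d)"
    proof
      fix x assume "x \<in> ma.vec ` ?E"
      then obtain a s where as: "a \<in> exponents n" "s < r" "total_degree n a \<le> d"
        "x = frob_word p n (monomial_word n a) \<odot>\<^bsub>M\<^esub> g s"
        by (auto simp: ma.vec_def ma.indices_def module_x_def)
      have "g s \<in> \<Omega> k0" using g as(2) by blast
      then have "x \<in> \<Omega> (total_degree n a + k0)"
        unfolding as(4) using fm.B_smult[OF word_bernstein[OF monomial_word_letters]]
        by (metis length_monomial_word)
      then show "x \<in> \<Omega> (k0 + d)" using Omega_mono[of "total_degree n a + k0" "k0 + d"] as(3) by auto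
    qed
    have sub: "F_image M \<union> ma.vec ` ?E \<subseteq> carrier M" using ma.J_carrier ma.vec_closed by auto
    show "\<Omega> (k0 + d) \<subseteq> add_span M (F_image M \<union> ma.vec ` ?E)"
    proof
      fix x assume "x \<in> \<Omega> (k0 + d)"
      then have "x \<in> add_span M {frob_word p n w \<odot>\<^bsub>M\<^esub> t | w t. w \<in> lists (letters n) \<and> length w \<le> d \<and> t \<in> \<Omega> k0}"
        using k0 by blast
      then show "x \<in> add_span M (F_image M \<union> ma.vec ` ?E)"
      proof (rule fm.M.add_span_subset[OF _ _ sub])
        show "{frob_word p n w \<odot>\<^bsub>M\<^esub> t | w t. w \<in> lists (letters n) \<and> length w \<le> d \<and> t \<in> \<Omega> k0}
            \<subseteq> add_span M (F_image M \<union> ma.vec ` ?E)"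
        proof
          fix y assume "y \<in> {frob_word p n w \<odot>\<^bsub>M\<^esub> t | w t. w \<in> lists (letters n) \<and> length w \<le> d \<and> t \<in> \<Omega> k0}"
          then obtain w t where wt: "w \<in> lists (letters n)" "length w \<le> d" "t \<in> \<Omega> k0" "y = frob_word p n w \<odot>\<^bsub>M\<^esub> t" by blast
          have tc: "t \<in> carrier M" by (rule fm.Omega_closed[OF wt(3)])
          have "y \<in> F_image M \<union> ma.vec ` ?E"
            using X_word_split[OF wt(1)]
          proof
            assume x: "w \<in> lists (X ` {..<n})"
            let ?a = "fst (word_value p w)"
            have a: "?a \<in> exponents n" "total_degree n ?a \<le> d"
              using fst_word_value[OF wt(1)] word_value_X_word[OF x] wt(2) by auto
            have "frob_word p n w = frob_word p n (monomial_word n ?a)"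
              using word_value_X_word[OF x] word_value_exponents[OF a(1)]
              by (intro frob_word_eqI[OF wt(1) monomial_word_letters]) (auto simp: prod_eq_iff)
            moreover obtain s where s: "s < r" "t = g s" using wt(3) g by blast
            ultimately have "y = ma.vec (?a, s)" by (simp add: ma.vec_def module_x_def wt(4))
            moreover have "(?a, s) \<in> ?E" using a s by (simp add: ma.indices_def)
            ultimately show ?thesis by blast
          next
            assume "\<exists>u v. w = u @ Frob # v \<and> u \<in> lists (X ` {..<n}) \<and> v \<in> lists (letters n)"
            then obtain u v where uv: "w = u @ Frob # v" "u \<in> lists (X ` {..<n})" "v \<in> lists (letters n)" by blast
            let ?a = "fst (word_value p u)"
            have a: "?a \<in> exponents n" by (rule fst_word_value[OF X_letters[OF uv(2)]])
            have "frob_word p n w = frob_word p n ((monomial_word n ?a @ [Frob]) @ v)"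
            proof (rule frob_word_eqI[OF wt(1)])
              show "(monomial_word n ?a @ [Frob]) @ v \<in> lists (letters n)" using xF_letters[of ?a] uv(3) by auto
              show "word_value p w = word_value p ((monomial_word n ?a @ [Frob]) @ v)"
                unfolding uv(1) using word_value_X_word[OF uv(2)]
                by (simp add: word_value_append word_value_exponents[OF a] prod_eq_iff)
            qed
            then have "y = module_F M ?a (frob_word p n v \<odot>\<^bsub>M\<^esub> t)"
              unfolding wt(4) module_F_def
              using frob_word_append[OF xF_letters uv(3)] fm.smult_assoc1[OF xF_closed frob_word_closed[OF uv(3)] tc]
              by simp
            moreover have "frob_word p n v \<odot>\<^bsub>M\<^esub> t \<in> carrier M" by (rule fm.smult_closed[OF frob_word_closed[OF uv(3)] tc])
            moreover have "module_F M ?a z \<in> F_image M" if "z \<in> carrier M" for z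
              unfolding F_image_def mo.F_span_def using a that
              by (intro fm.M.add_span_base[OF _ mo.F_span_gen[OF carrier_span]]) blast
            ultimately show ?thesis by auto
          qed
          then show "y \<in> add_span M (F_image M \<union> ma.vec ` ?E)" by (rule fm.M.add_span_base[OF _ sub])
        qed
      qed
    qed
  qed
  define h where "h = (\<lambda>i. if i < k0 then 0 else card {m \<in> ma.standard. total_degree n (fst m) \<le> i - k0})"
  have "Abs_fps (\<lambda>i. of_nat (h i) :: rat)
      = fps_X ^ k0 * Abs_fps (\<lambda>d. of_nat (card {m \<in> ma.standard. total_degree n (fst m) \<le> d}))"
    by (rule fps_ext) (simp add: h_def fps_X_power_mult_nth)
  also have "\<dots> = fps_of_poly (monom 1 k0) * Abs_fps (\<lambda>d. of_nat (card {m \<in> ma.standard. total_degree n (fst m) \<le> d}))"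
    by (simp add: fps_of_poly_monom)
  finally have "pole_order_le (Suc n) (Abs_fps (\<lambda>i. of_nat (h i)))"
    using pole_order_le_mult_poly[OF ma.pole_order_standard_count] by simp
  moreover have "card (\<Omega> i) = p ^ h i * card (\<Omega> i \<inter> F_image M)" if "k0 \<le> i" for i
    using eq[of "i - k0"] that by (simp add: h_def)
  ultimately show ?thesis by blast
qed

lemma card_coset_image:
  "card (\<Omega> i) = card (\<Omega> i \<inter> F_image M) * card ((\<lambda>x. F_image M +>\<^bsub>M\<^esub> x) ` \<Omega> i)"
proof (rule card_fibers[OF Omega_finite])
  interpret O: additive_subgroup "\<Omega> i" M by (rule fm.Omega_subgroup)
  interpret H: abelian_subgroup "F_image M" M
    by (rule abelian_subgroupI3[OF F_image_subgroup fm.M.abelian_group_axioms])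
  fix x assume x: "x \<in> \<Omega> i"
  have xc: "x \<in> carrier M" by (rule fm.Omega_closed[OF x])
  have iff: "F_image M +>\<^bsub>M\<^esub> y = F_image M +>\<^bsub>M\<^esub> x \<longleftrightarrow> y \<ominus>\<^bsub>M\<^esub> x \<in> F_image M" if "y \<in> carrier M" for y
  proof
    assume "F_image M +>\<^bsub>M\<^esub> y = F_image M +>\<^bsub>M\<^esub> x"
    then have "y \<in> F_image M +>\<^bsub>M\<^esub> x" using H.a_rcos_self[OF that] by simp
    then show "y \<ominus>\<^bsub>M\<^esub> x \<in> F_image M" using that xc by (simp add: H.a_rcos_module a_minus_def)
  next
    assume "y \<ominus>\<^bsub>M\<^esub> x \<in> F_image M"
    then have "y \<in> F_image M +>\<^bsub>M\<^esub> x" using that xc by (simp add: H.a_rcos_module a_minus_def)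
    then show "F_image M +>\<^bsub>M\<^esub> y = F_image M +>\<^bsub>M\<^esub> x" using H.a_repr_independence' xc by simp
  qed
  have "bij_betw (\<lambda>h. h \<oplus>\<^bsub>M\<^esub> x) (\<Omega> i \<inter> F_image M) {y \<in> \<Omega> i. F_image M +>\<^bsub>M\<^esub> y = F_image M +>\<^bsub>M\<^esub> x}"
  proof (rule bij_betw_byWitness[of _ "\<lambda>y. y \<ominus>\<^bsub>M\<^esub> x"])
    have 1: "(h \<oplus>\<^bsub>M\<^esub> x) \<ominus>\<^bsub>M\<^esub> x = h" "(h \<ominus>\<^bsub>M\<^esub> x) \<oplus>\<^bsub>M\<^esub> x = h" if "h \<in> carrier M" for h
      using that xc by (simp_all add: a_minus_def fm.M.a_assoc fm.M.r_neg fm.M.l_neg)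
    show "\<forall>h\<in>\<Omega> i \<inter> F_image M. (h \<oplus>\<^bsub>M\<^esub> x) \<ominus>\<^bsub>M\<^esub> x = h" using 1 fm.Omega_closed by auto
    show "\<forall>y\<in>{y \<in> \<Omega> i. F_image M +>\<^bsub>M\<^esub> y = F_image M +>\<^bsub>M\<^esub> x}. (y \<ominus>\<^bsub>M\<^esub> x) \<oplus>\<^bsub>M\<^esub> x = y"
      using 1 fm.Omega_closed by auto
    show "(\<lambda>h. h \<oplus>\<^bsub>M\<^esub> x) ` (\<Omega> i \<inter> F_image M) \<subseteq> {y \<in> \<Omega> i. F_image M +>\<^bsub>M\<^esub> y = F_image M +>\<^bsub>M\<^esub> x}"
    proof
      fix y assume "y \<in> (\<lambda>h. h \<oplus>\<^bsub>M\<^esub> x) ` (\<Omega> i \<inter> F_image M)"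
      then obtain h where h: "h \<in> \<Omega> i" "h \<in> F_image M" "y = h \<oplus>\<^bsub>M\<^esub> x" by blast
      have hc: "h \<in> carrier M" by (rule fm.Omega_closed[OF h(1)])
      have y: "y \<in> \<Omega> i" unfolding h(3) using h(1) x by simp
      have "y \<ominus>\<^bsub>M\<^esub> x \<in> F_image M" using 1(1)[OF hc] h by simp
      then show "y \<in> {y \<in> \<Omega> i. F_image M +>\<^bsub>M\<^esub> y = F_image M +>\<^bsub>M\<^esub> x}"
        using iff[OF fm.Omega_closed[OF y]] y by blast
    qed
    show "(\<lambda>y. y \<ominus>\<^bsub>M\<^esub> x) ` {y \<in> \<Omega> i. F_image M +>\<^bsub>M\<^esub> y = F_image M +>\<^bsub>M\<^esub> x} \<subseteq> \<Omega> i \<inter> F_image M"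
    proof
      fix h assume "h \<in> (\<lambda>y. y \<ominus>\<^bsub>M\<^esub> x) ` {y \<in> \<Omega> i. F_image M +>\<^bsub>M\<^esub> y = F_image M +>\<^bsub>M\<^esub> x}"
      then obtain y where y: "y \<in> \<Omega> i" "F_image M +>\<^bsub>M\<^esub> y = F_image M +>\<^bsub>M\<^esub> x" "h = y \<ominus>\<^bsub>M\<^esub> x" by blast
      have "h \<in> F_image M" using iff[OF fm.Omega_closed[OF y(1)]] y by simp
      moreover have "h \<in> \<Omega> i" unfolding y(3) a_minus_def using y(1) x by simp
      ultimately show "h \<in> \<Omega> i \<inter> F_image M" by blast
    qed
  qed
  then show "card {y \<in> \<Omega> i. F_image M +>\<^bsub>M\<^esub> y = F_image M +>\<^bsub>M\<^esub> x} = card (\<Omega> i \<inter> F_image M)"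
    by (simp add: bij_betw_same_card)
qed

text \<open>The dimension of \<open>\<Omega>\<^sub>i\<^sub>-\<^sub>1\<close>, with \<open>\<Omega>\<^sub>-\<^sub>1 = 0\<close>.\<close>

definition dim_below :: "nat \<Rightarrow> nat" where
  "dim_below i = (case i of 0 \<Rightarrow> 0 | Suc j \<Rightarrow> dim_upto j)"

lemma card_below: "card (below M \<Omega> i) = p ^ dim_below i"
  by (cases i) (simp_all add: below_def dim_below_def card_Omega)

text \<open>The dimension count behind \<open>g HS = HS(Tor\<^sub>0) - HS(Tor\<^sub>1)\<close>: \<open>h i\<close> is the
  dimension of the image of \<open>\<Omega>\<^sub>i\<close> in \<open>M / R F M\<close> for large \<open>i\<close>.\<close>

theorem dimension_count:
  "\<exists>h N c. pole_order_le (Suc n) (Abs_fps (\<lambda>i. of_nat (h i))) \<and> p ^ c = card (F_kernel M) \<and>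
    (\<forall>i\<ge>N. card ((\<lambda>x. F_image M +>\<^bsub>M\<^esub> x) ` \<Omega> i) = p ^ h i \<and>
      dim_upto i + c = h i + (\<Sum>b\<in>digits. dim_below (i - total_degree n b)))"
proof -
  obtain D where D: "\<forall>i\<ge>D. card (source i) = card (F_kernel M) * card (\<Omega> i \<inter> F_image M) \<and> card (F_kernel M) \<noteq> 0"
    using card_source ..
  obtain h k0 where h: "pole_order_le (Suc n) (Abs_fps (\<lambda>i. of_nat (h i)))"
    "\<forall>i\<ge>k0. card (\<Omega> i) = p ^ h i * card (\<Omega> i \<inter> F_image M)"
    using growth_modulo_F_image by blast
  have p0: "p > 0" "p > 1" using p_gt_1 by auto
  have src: "card (source i) = p ^ (\<Sum>b\<in>digits. dim_below (i - total_degree n b))" for i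
    unfolding source_def card_PiE[OF finite_digits] card_below by (simp add: power_sum)
  have main: "p ^ dim_upto i * card (F_kernel M) = p ^ (h i + (\<Sum>b\<in>digits. dim_below (i - total_degree n b)))"
    if "D \<le> i" "k0 \<le> i" for i
  proof -
    have "p ^ dim_upto i * card (F_kernel M) = p ^ h i * (card (F_kernel M) * card (\<Omega> i \<inter> F_image M))"
      using h(2) that by (simp add: card_Omega[symmetric] mult.commute mult.left_commute)
    also have "\<dots> = p ^ h i * card (source i)" using D that by simp
    finally show ?thesis by (simp add: src power_add)
  qed
  have "card (F_kernel M) dvd p ^ (h (D + k0) + (\<Sum>b\<in>digits. dim_below (D + k0 - total_degree n b)))"
    using main[of "D + k0"] by (metis dvd_triv_right le_add1 le_add2)
  then obtain c where c: "card (F_kernel M) = p ^ c"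
    using divides_primepow_nat[OF prime_p] by blast
  have "dim_upto i + c = h i + (\<Sum>b\<in>digits. dim_below (i - total_degree n b))" if "D \<le> i" "k0 \<le> i" for i
  proof -
    have "p ^ (dim_upto i + c) = p ^ (h i + (\<Sum>b\<in>digits. dim_below (i - total_degree n b)))"
      using main[OF that] by (simp add: c power_add)
    then show ?thesis using p0(2) power_inject_exp by blast
  qed
  moreover have "card ((\<lambda>x. F_image M +>\<^bsub>M\<^esub> x) ` \<Omega> i) = p ^ h i" if "k0 \<le> i" for i
  proof -
    have pos: "card (\<Omega> i \<inter> F_image M) \<noteq> 0"
    proof -
      have "\<zero>\<^bsub>M\<^esub> \<in> \<Omega> i \<inter> F_image M"
        using additive_subgroup.zero_closed[OF fm.Omega_subgroup]
          additive_subgroup.zero_closed[OF F_image_subgroup] by blast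
      moreover have "finite (\<Omega> i \<inter> F_image M)" using Omega_finite by simp
      ultimately show ?thesis by (metis card_0_eq empty_iff)
    qed
    have "card (\<Omega> i \<inter> F_image M) * card ((\<lambda>x. F_image M +>\<^bsub>M\<^esub> x) ` \<Omega> i) = card (\<Omega> i \<inter> F_image M) * p ^ h i"
      using card_coset_image[of i] h(2)[rule_format, OF that] by (metis mult.commute)
    then show ?thesis using pos by simp
  qed
  ultimately show ?thesis using h(1) c by (intro exI[of _ h] exI[of _ "D + k0"] exI[of _ c]) auto
qed

end

text \<open>Two great filtrations of the same module are comparable up to a shift.\<close>

lemma great_filtrations_comparable:
  assumes S: "frobenius_great p n M \<Sigma>" and O: "frobenius_great p n M \<Omega>"
  shows "\<exists>N c. \<forall>i\<ge>N. \<Sigma> i \<subseteq> \<Omega> (i + c)"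
proof -
  interpret S: frobenius_great p n M \<Sigma> by fact
  interpret O: frobenius_great p n M \<Omega> by fact
  obtain k0 where k0: "\<forall>d. \<Sigma> (k0 + d) \<subseteq>
      add_span M {frob_word p n w \<odot>\<^bsub>M\<^esub> t | w t. w \<in> lists (letters n) \<and> length w \<le> d \<and> t \<in> \<Sigma> k0}"
    using S.filtration_generated ..
  have "\<exists>c. T \<subseteq> \<Omega> c" if "finite T" "T \<subseteq> carrier M" for T
    using that
  proof (induction T)
    case (insert x T)
    then obtain c d where "T \<subseteq> \<Omega> c" "x \<in> \<Omega> d" using O.Omega_union by (metis UN_E insert_subset)
    then have "insert x T \<subseteq> \<Omega> (max c d)" using O.Omega_mono[of c "max c d"] O.Omega_mono[of d "max c d"] by auto
    then show ?case by blast
  qed auto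
  then obtain c where c: "\<Sigma> k0 \<subseteq> \<Omega> c" using S.Omega_finite S.fm.Omega_closed by (metis subsetI)
  have "\<Sigma> (k0 + d) \<subseteq> \<Omega> (d + c)" for d
  proof
    fix x assume "x \<in> \<Sigma> (k0 + d)"
    then have "x \<in> add_span M {frob_word p n w \<odot>\<^bsub>M\<^esub> t | w t. w \<in> lists (letters n) \<and> length w \<le> d \<and> t \<in> \<Sigma> k0}"
      using k0 by blast
    moreover have "{frob_word p n w \<odot>\<^bsub>M\<^esub> t | w t. w \<in> lists (letters n) \<and> length w \<le> d \<and> t \<in> \<Sigma> k0} \<subseteq> \<Omega> (d + c)"
    proof
      fix y assume "y \<in> {frob_word p n w \<odot>\<^bsub>M\<^esub> t | w t. w \<in> lists (letters n) \<and> length w \<le> d \<and> t \<in> \<Sigma> k0}"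
      then obtain w t where wt: "w \<in> lists (letters n)" "length w \<le> d" "t \<in> \<Sigma> k0" "y = frob_word p n w \<odot>\<^bsub>M\<^esub> t" by blast
      have "t \<in> \<Omega> c" using wt(3) c by blast
      then have "y \<in> \<Omega> (length w + c)" unfolding wt(4) by (rule O.fm.B_smult[OF O.word_bernstein[OF wt(1)]])
      then show "y \<in> \<Omega> (d + c)" using O.Omega_mono[of "length w + c" "d + c"] wt(2) by auto
    qed
    ultimately have "x \<in> add_span M (\<Omega> (d + c))" by (rule add_span_mono)
    then show "x \<in> \<Omega> (d + c)" using O.Omega_span by blast
  qed
  then have "\<Sigma> i \<subseteq> \<Omega> (i + c)" if "k0 \<le> i" for i
    using that O.Omega_mono[of "i - k0 + c" "i + c"] by (metis diff_le_self add_le_mono1 le_add_diff_inverse subset_trans)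
  then show ?thesis by blast
qed

section \<open>Rational functions and growth of coefficients\<close>

lemma inverse_one_minus_fps_X:
  "inverse (1 - fps_X) = (Abs_fps (\<lambda>_. 1) :: 'a :: field_char_0 fps)"
proof -
  have "(1 - fps_X) * (Abs_fps (\<lambda>_. 1) :: 'a fps) = 1"
    by (rule fps_ext) (simp add: left_diff_distrib)
  then show ?thesis by (rule fps_inverse_unique)
qed

lemma fps_inverse_power_nth:
  "(inverse ((1 - fps_X) ^ Suc k) :: 'a :: field_char_0 fps) $ i = of_nat ((i + k) choose k)"
proof (induction k arbitrary: i)
  case 0
  have "inverse (1 - fps_X :: 'a fps) = Abs_fps (\<lambda>_. 1)"
    by (rule inverse_one_minus_fps_X)
  then show ?case by simp
next
  case (Suc k)
  let ?u = "1 - fps_X :: 'a fps"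
  have u: "?u $ 0 \<noteq> 0" by simp
  have inv: "inverse (?u ^ Suc (Suc k)) = inverse (?u ^ Suc k) * inverse ?u"
    by (metis fps_inverse_mult mult.commute power_Suc)
  have g: "inverse ?u = Abs_fps (\<lambda>_. 1)" by (rule inverse_one_minus_fps_X)
  have "inverse (?u ^ Suc (Suc k)) $ i = (\<Sum>j=0..i. inverse (?u ^ Suc k) $ j)"
    unfolding inv g by (simp add: fps_mult_nth)
  also have "\<dots> = (\<Sum>j\<le>i. of_nat ((j + k) choose k))"
    using Suc.IH by (simp add: atLeast0AtMost)
  also have "\<dots> = of_nat (\<Sum>j\<le>i. (k + j) choose j)"
    by (simp add: binomial_symmetric[of k "_ + k"] add.commute)
  also have "(\<Sum>j\<le>i. (k + j) choose j) = Suc (k + i) choose i" by (rule sum_choose_lower)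
  also have "\<dots> = (i + Suc k) choose Suc k"
    using binomial_symmetric[of i "Suc (k + i)"] by (simp add: add.commute)
  finally show ?case .
qed

lemma binomial_limit:
  "(\<lambda>i. real ((i - j + k) choose k) / real i ^ k) \<longlonglongrightarrow> 1 / fact k"
proof -
  have "(\<lambda>i. \<Prod>l = 0..<k. real (i - j + k - l) / real (k - l) / real i) \<longlonglongrightarrow> (\<Prod>l = 0..<k. 1 / real (k - l))"
  proof (rule tendsto_prod)
    fix l assume l: "l \<in> {0..<k}"
    then have kl: "real (k - l) > 0" by simp
    have ev: "eventually (\<lambda>i. (real i - real j + real k - real l) / real (k - l) / real i
        = real (i - j + k - l) / real (k - l) / real i) sequentially"
      using eventually_ge_at_top[of j] by eventually_elim (use l in \<open>simp add: of_nat_diff\<close>)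
    have "(\<lambda>i. (real i - real j + real k - real l) / real (k - l) / real i) \<longlonglongrightarrow> 1 / real (k - l)"
    proof -
      define c where "c = (real k - real j - real l) / real (k - l)"
      have "(\<lambda>i. c / real i + 1 / real (k - l)) \<longlonglongrightarrow> 0 + 1 / real (k - l)"
        by (intro tendsto_add lim_const_over_n tendsto_const)
      moreover have "eventually (\<lambda>i. c / real i + 1 / real (k - l)
          = (real i - real j + real k - real l) / real (k - l) / real i) sequentially"
      proof (rule eventually_sequentiallyI[of 1])
        fix i :: nat assume "1 \<le> i"
        moreover have "u / D / x + 1 / D = (x + u) / D / x" if "D \<noteq> 0" "x \<noteq> 0" for u D x :: real
          using that by (simp add: field_simps)
        ultimately have "c / real i + 1 / real (k - l) = (real i + (real k - real j - real l)) / real (k - l) / real i"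
          unfolding c_def using kl by simp
        then show "c / real i + 1 / real (k - l) = (real i - real j + real k - real l) / real (k - l) / real i"
          by (simp only: add_diff_eq diff_add_eq)
      qed
      ultimately show ?thesis by (simp add: Lim_transform_eventually)
    qed
    then show "(\<lambda>i. real (i - j + k - l) / real (k - l) / real i) \<longlonglongrightarrow> 1 / real (k - l)"
      using ev by (rule Lim_transform_eventually)
  qed
  moreover have "(\<Prod>l = 0..<k. real (i - j + k - l) / real (k - l) / real i)
      = real ((i - j + k) choose k) / real i ^ k" for i
    using binomial_altdef_of_nat[of k "i - j + k", where 'a = real] by (simp add: prod_dividef prod.distrib)
  moreover have "(\<Prod>l = 0..<k. 1 / real (k - l)) = 1 / fact k"
  proof -
    have "(\<Prod>l = 0..<k. real (k - l)) = (\<Prod>l = 0..<k. real (Suc l))"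
      by (rule prod.reindex_bij_witness[of _ "\<lambda>l. k - Suc l" "\<lambda>l. k - Suc l"]) auto
    also have "\<dots> = fact k" by (simp add: fact_prod_Suc)
    finally show ?thesis by (simp add: prod_dividef prod.distrib)
  qed
  ultimately show ?thesis by simp
qed

text \<open>The leading term of the coefficients of \<open>Q / (1 - t)\<^sup>k\<^sup>+\<^sup>1\<close>.\<close>

lemma coefficient_limit:
  fixes E :: "rat fps" and Q :: "rat poly"
  assumes "(1 - fps_X) ^ Suc k * E = fps_of_poly Q"
  shows "(\<lambda>i. real_of_rat (E $ i) / real i ^ k) \<longlonglongrightarrow> real_of_rat (poly Q 1) / fact k"
proof -
  let ?u = "(1 - fps_X :: rat fps) ^ Suc k"
  have "?u $ 0 \<noteq> 0" by (simp add: fps_power_zeroth)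
  then have inv: "?u * inverse ?u = 1" by (rule inverse_mult_eq_1')
  have "E = fps_of_poly Q * inverse ?u"
  proof -
    have "?u * E * inverse ?u = E" by (simp only: mult.commute[of ?u E] mult.assoc inv mult_1_right)
    then show ?thesis unfolding assms by (rule sym)
  qed
  then have E: "E $ i = (\<Sum>j=0..i. coeff Q j * of_nat ((i - j + k) choose k))" for i
    by (simp only: fps_mult_nth fps_inverse_power_nth fps_of_poly_nth)
  have "E $ i = (\<Sum>j\<le>degree Q. coeff Q j * of_nat ((i - j + k) choose k))" if "degree Q \<le> i" for i
    unfolding E using that coeff_eq_0[of Q]
    by (intro sum.mono_neutral_right) (auto simp: not_le)
  then have ev: "eventually (\<lambda>i. (\<Sum>j\<le>degree Q. real_of_rat (coeff Q j) * (real ((i - j + k) choose k) / real i ^ k))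
      = real_of_rat (E $ i) / real i ^ k) sequentially"
    by (intro eventually_sequentiallyI[of "degree Q"])
      (simp add: of_rat_sum of_rat_mult sum_divide_distrib)
  have "(\<lambda>i. \<Sum>j\<le>degree Q. real_of_rat (coeff Q j) * (real ((i - j + k) choose k) / real i ^ k))
      \<longlonglongrightarrow> (\<Sum>j\<le>degree Q. real_of_rat (coeff Q j) * (1 / fact k))"
    by (intro tendsto_sum tendsto_mult tendsto_const binomial_limit)
  also have "(\<Sum>j\<le>degree Q. real_of_rat (coeff Q j) * (1 / fact k)) = real_of_rat (poly Q 1) / fact k"
    by (simp add: poly_altdef of_rat_sum sum_divide_distrib)
  finally show ?thesis using ev by (rule Lim_transform_eventually)
qed

lemma shifted_limit:
  fixes e :: "nat \<Rightarrow> real"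
  assumes "(\<lambda>i. e i / real i ^ d) \<longlonglongrightarrow> a" "d \<le> k"
  shows "(\<lambda>i. e (i + c) / real i ^ k) \<longlonglongrightarrow> (if k = d then a else 0)"
proof -
  have 1: "(\<lambda>i. e (i + c) / real (i + c) ^ d) \<longlonglongrightarrow> a"
    using assms(1) by (rule LIMSEQ_ignore_initial_segment)
  have "(\<lambda>i. 1 + real c / real i) \<longlonglongrightarrow> 1 + 0"
    by (intro tendsto_add lim_const_over_n tendsto_const)
  moreover have "eventually (\<lambda>i. 1 + real c / real i = real (i + c) / real i) sequentially"
    by (rule eventually_sequentiallyI[of 1]) (simp add: field_simps)
  ultimately have "(\<lambda>i. real (i + c) / real i) \<longlonglongrightarrow> 1" by (simp add: Lim_transform_eventually)
  then have 2: "(\<lambda>i. (real (i + c) / real i) ^ d) \<longlonglongrightarrow> 1 ^ d" by (rule tendsto_power)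
  have 3: "(\<lambda>i. (1 / real i) ^ (k - d)) \<longlonglongrightarrow> (if k = d then 1 else 0)"
  proof (cases "k = d")
    case False
    have "(\<lambda>i. 1 / real i) \<longlonglongrightarrow> 0" by (rule lim_const_over_n)
    then have "(\<lambda>i. (1 / real i) ^ (k - d)) \<longlonglongrightarrow> 0 ^ (k - d)" by (rule tendsto_power)
    moreover have "(0 :: real) ^ (k - d) = 0" using False assms(2) by (intro zero_power) simp
    ultimately show ?thesis using False by (simp only: if_False)
  qed simp
  have "(\<lambda>i. e (i + c) / real (i + c) ^ d * ((real (i + c) / real i) ^ d * (1 / real i) ^ (k - d)))
      \<longlonglongrightarrow> a * (1 ^ d * (if k = d then 1 else 0))"
    by (intro tendsto_mult 1 2 3)
  moreover have "eventually (\<lambda>i. e (i + c) / real (i + c) ^ d * ((real (i + c) / real i) ^ d * (1 / real i) ^ (k - d))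
      = e (i + c) / real i ^ k) sequentially"
  proof (rule eventually_sequentiallyI[of 1])
    fix i :: nat assume "1 \<le> i"
    moreover have "real i ^ k = real i ^ d * real i ^ (k - d)" using assms(2) by (simp flip: power_add)
    ultimately show "e (i + c) / real (i + c) ^ d * ((real (i + c) / real i) ^ d * (1 / real i) ^ (k - d))
      = e (i + c) / real i ^ k" by (simp add: power_divide divide_simps)
  qed
  ultimately have "(\<lambda>i. e (i + c) / real i ^ k) \<longlonglongrightarrow> a * (1 ^ d * (if k = d then 1 else 0))"
    by (rule Lim_transform_eventually)
  then show ?thesis by (simp split: if_splits)
qed

text \<open>Sequences that bound each other up to a shift of the index have the same growth. The case
  \<open>d = 0\<close> allows the limit \<open>0\<close>, which occurs for sequences that vanish in the end.\<close>

lemma same_growth_aux: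
  fixes e f :: "nat \<Rightarrow> real"
  assumes e: "(\<lambda>i. e i / real i ^ d) \<longlonglongrightarrow> a" and f: "(\<lambda>i. f i / real i ^ k) \<longlonglongrightarrow> b"
    and "d \<le> k" and ef: "\<And>i. i \<ge> N \<Longrightarrow> e i \<le> f (i + c)" and fe: "\<And>i. i \<ge> N \<Longrightarrow> f i \<le> e (i + c)"
  shows "b = (if k = d then a else 0)"
proof (rule antisym)
  have le: "(\<lambda>i. e (i + c) / real i ^ k) \<longlonglongrightarrow> (if k = d then a else 0)" for c
    using e \<open>d \<le> k\<close> by (rule shifted_limit)
  have lf: "(\<lambda>i. f (i + c) / real i ^ k) \<longlonglongrightarrow> b"
    using shifted_limit[OF f order_refl, of c] by simp
  show "b \<le> (if k = d then a else 0)"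
    by (rule LIMSEQ_le[OF f le[of c]]) (use fe in \<open>auto intro!: exI[of _ N] divide_right_mono\<close>)
  show "(if k = d then a else 0) \<le> b"
    by (rule LIMSEQ_le[OF le[of 0] lf]) (use ef in \<open>auto intro!: exI[of _ N] divide_right_mono\<close>)
qed

lemma same_growth:
  fixes e f :: "nat \<Rightarrow> real"
  assumes e: "(\<lambda>i. e i / real i ^ d) \<longlonglongrightarrow> a" and f: "(\<lambda>i. f i / real i ^ k) \<longlonglongrightarrow> b"
    and a: "d > 0 \<Longrightarrow> a \<noteq> 0" and b: "k > 0 \<Longrightarrow> b \<noteq> 0"
    and ef: "\<And>i. i \<ge> N \<Longrightarrow> e i \<le> f (i + c)" and fe: "\<And>i. i \<ge> N \<Longrightarrow> f i \<le> e (i + c)"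
  shows "d = k \<and> a = b"
proof -
  have "d = k"
  proof (rule ccontr)
    assume "d \<noteq> k"
    then consider "d < k" | "k < d" by linarith
    then show False
    proof cases
      case 1
      then show False using same_growth_aux[OF e f _ ef fe] b by simp
    next
      case 2
      then show False using same_growth_aux[OF f e _ fe ef] a by simp
    qed
  qed
  then show ?thesis using same_growth_aux[OF e f _ ef fe] by simp
qed

lemma Fract_eq_iff:
  "q \<noteq> 0 \<Longrightarrow> s \<noteq> 0 \<Longrightarrow> Fraction_Field.Fract p q = Fraction_Field.Fract r s \<longleftrightarrow> p * s = r * q"
  by (rule eq_fract(1))

lemma expands_to_unique:
  assumes "expands_to h f" "expands_to k f" shows "h = k"
proof -
  obtain P Q where 1: "Q \<noteq> 0" "h = Fraction_Field.Fract P Q" "fps_of_poly Q * f = fps_of_poly P"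
    using assms(1) by (auto simp: expands_to_def)
  obtain R S where 2: "S \<noteq> 0" "k = Fraction_Field.Fract R S" "fps_of_poly S * f = fps_of_poly R"
    using assms(2) by (auto simp: expands_to_def)
  have "fps_of_poly (P * S) = fps_of_poly (R * Q)"
    unfolding fps_of_poly_mult 1(3)[symmetric] 2(3)[symmetric] by (simp add: mult.commute mult.left_commute)
  then have "P * S = R * Q" by (simp only: fps_of_poly_eq_iff)
  then show ?thesis using 1 2 by (simp add: Fract_eq_iff)
qed

lemma eval_at_eq:
  assumes "poly Q a \<noteq> 0" shows "eval_at a (Fraction_Field.Fract P Q) = poly P a / poly Q a"
  unfolding eval_at_def
proof (rule the_equality)
  show "\<exists>P' Q'. poly Q' a \<noteq> 0 \<and> Fraction_Field.Fract P Q = Fraction_Field.Fract P' Q' \<and> poly P a / poly Q a = poly P' a / poly Q' a"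
    using assms by blast
  fix v assume "\<exists>P' Q'. poly Q' a \<noteq> 0 \<and> Fraction_Field.Fract P Q = Fraction_Field.Fract P' Q' \<and> v = poly P' a / poly Q' a"
  then obtain P' Q' where PQ: "poly Q' a \<noteq> 0" "Fraction_Field.Fract P Q = Fraction_Field.Fract P' Q'" "v = poly P' a / poly Q' a"
    by blast
  have "Q \<noteq> 0" "Q' \<noteq> 0" using assms PQ(1) by auto
  then have "P * Q' = P' * Q" using PQ(2) by (simp add: Fract_eq_iff)
  then have "poly P a * poly Q' a = poly P' a * poly Q a" by (metis poly_mult)
  then show "v = poly P a / poly Q a" unfolding PQ(3) using assms PQ(1) by (simp add: frac_eq_eq)
qed

lemma one_minus_t_power: "one_minus_t ^ d = Fraction_Field.Fract ([:1, - 1:] ^ d) 1"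
  by (induction d) (simp_all add: one_minus_t_def One_fract_def)

text \<open>Pole order \<open>\<delta>\<close> and leading coefficient at \<open>1\<close> of \<open>P / (g (1 - t)\<^sup>n)\<close>; the polynomial \<open>R\<close> is
  \<open>(1 - t)\<^sup>\<delta>\<^sup>-\<^sup>n P\<close>. If there is no pole, then \<open>R\<close> may vanish at \<open>1\<close>.\<close>

lemma pole_at_one:
  fixes P g :: "rat poly" and n :: nat
  assumes g: "poly g 1 \<noteq> 0"
  defines "h \<equiv> Fraction_Field.Fract P (g * [:1, - 1:] ^ n)"
  shows "\<exists>\<delta> R. [:1, - 1:] ^ n * R = [:1, - 1:] ^ \<delta> * P \<and> (\<delta> > 0 \<longrightarrow> poly R 1 \<noteq> 0) \<and> delta1 h = \<delta> \<and>
    eval_at 1 (one_minus_t ^ \<delta> * Fraction_Field.Fract g 1 * h) = poly R 1"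
proof -
  let ?u = "[:1, - 1:] :: rat poly"
  have g0: "g \<noteq> 0" using g by auto
  have u: "?u ^ k \<noteq> 0" for k by simp
  have pu: "poly (?u ^ k) 1 = (if k = 0 then 1 else 0)" for k by (simp add: poly_power)
  have leading: "eval_at 1 (one_minus_t ^ d * Fraction_Field.Fract g 1 * h) = poly R 1"
    if R: "?u ^ n * R = ?u ^ d * P" for d R
  proof -
    have "one_minus_t ^ d * Fraction_Field.Fract g 1 * h = Fraction_Field.Fract (?u ^ d * g * P) (g * ?u ^ n)"
      by (simp add: h_def one_minus_t_power)
    also have "\<dots> = Fraction_Field.Fract R 1"
    proof (subst Fract_eq_iff)
      have "?u ^ d * g * P * 1 = g * (?u ^ d * P)" by (simp add: mult_ac)
      also have "\<dots> = R * (g * ?u ^ n)" unfolding R[symmetric] by (simp add: mult_ac)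
      finally show "?u ^ d * g * P * 1 = R * (g * ?u ^ n)" .
    qed (use g0 in auto)
    finally show ?thesis using eval_at_eq[of 1 1 R] by simp
  qed
  show ?thesis
  proof (cases "P = 0")
    case True
    have "no_pole_at 1 (one_minus_t ^ 0 * h)"
      unfolding no_pole_at_def
      by (rule exI[of _ 0], rule exI[of _ 1]) (simp add: h_def True Zero_fract_def[symmetric] fract_collapse)
    then have "delta1 h = 0" unfolding delta1_def by (intro Least_equality) auto
    then show ?thesis using leading[of 0 0] True by (intro exI[of _ 0] exI[of _ 0]) simp
  next
    case False
    define m where "m = order 1 P"
    obtain Q where Q: "P = [:- 1, 1:] ^ m * Q" "\<not> [:- 1, 1:] dvd Q"
      using order_decomp[OF False, of 1] unfolding m_def by auto
    have Q1: "poly Q 1 \<noteq> 0" using Q(2) by (simp add: poly_eq_0_iff_dvd)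
    have "[:- 1, 1:] = smult (- 1) ?u" by simp
    then have PQ: "P = ?u ^ m * (smult ((- 1) ^ m) Q)"
      using Q(1) by (simp only: smult_power mult_smult_left mult_smult_right)
    define S where "S = smult ((- 1) ^ m) Q"
    have S1: "poly S 1 \<noteq> 0" using Q1 by (simp add: S_def)
    have P: "P = ?u ^ m * S" using PQ by (simp add: S_def)
    define \<delta> where "\<delta> = n - m"
    define R where "R = ?u ^ (m - n) * S"
    have "?u ^ n * ?u ^ (m - n) = ?u ^ \<delta> * ?u ^ m"
      unfolding \<delta>_def by (cases "m \<le> n") (simp_all flip: power_add)
    then have R: "?u ^ n * R = ?u ^ \<delta> * P" unfolding R_def P by (simp only: mult.assoc[symmetric])
    have R1: "poly R 1 \<noteq> 0" if "\<delta> > 0" using that S1 by (simp add: R_def \<delta>_def)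
    have d1: "delta1 h = \<delta>"
      unfolding delta1_def
    proof (rule Least_equality)
      have "one_minus_t ^ \<delta> * h = Fraction_Field.Fract R g"
        unfolding h_def one_minus_t_power using g0 R by (simp add: Fract_eq_iff) (simp add: mult_ac)
      then show "no_pole_at 1 (one_minus_t ^ \<delta> * h)" unfolding no_pole_at_def using g by blast
      fix d assume "no_pole_at 1 (one_minus_t ^ d * h)"
      then obtain A B where AB: "poly B 1 \<noteq> 0" "one_minus_t ^ d * h = Fraction_Field.Fract A B"
        unfolding no_pole_at_def by blast
      have "B \<noteq> 0" using AB(1) by auto
      then have eq: "?u ^ d * P * B = A * (g * ?u ^ n)"
        using AB(2) g0 unfolding h_def one_minus_t_power by (simp add: Fract_eq_iff)
      show "\<delta> \<le> d"
      proof (rule ccontr)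
        assume "\<not> \<delta> \<le> d"
        then obtain e where n: "n = (d + m) + Suc e" by (metis \<delta>_def less_diff_conv less_iff_Suc_add not_le add_Suc_right)
        have un: "?u ^ n = ?u ^ (d + m) * ?u ^ Suc e" unfolding n by (rule power_add)
        have "?u ^ (d + m) * (S * B) = ?u ^ (d + m) * (A * g * ?u ^ Suc e)"
          using eq unfolding P un power_add by (simp only: mult_ac)
        then have "S * B = A * g * ?u ^ Suc e" using u mult_left_cancel by blast
        then have "poly S 1 * poly B 1 = 0" using pu by (metis mult_zero_right nat.distinct(1) poly_mult)
        then show False using S1 AB(1) by simp
      qed
    qed
    show ?thesis
      by (intro exI[of _ \<delta>] exI[of _ R] conjI impI R d1 leading[OF R]) (rule R1)
  qed
qed

section \<open>The Hilbert series of a great filtration\<close>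

lemma fps_eventually_zero_poly:
  fixes f :: "rat fps"
  assumes "\<And>i. i \<ge> N \<Longrightarrow> f $ i = 0" shows "\<exists>Q. f = fps_of_poly Q"
proof
  show "f = fps_of_poly (Poly (map (fps_nth f) [0..<N]))"
    by (rule fps_ext) (use assms in \<open>auto simp: nth_default_def\<close>)
qed

lemma pole_order_le_constant_series: "pole_order_le (Suc n) (Abs_fps (\<lambda>_. a))"
proof (rule pole_order_le_mono)
  have "(1 - fps_X) * Abs_fps (\<lambda>_. a) = fps_of_poly [:a:]"
    by (rule fps_ext) (simp add: left_diff_distrib fps_X_mult_nth coeff_pCons split: nat.splits)
  then show "pole_order_le 1 (Abs_fps (\<lambda>_. a))" unfolding pole_order_le_def by auto
qed simp

lemma poly_g_poly_1: "poly (g_poly p n) 1 = 1 - of_nat p ^ n"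
  by (simp add: g_poly_def poly_sum)

context frobenius
begin

text \<open>The digit vectors, counted by total degree.\<close>

lemma digits_series: "(\<Sum>k<p. z ^ k) ^ n = (\<Sum>b\<in>digits. z ^ total_degree n b)"
  for z :: "'r :: comm_semiring_1"
proof -
  have "(\<Sum>k<p. z ^ k) ^ n = (\<Prod>i<n. \<Sum>k<p. z ^ k)" by simp
  also have "\<dots> = (\<Sum>f\<in>PiE {..<n} (\<lambda>_. {..<p}). \<Prod>i<n. z ^ f i)" by (rule prod_sum_PiE) auto
  also have "\<dots> = (\<Sum>b\<in>digits. z ^ total_degree n b)"
  proof (rule sum.reindex_bij_witness[of _ "\<lambda>b. restrict b {..<n}" "\<lambda>f i. if i < n then f i else 0"])
    fix f assume f: "f \<in> PiE {..<n} (\<lambda>_. {..<p})"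
    show "restrict (\<lambda>i. if i < n then f i else 0) {..<n} = f"
      using f by (auto simp: fun_eq_iff PiE_def extensional_def)
    show "(\<lambda>i. if i < n then f i else 0) \<in> digits"
      using f p_gt_1 by (auto simp: digits_def exponents_def PiE_iff)
    show "z ^ total_degree n (\<lambda>i. if i < n then f i else 0) = (\<Prod>i<n. z ^ f i)"
      by (simp add: total_degree_def power_sum)
  next
    fix b assume b: "b \<in> digits"
    then show "restrict b {..<n} \<in> PiE {..<n} (\<lambda>_. {..<p})" by (auto simp: digits_def)
    show "(\<lambda>i. if i < n then restrict b {..<n} i else 0) = b"
      using b by (auto simp: fun_eq_iff digits_def exponents_def)
  qed
  finally show ?thesis .
qed

lemma g_poly_series: "fps_of_poly (g_poly p n) = 1 - (\<Sum>b\<in>digits. fps_X ^ Suc (total_degree n b))"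
proof -
  have X: "fps_of_poly [:0, 1:] = (fps_X :: rat fps)" by (simp add: fps_of_poly_pCons)
  have "fps_of_poly (g_poly p n) = 1 - fps_X * (\<Sum>k<p. fps_X ^ k) ^ n"
    unfolding g_poly_def fps_of_poly_diff fps_of_poly_mult fps_of_poly_power fps_of_poly_sum X fps_of_poly_1 ..
  then show ?thesis by (simp add: digits_series sum_distrib_left)
qed

end

context frobenius_great
begin

lemma hilbert_fps_partial_sums: "hilbert_fps p n M \<Omega> = (1 - fps_X) * Abs_fps (\<lambda>i. of_nat (dim_upto i))"
proof (rule fps_ext)
  fix i show "hilbert_fps p n M \<Omega> $ i = ((1 - fps_X) * Abs_fps (\<lambda>i. of_nat (dim_upto i))) $ i"
    by (cases i) (simp_all add: hilbert_fps_def dim_upto_def left_diff_distrib fps_X_mult_nth)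
qed

lemma g_poly_times_series:
  "(fps_of_poly (g_poly p n) * Abs_fps (\<lambda>i. of_nat (dim_upto i))) $ i
    = of_nat (dim_upto i) - of_nat (\<Sum>b\<in>digits. dim_below (i - total_degree n b))"
proof -
  have "(fps_X ^ Suc (total_degree n b) * Abs_fps (\<lambda>i. of_nat (dim_upto i))) $ i
      = (of_nat (dim_below (i - total_degree n b)) :: rat)" for b
    unfolding fps_X_power_mult_nth
    by (auto simp: dim_below_def split: nat.splits) (metis Suc_diff_Suc diff_Suc_Suc nat.inject not_less_eq)
  then show ?thesis
    by (simp only: g_poly_series left_diff_distrib sum_distrib_right fps_sub_nth fps_sum_nth
        mult_1_left fps_nth_Abs_fps of_nat_sum)
qed

text \<open>The pole of the Hilbert series at \<open>1\<close> is read off from the growth of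
  \<open>h\<^sub>i - c\<close>, where \<open>h\<^sub>i\<close> is the dimension of the image of \<open>\<Omega>\<^sub>i\<close> in \<open>M / R F M\<close> and
  \<open>c\<close> is that of the kernel.\<close>

theorem hilbert_series_growth:
  assumes n: "n \<ge> 1"
  shows "\<exists>h N c \<delta> r. p ^ c = card (F_kernel M) \<and>
    (\<forall>i\<ge>N. card ((\<lambda>x. F_image M +>\<^bsub>M\<^esub> x) ` \<Omega> i) = p ^ h i) \<and>
    (\<lambda>i. (real (h i) - real c) / real i ^ \<delta>) \<longlonglongrightarrow> real_of_rat r / fact \<delta> \<and> (\<delta> > 0 \<longrightarrow> r \<noteq> 0) \<and>
    delta1 (HS p n M \<Omega>) = \<delta> \<and> eval_at 1 (leading_fun p n M \<Omega>) = r"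
proof -
  obtain h N c where h: "pole_order_le (Suc n) (Abs_fps (\<lambda>i. of_nat (h i)))"
    and c: "p ^ c = card (F_kernel M)"
    and N: "\<And>i. i \<ge> N \<Longrightarrow> card ((\<lambda>x. F_image M +>\<^bsub>M\<^esub> x) ` \<Omega> i) = p ^ h i \<and>
      dim_upto i + c = h i + (\<Sum>b\<in>digits. dim_below (i - total_degree n b))"
    using dimension_count by blast
  define E where "E = fps_of_poly (g_poly p n) * Abs_fps (\<lambda>i. of_nat (dim_upto i))"
  have E: "E $ i = of_nat (h i) - of_nat c" if "N \<le> i" for i
  proof -
    have "(of_nat (dim_upto i + c) :: rat) = of_nat (h i + (\<Sum>b\<in>digits. dim_below (i - total_degree n b)))"
      using N[OF that] by simp
    then show ?thesis unfolding E_def g_poly_times_series by simp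
  qed
  have "pole_order_le (Suc n) E"
  proof -
    let ?H = "Abs_fps (\<lambda>i. of_nat (h i)) + Abs_fps (\<lambda>_. - of_nat c)"
    obtain Q where "E - ?H = fps_of_poly Q"
      using fps_eventually_zero_poly[of N "E - ?H"] E by auto
    then have "E = ?H + fps_of_poly Q" by (metis add.commute diff_add_cancel)
    then show ?thesis
      using pole_order_le_add[OF pole_order_le_add[OF h pole_order_le_constant_series] pole_order_le_poly]
      by metis
  qed
  then obtain P where P: "(1 - fps_X) ^ Suc n * E = fps_of_poly P" unfolding pole_order_le_def ..
  let ?u = "[:1, - 1:] :: rat poly" and ?g = "g_poly p n"
  have u: "fps_of_poly (?u ^ k) = (1 - fps_X) ^ k" for k
    by (simp add: fps_of_poly_power fps_one_minus_X_poly)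
  have g1: "poly ?g 1 \<noteq> 0"
  proof -
    have "p ^ n \<noteq> 1" using n p_gt_1 by simp
    then have "(of_nat (p ^ n) :: rat) \<noteq> of_nat 1" by (simp only: of_nat_eq_iff simp_thms)
    then show ?thesis by (simp add: poly_g_poly_1)
  qed
  have HS: "HS p n M \<Omega> = Fraction_Field.Fract P (?g * ?u ^ n)"
  proof -
    have "fps_of_poly (?g * ?u ^ n) * hilbert_fps p n M \<Omega> = (1 - fps_X) ^ Suc n * E"
      unfolding fps_of_poly_mult u hilbert_fps_partial_sums E_def by (simp add: mult_ac)
    moreover have "?g * ?u ^ n \<noteq> 0" using g1 by auto
    ultimately have "expands_to (Fraction_Field.Fract P (?g * ?u ^ n)) (hilbert_fps p n M \<Omega>)"
      unfolding expands_to_def P by blast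
    then show ?thesis unfolding HS_def
      by (intro the_equality) (auto intro: expands_to_unique)
  qed
  obtain \<delta> R where R: "?u ^ n * R = ?u ^ \<delta> * P" "\<delta> > 0 \<longrightarrow> poly R 1 \<noteq> 0"
    "delta1 (HS p n M \<Omega>) = \<delta>"
    "eval_at 1 (one_minus_t ^ \<delta> * Fraction_Field.Fract ?g 1 * HS p n M \<Omega>) = poly R 1"
    using pole_at_one[OF g1] unfolding HS by blast
  have "(1 - fps_X) ^ n * ((1 - fps_X) ^ Suc \<delta> * E) = (1 - fps_X) ^ n * fps_of_poly R"
  proof -
    have "(1 - fps_X) ^ n * ((1 - fps_X) ^ Suc \<delta> * E) = (1 - fps_X) ^ \<delta> * ((1 - fps_X) ^ Suc n * E)"
      by (simp add: mult_ac)
    also have "\<dots> = fps_of_poly (?u ^ \<delta> * P)" unfolding P fps_of_poly_mult u ..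
    also have "\<dots> = (1 - fps_X) ^ n * fps_of_poly R" unfolding R(1)[symmetric] fps_of_poly_mult u ..
    finally show ?thesis .
  qed
  moreover have "(1 - fps_X :: rat fps) ^ n \<noteq> 0"
    using u[of n, symmetric] by (simp add: fps_one_minus_X_poly[symmetric])
  ultimately have "(1 - fps_X) ^ Suc \<delta> * E = fps_of_poly R" using mult_left_cancel by blast
  then have "(\<lambda>i. real_of_rat (E $ i) / real i ^ \<delta>) \<longlonglongrightarrow> real_of_rat (poly R 1) / fact \<delta>"
    by (rule coefficient_limit)
  moreover have "eventually (\<lambda>i. real_of_rat (E $ i) / real i ^ \<delta> = (real (h i) - real c) / real i ^ \<delta>) sequentially"
    by (rule eventually_sequentiallyI[of N]) (simp add: E of_rat_diff)
  ultimately have lim: "(\<lambda>i. (real (h i) - real c) / real i ^ \<delta>) \<longlonglongrightarrow> real_of_rat (poly R 1) / fact \<delta>"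
    by (rule Lim_transform_eventually)
  have "eval_at 1 (leading_fun p n M \<Omega>) = poly R 1"
    unfolding leading_fun_def R(3) by (rule R(4))
  then show ?thesis using c N lim R(2,3)
    by (intro exI[of _ h] exI[of _ N] exI[of _ c] exI[of _ \<delta>] exI[of _ "poly R 1"]) simp
qed

end

text \<open>Applied to \<open>f\<close> the projection to \<open>M / R F M\<close>, this compares the two functions \<open>h\<close>.\<close>

lemma great_images_comparable:
  assumes S: "frobenius_great p n M \<Sigma>" and O: "frobenius_great p n M \<Omega>"
    and hS: "\<forall>i\<ge>A. card (f ` \<Sigma> i) = p ^ h i" and hO: "\<forall>i\<ge>B. card (f ` \<Omega> i) = p ^ k i"
  shows "\<exists>N c. \<forall>i\<ge>N. \<forall>d\<ge>c. h i \<le> k (i + d)"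
proof -
  interpret S: frobenius_great p n M \<Sigma> by fact
  interpret O: frobenius_great p n M \<Omega> by fact
  obtain N c where N: "\<forall>i\<ge>N. \<Sigma> i \<subseteq> \<Omega> (i + c)"
    using great_filtrations_comparable[OF S O] by blast
  have "h i \<le> k (i + d)" if i: "A + B + N \<le> i" and d: "c \<le> d" for i d
  proof -
    have "\<Sigma> i \<subseteq> \<Omega> (i + c)" using N i by simp
    also have "\<dots> \<subseteq> \<Omega> (i + d)" using d by (intro O.Omega_mono) simp
    finally have "\<Sigma> i \<subseteq> \<Omega> (i + d)" .
    then have "card (f ` \<Sigma> i) \<le> card (f ` \<Omega> (i + d))"
      by (intro card_mono image_mono finite_imageI O.Omega_finite)
    then have "p ^ h i \<le> p ^ k (i + d)" using hS hO i by simp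
    then show ?thesis using S.p_gt_1 by simp
  qed
  then show ?thesis by blast
qed

theorem theorem5p13:
  fixes p n :: nat
    and M :: "(frob, 'm, 'd) module_scheme"
    and \<Sigma> \<Omega> :: "nat \<Rightarrow> 'm set"
  assumes "prime p"
    and "n \<ge> 1"
    and "left_module (frob_ring p n) M"
    and "great_filtration p n M \<Sigma>"
    and "great_filtration p n M \<Omega>"
  shows "delta1 (HS p n M \<Omega>) = delta1 (HS p n M \<Sigma>)
    \<and> eval_at 1 (leading_fun p n M \<Omega>) = eval_at 1 (leading_fun p n M \<Sigma>)"
proof -
  interpret frobenius p n by unfold_locales (rule assms(1))
  have great: "frobenius_great p n M \<Phi>" if "great_filtration p n M \<Phi>" for \<Phi>
    by (intro frobenius_great.intro frobenius_great_axioms.intro great_filtrationD[OF assms(3) that])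
  note S = great[OF assms(4)] and O = great[OF assms(5)]
  obtain h A c \<delta> r where h: "p ^ c = card (F_kernel M)"
    "\<forall>i\<ge>A. card ((\<lambda>x. F_image M +>\<^bsub>M\<^esub> x) ` \<Sigma> i) = p ^ h i"
    "(\<lambda>i. (real (h i) - real c) / real i ^ \<delta>) \<longlonglongrightarrow> real_of_rat r / fact \<delta>" "\<delta> > 0 \<longrightarrow> r \<noteq> 0"
    "delta1 (HS p n M \<Sigma>) = \<delta>" "eval_at 1 (leading_fun p n M \<Sigma>) = r"
    using frobenius_great.hilbert_series_growth[OF S assms(2)] by blast
  obtain k B e \<epsilon> s where k: "p ^ e = card (F_kernel M)"
    "\<forall>i\<ge>B. card ((\<lambda>x. F_image M +>\<^bsub>M\<^esub> x) ` \<Omega> i) = p ^ k i"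
    "(\<lambda>i. (real (k i) - real e) / real i ^ \<epsilon>) \<longlonglongrightarrow> real_of_rat s / fact \<epsilon>" "\<epsilon> > 0 \<longrightarrow> s \<noteq> 0"
    "delta1 (HS p n M \<Omega>) = \<epsilon>" "eval_at 1 (leading_fun p n M \<Omega>) = s"
    using frobenius_great.hilbert_series_growth[OF O assms(2)] by blast
  have "p ^ e = p ^ c" using h(1) k(1) by simp
  then have ec: "e = c" using p_gt_1 by simp
  obtain N c1 where N: "\<forall>i\<ge>N. \<forall>d\<ge>c1. h i \<le> k (i + d)"
    using great_images_comparable[OF S O h(2) k(2)] by blast
  obtain L c2 where L: "\<forall>i\<ge>L. \<forall>d\<ge>c2. k i \<le> h (i + d)"
    using great_images_comparable[OF O S k(2) h(2)] by blast
  have "\<delta> = \<epsilon> \<and> real_of_rat r / fact \<delta> = real_of_rat s / fact \<epsilon>"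
  proof (rule same_growth[OF h(3) k(3)])
    fix i assume i: "N + L \<le> i"
    show "real (h i) - real c \<le> real (k (i + (c1 + c2))) - real e" using N i ec by simp
    show "real (k i) - real e \<le> real (h (i + (c1 + c2))) - real c" using L i ec by simp
  qed (use h(4) k(4) in simp_all)
  then have "\<epsilon> = \<delta>" "real_of_rat s = real_of_rat r" by auto
  then show ?thesis using h(5,6) k(5,6) by (simp only: of_rat_eq_iff simp_thms)
qed

end
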